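(* Let $d=4$. Assume that the offspring law $\{p_k\}_{k\ge 0}$ satisfies $p_1<1$, $\sum_{k\ge0}kp_k=1$ and $\sigma^2:=\sum_{k\ge0}(k-1)^2p_k\in(0,\infty)$, and that the jump law $\mu$ on $\mathbb{Z}^4$ (with zero mean, positive definite covariance matrix $\Gamma$, and not supported on a strict subgroup of $\mathbb{Z}^4$) is symmetric and has finite support. Let $K\subset\mathbb{Z}^4$ be nonempty and compact (i.e. finite). Then, under $\mathbf{P}_x(\,\cdot\mid Z_{\mathbb{T}}(K)\ge 1)$, as $\|x\|\to\infty$, the following joint convergence in law in $\mathbb{R}^{K}$ holds: $$\left(\frac{Z_{\mathbb{T}}(y)}{2\sigma^2\mathbf{c}_4\log\mathcal{J}(x)}\right)_{y\in K}\xrightarrow{(d)}(Y,\dots,Y),$$ where all $|K|$ coordinates of the limit equal the same random variable $Y$, which is exponential with parameter $1$, and $\mathbf{c}_4=\frac{1}{8\pi^2\sqrt{\det\Gamma}}$.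
   Context: Critical branching random walk (CBRW) on $\mathbb{Z}^d$: under $\mathbf{P}_x$, one ancestor $\rho$ is located at $S_\rho=x\in\mathbb{Z}^d$ at time $0$. Each individual $v$ of generation $n$ dies at time $n+1$ and gives birth to a random number of children with law $\{p_k\}$; each child immediately makes a jump from the position of $v$ distributed as $\mu$; all offspring numbers and jumps are independent. The genealogical tree is $\mathbb{T}$, and $S_u\in\mathbb{Z}^d$ is the position of $u\in\mathbb{T}$. Occupation time: $Z_{\mathbb{T}}(B):=\sum_{u\in\mathbb{T}}\mathbf{1}_{\{S_u\in B\}}$ for $B\subset\mathbb{Z}^d$, and $Z_{\mathbb{T}}(y):=Z_{\mathbb{T}}(\{y\})$. Norms: $\|\cdot\|$ is the Euclidean norm and $\mathcal{J}(x):=\sqrt{x\cdot\Gamma^{-1}x/d}$. *)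

theory Defs
  imports "HOL-Probability.Probability"
begin

definition real_vec :: "int ^ 'd \<Rightarrow> real ^ 'd" where
  "real_vec x = (\<chi> i. real_of_int (x $ i))"

definition mean_vec :: "(int ^ 'd) pmf \<Rightarrow> real ^ 'd" where
  "mean_vec \<mu> = (\<chi> i. measure_pmf.expectation \<mu> (\<lambda>z. real_vec z $ i))"

definition covariance_matrix :: "(int ^ 'd) pmf \<Rightarrow> real ^ 'd ^ 'd" where
  "covariance_matrix \<mu> =
     (\<chi> i j. measure_pmf.expectation \<mu>
       (\<lambda>z. (real_vec z $ i - mean_vec \<mu> $ i) * (real_vec z $ j - mean_vec \<mu> $ j)))"

definition positive_definite :: "real ^ 'd ^ 'd \<Rightarrow> bool" where
  "positive_definite A \<longleftrightarrow> transpose A = A \<and> (\<forall>v. v \<noteq> 0 \<longrightarrow> 0 < v \<bullet> (A *v v))"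

definition lattice_subgroup :: "(int ^ 'd) set \<Rightarrow> bool" where
  "lattice_subgroup H \<longleftrightarrow> 0 \<in> H \<and> (\<forall>a\<in>H. \<forall>b\<in>H. a + b \<in> H) \<and> (\<forall>a\<in>H. - a \<in> H)"

definition jump_norm :: "(int ^ 'd) pmf \<Rightarrow> int ^ 'd \<Rightarrow> real" where
  "jump_norm \<mu> x =
     sqrt ((real_vec x \<bullet> (matrix_inv (covariance_matrix \<mu>) *v real_vec x)) / real CARD('d))"

text \<open>
  Individuals carry Ulam--Harris labels, written with the most recent generation first: the
  root is the empty list and the children of \<open>v\<close> are \<open>0 # v\<close>, \<open>1 # v\<close>, and so on.
  A sample point \<open>\<omega>\<close> attaches to every label \<open>v\<close>, whether or not it is realised in the tree,
  the number \<open>fst (\<omega> v)\<close> of children of \<open>v\<close> and the jump \<open>snd (\<omega> v)\<close> that \<open>v\<close> makes from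
  the position of its parent; all of these are independent.  The jump attached to the root is
  not used.  The starting point \<open>x\<close> enters only through the positions, so that the law
  \<open>P\<^sub>x\<close> is obtained from the single probability space below by starting the root at \<open>x\<close>.
\<close>

type_synonym 'd brw_sample = "nat list \<Rightarrow> nat \<times> (int ^ 'd)"

definition brw_space :: "nat pmf \<Rightarrow> (int ^ 'd) pmf \<Rightarrow> 'd brw_sample measure" where
  "brw_space p \<mu> = (\<Pi>\<^sub>M v\<in>UNIV. measure_pmf (pair_pmf p \<mu>))"

inductive_set tree :: "'d brw_sample \<Rightarrow> nat list set" for \<omega> :: "'d brw_sample" where
  root: "[] \<in> tree \<omega>"
| child: "v \<in> tree \<omega> \<Longrightarrow> i < fst (\<omega> v) \<Longrightarrow> i # v \<in> tree \<omega>"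

primrec position :: "int ^ 'd \<Rightarrow> 'd brw_sample \<Rightarrow> nat list \<Rightarrow> int ^ 'd" where
  "position x \<omega> [] = x"
| "position x \<omega> (i # v) = position x \<omega> v + snd (\<omega> (i # v))"

text \<open>
  The occupation time is a sum over the tree with values in \<open>[0, \<infinity>]\<close>, written as an integral
  against counting measure; it is infinite only if the tree is.
\<close>

definition occupation :: "int ^ 'd \<Rightarrow> (int ^ 'd) set \<Rightarrow> 'd brw_sample \<Rightarrow> ennreal" where
  "occupation x B \<omega> = (\<integral>\<^sup>+ u. indicator B (position x \<omega> u) \<partial>count_space (tree \<omega>))"

definition brw_visiting ::
  "nat pmf \<Rightarrow> (int ^ 'd) pmf \<Rightarrow> int ^ 'd \<Rightarrow> (int ^ 'd) set \<Rightarrow> 'd brw_sample measure" where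
  "brw_visiting p \<mu> x K =
     uniform_measure (brw_space p \<mu>)
       {\<omega> \<in> space (brw_space p \<mu>). 1 \<le> occupation x K \<omega>}"

text \<open>
  Convergence along a filter of laws on a topological space: integrals of bounded continuous
  functions converge.  For a finite index set \<open>K\<close>, the space of real vectors indexed by \<open>K\<close>
  is represented by \<open>product_topology (\<lambda>_. euclideanreal) K\<close>, whose points are the functions
  that are \<open>undefined\<close> outside \<open>K\<close>; the matching Borel sets are those of
  \<open>\<Pi>\<^sub>M y\<in>K. borel\<close>.
\<close>

definition converges_in_law ::
  "'b topology \<Rightarrow> ('a \<Rightarrow> 'b measure) \<Rightarrow> 'b measure \<Rightarrow> 'a filter \<Rightarrow> bool" where
  "converges_in_law X N L F \<longleftrightarrow>
     (\<forall>f. continuous_map X euclideanreal f \<and> bounded (f ` topspace X) \<longrightarrow>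
       ((\<lambda>x. \<integral>z. f z \<partial>N x) \<longlongrightarrow> (\<integral>z. f z \<partial>L)) F)"

end

theory Submission
  imports Defs "HOL-Real_Asymp.Real_Asymp"
begin

text \<open>
  Fix a finite set \<open>K\<close> of sites, weights \<open>m y \<ge> 0\<close> on \<open>K\<close> with total \<open>\<Lambda>\<close>, and a normalisation
  \<open>T\<close>.  Let \<open>q x\<close> be the probability that the walk started at \<open>x\<close> visits \<open>K\<close>, and let
  \<open>u x = 1 - E exp (- \<Sum>y\<in>K. m y * Z y / T)\<close>, where \<open>Z y\<close> is the occupation time of \<open>y\<close>.  The
  exponential equals \<open>1\<close> when \<open>K\<close> is not visited, so its conditional expectation given a visit is
  \<open>1 - u x / q x\<close>.  The theorem therefore says that \<open>u x / q x\<close> tends to \<open>\<Lambda> / (1 + \<Lambda>)\<close> when \<open>T\<close>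
  grows like the appropriate multiple of the logarithm of the distance; a Stone--Weierstrass
  argument (\<open>law_from_laplace\<close>) turns the convergence of these Laplace transforms with integer
  weights into joint convergence in law.

  Both functions are of the form \<open>1 - E (\<Prod>u. \<Theta> (S u))\<close> with \<open>0 \<le> \<Theta> \<le> 1\<close> and \<open>\<Theta> = 1\<close> off \<open>K\<close>.
  Decomposing the tree at the root shows that such a function \<open>w\<close> satisfies \<open>w = N (P w)\<close> off \<open>K\<close>,
  where \<open>P\<close> averages over one jump and \<open>N s = 1 - f (1 - s) = s - (\<sigma>\<^sup>2 / 2) * s\<^sup>2 + o (s\<^sup>2)\<close> for the
  generating function \<open>f\<close> of the offspring law.  This is a discrete semilinear equation with a
  quadratic nonlinearity, and dimension four is critical for it: decaying solutions are of order
  \<open>1 / (Q ln Q)\<close>, where \<open>Q\<close> is the squared norm in coordinates in which the jumps have identity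
  covariance.

  The asymptotics come from a comparison principle (\<open>comparison\<close>) and explicit barriers.  The
  function \<open>1 / ((Q + \<kappa>) * (\<alpha> + \<beta> * ln (Q + \<kappa>)))\<close> is a supersolution far out when \<open>\<beta>\<close> is slightly
  below \<open>\<sigma>\<^sup>2 / 4\<close> and \<open>\<kappa>\<close> is large, and a subsolution when \<open>\<beta>\<close> is slightly above \<open>\<sigma>\<^sup>2 / 4\<close> and
  \<open>- \<kappa>\<close> is large.  How far out this holds depends on \<open>\<alpha>\<close> only through a lower bound for the bracket,
  so \<open>\<alpha>\<close> remains free to match the behaviour at a bounded distance from \<open>K\<close>.  For \<open>q\<close> the bracket is
  of order one there and \<open>Q * ln Q * q\<close> tends to \<open>4 / \<sigma>\<^sup>2\<close> (\<open>kill_asymptotics\<close>).  For \<open>u\<close> with \<open>T\<close>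
  large, \<open>u\<close> is near \<open>K\<close> close to \<open>1 / T\<close> times a potential of total mass \<open>\<Lambda>\<close>, which decays like
  \<open>\<Lambda> / (mass * Q)\<close>; so \<open>\<alpha>\<close> is about \<open>T * mass / \<Lambda>\<close> and, if \<open>T\<close> is asymptotic to \<open>\<tau> * ln Q\<close>, then
  \<open>Q * ln Q * u\<close> tends to \<open>1 / (\<tau> * mass / \<Lambda> + \<sigma>\<^sup>2 / 4)\<close> (\<open>laplace_asymptotics\<close>).  When
  \<open>\<tau> * mass = \<sigma>\<^sup>2 / 4\<close> the quotient is \<open>\<Lambda> / (1 + \<Lambda>)\<close>, as required.

  Here \<open>1 / mass\<close> is the limit of \<open>Q * G\<close> for the Green function \<open>G\<close>.  Its value needs
  no local limit theorem: \<open>1 / (Q + \<kappa>)\<close> is the potential of an explicit positive charge of size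
  \<open>4 * \<kappa> / (Q + \<kappa>)\<^sup>3\<close> up to lower order, whose total converges to \<open>2 * \<pi>\<^sup>2 * sqrt (det \<Gamma>)\<close> as \<open>\<kappa>\<close>
  grows, because the sum over the lattice approaches the integral.  Along a sequence that realises
  the upper (or lower) limit of \<open>Q * G\<close>, the strong maximum principle forces all translates of \<open>Q * G\<close>
  to converge to the same constant, and integrating against the charge identifies that constant
  (\<open>green_asymptotics\<close>).
\<close>

section \<open>The offspring law near extinction\<close>

definition gen_fun :: "nat pmf \<Rightarrow> real \<Rightarrow> real" where
  "gen_fun p s = (\<Sum>k. pmf p k * s ^ k)"

text \<open>
  The probability that at least one child is marked, when the children are marked independently with
  probability \<open>s\<close>; all estimates are about this function because it has the fixed point \<open>0\<close>.
\<close>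

definition survive :: "nat pmf \<Rightarrow> real \<Rightarrow> real" where
  "survive p s = 1 - gen_fun p (1 - s)"

lemma pmf_nat_sums: "pmf (p :: nat pmf) sums 1"
proof -
  have "((\<lambda>k. ennreal (pmf p k)) sums 1)"
  proof -
    have "(\<integral>\<^sup>+k. ennreal (pmf p k) \<partial>count_space UNIV) = 1"
      using nn_integral_pmf[of UNIV p] by (simp add: measure_pmf.emeasure_space_1[simplified])
    then show ?thesis
      by (simp add: nn_integral_count_space_nat sums_iff)
  qed
  then show ?thesis by (simp flip: ennreal_1)
qed

text \<open>
  The second-order Taylor expansion of \<open>(1 - s) ^ k\<close>, with an error that is cubic in both \<open>s\<close> and
  \<open>k\<close>.  The cubic growth in \<open>k\<close> is harmless because the third bound is used for finitely many \<open>k\<close>.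
\<close>

lemma one_minus_power_bounds:
  fixes s :: real
  assumes "0 \<le> s" "s \<le> 1"
  shows "0 \<le> (1 - s) ^ k - 1 + real k * s"
    and "(1 - s) ^ k - 1 + real k * s \<le> real k * (real k - 1) / 2 * s\<^sup>2"
    and "real k * (real k - 1) / 2 * s\<^sup>2 - real k ^ 3 * s ^ 3 \<le> (1 - s) ^ k - 1 + real k * s"
proof -
  have step: "(1 - s) ^ Suc k - 1 + real (Suc k) * s = (1 - s) * ((1 - s) ^ k - 1 + real k * s) + real k * s\<^sup>2" for k
    by (simp add: algebra_simps power2_eq_square)
  show A: "0 \<le> (1 - s) ^ k - 1 + real k * s" for k
  proof (induction k)
    case (Suc k)
    then show ?case unfolding step using assms by simp
  qed simp
  show B: "(1 - s) ^ k - 1 + real k * s \<le> real k * (real k - 1) / 2 * s\<^sup>2" for k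
  proof (induction k)
    case (Suc k)
    have "(1 - s) * ((1 - s) ^ k - 1 + real k * s) \<le> 1 * ((1 - s) ^ k - 1 + real k * s)"
      using A[of k] assms by (intro mult_right_mono) auto
    also have "\<dots> \<le> real k * (real k - 1) / 2 * s\<^sup>2" using Suc by simp
    finally show ?case unfolding step by (simp add: field_simps)
  qed simp
  show "real k * (real k - 1) / 2 * s\<^sup>2 - real k ^ 3 * s ^ 3 \<le> (1 - s) ^ k - 1 + real k * s"
  proof (induction k)
    case (Suc k)
    define b where "b = (1 - s) ^ k - 1 + real k * s"
    have "s * b \<le> s * (real k * (real k - 1) / 2 * s\<^sup>2)"
      using B[of k] assms unfolding b_def by (intro mult_left_mono) auto
    then have sb: "s * b \<le> real k * (real k - 1) / 2 * s ^ 3"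
      by (simp add: power2_eq_square power3_eq_cube algebra_simps)
    have ih: "real k * (real k - 1) / 2 * s\<^sup>2 - real k ^ 3 * s ^ 3 \<le> b"
      using Suc unfolding b_def by simp
    have "(real k ^ 3 + real k * (real k - 1) / 2) * s ^ 3 \<le> real (Suc k) ^ 3 * s ^ 3"
      using assms by (intro mult_right_mono) (auto simp: power3_eq_cube field_simps add_nonneg_nonneg)
    then have "real (Suc k) * (real (Suc k) - 1) / 2 * s\<^sup>2 - real (Suc k) ^ 3 * s ^ 3 \<le> b - s * b + real k * s\<^sup>2"
      using sb ih by (simp add: field_simps)
    also have "\<dots> = (1 - s) ^ Suc k - 1 + real (Suc k) * s" unfolding step b_def by (simp add: algebra_simps)
    finally show ?case .
  qed simp
qed

lemma gen_fun_sums: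
  assumes "0 \<le> s" "s \<le> 1"
  shows "(\<lambda>k. pmf p k * s ^ k) sums gen_fun p s"
proof -
  have "summable (\<lambda>k. pmf p k * s ^ k)"
    by (rule summable_comparison_test'[OF sums_summable[OF pmf_nat_sums[of p]]])
       (use assms in \<open>auto simp: mult_left_le power_le_one\<close>)
  then show ?thesis unfolding gen_fun_def by (rule summable_sums)
qed

locale critical_offspring =
  fixes p :: "nat pmf" and \<sigma> :: real
  assumes mean_one: "(\<lambda>k. real k * pmf p k) sums 1"
    and variance: "(\<lambda>k. (real k - 1)\<^sup>2 * pmf p k) sums \<sigma>\<^sup>2"
    and variance_pos: "0 < \<sigma>\<^sup>2"
begin

lemma factorial_moment: "(\<lambda>k. real k * (real k - 1) * pmf p k) sums \<sigma>\<^sup>2"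
proof -
  have "(\<lambda>k. (real k - 1)\<^sup>2 * pmf p k + real k * pmf p k - pmf p k) sums (\<sigma>\<^sup>2 + 1 - 1)"
    by (intro sums_add sums_diff variance mean_one pmf_nat_sums)
  then show ?thesis by (simp add: algebra_simps power2_eq_square)
qed

lemma survive_deficit_sums:
  assumes "0 \<le> s" "s \<le> 1"
  shows "(\<lambda>k. pmf p k * ((1 - s) ^ k - 1 + real k * s)) sums (s - survive p s)"
proof -
  have "(\<lambda>k. pmf p k * (1 - s) ^ k - pmf p k + (real k * pmf p k) * s) sums (gen_fun p (1 - s) - 1 + 1 * s)"
    using assms by (intro sums_add sums_diff gen_fun_sums sums_mult2 mean_one pmf_nat_sums) auto
  then show ?thesis by (simp add: survive_def algebra_simps)
qed

text \<open>
  Monotone and non-expanding: the slope of \<open>survive p\<close> is at most the mean number of children, which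
  is one.  This is what lets the comparison principle treat the nonlinearity like the identity.
\<close>

lemma survive_diff:
  assumes "0 \<le> b" "b \<le> a" "a \<le> 1"
  shows "0 \<le> survive p a - survive p b" "survive p a - survive p b \<le> a - b"
proof -
  have S: "(\<lambda>k. pmf p k * (1 - b) ^ k - pmf p k * (1 - a) ^ k) sums (survive p a - survive p b)"
    using sums_diff[OF gen_fun_sums[of "1 - b"] gen_fun_sums[of "1 - a"]] assms
    by (simp add: survive_def)
  have T: "(\<lambda>k. (real k * pmf p k) * (a - b)) sums (1 * (a - b))"
    by (intro sums_mult2 mean_one)
  have mono: "(1 - a) ^ k \<le> (1 - b) ^ k" for k
    using assms by (intro power_mono) auto
  have lip: "(1 - b) ^ k - (1 - a) ^ k \<le> real k * (a - b)" for k
  proof (induction k)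
    case (Suc k)
    have "(1 - b) ^ Suc k - (1 - a) ^ Suc k = (1 - b) * ((1 - b) ^ k - (1 - a) ^ k) + (a - b) * (1 - a) ^ k"
      by (simp add: algebra_simps)
    also have "\<dots> \<le> 1 * ((1 - b) ^ k - (1 - a) ^ k) + (a - b) * 1"
      using assms mono[of k] by (intro add_mono mult_right_mono mult_left_mono power_le_one) auto
    finally show ?case using Suc by (simp add: algebra_simps)
  qed simp
  show "0 \<le> survive p a - survive p b"
    by (rule sums_le[OF _ sums_zero S]) (use mono in \<open>auto intro: mult_left_mono\<close>)
  have "pmf p k * (1 - b) ^ k - pmf p k * (1 - a) ^ k \<le> real k * pmf p k * (a - b)" for k
    using mult_left_mono[OF lip[of k], of "pmf p k"] by (simp add: algebra_simps)
  then show "survive p a - survive p b \<le> a - b"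
    using sums_le[OF _ S T] by simp
qed

lemma survive_0 [simp]: "survive p 0 = 0"
  using sums_unique2[OF pmf_nat_sums, of p "gen_fun p 1"] gen_fun_sums[of 1] by (simp add: survive_def)

lemma survive_nonneg: "0 \<le> s \<Longrightarrow> s \<le> 1 \<Longrightarrow> 0 \<le> survive p s"
  using survive_diff(1)[of 0 s] by simp

lemma survive_le: "0 \<le> s \<Longrightarrow> s \<le> 1 \<Longrightarrow> survive p s \<le> s"
  using survive_diff(2)[of 0 s] by simp

lemma survive_mono: "0 \<le> b \<Longrightarrow> b \<le> a \<Longrightarrow> a \<le> 1 \<Longrightarrow> survive p b \<le> survive p a"
  using survive_diff(1)[of b a] by simp

lemma survive_ge:
  assumes "0 \<le> s" "s \<le> 1"
  shows "s - \<sigma>\<^sup>2 / 2 * s\<^sup>2 \<le> survive p s"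
proof -
  have "(\<lambda>k. (real k * (real k - 1) * pmf p k) * (s\<^sup>2 / 2)) sums (\<sigma>\<^sup>2 * (s\<^sup>2 / 2))"
    by (intro sums_mult2 factorial_moment)
  moreover have "pmf p k * ((1 - s) ^ k - 1 + real k * s) \<le> (real k * (real k - 1) * pmf p k) * (s\<^sup>2 / 2)" for k
    using mult_left_mono[OF one_minus_power_bounds(2)[OF assms, of k], of "pmf p k"]
    by (simp add: algebra_simps)
  ultimately show ?thesis
    using sums_le[OF _ survive_deficit_sums[OF assms], of "\<lambda>k. (real k * (real k - 1) * pmf p k) * (s\<^sup>2 / 2)" "\<sigma>\<^sup>2 * (s\<^sup>2 / 2)"]
    by (simp add: algebra_simps)
qed

text \<open>
  Matches \<open>survive_ge\<close> up to the factor \<open>1 - \<epsilon>\<close>.  The third moment may be infinite, so the sum over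
  \<open>k\<close> is cut where the truncated factorial moment is already close to \<open>\<sigma>\<^sup>2\<close>; the discarded terms have
  a favourable sign.
\<close>

lemma survive_le_quadratic:
  assumes "0 < \<epsilon>"
  obtains s0 where "0 < s0" "s0 \<le> 1" "\<And>s. 0 \<le> s \<Longrightarrow> s \<le> s0 \<Longrightarrow> survive p s \<le> s - (1 - \<epsilon>) * (\<sigma>\<^sup>2 / 2) * s\<^sup>2"
proof -
  have "(\<lambda>n. \<Sum>k<n. real k * (real k - 1) * pmf p k) \<longlonglongrightarrow> \<sigma>\<^sup>2"
    using factorial_moment by (simp add: sums_def)
  moreover have "(1 - \<epsilon> / 2) * \<sigma>\<^sup>2 < \<sigma>\<^sup>2" using assms variance_pos by simp
  ultimately have "\<forall>\<^sub>F n in sequentially. (1 - \<epsilon> / 2) * \<sigma>\<^sup>2 < (\<Sum>k<n. real k * (real k - 1) * pmf p k)"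
    by (rule order_tendstoD)
  then obtain n where n: "(1 - \<epsilon> / 2) * \<sigma>\<^sup>2 < (\<Sum>k<n. real k * (real k - 1) * pmf p k)"
    by (auto simp: eventually_sequentially)
  define C where "C = (\<Sum>k<n. real k ^ 3 * pmf p k) + 1"
  have C: "C > 0" unfolding C_def by (intro add_nonneg_pos sum_nonneg) auto
  define s0 where "s0 = min 1 (\<epsilon> / 2 * (\<sigma>\<^sup>2 / 2) / C)"
  show thesis
  proof (rule that[of s0])
    show "0 < s0" "s0 \<le> 1" using assms C variance_pos by (auto simp: s0_def)
    fix s assume s: "0 \<le> s" "s \<le> s0"
    then have s1: "s \<le> 1" and "s * C \<le> \<epsilon> / 2 * (\<sigma>\<^sup>2 / 2)" using C by (auto simp: s0_def field_simps)
    then have sC: "s ^ 3 * C \<le> \<epsilon> / 2 * (\<sigma>\<^sup>2 / 2) * s\<^sup>2"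
      using mult_right_mono[of "s * C" "\<epsilon> / 2 * (\<sigma>\<^sup>2 / 2)" "s\<^sup>2"]
      by (simp add: power2_eq_square power3_eq_cube algebra_simps)
    have "(1 - \<epsilon> / 2) * \<sigma>\<^sup>2 * (s\<^sup>2 / 2) - s ^ 3 * C
        \<le> (\<Sum>k<n. real k * (real k - 1) * pmf p k) * (s\<^sup>2 / 2) - s ^ 3 * (\<Sum>k<n. real k ^ 3 * pmf p k)"
      using n s by (intro diff_mono mult_right_mono mult_left_mono) (auto simp: C_def)
    also have "\<dots> = (\<Sum>k<n. pmf p k * (real k * (real k - 1) / 2 * s\<^sup>2 - real k ^ 3 * s ^ 3))"
      unfolding sum_distrib_left sum_distrib_right sum_subtractf[symmetric]
      by (intro sum.cong refl) (simp add: field_simps)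
    also have "\<dots> \<le> (\<Sum>k<n. pmf p k * ((1 - s) ^ k - 1 + real k * s))"
      using s s1 by (intro sum_mono mult_left_mono one_minus_power_bounds) auto
    also have "\<dots> \<le> s - survive p s"
      using s s1 survive_deficit_sums[of s] one_minus_power_bounds(1)[of s]
      by (metis (no_types, lifting) sum_le_suminf sums_iff finite_lessThan mult_nonneg_nonneg pmf_nonneg)
    finally show "survive p s \<le> s - (1 - \<epsilon>) * (\<sigma>\<^sup>2 / 2) * s\<^sup>2"
      using sC by (simp add: field_simps)
  qed
qed

end

section \<open>An isotropic walk and its Newtonian kernel\<close>

definition walk_avg :: "'a::ab_group_add pmf \<Rightarrow> ('a \<Rightarrow> real) \<Rightarrow> 'a \<Rightarrow> real" where
  "walk_avg \<mu> w x = (\<Sum>z\<in>set_pmf \<mu>. pmf \<mu> z * w (x + z))"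

text \<open>
  The walk lives on an abstract group and is seen through additive coordinates \<open>e\<close> in which a step has
  the identity as covariance matrix.  The last assumption is a form of irreducibility that can be used
  directly as an induction principle along steps.
\<close>

locale isotropic_walk =
  fixes \<mu> :: "'a::ab_group_add pmf" and e :: "'a \<Rightarrow> real ^ 4"
  assumes e_add: "e (x + y) = e x + e y"
    and finite_steps: "finite (set_pmf \<mu>)"
    and symmetric: "pmf \<mu> (- z) = pmf \<mu> z"
    and isotropic: "(\<Sum>z\<in>set_pmf \<mu>. pmf \<mu> z * (v \<bullet> e z)\<^sup>2) = v \<bullet> v"
    and finite_balls: "finite {x. norm (e x) \<le> r}"
    and irreducible: "0 \<in> H \<Longrightarrow> (\<And>x z. x \<in> H \<Longrightarrow> z \<in> set_pmf \<mu> \<Longrightarrow> x + z \<in> H) \<Longrightarrow> H = UNIV"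
begin

abbreviation steps :: "'a set" where "steps \<equiv> set_pmf \<mu>"

abbreviation P :: "('a \<Rightarrow> real) \<Rightarrow> 'a \<Rightarrow> real" where "P \<equiv> walk_avg \<mu>"

definition Q :: "'a \<Rightarrow> real" where "Q x = (norm (e x))\<^sup>2"

text \<open>
  The neighbourhoods of infinity, measured by \<open>Q\<close>; since balls are finite, this is the cofinite filter.
\<close>

definition far :: "'a filter" where "far = filtercomap Q at_top"

lemma sum_steps: "(\<Sum>z\<in>steps. pmf \<mu> z) = 1"
  using finite_steps by (simp add: sum_pmf_eq_1)

lemma uminus_steps: "z \<in> steps \<Longrightarrow> - z \<in> steps"
  by (metis symmetric pmf_eq_0_set_pmf)

lemma sum_steps_uminus: "(\<Sum>z\<in>steps. pmf \<mu> z * f (- z)) = (\<Sum>z\<in>steps. pmf \<mu> z * f z)"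
  by (rule sum.reindex_bij_witness[of _ uminus uminus]) (auto simp: symmetric uminus_steps)

text \<open>
  The source of every cancellation in the moment computations below.
\<close>

lemma sum_steps_odd:
  assumes "\<And>z. f (- z) = - f z"
  shows "(\<Sum>z\<in>steps. pmf \<mu> z * f z) = (0::real)"
  using sum_steps_uminus[of f] by (simp add: assms sum_negf)

lemma e_0 [simp]: "e 0 = 0"
  using e_add[of 0 0] by simp

lemma e_uminus [simp]: "e (- x) = - e x"
  using e_add[of x "- x"] by (simp add: eq_neg_iff_add_eq_0 add.commute)

lemma Q_nonneg [simp]: "0 \<le> Q x"
  by (simp add: Q_def)

lemma Q_uminus [simp]: "Q (- x) = Q x"
  by (simp add: Q_def)

lemma Q_add: "Q (x + z) = Q x + (2 * (e x \<bullet> e z) + Q z)"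
  by (simp add: Q_def e_add power2_norm_eq_inner algebra_simps inner_commute)

lemma finite_Q_le: "finite {x. Q x \<le> r}"
proof (cases "r \<ge> 0")
  case True
  have "{x. Q x \<le> r} \<subseteq> {x. norm (e x) \<le> sqrt r}"
    unfolding Q_def using True by (auto intro: real_le_rsqrt)
  then show ?thesis using finite_balls finite_subset by blast
next
  case False
  then have "{x. Q x \<le> r} = {}" using Q_nonneg order_trans by blast
  then show ?thesis by simp
qed

lemma finite_Q_less: "finite {x. Q x < r}"
  by (rule finite_subset[OF _ finite_Q_le[of r]]) auto

lemma eventually_far: "(\<forall>\<^sub>F x in far. R x) \<longleftrightarrow> (\<exists>r. \<forall>x. r \<le> Q x \<longrightarrow> R x)"
proof
  assume "\<forall>\<^sub>F x in far. R x"
  then obtain S where S: "eventually S at_top" "\<And>x. S (Q x) \<Longrightarrow> R x"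
    by (auto simp: far_def eventually_filtercomap)
  then obtain r where "\<And>q. q \<ge> r \<Longrightarrow> S q" by (auto simp: eventually_at_top_linorder)
  with S show "\<exists>r. \<forall>x. r \<le> Q x \<longrightarrow> R x" by blast
next
  assume "\<exists>r. \<forall>x. r \<le> Q x \<longrightarrow> R x"
  then obtain r where "\<And>x. r \<le> Q x \<Longrightarrow> R x" by blast
  then show "\<forall>\<^sub>F x in far. R x"
    unfolding far_def eventually_filtercomap
    by (intro exI[of _ "\<lambda>q. r \<le> q"]) (auto simp: eventually_ge_at_top)
qed

lemma Q_at_top: "filterlim Q at_top far"
  unfolding far_def by (rule filterlim_filtercomap)

lemma eventually_far_finite: "finite {x. \<not> R x} \<Longrightarrow> \<forall>\<^sub>F x in far. R x"
proof -
  assume fin: "finite {x. \<not> R x}"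
  define r where "r = Max (insert 0 (Q ` {x. \<not> R x})) + 1"
  have "R x" if "r \<le> Q x" for x
  proof (rule ccontr)
    assume "\<not> R x"
    then have "Q x \<le> r - 1" unfolding r_def using fin Max_ge[of "insert 0 (Q ` {x. \<not> R x})" "Q x"] by simp
    with that show False by simp
  qed
  then show ?thesis by (auto simp: eventually_far)
qed

lemma eventually_far_iff_finite: "(\<forall>\<^sub>F x in far. R x) \<longleftrightarrow> finite {x. \<not> R x}"
proof
  assume "\<forall>\<^sub>F x in far. R x"
  then obtain r where r: "\<And>x. r \<le> Q x \<Longrightarrow> R x" by (auto simp: eventually_far)
  have "{x. \<not> R x} \<subseteq> {x. Q x < r}" using r by (auto simp: not_le[symmetric])
  then show "finite {x. \<not> R x}" using finite_Q_less finite_subset by blast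
qed (rule eventually_far_finite)

lemma walk_avg_mono: "(\<And>z. z \<in> steps \<Longrightarrow> v (x + z) \<le> w (x + z)) \<Longrightarrow> P v x \<le> P w x"
  unfolding walk_avg_def by (intro sum_mono mult_left_mono) auto

lemma walk_avg_const [simp]: "P (\<lambda>_. c) x = c"
  by (simp add: walk_avg_def sum_steps flip: sum_distrib_right)

lemma walk_avg_ge: "(\<And>z. z \<in> steps \<Longrightarrow> c \<le> w (x + z)) \<Longrightarrow> c \<le> P w x"
  using walk_avg_mono[where v = "\<lambda>_. c" and w = w and x = x] by simp

lemma walk_avg_le: "(\<And>z. z \<in> steps \<Longrightarrow> w (x + z) \<le> c) \<Longrightarrow> P w x \<le> c"
  using walk_avg_mono[where w = "\<lambda>_. c" and v = w and x = x] by simp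

lemma walk_avg_cong: "(\<And>z. z \<in> steps \<Longrightarrow> v (x + z) = w (x + z)) \<Longrightarrow> P v x = P w x"
  unfolding walk_avg_def by (intro sum.cong) auto

lemma walk_avg_diff: "P (\<lambda>x. v x - w x) x = P v x - P w x"
  by (simp add: walk_avg_def sum_subtractf algebra_simps)

lemma walk_avg_cmult: "P (\<lambda>x. c * w x) x = c * P w x"
  by (simp add: walk_avg_def sum_distrib_left algebra_simps)

lemma walk_avg_tendsto:
  "(\<And>y. ((\<lambda>n. w n y) \<longlongrightarrow> v y) F) \<Longrightarrow> ((\<lambda>n. P (w n) x) \<longlongrightarrow> P v x) F"
  unfolding walk_avg_def by (intro tendsto_intros)

lemma moment_1: "(\<Sum>z\<in>steps. pmf \<mu> z * (v \<bullet> e z)) = 0"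
  by (rule sum_steps_odd) simp

text \<open>
  The trace of the identity matrix: this is where the dimension enters.
\<close>

lemma moment_Q: "(\<Sum>z\<in>steps. pmf \<mu> z * Q z) = 4"
proof -
  have "Q z = (\<Sum>b\<in>Basis. (b \<bullet> e z)\<^sup>2)" for z
    unfolding Q_def power2_norm_eq_inner by (subst euclidean_inner) (simp add: power2_eq_square inner_commute)
  then have "(\<Sum>z\<in>steps. pmf \<mu> z * Q z) = (\<Sum>b\<in>Basis. \<Sum>z\<in>steps. pmf \<mu> z * (b \<bullet> e z)\<^sup>2)"
    by (simp add: sum_distrib_left) (rule sum.swap)
  also have "\<dots> = (\<Sum>b\<in>(Basis::(real^4) set). 1)"
    by (intro sum.cong) (auto simp: isotropic inner_Basis)
  also have "\<dots> = 4" by simp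
  finally show ?thesis .
qed

text \<open>
  A crude bound for the length of a step, at least one so that its powers are increasing.
\<close>

definition reach :: real where "reach = 1 + (\<Sum>z\<in>steps. norm (e z))"

lemma reach_ge_1: "1 \<le> reach"
  unfolding reach_def by (simp add: sum_nonneg)

lemma norm_step_le: "z \<in> steps \<Longrightarrow> norm (e z) \<le> reach"
  unfolding reach_def
  using member_le_sum[of z steps "\<lambda>z. norm (e z)"] finite_steps by auto

lemma Q_step_le: "z \<in> steps \<Longrightarrow> Q z \<le> reach\<^sup>2"
  unfolding Q_def using norm_step_le by (intro power_mono) auto

text \<open>
  The change of \<open>Q\<close> in one step; see \<open>Q_add\<close>.
\<close>

abbreviation incr :: "'a \<Rightarrow> 'a \<Rightarrow> real" where "incr x z \<equiv> 2 * (e x \<bullet> e z) + Q z"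

lemma inner_step_le: "z \<in> steps \<Longrightarrow> (e x \<bullet> e z)\<^sup>2 \<le> reach\<^sup>2 * Q x"
proof -
  assume z: "z \<in> steps"
  have "(e x \<bullet> e z)\<^sup>2 \<le> Q x * Q z"
    using Cauchy_Schwarz_ineq[of "e x" "e z"] by (simp add: Q_def power2_norm_eq_inner)
  also have "\<dots> \<le> Q x * reach\<^sup>2" using Q_step_le[OF z] by (intro mult_left_mono) auto
  finally show ?thesis by (simp add: mult.commute)
qed

lemma incr_sq_le: "z \<in> steps \<Longrightarrow> (incr x z)\<^sup>2 \<le> 8 * reach ^ 4 * (Q x + 1)"
proof -
  assume z: "z \<in> steps"
  have R: "reach\<^sup>2 \<le> reach ^ 4" using reach_ge_1 by (intro power_increasing) auto
  have "(incr x z)\<^sup>2 \<le> 2 * (2 * (e x \<bullet> e z))\<^sup>2 + 2 * (Q z)\<^sup>2"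
    using sum_squares_bound[of "2 * (e x \<bullet> e z)" "Q z"] by (simp add: power2_eq_square algebra_simps)
  also have "\<dots> \<le> 2 * (4 * (reach\<^sup>2 * Q x)) + 2 * (reach\<^sup>2)\<^sup>2"
    using inner_step_le[OF z, of x] Q_step_le[OF z]
    by (intro add_mono mult_left_mono power_mono) (auto simp: power_mult_distrib)
  also have "\<dots> \<le> 8 * (reach ^ 4 * Q x) + 8 * reach ^ 4"
  proof -
    have "0 \<le> reach ^ 4" by simp
    moreover have "(reach\<^sup>2)\<^sup>2 = reach ^ 4" by simp
    ultimately show ?thesis using mult_right_mono[OF R, of "Q x"] Q_nonneg[of x] by linarith
  qed
  finally show ?thesis by (simp add: algebra_simps)
qed

lemma incr_ge: "z \<in> steps \<Longrightarrow> - (Q x / 2 + 2 * reach\<^sup>2) \<le> incr x z"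
proof -
  assume z: "z \<in> steps"
  have "\<bar>2 * (e x \<bullet> e z)\<bar> \<le> 2 * (norm (e x) * reach)"
    using order_trans[OF Cauchy_Schwarz_ineq2[of "e x" "e z"] mult_left_mono[OF norm_step_le[OF z], of "norm (e x)"]]
    by (simp add: abs_mult)
  also have "\<dots> \<le> Q x / 2 + 2 * reach\<^sup>2"
    using sum_squares_bound[of "norm (e x)" "2 * reach"] by (simp add: Q_def power2_eq_square)
  finally show ?thesis using Q_nonneg[of z] by linarith
qed

lemma moment_incr_1: "(\<Sum>z\<in>steps. pmf \<mu> z * incr x z) = 4"
  using moment_1[of "e x"] moment_Q
  by (simp add: algebra_simps sum.distrib flip: sum_distrib_left)

definition c2 :: real where "c2 = (\<Sum>z\<in>steps. pmf \<mu> z * (Q z)\<^sup>2)"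

lemma c2_nonneg: "0 \<le> c2" unfolding c2_def by (intro sum_nonneg) auto

lemma moment_incr_2: "(\<Sum>z\<in>steps. pmf \<mu> z * (incr x z)\<^sup>2) = 4 * Q x + c2"
proof -
  have "(\<Sum>z\<in>steps. pmf \<mu> z * (incr x z)\<^sup>2) =
      4 * (\<Sum>z\<in>steps. pmf \<mu> z * (e x \<bullet> e z)\<^sup>2) + 4 * (\<Sum>z\<in>steps. pmf \<mu> z * ((e x \<bullet> e z) * Q z)) + c2"
    unfolding c2_def sum_distrib_left sum.distrib[symmetric]
    by (intro sum.cong refl) (simp add: power2_eq_square algebra_simps)
  also have "(\<Sum>z\<in>steps. pmf \<mu> z * ((e x \<bullet> e z) * Q z)) = 0"
    by (rule sum_steps_odd) simp
  finally show ?thesis by (simp add: isotropic Q_def power2_norm_eq_inner)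
qed

text \<open>
  The cube of an increment is formally of order \<open>Q\<^bsup>3/2\<^esup>\<close>, but its leading part is odd in the step and
  averages to zero, which gains a factor \<open>sqrt Q\<close>.
\<close>

lemma moment_incr_3:
  "\<bar>\<Sum>z\<in>steps. pmf \<mu> z * (incr x z) ^ 3\<bar> \<le> 12 * reach ^ 6 * (Q x + 1)"
proof -
  have eq: "(\<Sum>z\<in>steps. pmf \<mu> z * (incr x z) ^ 3) =
      (\<Sum>z\<in>steps. pmf \<mu> z * (8 * (e x \<bullet> e z) ^ 3 + 6 * (e x \<bullet> e z) * (Q z)\<^sup>2)) +
      (\<Sum>z\<in>steps. pmf \<mu> z * (12 * (e x \<bullet> e z)\<^sup>2 * Q z + (Q z) ^ 3))"
    unfolding sum.distrib[symmetric]
    by (intro sum.cong refl) (simp add: power2_eq_square power3_eq_cube algebra_simps)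
  have odd: "(\<Sum>z\<in>steps. pmf \<mu> z * (8 * (e x \<bullet> e z) ^ 3 + 6 * (e x \<bullet> e z) * (Q z)\<^sup>2)) = 0"
    by (rule sum_steps_odd) (simp add: power3_eq_cube)
  have b: "12 * (e x \<bullet> e z)\<^sup>2 * Q z + (Q z) ^ 3 \<le> 12 * reach ^ 6 * (Q x + 1)" if z: "z \<in> steps" for z
  proof -
    have r: "0 \<le> reach ^ 6" using reach_ge_1 by simp
    have "(e x \<bullet> e z)\<^sup>2 * Q z \<le> (reach\<^sup>2 * Q x) * reach\<^sup>2"
      using inner_step_le[OF z] Q_step_le[OF z] by (intro mult_mono) auto
    also have "\<dots> = reach ^ 4 * Q x" by (simp add: power_numeral_reduce)
    also have "\<dots> \<le> reach ^ 6 * Q x"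
      using reach_ge_1 by (intro mult_right_mono power_increasing) auto
    finally have "(e x \<bullet> e z)\<^sup>2 * Q z \<le> reach ^ 6 * Q x" .
    moreover have "(Q z) ^ 3 \<le> (reach\<^sup>2) ^ 3" using Q_step_le[OF z] by (intro power_mono) auto
    then have "(Q z) ^ 3 \<le> reach ^ 6" by simp
    ultimately have "12 * ((e x \<bullet> e z)\<^sup>2 * Q z) + Q z ^ 3 \<le> 12 * (reach ^ 6 * Q x) + 12 * reach ^ 6"
      using r by linarith
    then show ?thesis by (simp add: algebra_simps)
  qed
  have "(\<Sum>z\<in>steps. pmf \<mu> z * (12 * (e x \<bullet> e z)\<^sup>2 * Q z + (Q z) ^ 3))
      \<le> (\<Sum>z\<in>steps. pmf \<mu> z * (12 * reach ^ 6 * (Q x + 1)))"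
    using b by (intro sum_mono mult_left_mono) auto
  also have "\<dots> = 12 * reach ^ 6 * (Q x + 1)" by (simp add: sum_steps flip: sum_distrib_right)
  finally have "(\<Sum>z\<in>steps. pmf \<mu> z * (12 * (e x \<bullet> e z)\<^sup>2 * Q z + (Q z) ^ 3)) \<le> 12 * reach ^ 6 * (Q x + 1)" .
  moreover have "0 \<le> (\<Sum>z\<in>steps. pmf \<mu> z * (12 * (e x \<bullet> e z)\<^sup>2 * Q z + (Q z) ^ 3))"
    by (intro sum_nonneg mult_nonneg_nonneg add_nonneg_nonneg) auto
  ultimately show ?thesis unfolding eq odd by simp
qed

text \<open>
  Collects the error terms of the expansion in \<open>walk_avg_newtonian\<close>.
\<close>

definition C1 :: real where "C1 = c2 + 24 * reach ^ 6 + 1024 * reach ^ 8"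

lemma C1_nonneg: "0 \<le> C1"
  unfolding C1_def using c2_nonneg reach_ge_1 by simp

lemma inverse_shift_expansion:
  fixes a d :: real
  assumes "a \<noteq> 0" "a + d \<noteq> 0"
  shows "1 / (a + d) = 1 / a - d / a\<^sup>2 + d\<^sup>2 / a ^ 3 - d ^ 3 / a ^ 4 + d ^ 4 / (a ^ 4 * (a + d))"
proof -
  define i r where "i = 1 / (a + d)" and "r = 1 / a"
  have "(a + d) * i = 1" "a * r = 1" using assms by (auto simp: i_def r_def)
  then have i: "i = r - d * r * i" by algebra
  have "i = r - d * r\<^sup>2 + d\<^sup>2 * r ^ 3 - d ^ 3 * r ^ 4 + d ^ 4 * r ^ 4 * i"
    using i by algebra
  then show ?thesis using assms by (simp add: i_def r_def power_divide)
qed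

text \<open>
  In dimension four \<open>1 / Q\<close> is harmonic to leading order, and shifting \<open>Q\<close> by \<open>\<kappa>\<close> produces the explicit
  charge \<open>4 * \<kappa> / (Q + \<kappa>)\<^sup>3\<close>: in the expansion of \<open>1 / (a + d)\<close> with \<open>a = Q x + \<kappa>\<close> the terms of first and
  second order contribute \<open>- 4 / a\<^sup>2 + 4 * Q x / a\<^sup>3\<close>.  All other terms are \<open>O (1 / a\<^sup>3)\<close> with a constant
  independent of \<open>\<kappa>\<close>, so the charge dominates once \<open>\<kappa>\<close> is large.
\<close>

lemma walk_avg_newtonian:
  fixes \<kappa> :: real
  defines "w \<equiv> \<lambda>y. 1 / (Q y + \<kappa>)"
  assumes a: "Q x + 1 \<le> 2 * (Q x + \<kappa>)"
    and step: "\<And>z. z \<in> steps \<Longrightarrow> (Q x + \<kappa>) / 4 \<le> Q (x + z) + \<kappa>"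
  shows "\<bar>w x - P w x - 4 * \<kappa> / (Q x + \<kappa>) ^ 3\<bar> \<le> C1 / (Q x + \<kappa>) ^ 3"
proof -
  define a where "a = Q x + \<kappa>"
  have Qa: "Q x + 1 \<le> 2 * a" using a unfolding a_def by simp
  then have apos: "0 < a" using Q_nonneg[of x] by linarith
  have qz: "Q (x + z) + \<kappa> = a + incr x z" for z by (simp add: Q_add a_def)
  have ad: "a / 4 \<le> a + incr x z" if "z \<in> steps" for z
    using step[OF that] unfolding qz a_def by simp
  have wx: "w x = 1 / a" by (simp add: w_def a_def)
  define r4 where "r4 = (\<Sum>z\<in>steps. pmf \<mu> z * ((incr x z) ^ 4 / (a ^ 4 * (a + incr x z))))"
  have "P w x = (\<Sum>z\<in>steps. pmf \<mu> z * (1 / a - incr x z / a\<^sup>2 + (incr x z)\<^sup>2 / a ^ 3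
          - (incr x z) ^ 3 / a ^ 4 + (incr x z) ^ 4 / (a ^ 4 * (a + incr x z))))"
    unfolding walk_avg_def w_def
  proof (intro sum.cong refl)
    fix z assume z: "z \<in> steps"
    have "a + incr x z > 0" using ad[OF z] apos by linarith
    then show "pmf \<mu> z * (1 / (Q (x + z) + \<kappa>)) = pmf \<mu> z * (1 / a - incr x z / a\<^sup>2 + (incr x z)\<^sup>2 / a ^ 3
          - (incr x z) ^ 3 / a ^ 4 + (incr x z) ^ 4 / (a ^ 4 * (a + incr x z)))"
      unfolding qz using apos by (subst inverse_shift_expansion) auto
  qed
  also have "\<dots> = (\<Sum>z\<in>steps. pmf \<mu> z) / a - (\<Sum>z\<in>steps. pmf \<mu> z * incr x z) / a\<^sup>2
      + (\<Sum>z\<in>steps. pmf \<mu> z * (incr x z)\<^sup>2) / a ^ 3 - (\<Sum>z\<in>steps. pmf \<mu> z * (incr x z) ^ 3) / a ^ 4 + r4"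
    unfolding r4_def sum_divide_distrib sum.distrib[symmetric] sum_subtractf[symmetric]
    by (intro sum.cong refl) (simp add: algebra_simps)
  also have "\<dots> = 1 / a - 4 / a\<^sup>2 + (4 * Q x + c2) / a ^ 3 - (\<Sum>z\<in>steps. pmf \<mu> z * (incr x z) ^ 3) / a ^ 4 + r4"
    unfolding sum_steps moment_incr_1 moment_incr_2 by simp
  also have "4 / a\<^sup>2 = 4 * (Q x + \<kappa>) / a ^ 3"
    unfolding a_def[symmetric] using apos by (simp add: power2_eq_square power3_eq_cube)
  finally have eq: "w x - P w x - 4 * \<kappa> / a ^ 3
      = - (c2 / a ^ 3) + (\<Sum>z\<in>steps. pmf \<mu> z * (incr x z) ^ 3) / a ^ 4 - r4"
    by (simp add: wx add_divide_distrib distrib_left)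
  have t3: "\<bar>(\<Sum>z\<in>steps. pmf \<mu> z * (incr x z) ^ 3) / a ^ 4\<bar> \<le> 24 * reach ^ 6 / a ^ 3"
  proof -
    have "\<bar>\<Sum>z\<in>steps. pmf \<mu> z * (incr x z) ^ 3\<bar> \<le> 12 * reach ^ 6 * (2 * a)"
      by (rule order_trans[OF moment_incr_3]) (use Qa reach_ge_1 in \<open>intro mult_left_mono; simp\<close>)
    then have "\<bar>\<Sum>z\<in>steps. pmf \<mu> z * (incr x z) ^ 3\<bar> / a ^ 4 \<le> (12 * reach ^ 6 * (2 * a)) / a ^ 4"
      using apos by (intro divide_right_mono) auto
    also have "\<dots> = 24 * reach ^ 6 / a ^ 3" using apos by (simp add: power_numeral_reduce)
    finally show ?thesis using apos by simp
  qed
  have b4: "0 \<le> (incr x z) ^ 4 / (a ^ 4 * (a + incr x z)) \<and>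
     (incr x z) ^ 4 / (a ^ 4 * (a + incr x z)) \<le> 1024 * reach ^ 8 / a ^ 3" if z: "z \<in> steps" for z
  proof -
    have pos: "a + incr x z > 0" using ad[OF z] apos by linarith
    have "(incr x z) ^ 4 = ((incr x z)\<^sup>2)\<^sup>2" by simp
    also have "\<dots> \<le> (8 * reach ^ 4 * (2 * a))\<^sup>2"
      using incr_sq_le[OF z, of x] Qa reach_ge_1
      by (intro power_mono) (auto elim!: order_trans intro!: mult_left_mono)
    also have "\<dots> = 256 * reach ^ 8 * a\<^sup>2" by (simp add: power_mult_distrib flip: power_mult)
    finally have "(incr x z) ^ 4 / (a ^ 4 * (a + incr x z)) \<le> 256 * reach ^ 8 * a\<^sup>2 / (a ^ 4 * (a / 4))"
      using ad[OF z] apos pos by (intro frac_le mult_left_mono) auto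
    also have "\<dots> = 1024 * reach ^ 8 / a ^ 3"
      using apos by (simp add: power_numeral_reduce)
    finally show ?thesis using pos apos by simp
  qed
  have "0 \<le> r4" unfolding r4_def using b4 by (intro sum_nonneg mult_nonneg_nonneg) auto
  moreover have "r4 \<le> (\<Sum>z\<in>steps. pmf \<mu> z * (1024 * reach ^ 8 / a ^ 3))"
    unfolding r4_def using b4 by (intro sum_mono mult_left_mono) auto
  then have "r4 \<le> 1024 * reach ^ 8 / a ^ 3" by (simp add: sum_steps flip: sum_distrib_right sum_divide_distrib)
  moreover have "0 \<le> c2 / a ^ 3" using c2_nonneg apos by simp
  moreover have "C1 / a ^ 3 = c2 / a ^ 3 + 24 * reach ^ 6 / a ^ 3 + 1024 * reach ^ 8 / a ^ 3"
    by (simp add: C1_def add_divide_distrib)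
  ultimately show ?thesis
    using t3 eq unfolding a_def[symmetric] by linarith
qed

end

section \<open>Comparison principle and explicit barriers\<close>

context isotropic_walk
begin

text \<open>
  A subsolution that is below a supersolution outside \<open>\<Omega>\<close> and at infinity is below it everywhere.
  Otherwise the difference \<open>a - b\<close> has a positive maximum.  At a maximiser, \<open>N\<close> being non-expanding
  forces all neighbours to be maximisers as well; but \<open>Q\<close> is strictly larger at one of \<open>y + z\<close> and
  \<open>y - z\<close>, so a maximiser with the largest \<open>Q\<close> gives a contradiction.
\<close>

lemma comparison:
  fixes N :: "real \<Rightarrow> real"
  assumes N_lip: "\<And>s t. 0 \<le> s \<Longrightarrow> s \<le> t \<Longrightarrow> t \<le> 1 \<Longrightarrow> N t - N s \<le> t - s"
    and N_mono: "\<And>s t. 0 \<le> s \<Longrightarrow> s \<le> t \<Longrightarrow> t \<le> 1 \<Longrightarrow> N s \<le> N t"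
    and a01: "\<And>x. 0 \<le> a x \<and> a x \<le> 1" and b01: "\<And>x. 0 \<le> b x \<and> b x \<le> 1"
    and a: "\<And>x. x \<in> \<Omega> \<Longrightarrow> a x \<le> N (P a x)"
    and b: "\<And>x. x \<in> \<Omega> \<Longrightarrow> N (P b x) \<le> b x"
    and outside: "\<And>x. x \<notin> \<Omega> \<Longrightarrow> a x \<le> b x"
    and infinity: "\<And>\<epsilon>. 0 < \<epsilon> \<Longrightarrow> \<forall>\<^sub>F x in far. a x \<le> b x + \<epsilon>"
  shows "a x \<le> b x"
proof (rule ccontr)
  assume "\<not> a x \<le> b x"
  define d where "d y = a y - b y" for y
  have dx: "0 < d x" using \<open>\<not> a x \<le> b x\<close> by (simp add: d_def)
  define S where "S = {y. d x \<le> d y}"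
  have "finite {y. \<not> a y \<le> b y + d x / 2}"
    using infinity[of "d x / 2"] dx by (simp add: eventually_far_iff_finite)
  moreover have "S \<subseteq> {y. \<not> a y \<le> b y + d x / 2}" using dx by (auto simp: S_def d_def field_simps)
  ultimately have finS: "finite S" by (rule rev_finite_subset)
  have xS: "x \<in> S" by (simp add: S_def)
  define m where "m = Max (d ` S)"
  have mS: "m \<in> d ` S" unfolding m_def using finS xS by (intro Max_in) auto
  have dm: "d y \<le> m" for y
  proof (cases "y \<in> S")
    case False
    then have "d y \<le> d x" by (simp add: S_def)
    also have "d x \<le> m" unfolding m_def using finS xS by (intro Max_ge) auto
    finally show ?thesis .
  qed (use finS in \<open>auto simp: m_def\<close>)
  have mpos: "0 < m" using dm[of x] dx by linarith
  define T where "T = {y. d y = m}"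
  have "T \<subseteq> S" using dm[of x] by (auto simp: T_def S_def)
  then have finT: "finite T" using finS finite_subset by blast
  have "T \<noteq> {}" using mS by (auto simp: T_def)
  \<comment> \<open>among the maximisers of \<open>d\<close>, take one that is farthest out\<close>
  then obtain y where y: "y \<in> T" and far_y: "\<And>u. u \<in> T \<Longrightarrow> Q u \<le> Q y"
    using finT obtains_MAX[of T Q] by (metis Max_ge finite_imageI imageI)
  have dy: "d y = m" using y by (simp add: T_def)
  have "y \<in> \<Omega>" using outside[of y] dy mpos by (force simp: d_def)
  have Pa: "0 \<le> P a y" "P a y \<le> 1" and Pb: "0 \<le> P b y" "P b y \<le> 1"
    using a01 b01 by (auto intro: walk_avg_ge walk_avg_le)
  have "m \<le> N (P a y) - N (P b y)" using a[OF \<open>y \<in> \<Omega>\<close>] b[OF \<open>y \<in> \<Omega>\<close>] dy by (simp add: d_def)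
  then have m_le: "m \<le> P a y - P b y"
    using N_lip[of "P b y" "P a y"] N_mono[of "P a y" "P b y"] Pa Pb mpos by linarith
  have nbr: "d (y + z) = m" if z: "z \<in> steps" for z
  proof (rule ccontr)
    assume "d (y + z) \<noteq> m"
    then have lt: "d (y + z) < m" using dm[of "y + z"] by linarith
    have "P a y - P b y = P d y" by (simp add: d_def[abs_def] walk_avg_diff)
    also have "\<dots> < (\<Sum>z\<in>steps. pmf \<mu> z * m)"
      unfolding walk_avg_def
      by (intro sum_strict_mono_ex1[OF finite_steps])
         (use dm z lt in \<open>auto intro!: mult_left_mono bexI[of _ z] mult_strict_left_mono simp: pmf_positive_iff\<close>)
    also have "\<dots> = m" by (simp add: sum_steps flip: sum_distrib_right)
    finally show False using m_le by simp
  qed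
  have "\<exists>z\<in>steps. Q z \<noteq> 0"
  proof (rule ccontr)
    assume "\<not> ?thesis"
    then have "(\<Sum>z\<in>steps. pmf \<mu> z * Q z) = 0" by (intro sum.neutral) auto
    then show False using moment_Q by simp
  qed
  then obtain z where z: "z \<in> steps" "0 < Q z" using Q_nonneg by (metis less_eq_real_def)
  have "Q (y + z) \<le> Q y" "Q (y + (- z)) \<le> Q y"
    using nbr[OF z(1)] nbr[OF uminus_steps[OF z(1)]] far_y by (auto simp: T_def)
  then show False using z(2) Q_add[of y z] Q_add[of y "- z"] by simp
qed

lemma Q_step_ge: "z \<in> steps \<Longrightarrow> Q x / 2 - 2 * reach\<^sup>2 \<le> Q (x + z)"
  using incr_ge[of z x] by (simp add: Q_add)

definition newton :: "real \<Rightarrow> 'a \<Rightarrow> real" where "newton \<kappa> x = 1 / (Q x + \<kappa>)"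

text \<open>
  Large enough that the charge of \<open>1 / (Q + \<kappa>)\<close> beats the error \<open>C1\<close>, and that a step changes \<open>Q + \<kappa>\<close>
  at most by a bounded factor at every site.
\<close>

definition \<kappa>0 :: real where "\<kappa>0 = max (C1 / 4 + 1) (max 1 (4 * reach\<^sup>2))"

lemma \<kappa>0_bounds: "C1 / 4 + 1 \<le> \<kappa>0" "1 \<le> \<kappa>0" "4 * reach\<^sup>2 \<le> \<kappa>0"
  by (auto simp: \<kappa>0_def)

lemma newton_laplacian:
  assumes "\<kappa>0 \<le> \<kappa>"
  shows "\<bar>newton \<kappa> x - P (newton \<kappa>) x - 4 * \<kappa> / (Q x + \<kappa>) ^ 3\<bar> \<le> C1 / (Q x + \<kappa>) ^ 3"
  unfolding newton_def
proof (rule walk_avg_newtonian)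
  show "Q x + 1 \<le> 2 * (Q x + \<kappa>)" using assms \<kappa>0_bounds(2) Q_nonneg[of x] unfolding distrib_left by linarith
  fix z assume "z \<in> steps"
  then show "(Q x + \<kappa>) / 4 \<le> Q (x + z) + \<kappa>"
    using Q_step_ge[of z x] assms \<kappa>0_bounds(2,3) Q_nonneg[of x] unfolding add_divide_distrib by linarith
qed

lemma newton_superharmonic:
  assumes "\<kappa>0 \<le> \<kappa>"
  shows "4 / (Q x + \<kappa>) ^ 3 \<le> newton \<kappa> x - P (newton \<kappa>) x"
proof -
  have pos: "0 < (Q x + \<kappa>) ^ 3" using assms \<kappa>0_bounds Q_nonneg[of x] by (intro zero_less_power) linarith
  have "4 / (Q x + \<kappa>) ^ 3 \<le> (4 * \<kappa> - C1) / (Q x + \<kappa>) ^ 3"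
    using pos assms \<kappa>0_bounds by (intro divide_right_mono) auto
  then show ?thesis using newton_laplacian[OF assms, of x] by (simp add: diff_divide_distrib abs_le_iff)
qed

text \<open>
  A negative shift gives a charge of the opposite sign, at sites where \<open>Q + \<kappa>\<close> is positive.
\<close>

lemma newton_subharmonic:
  assumes "\<kappa> \<le> - \<kappa>0"
  shows "\<forall>\<^sub>F x in far. newton \<kappa> x \<le> P (newton \<kappa>) x"
proof -
  have "newton \<kappa> x \<le> P (newton \<kappa>) x" if x: "8 * reach\<^sup>2 + 1 - 4 * \<kappa> \<le> Q x" for x
  proof -
    have r: "0 \<le> reach\<^sup>2" by simp
    have "\<bar>newton \<kappa> x - P (newton \<kappa>) x - 4 * \<kappa> / (Q x + \<kappa>) ^ 3\<bar> \<le> C1 / (Q x + \<kappa>) ^ 3"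
      unfolding newton_def
    proof (rule walk_avg_newtonian)
      show "Q x + 1 \<le> 2 * (Q x + \<kappa>)" using x assms \<kappa>0_bounds r unfolding distrib_left by linarith
      fix z assume "z \<in> steps"
      then show "(Q x + \<kappa>) / 4 \<le> Q (x + z) + \<kappa>"
        using Q_step_ge[of z x] x assms \<kappa>0_bounds r unfolding add_divide_distrib by linarith
    qed
    moreover have "0 < (Q x + \<kappa>) ^ 3" using x assms \<kappa>0_bounds r by (intro zero_less_power) linarith
    then have "(4 * \<kappa> + C1) / (Q x + \<kappa>) ^ 3 \<le> 0"
      using assms \<kappa>0_bounds by (intro divide_nonpos_pos) auto
    ultimately show ?thesis by (simp add: add_divide_distrib abs_le_iff)
  qed
  then show ?thesis by (auto simp: eventually_far)
qed

text \<open>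
  The factor by which \<open>newton \<kappa>\<close> changes in one step from \<open>x\<close>; it is within \<open>O (1 / sqrt (Q x))\<close> of one.
\<close>

definition ratio :: "real \<Rightarrow> 'a \<Rightarrow> 'a \<Rightarrow> real" where
  "ratio \<kappa> x z = (Q x + \<kappa>) / (Q (x + z) + \<kappa>)"

lemma ratio_minus_1:
  assumes "0 < Q (x + z) + \<kappa>"
  shows "ratio \<kappa> x z - 1 = - (incr x z / (Q (x + z) + \<kappa>))"
proof -
  have "Q x + \<kappa> = (Q (x + z) + \<kappa>) - incr x z" by (simp add: Q_add)
  then show ?thesis using assms unfolding ratio_def by (simp only: diff_divide_distrib) simp
qed

lemma ratio_near_1:
  assumes "0 < \<epsilon>"
  shows "\<forall>\<^sub>F x in far. 0 < Q x + \<kappa> \<and> (\<forall>z\<in>steps. 0 < Q (x + z) + \<kappa> \<and> \<bar>ratio \<kappa> x z - 1\<bar> \<le> \<epsilon>)"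
proof -
  define C where "C = sqrt (8 * reach ^ 4)"
  have C: "\<bar>incr x z\<bar> \<le> C * sqrt (Q x + 1)" if "z \<in> steps" for x z
    using real_sqrt_le_mono[OF incr_sq_le[OF that, of x]] by (simp add: C_def real_sqrt_mult)
  have "((\<lambda>q. C * sqrt (q + 1) / (q + \<kappa> - C * sqrt (q + 1))) \<longlongrightarrow> 0) at_top"
       "filterlim (\<lambda>q. q + \<kappa> - C * sqrt (q + 1)) at_top at_top"
       "filterlim (\<lambda>q. q + \<kappa>) at_top at_top"
    by real_asymp+
  then have "\<forall>\<^sub>F q in at_top. C * sqrt (q + 1) / (q + \<kappa> - C * sqrt (q + 1)) < \<epsilon>
      \<and> 0 < q + \<kappa> - C * sqrt (q + 1) \<and> 0 < q + \<kappa>"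
    using assms unfolding filterlim_at_top_dense by (intro eventually_conj order_tendstoD(2)) blast+
  from eventually_compose_filterlim[OF this Q_at_top]
  show ?thesis
  proof (rule eventually_mono)
    fix x assume x: "C * sqrt (Q x + 1) / (Q x + \<kappa> - C * sqrt (Q x + 1)) < \<epsilon>
      \<and> 0 < Q x + \<kappa> - C * sqrt (Q x + 1) \<and> 0 < Q x + \<kappa>"
    have "0 < Q (x + z) + \<kappa> \<and> \<bar>ratio \<kappa> x z - 1\<bar> \<le> \<epsilon>" if z: "z \<in> steps" for z
    proof -
      have lower: "Q x + \<kappa> - C * sqrt (Q x + 1) \<le> Q (x + z) + \<kappa>"
        using C[OF z, of x] by (simp add: Q_add)
      then have pos: "0 < Q (x + z) + \<kappa>" using x by linarith
      have "\<bar>ratio \<kappa> x z - 1\<bar> = \<bar>incr x z\<bar> / (Q (x + z) + \<kappa>)"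
        using pos by (simp add: ratio_minus_1[OF pos])
      also have "\<dots> \<le> C * sqrt (Q x + 1) / (Q x + \<kappa> - C * sqrt (Q x + 1))"
        using C[OF z, of x] lower x by (intro frac_le) auto
      finally show ?thesis using x pos by simp
    qed
    then show "0 < Q x + \<kappa> \<and> (\<forall>z\<in>steps. 0 < Q (x + z) + \<kappa> \<and> \<bar>ratio \<kappa> x z - 1\<bar> \<le> \<epsilon>)"
      using x by blast
  qed
qed

text \<open>
  The carre du champ of \<open>ln (Q + \<kappa>)\<close>: the squared gradient of \<open>ln Q\<close> is \<open>4 / Q\<close>.
\<close>

lemma ratio_second_moment:
  assumes "0 < \<epsilon>"
  shows "\<forall>\<^sub>F x in far. 4 * (1 - \<epsilon>) \<le> (Q x + \<kappa>) * (\<Sum>z\<in>steps. pmf \<mu> z * (ratio \<kappa> x z - 1)\<^sup>2)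
      \<and> (Q x + \<kappa>) * (\<Sum>z\<in>steps. pmf \<mu> z * (ratio \<kappa> x z - 1)\<^sup>2) \<le> 4 * (1 + \<epsilon>)"
proof -
  define \<eta> where "\<eta> = min 1 (\<epsilon> / 4)"
  have \<eta>: "0 < \<eta>" "\<eta> \<le> 1" "4 * \<eta> \<le> \<epsilon>" using assms by (auto simp: \<eta>_def)
  have "((\<lambda>q. (4 * q + c) / (q + \<kappa>)) \<longlongrightarrow> 4) at_top" for c by real_asymp
  then have "\<forall>\<^sub>F q in at_top. 4 - \<eta> < (4 * q + c2) / (q + \<kappa>) \<and> (4 * q + c2) / (q + \<kappa>) < 4 + \<eta>"
    using \<eta> by (intro eventually_conj order_tendstoD) auto
  from eventually_conj[OF eventually_compose_filterlim[OF this Q_at_top] ratio_near_1[OF \<eta>(1), of \<kappa>]]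
  show ?thesis
  proof (rule eventually_mono)
    fix x assume x: "(4 - \<eta> < (4 * Q x + c2) / (Q x + \<kappa>) \<and> (4 * Q x + c2) / (Q x + \<kappa>) < 4 + \<eta>) \<and>
      0 < Q x + \<kappa> \<and> (\<forall>z\<in>steps. 0 < Q (x + z) + \<kappa> \<and> \<bar>ratio \<kappa> x z - 1\<bar> \<le> \<eta>)"
    define a where "a = Q x + \<kappa>"
    have a: "0 < a" using x by (simp add: a_def)
    define V where "V = (\<Sum>z\<in>steps. pmf \<mu> z * (ratio \<kappa> x z - 1)\<^sup>2)"
    have sq: "(ratio \<kappa> x z - 1)\<^sup>2 = (ratio \<kappa> x z)\<^sup>2 * ((incr x z)\<^sup>2 / a\<^sup>2)" if "z \<in> steps" for z
    proof -
      have pos: "0 < Q (x + z) + \<kappa>" using x that by blast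
      have "ratio \<kappa> x z - 1 = - (ratio \<kappa> x z * (incr x z / a))"
        using a unfolding ratio_minus_1[OF pos] by (simp add: ratio_def a_def)
      then show ?thesis by (simp add: power_mult_distrib power_divide)
    qed
    have r: "(1 - \<eta>)\<^sup>2 \<le> (ratio \<kappa> x z)\<^sup>2 \<and> (ratio \<kappa> x z)\<^sup>2 \<le> (1 + \<eta>)\<^sup>2" if "z \<in> steps" for z
      using x that \<eta> by (intro conjI power_mono) (auto simp: abs_le_iff algebra_simps)
    have S: "(\<Sum>z\<in>steps. pmf \<mu> z * (c * ((incr x z)\<^sup>2 / a\<^sup>2))) = c * (4 * Q x + c2) / a\<^sup>2" for c
      unfolding moment_incr_2[symmetric] by (simp add: sum_distrib_left sum_divide_distrib algebra_simps)
    have "V \<le> (\<Sum>z\<in>steps. pmf \<mu> z * ((1 + \<eta>)\<^sup>2 * ((incr x z)\<^sup>2 / a\<^sup>2)))"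
      unfolding V_def
    proof (intro sum_mono mult_left_mono)
      fix z assume z: "z \<in> steps"
      show "(ratio \<kappa> x z - 1)\<^sup>2 \<le> (1 + \<eta>)\<^sup>2 * ((incr x z)\<^sup>2 / a\<^sup>2)"
        unfolding sq[OF z] using r[OF z] by (intro mult_right_mono) auto
    qed auto
    then have "V \<le> (1 + \<eta>)\<^sup>2 * (4 * Q x + c2) / a\<^sup>2" by (simp only: S)
    then have "a * V \<le> a * ((1 + \<eta>)\<^sup>2 * (4 * Q x + c2) / a\<^sup>2)" using a by (intro mult_left_mono) auto
    also have "\<dots> = (1 + \<eta>)\<^sup>2 * ((4 * Q x + c2) / a)" using a by (simp add: power2_eq_square)
    also have "\<dots> \<le> (1 + \<eta>)\<^sup>2 * (4 + \<eta>)" using x by (intro mult_left_mono) (auto simp: a_def)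
    also have "\<dots> \<le> (1 + 3 * \<eta>) * (4 + \<eta>)"
      using \<eta> by (intro mult_right_mono) (auto simp: power2_eq_square algebra_simps)
    also have "\<dots> \<le> 4 * (1 + \<epsilon>)"
    proof -
      have "\<eta> * \<eta> \<le> \<eta>" using mult_left_mono[OF \<eta>(2), of \<eta>] \<eta> by simp
      then have "13 * \<eta> + 3 * (\<eta> * \<eta>) \<le> 4 * \<epsilon>" using \<eta> by linarith
      then show ?thesis by (simp add: algebra_simps)
    qed
    finally have up: "a * V \<le> 4 * (1 + \<epsilon>)" .
    have "(\<Sum>z\<in>steps. pmf \<mu> z * ((1 - \<eta>)\<^sup>2 * ((incr x z)\<^sup>2 / a\<^sup>2))) \<le> V"
      unfolding V_def
    proof (intro sum_mono mult_left_mono)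
      fix z assume z: "z \<in> steps"
      show "(1 - \<eta>)\<^sup>2 * ((incr x z)\<^sup>2 / a\<^sup>2) \<le> (ratio \<kappa> x z - 1)\<^sup>2"
        unfolding sq[OF z] using r[OF z] by (intro mult_right_mono) auto
    qed auto
    then have "(1 - \<eta>)\<^sup>2 * (4 * Q x + c2) / a\<^sup>2 \<le> V" by (simp only: S)
    then have "a * ((1 - \<eta>)\<^sup>2 * (4 * Q x + c2) / a\<^sup>2) \<le> a * V" using a by (intro mult_left_mono) auto
    moreover have "a * ((1 - \<eta>)\<^sup>2 * (4 * Q x + c2) / a\<^sup>2) = (1 - \<eta>)\<^sup>2 * ((4 * Q x + c2) / a)"
      using a by (simp add: power2_eq_square)
    moreover have "(1 - \<eta>)\<^sup>2 * (4 - \<eta>) \<le> (1 - \<eta>)\<^sup>2 * ((4 * Q x + c2) / a)"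
      using x by (intro mult_left_mono) (auto simp: a_def)
    moreover have "(1 - 2 * \<eta>) * (4 - \<eta>) \<le> (1 - \<eta>)\<^sup>2 * (4 - \<eta>)"
      using \<eta> by (intro mult_right_mono) (auto simp: power2_eq_square algebra_simps)
    moreover have "4 * (1 - \<epsilon>) \<le> (1 - 2 * \<eta>) * (4 - \<eta>)"
      using \<eta> by (simp add: algebra_simps add_increasing2)
    ultimately have "4 * (1 - \<epsilon>) \<le> a * V" by linarith
    with up show "4 * (1 - \<epsilon>) \<le> (Q x + \<kappa>) * (\<Sum>z\<in>steps. pmf \<mu> z * (ratio \<kappa> x z - 1)\<^sup>2)
      \<and> (Q x + \<kappa>) * (\<Sum>z\<in>steps. pmf \<mu> z * (ratio \<kappa> x z - 1)\<^sup>2) \<le> 4 * (1 + \<epsilon>)"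
      by (simp add: a_def V_def)
  qed
qed

text \<open>
  \<open>t * ln t\<close> has derivative one and second derivative one at \<open>t = 1\<close>.
\<close>

lemma entropy_bounds:
  fixes \<epsilon> :: real
  assumes "0 < \<epsilon>"
  obtains \<eta> where "0 < \<eta>" "\<eta> \<le> 1 / 2" "\<And>t. \<bar>t - 1\<bar> \<le> \<eta> \<Longrightarrow>
      (t - 1) + (1 - \<epsilon>) * ((t - 1)\<^sup>2 / 2) \<le> t * ln t \<and>
      t * ln t \<le> (t - 1) + (1 + \<epsilon>) * ((t - 1)\<^sup>2 / 2) \<and>
      t * (ln t)\<^sup>2 \<le> (1 + \<epsilon>) * (t - 1)\<^sup>2 \<and> \<bar>ln t\<bar> \<le> \<epsilon>"
proof -
  define \<eta> where "\<eta> = min (1 / 2) (\<epsilon> / 2)"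
  have \<eta>: "0 < \<eta>" "\<eta> \<le> 1 / 2" "2 * \<eta> \<le> \<epsilon>" using assms by (auto simp: \<eta>_def)
  show thesis
  proof (rule that[OF \<eta>(1,2)])
    fix t :: real assume t: "\<bar>t - 1\<bar> \<le> \<eta>"
    then have tpos: "1 / 2 \<le> t" "t \<le> 3 / 2" using \<eta> by (auto simp: abs_le_iff)
    have inv: "1 - \<epsilon> \<le> 1 / \<xi> \<and> 1 / \<xi> \<le> 1 + \<epsilon>" if "\<bar>\<xi> - 1\<bar> \<le> \<eta>" for \<xi> :: real
    proof -
      have x: "1 / 2 \<le> \<xi>" "\<xi> \<le> 1 + \<eta>" "1 - \<eta> \<le> \<xi>" using that \<eta> by (auto simp: abs_le_iff)
      have "\<bar>1 / \<xi> - 1\<bar> = \<bar>\<xi> - 1\<bar> / \<xi>" using x by (simp add: field_simps abs_if)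
      also have "\<dots> \<le> \<eta> / (1 / 2)" using x that \<eta> by (intro frac_le) auto
      also have "\<dots> \<le> \<epsilon>" using \<eta> by simp
      finally show ?thesis by (simp add: abs_le_iff)
    qed
    have "\<exists>\<xi>. \<bar>\<xi> - 1\<bar> \<le> \<eta> \<and> t * ln t = (t - 1) + 1 / \<xi> * ((t - 1)\<^sup>2 / 2)"
    proof (cases "t = 1")
      case False
      define D :: "nat \<Rightarrow> real \<Rightarrow> real" where
        "D m = (if m = 0 then (\<lambda>t. t * ln t) else if m = 1 then (\<lambda>t. ln t + 1) else (\<lambda>t. 1 / t))" for m
      have der: "DERIV (D m) s :> D (Suc m) s" if "m < 2" "1 / 2 \<le> s" for m s
        using that by (auto simp: D_def less_2_cases_iff intro!: derivative_eq_intros)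
      obtain \<xi> where "if t < 1 then t < \<xi> \<and> \<xi> < 1 else 1 < \<xi> \<and> \<xi> < t"
        and "t * ln t = (\<Sum>m<2. D m 1 / fact m * (t - 1) ^ m) + D 2 \<xi> / fact 2 * (t - 1)\<^sup>2"
        using Taylor[of 2 D "\<lambda>t. t * ln t" "1 / 2" "3 / 2" 1 t] der tpos False
        by (auto simp: D_def)
      then show ?thesis using t by (intro exI[of _ \<xi>])
        (auto simp: D_def numeral_2_eq_2 abs_if split: if_splits)
    qed (use \<eta> in \<open>auto intro!: exI[of _ 1]\<close>)
    then obtain \<xi> where \<xi>: "\<bar>\<xi> - 1\<bar> \<le> \<eta>" "t * ln t = (t - 1) + 1 / \<xi> * ((t - 1)\<^sup>2 / 2)" by blast
    have 1: "(t - 1) + (1 - \<epsilon>) * ((t - 1)\<^sup>2 / 2) \<le> t * ln t" "t * ln t \<le> (t - 1) + (1 + \<epsilon>) * ((t - 1)\<^sup>2 / 2)"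
      unfolding \<xi>(2) using inv[OF \<xi>(1)] by (intro add_left_mono mult_right_mono; simp)+
    have 2: "\<bar>ln t\<bar> \<le> \<bar>t - 1\<bar> / min 1 t"
    proof (cases "t \<ge> 1")
      case True
      then show ?thesis using ln_le_minus_one[of t] by simp
    next
      case False
      have "ln (1 / t) \<le> 1 / t - 1" using tpos by (intro ln_le_minus_one) simp
      then show ?thesis using tpos False by (simp add: ln_div field_simps)
    qed
    have 3: "t * (ln t)\<^sup>2 \<le> (1 + \<epsilon>) * (t - 1)\<^sup>2"
    proof -
      have "(ln t)\<^sup>2 \<le> (\<bar>t - 1\<bar> / min 1 t)\<^sup>2" using power_mono[OF 2, of 2] by simp
      then have "t * (ln t)\<^sup>2 \<le> t * ((t - 1)\<^sup>2 / (min 1 t)\<^sup>2)" using tpos by (intro mult_left_mono) (auto simp: power_divide)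
      also have "\<dots> = t / (min 1 t)\<^sup>2 * (t - 1)\<^sup>2" by simp
      also have "t / (min 1 t)\<^sup>2 \<le> 1 + \<epsilon>"
      proof (cases "t \<ge> 1")
        case True then show ?thesis using t \<eta> by (auto simp: abs_le_iff)
      next
        case False
        then have "t / (min 1 t)\<^sup>2 = 1 / t" using tpos by (simp add: power2_eq_square)
        then show ?thesis using inv[OF t] by simp
      qed
      finally show ?thesis by (simp add: mult_right_mono)
    qed
    have "\<bar>ln t\<bar> \<le> \<eta> / (1 / 2)" using 2 t tpos \<eta> by (elim order_trans) (intro frac_le, auto)
    then have "\<bar>ln t\<bar> \<le> \<epsilon>" using \<eta> by simp
    with 1 3 show "(t - 1) + (1 - \<epsilon>) * ((t - 1)\<^sup>2 / 2) \<le> t * ln t \<and>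
      t * ln t \<le> (t - 1) + (1 + \<epsilon>) * ((t - 1)\<^sup>2 / 2) \<and>
      t * (ln t)\<^sup>2 \<le> (1 + \<epsilon>) * (t - 1)\<^sup>2 \<and> \<bar>ln t\<bar> \<le> \<epsilon>" by blast
  qed
qed

lemma log_quotient_expansion:
  fixes t L \<beta> \<tau> :: real
  assumes "L \<noteq> 0" "L - \<beta> * \<tau> \<noteq> 0"
  shows "t / (L - \<beta> * \<tau>) = t / L + \<beta> * (t * \<tau>) / L\<^sup>2 + \<beta>\<^sup>2 * (t * \<tau>\<^sup>2) / (L\<^sup>2 * (L - \<beta> * \<tau>))"
proof -
  define i r where "i = 1 / (L - \<beta> * \<tau>)" and "r = 1 / L"
  have "(L - \<beta> * \<tau>) * i = 1" "L * r = 1" using assms by (auto simp: i_def r_def)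
  then have "t * i = t * r + \<beta> * (t * \<tau>) * r\<^sup>2 + \<beta>\<^sup>2 * (t * \<tau>\<^sup>2) * (r\<^sup>2 * i)" by algebra
  then show ?thesis using assms by (simp add: i_def r_def power_divide)
qed

text \<open>
  The barrier.  Of its two parameters, \<open>\<beta>\<close> decides between super- and subsolution while \<open>\<alpha>\<close> is free and
  is adapted to the values on a bounded region.
\<close>

definition profile :: "real \<Rightarrow> real \<Rightarrow> real \<Rightarrow> 'a \<Rightarrow> real" where
  "profile \<alpha> \<beta> \<kappa> x = newton \<kappa> x / (\<alpha> + \<beta> * ln (Q x + \<kappa>))"

lemma eventually_newton_less: "0 < c \<Longrightarrow> \<forall>\<^sub>F x in far. newton \<kappa> x < c"
proof -
  assume "0 < c"
  moreover have "((\<lambda>q. 1 / (q + \<kappa>)) \<longlongrightarrow> 0) at_top" by real_asymp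
  ultimately have "\<forall>\<^sub>F q in at_top. 1 / (q + \<kappa>) < c" by (intro order_tendstoD)
  from eventually_compose_filterlim[OF this Q_at_top] show ?thesis by (simp add: newton_def)
qed

text \<open>
  The one-step average of the barrier, relative to that of the harmonic kernel \<open>w\<close>.  With \<open>t\<close> the factor
  by which \<open>w\<close> changes in a step, the barrier at \<open>x + z\<close> is \<open>w x * t / (L - \<beta> * ln t)\<close>.  Expanding in
  \<open>\<beta> * ln t / L\<close>, the linear terms reproduce \<open>P w - w\<close>, and the quadratic ones give \<open>2 * \<beta> * (w / L)\<^sup>2\<close>, which
  has to be balanced by the nonlinearity; the remainder is smaller by the factor \<open>\<beta> / L\<close>.  All
  estimates are uniform in \<open>\<alpha>\<close> once \<open>L\<close> is at least \<open>lmin\<close>.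
\<close>

lemma profile_step:
  assumes pos: "0 < Q x + \<kappa>" "\<And>z. z \<in> steps \<Longrightarrow> 0 < Q (x + z) + \<kappa>"
    and \<beta>: "0 < \<beta>" and \<epsilon>: "0 < \<epsilon>" "\<epsilon> < 1"
    and L: "L = \<alpha> + \<beta> * ln (Q x + \<kappa>)" "lmin \<le> L" "0 < lmin"
    and t: "\<And>z. z \<in> steps \<Longrightarrow> \<bar>ratio \<kappa> x z - 1\<bar> \<le> \<epsilon> \<and> \<beta> * \<bar>ln (ratio \<kappa> x z)\<bar> \<le> \<epsilon> * lmin \<and>
      (ratio \<kappa> x z - 1) + (1 - \<epsilon>) * ((ratio \<kappa> x z - 1)\<^sup>2 / 2) \<le> ratio \<kappa> x z * ln (ratio \<kappa> x z) \<and>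
      ratio \<kappa> x z * ln (ratio \<kappa> x z) \<le> (ratio \<kappa> x z - 1) + (1 + \<epsilon>) * ((ratio \<kappa> x z - 1)\<^sup>2 / 2) \<and>
      ratio \<kappa> x z * (ln (ratio \<kappa> x z))\<^sup>2 \<le> (1 + \<epsilon>) * (ratio \<kappa> x z - 1)\<^sup>2"
    and V: "4 * (1 - \<epsilon>) \<le> (Q x + \<kappa>) * (\<Sum>z\<in>steps. pmf \<mu> z * (ratio \<kappa> x z - 1)\<^sup>2)"
      "(Q x + \<kappa>) * (\<Sum>z\<in>steps. pmf \<mu> z * (ratio \<kappa> x z - 1)\<^sup>2) \<le> 4 * (1 + \<epsilon>)"
  defines "w \<equiv> newton \<kappa>" and "W \<equiv> profile \<alpha> \<beta> \<kappa>"
  shows "z \<in> steps \<Longrightarrow> (1 - \<epsilon>) / (1 + \<epsilon>) * (w x / L) \<le> W (x + z)"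
    and "z \<in> steps \<Longrightarrow> W (x + z) \<le> (1 + \<epsilon>) / (1 - \<epsilon>) * (w x / L)"
    and "P W x \<le> W x + (1 / L + \<beta> / L\<^sup>2) * (P w x - w x)
        + (w x / L)\<^sup>2 * (2 * \<beta> * (1 + \<epsilon>)\<^sup>2 + 4 * \<beta>\<^sup>2 * (1 + \<epsilon>)\<^sup>2 / ((1 - \<epsilon>) * lmin))"
    and "W x + (1 / L + \<beta> / L\<^sup>2) * (P w x - w x) + (w x / L)\<^sup>2 * (2 * \<beta> * (1 - \<epsilon>)\<^sup>2) \<le> P W x"
proof -
  define T where "T z = ratio \<kappa> x z" for z
  define v where "v = w x"
  have Lpos: "0 < L" using L by linarith
  have vpos: "0 < v" using pos by (simp add: v_def w_def newton_def)
  have Wx: "W x = v / L" by (simp add: W_def profile_def v_def w_def L(1))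
  define M where "M z = L - \<beta> * ln (T z)" for z
  have wz: "w (x + z) = v * T z" if "z \<in> steps" for z
    using pos pos(2)[OF that] by (simp add: w_def v_def newton_def T_def ratio_def)
  have Wz: "W (x + z) = v * (T z / M z)" if z: "z \<in> steps" for z
  proof -
    have lnT: "ln (T z) = ln (Q x + \<kappa>) - ln (Q (x + z) + \<kappa>)"
      unfolding T_def ratio_def using pos pos(2)[OF z] by (simp add: ln_div)
    have "\<alpha> + \<beta> * ln (Q (x + z) + \<kappa>) = M z" unfolding M_def L(1) lnT by (simp add: algebra_simps)
    then show ?thesis using wz[OF z] by (simp add: W_def profile_def w_def)
  qed
  have M: "(1 - \<epsilon>) * L \<le> M z \<and> M z \<le> (1 + \<epsilon>) * L" if z: "z \<in> steps" for z
  proof -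
    have "\<bar>\<beta> * ln (T z)\<bar> \<le> \<epsilon> * L"
    proof -
      have "\<bar>\<beta> * ln (T z)\<bar> = \<beta> * \<bar>ln (T z)\<bar>" using \<beta> by (simp add: abs_mult)
      also have "\<dots> \<le> \<epsilon> * lmin" using t[OF z] by (simp add: T_def)
      also have "\<dots> \<le> \<epsilon> * L" using \<epsilon> L(2) by (intro mult_left_mono) auto
      finally show ?thesis .
    qed
    then show ?thesis by (simp add: M_def abs_le_iff algebra_simps)
  qed
  have Mpos: "0 < (1 - \<epsilon>) * L" using \<epsilon> Lpos by simp
  have T: "1 - \<epsilon> \<le> T z \<and> T z \<le> 1 + \<epsilon>" if "z \<in> steps" for z
    using t[OF that] by (auto simp: T_def abs_le_iff)
  show "(1 - \<epsilon>) / (1 + \<epsilon>) * (w x / L) \<le> W (x + z)" if z: "z \<in> steps"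
  proof -
    have "(1 - \<epsilon>) / ((1 + \<epsilon>) * L) \<le> T z / M z"
      using M[OF z] T[OF z] Mpos \<epsilon> by (intro frac_le) auto
    then have "v * ((1 - \<epsilon>) / ((1 + \<epsilon>) * L)) \<le> v * (T z / M z)" using vpos by (intro mult_left_mono) auto
    then show ?thesis unfolding Wz[OF z] by (simp add: v_def mult_ac)
  qed
  show "W (x + z) \<le> (1 + \<epsilon>) / (1 - \<epsilon>) * (w x / L)" if z: "z \<in> steps"
  proof -
    have "T z / M z \<le> (1 + \<epsilon>) / ((1 - \<epsilon>) * L)"
      using M[OF z] T[OF z] Mpos \<epsilon> by (intro frac_le) auto
    then have "v * (T z / M z) \<le> v * ((1 + \<epsilon>) / ((1 - \<epsilon>) * L))" using vpos by (intro mult_left_mono) auto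
    then show ?thesis unfolding Wz[OF z] by (simp add: v_def mult_ac)
  qed
  define S where "S = (\<Sum>z\<in>steps. pmf \<mu> z * (T z - 1)\<^sup>2)"
  have S: "4 * (1 - \<epsilon>) * v \<le> S" "S \<le> 4 * (1 + \<epsilon>) * v"
    using V pos(1) by (auto simp: S_def T_def v_def w_def newton_def field_simps)
  have Tavg: "(\<Sum>z\<in>steps. pmf \<mu> z * (T z - 1)) = (P w x - w x) / v"
  proof -
    have "P w x = (\<Sum>z\<in>steps. pmf \<mu> z * (v * T z))" unfolding walk_avg_def using wz by (intro sum.cong) auto
    then have "P w x - w x = (\<Sum>z\<in>steps. pmf \<mu> z * (v * T z)) - (\<Sum>z\<in>steps. pmf \<mu> z) * v"
      by (simp add: sum_steps v_def)
    also have "\<dots> = (\<Sum>z\<in>steps. pmf \<mu> z * (T z - 1)) * v"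
      unfolding sum_distrib_right sum_subtractf[symmetric] by (intro sum.cong) (auto simp: algebra_simps)
    finally show ?thesis using vpos by simp
  qed
  have expand: "T z / M z = 1 / L + (T z - 1) / L + \<beta> * (T z * ln (T z)) / L\<^sup>2
      + \<beta>\<^sup>2 * (T z * (ln (T z))\<^sup>2) / (L\<^sup>2 * M z)" if z: "z \<in> steps" for z
  proof -
    have "M z \<noteq> 0" using M[OF z] Mpos by auto
    then have "T z / M z = T z / L + \<beta> * (T z * ln (T z)) / L\<^sup>2 + \<beta>\<^sup>2 * (T z * (ln (T z))\<^sup>2) / (L\<^sup>2 * M z)"
      unfolding M_def using Lpos by (intro log_quotient_expansion) auto
    then show ?thesis by (simp add: diff_divide_distrib)
  qed
  have sum_lin: "(\<Sum>z\<in>steps. pmf \<mu> z * (1 / L + b * (T z - 1) + c * (T z - 1)\<^sup>2))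
      = 1 / L + b * ((P w x - w x) / v) + c * S" for b c
    unfolding Tavg[symmetric] S_def
    by (simp add: distrib_left sum.distrib sum_distrib_left sum_steps mult.left_commute flip: sum_divide_distrib)
  have PW: "P W x = v * (\<Sum>z\<in>steps. pmf \<mu> z * (T z / M z))"
    unfolding walk_avg_def sum_distrib_left using Wz by (intro sum.cong) (auto simp: mult.left_commute)
  define cu where "cu = \<beta> * (1 + \<epsilon>) / (2 * L\<^sup>2) + \<beta>\<^sup>2 * (1 + \<epsilon>) / (L\<^sup>2 * ((1 - \<epsilon>) * lmin))"
  define cl where "cl = \<beta> * (1 - \<epsilon>) / (2 * L\<^sup>2)"
  have up: "T z / M z \<le> 1 / L + (1 / L + \<beta> / L\<^sup>2) * (T z - 1) + cu * (T z - 1)\<^sup>2" if z: "z \<in> steps" for z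
  proof -
    have a: "\<beta> * (T z * ln (T z)) / L\<^sup>2 \<le> \<beta> * ((T z - 1) + (1 + \<epsilon>) * ((T z - 1)\<^sup>2 / 2)) / L\<^sup>2"
      using t[OF z] \<beta> by (intro divide_right_mono mult_left_mono) (auto simp: T_def)
    have "(1 - \<epsilon>) * lmin \<le> (1 - \<epsilon>) * L" using \<epsilon> L(2) by (intro mult_left_mono) auto
    then have "(1 - \<epsilon>) * lmin \<le> M z" using M[OF z] by linarith
    then have b: "\<beta>\<^sup>2 * (T z * (ln (T z))\<^sup>2) / (L\<^sup>2 * M z) \<le> \<beta>\<^sup>2 * ((1 + \<epsilon>) * (T z - 1)\<^sup>2) / (L\<^sup>2 * ((1 - \<epsilon>) * lmin))"
      using t[OF z] \<beta> \<epsilon> Lpos L by (intro frac_le mult_left_mono mult_pos_pos) (auto simp: T_def)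
    have "1 / L + (T z - 1) / L + \<beta> * ((T z - 1) + (1 + \<epsilon>) * ((T z - 1)\<^sup>2 / 2)) / L\<^sup>2
        + \<beta>\<^sup>2 * ((1 + \<epsilon>) * (T z - 1)\<^sup>2) / (L\<^sup>2 * ((1 - \<epsilon>) * lmin))
       = 1 / L + (1 / L + \<beta> / L\<^sup>2) * (T z - 1) + cu * (T z - 1)\<^sup>2"
      by (simp add: cu_def ring_distribs add_divide_distrib diff_divide_distrib)
    then show ?thesis using expand[OF z] a b by linarith
  qed
  have low: "1 / L + (1 / L + \<beta> / L\<^sup>2) * (T z - 1) + cl * (T z - 1)\<^sup>2 \<le> T z / M z" if z: "z \<in> steps" for z
  proof -
    have a: "\<beta> * ((T z - 1) + (1 - \<epsilon>) * ((T z - 1)\<^sup>2 / 2)) / L\<^sup>2 \<le> \<beta> * (T z * ln (T z)) / L\<^sup>2"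
      using t[OF z] \<beta> by (intro divide_right_mono mult_left_mono) (auto simp: T_def)
    have "0 < M z" using M[OF z] Mpos by linarith
    moreover have "0 \<le> T z" using T[OF z] \<epsilon> by linarith
    ultimately have b: "0 \<le> \<beta>\<^sup>2 * (T z * (ln (T z))\<^sup>2) / (L\<^sup>2 * M z)" by simp
    have "1 / L + (T z - 1) / L + \<beta> * ((T z - 1) + (1 - \<epsilon>) * ((T z - 1)\<^sup>2 / 2)) / L\<^sup>2
       = 1 / L + (1 / L + \<beta> / L\<^sup>2) * (T z - 1) + cl * (T z - 1)\<^sup>2"
      by (simp add: cl_def ring_distribs add_divide_distrib diff_divide_distrib)
    then show ?thesis using expand[OF z] a b by linarith
  qed
  have lin: "v * (1 / L + A * (D / v) + c * (k * v)) = W x + A * D + v\<^sup>2 * (c * k)" for A D c k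
    using vpos by (simp add: Wx distrib_left power2_eq_square)
  have cu4: "v\<^sup>2 * ((\<beta> * e1 / (2 * L\<^sup>2) + \<beta>\<^sup>2 * e1 / (L\<^sup>2 * m)) * (4 * e1)) = v\<^sup>2 / L\<^sup>2 * (2 * \<beta> * e1\<^sup>2 + 4 * \<beta>\<^sup>2 * e1\<^sup>2 / m)"
    for e1 m by (simp add: distrib_left distrib_right power2_eq_square mult_ac)
  have cl4: "v\<^sup>2 * (\<beta> * e1 / (2 * L\<^sup>2) * (4 * e1)) = v\<^sup>2 / L\<^sup>2 * (2 * \<beta> * e1\<^sup>2)" for e1
    by (simp add: power2_eq_square)
  have cu0: "0 \<le> cu" unfolding cu_def using \<beta> \<epsilon> L by (intro add_nonneg_nonneg divide_nonneg_nonneg mult_nonneg_nonneg) auto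
  have cl0: "0 \<le> cl" unfolding cl_def using \<beta> \<epsilon> by simp
  have "(\<Sum>z\<in>steps. pmf \<mu> z * (T z / M z)) \<le> 1 / L + (1 / L + \<beta> / L\<^sup>2) * ((P w x - w x) / v) + cu * S"
    unfolding sum_lin[symmetric] using up by (intro sum_mono mult_left_mono) auto
  also have "\<dots> \<le> 1 / L + (1 / L + \<beta> / L\<^sup>2) * ((P w x - w x) / v) + cu * (4 * (1 + \<epsilon>) * v)"
    using S cu0 by (intro add_left_mono mult_left_mono)
  finally have "P W x \<le> v * (1 / L + (1 / L + \<beta> / L\<^sup>2) * ((P w x - w x) / v) + cu * (4 * (1 + \<epsilon>) * v))"
    unfolding PW using vpos by (intro mult_left_mono) auto
  also have "\<dots> = W x + (1 / L + \<beta> / L\<^sup>2) * (P w x - w x) + v\<^sup>2 * (cu * (4 * (1 + \<epsilon>)))"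
    by (rule lin)
  also have "v\<^sup>2 * (cu * (4 * (1 + \<epsilon>))) = (w x / L)\<^sup>2 * (2 * \<beta> * (1 + \<epsilon>)\<^sup>2 + 4 * \<beta>\<^sup>2 * (1 + \<epsilon>)\<^sup>2 / ((1 - \<epsilon>) * lmin))"
    unfolding cu_def v_def[symmetric] power_divide by (rule cu4)
  finally show "P W x \<le> W x + (1 / L + \<beta> / L\<^sup>2) * (P w x - w x)
        + (w x / L)\<^sup>2 * (2 * \<beta> * (1 + \<epsilon>)\<^sup>2 + 4 * \<beta>\<^sup>2 * (1 + \<epsilon>)\<^sup>2 / ((1 - \<epsilon>) * lmin))" .
  have "1 / L + (1 / L + \<beta> / L\<^sup>2) * ((P w x - w x) / v) + cl * (4 * (1 - \<epsilon>) * v)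
     \<le> 1 / L + (1 / L + \<beta> / L\<^sup>2) * ((P w x - w x) / v) + cl * S"
    using S cl0 by (intro add_left_mono mult_left_mono)
  also have "\<dots> \<le> (\<Sum>z\<in>steps. pmf \<mu> z * (T z / M z))"
    unfolding sum_lin[symmetric] using low by (intro sum_mono mult_left_mono) auto
  finally have "v * (1 / L + (1 / L + \<beta> / L\<^sup>2) * ((P w x - w x) / v) + cl * (4 * (1 - \<epsilon>) * v)) \<le> P W x"
    unfolding PW using vpos by (intro mult_left_mono) auto
  moreover have "v * (1 / L + (1 / L + \<beta> / L\<^sup>2) * ((P w x - w x) / v) + cl * (4 * (1 - \<epsilon>) * v))
     = W x + (1 / L + \<beta> / L\<^sup>2) * (P w x - w x) + v\<^sup>2 * (cl * (4 * (1 - \<epsilon>)))"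
    by (rule lin)
  moreover have "v\<^sup>2 * (cl * (4 * (1 - \<epsilon>))) = (w x / L)\<^sup>2 * (2 * \<beta> * (1 - \<epsilon>)\<^sup>2)"
    unfolding cl_def v_def[symmetric] power_divide by (rule cl4)
  ultimately show "W x + (1 / L + \<beta> / L\<^sup>2) * (P w x - w x) + (w x / L)\<^sup>2 * (2 * \<beta> * (1 - \<epsilon>)\<^sup>2) \<le> P W x" by simp
qed

text \<open>
  Far out, all the smallness conditions of \<open>profile_step\<close> hold simultaneously for every \<open>\<alpha>\<close>.
\<close>

lemma profile_step_eventually:
  assumes \<beta>: "0 < \<beta>" and \<epsilon>: "0 < \<epsilon>" "\<epsilon> < 1" and lmin: "0 < lmin"
  shows "\<forall>\<^sub>F x in far. 0 < Q x + \<kappa> \<and> (\<forall>z\<in>steps. 0 < Q (x + z) + \<kappa>) \<and>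
    (\<forall>\<alpha> L. L = \<alpha> + \<beta> * ln (Q x + \<kappa>) \<longrightarrow> lmin \<le> L \<longrightarrow>
      (\<forall>z\<in>steps. (1 - \<epsilon>) / (1 + \<epsilon>) * (newton \<kappa> x / L) \<le> profile \<alpha> \<beta> \<kappa> (x + z) \<and>
         profile \<alpha> \<beta> \<kappa> (x + z) \<le> (1 + \<epsilon>) / (1 - \<epsilon>) * (newton \<kappa> x / L)) \<and>
      P (profile \<alpha> \<beta> \<kappa>) x \<le> profile \<alpha> \<beta> \<kappa> x + (1 / L + \<beta> / L\<^sup>2) * (P (newton \<kappa>) x - newton \<kappa> x)
        + (newton \<kappa> x / L)\<^sup>2 * (2 * \<beta> * (1 + \<epsilon>)\<^sup>2 + 4 * \<beta>\<^sup>2 * (1 + \<epsilon>)\<^sup>2 / ((1 - \<epsilon>) * lmin)) \<and>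
      profile \<alpha> \<beta> \<kappa> x + (1 / L + \<beta> / L\<^sup>2) * (P (newton \<kappa>) x - newton \<kappa> x)
        + (newton \<kappa> x / L)\<^sup>2 * (2 * \<beta> * (1 - \<epsilon>)\<^sup>2) \<le> P (profile \<alpha> \<beta> \<kappa>) x)"
proof -
  define \<epsilon>' where "\<epsilon>' = min \<epsilon> (\<epsilon> * lmin / \<beta>)"
  have \<epsilon>': "0 < \<epsilon>'" "\<epsilon>' \<le> \<epsilon>" "\<beta> * \<epsilon>' \<le> \<epsilon> * lmin"
    using \<beta> \<epsilon> lmin by (auto simp: \<epsilon>'_def min_def field_simps)
  obtain \<eta> where \<eta>: "0 < \<eta>" "\<eta> \<le> 1 / 2" "\<And>t. \<bar>t - 1\<bar> \<le> \<eta> \<Longrightarrow>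
      (t - 1) + (1 - \<epsilon>') * ((t - 1)\<^sup>2 / 2) \<le> t * ln t \<and>
      t * ln t \<le> (t - 1) + (1 + \<epsilon>') * ((t - 1)\<^sup>2 / 2) \<and>
      t * (ln t)\<^sup>2 \<le> (1 + \<epsilon>') * (t - 1)\<^sup>2 \<and> \<bar>ln t\<bar> \<le> \<epsilon>'"
    by (rule entropy_bounds[OF \<epsilon>'(1)]) blast
  have t: "\<beta> * \<bar>ln t\<bar> \<le> \<epsilon> * lmin \<and>
      (t - 1) + (1 - \<epsilon>) * ((t - 1)\<^sup>2 / 2) \<le> t * ln t \<and>
      t * ln t \<le> (t - 1) + (1 + \<epsilon>) * ((t - 1)\<^sup>2 / 2) \<and>
      t * (ln t)\<^sup>2 \<le> (1 + \<epsilon>) * (t - 1)\<^sup>2" if "\<bar>t - 1\<bar> \<le> \<eta>" for t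
  proof -
    have "(1 - \<epsilon>) * ((t - 1)\<^sup>2 / 2) \<le> (1 - \<epsilon>') * ((t - 1)\<^sup>2 / 2)"
      "(1 + \<epsilon>') * ((t - 1)\<^sup>2 / 2) \<le> (1 + \<epsilon>) * ((t - 1)\<^sup>2 / 2)"
      "(1 + \<epsilon>') * (t - 1)\<^sup>2 \<le> (1 + \<epsilon>) * (t - 1)\<^sup>2"
      using \<epsilon>' by (intro mult_right_mono; simp)+
    moreover have "\<beta> * \<bar>ln t\<bar> \<le> \<epsilon> * lmin"
      using mult_left_mono[of "\<bar>ln t\<bar>" \<epsilon>' \<beta>] \<eta>(3)[OF that] \<beta> \<epsilon>' by linarith
    ultimately show ?thesis using \<eta>(3)[OF that] by linarith
  qed
  define \<delta> where "\<delta> = min \<epsilon> \<eta>"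
  have "0 < \<delta>" using \<epsilon> \<eta> by (simp add: \<delta>_def)
  from eventually_conj[OF ratio_near_1[OF this, of \<kappa>] ratio_second_moment[OF \<epsilon>(1), of \<kappa>]]
  show ?thesis
  proof (rule eventually_mono)
    fix x assume x: "(0 < Q x + \<kappa> \<and> (\<forall>z\<in>steps. 0 < Q (x + z) + \<kappa> \<and> \<bar>ratio \<kappa> x z - 1\<bar> \<le> \<delta>)) \<and>
      4 * (1 - \<epsilon>) \<le> (Q x + \<kappa>) * (\<Sum>z\<in>steps. pmf \<mu> z * (ratio \<kappa> x z - 1)\<^sup>2)
      \<and> (Q x + \<kappa>) * (\<Sum>z\<in>steps. pmf \<mu> z * (ratio \<kappa> x z - 1)\<^sup>2) \<le> 4 * (1 + \<epsilon>)"
    have tz: "\<bar>ratio \<kappa> x z - 1\<bar> \<le> \<epsilon> \<and> \<beta> * \<bar>ln (ratio \<kappa> x z)\<bar> \<le> \<epsilon> * lmin \<and>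
      (ratio \<kappa> x z - 1) + (1 - \<epsilon>) * ((ratio \<kappa> x z - 1)\<^sup>2 / 2) \<le> ratio \<kappa> x z * ln (ratio \<kappa> x z) \<and>
      ratio \<kappa> x z * ln (ratio \<kappa> x z) \<le> (ratio \<kappa> x z - 1) + (1 + \<epsilon>) * ((ratio \<kappa> x z - 1)\<^sup>2 / 2) \<and>
      ratio \<kappa> x z * (ln (ratio \<kappa> x z))\<^sup>2 \<le> (1 + \<epsilon>) * (ratio \<kappa> x z - 1)\<^sup>2" if "z \<in> steps" for z
      using t[of "ratio \<kappa> x z"] x that by (auto simp: \<delta>_def)
    have pos: "0 < Q x + \<kappa>" "\<And>z. z \<in> steps \<Longrightarrow> 0 < Q (x + z) + \<kappa>" using x by auto
    note S = profile_step[OF pos \<beta> \<epsilon> _ _ lmin tz conjunct1[OF conjunct2[OF x]] conjunct2[OF conjunct2[OF x]]]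
    show "0 < Q x + \<kappa> \<and> (\<forall>z\<in>steps. 0 < Q (x + z) + \<kappa>) \<and>
    (\<forall>\<alpha> L. L = \<alpha> + \<beta> * ln (Q x + \<kappa>) \<longrightarrow> lmin \<le> L \<longrightarrow>
      (\<forall>z\<in>steps. (1 - \<epsilon>) / (1 + \<epsilon>) * (newton \<kappa> x / L) \<le> profile \<alpha> \<beta> \<kappa> (x + z) \<and>
         profile \<alpha> \<beta> \<kappa> (x + z) \<le> (1 + \<epsilon>) / (1 - \<epsilon>) * (newton \<kappa> x / L)) \<and>
      P (profile \<alpha> \<beta> \<kappa>) x \<le> profile \<alpha> \<beta> \<kappa> x + (1 / L + \<beta> / L\<^sup>2) * (P (newton \<kappa>) x - newton \<kappa> x)
        + (newton \<kappa> x / L)\<^sup>2 * (2 * \<beta> * (1 + \<epsilon>)\<^sup>2 + 4 * \<beta>\<^sup>2 * (1 + \<epsilon>)\<^sup>2 / ((1 - \<epsilon>) * lmin)) \<and>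
      profile \<alpha> \<beta> \<kappa> x + (1 / L + \<beta> / L\<^sup>2) * (P (newton \<kappa>) x - newton \<kappa> x)
        + (newton \<kappa> x / L)\<^sup>2 * (2 * \<beta> * (1 - \<epsilon>)\<^sup>2) \<le> P (profile \<alpha> \<beta> \<kappa>) x)"
    proof (intro conjI allI impI ballI)
      fix \<alpha> L assume L: "L = \<alpha> + \<beta> * ln (Q x + \<kappa>)" "lmin \<le> L"
      note S' = S[OF _ L]
      show "(1 - \<epsilon>) / (1 + \<epsilon>) * (newton \<kappa> x / L) \<le> profile \<alpha> \<beta> \<kappa> (x + z)" if "z \<in> steps" for z
        by (rule S'(1)) (use that in auto)
      show "profile \<alpha> \<beta> \<kappa> (x + z) \<le> (1 + \<epsilon>) / (1 - \<epsilon>) * (newton \<kappa> x / L)" if "z \<in> steps" for z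
        by (rule S'(2)) (use that in auto)
      show "P (profile \<alpha> \<beta> \<kappa>) x \<le> profile \<alpha> \<beta> \<kappa> x + (1 / L + \<beta> / L\<^sup>2) * (P (newton \<kappa>) x - newton \<kappa> x)
        + (newton \<kappa> x / L)\<^sup>2 * (2 * \<beta> * (1 + \<epsilon>)\<^sup>2 + 4 * \<beta>\<^sup>2 * (1 + \<epsilon>)\<^sup>2 / ((1 - \<epsilon>) * lmin))"
        by (rule S'(3)) auto
      show "profile \<alpha> \<beta> \<kappa> x + (1 / L + \<beta> / L\<^sup>2) * (P (newton \<kappa>) x - newton \<kappa> x)
        + (newton \<kappa> x / L)\<^sup>2 * (2 * \<beta> * (1 - \<epsilon>)\<^sup>2) \<le> P (profile \<alpha> \<beta> \<kappa>) x"
        by (rule S'(4)) auto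
    qed (use pos in auto)
  qed
qed

text \<open>
  Averaging raises the barrier \<open>W\<close> by at most about \<open>2 * \<beta> * (1 + 2 * \<beta> / lmin) * W\<^sup>2\<close>, and \<open>N\<close> lowers it by
  about \<open>\<theta> * W\<^sup>2\<close>.  The superharmonicity of \<open>newton \<kappa>\<close> gives the linear terms the right sign.
\<close>

lemma profile_supersolution:
  assumes N: "\<And>\<epsilon>. 0 < \<epsilon> \<Longrightarrow> \<exists>s0>0. \<forall>s. 0 \<le> s \<longrightarrow> s \<le> s0 \<longrightarrow> N s \<le> s - (1 - \<epsilon>) * \<theta> * s\<^sup>2"
    and "0 < \<theta>" "0 < \<beta>" "0 < lmin" and \<beta>: "2 * \<beta> * (1 + 2 * \<beta> / lmin) < \<theta>" and \<kappa>: "\<kappa>0 \<le> \<kappa>"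
  shows "\<forall>\<^sub>F x in far. \<forall>\<alpha>. lmin \<le> \<alpha> + \<beta> * ln (Q x + \<kappa>) \<longrightarrow>
    (\<forall>z\<in>steps. 0 \<le> profile \<alpha> \<beta> \<kappa> (x + z) \<and> profile \<alpha> \<beta> \<kappa> (x + z) \<le> 1) \<and>
    N (P (profile \<alpha> \<beta> \<kappa>) x) \<le> profile \<alpha> \<beta> \<kappa> x"
proof -
  have "((\<lambda>\<epsilon>. 2 * \<beta> * (1 + \<epsilon>)\<^sup>2 + 4 * \<beta>\<^sup>2 * (1 + \<epsilon>)\<^sup>2 / ((1 - \<epsilon>) * lmin)
      - (1 - \<epsilon>) * \<theta> * ((1 - \<epsilon>) / (1 + \<epsilon>))\<^sup>2) \<longlongrightarrow> 2 * \<beta> + 4 * \<beta>\<^sup>2 / lmin - \<theta>) (at_right 0)"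
    using \<open>0 < lmin\<close> by (auto intro!: tendsto_eq_intros)
  moreover have "2 * \<beta> + 4 * \<beta>\<^sup>2 / lmin - \<theta> < 0" using \<beta> by (simp add: algebra_simps power2_eq_square)
  ultimately have "\<forall>\<^sub>F \<epsilon> in at_right 0. 2 * \<beta> * (1 + \<epsilon>)\<^sup>2 + 4 * \<beta>\<^sup>2 * (1 + \<epsilon>)\<^sup>2 / ((1 - \<epsilon>) * lmin)
      - (1 - \<epsilon>) * \<theta> * ((1 - \<epsilon>) / (1 + \<epsilon>))\<^sup>2 < 0" by (rule order_tendstoD)
  moreover have "\<forall>\<^sub>F \<epsilon> in at_right (0::real). 0 < \<epsilon> \<and> \<epsilon> < 1"
    using eventually_at_right_real[of 0 1] by (simp add: eventually_mono)
  ultimately have "\<forall>\<^sub>F \<epsilon> in at_right 0. (2 * \<beta> * (1 + \<epsilon>)\<^sup>2 + 4 * \<beta>\<^sup>2 * (1 + \<epsilon>)\<^sup>2 / ((1 - \<epsilon>) * lmin)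
      - (1 - \<epsilon>) * \<theta> * ((1 - \<epsilon>) / (1 + \<epsilon>))\<^sup>2 < 0) \<and> 0 < \<epsilon> \<and> \<epsilon> < 1" by (rule eventually_conj)
  from eventually_happens[OF this] obtain \<epsilon> where
    h: "2 * \<beta> * (1 + \<epsilon>)\<^sup>2 + 4 * \<beta>\<^sup>2 * (1 + \<epsilon>)\<^sup>2 / ((1 - \<epsilon>) * lmin) < (1 - \<epsilon>) * \<theta> * ((1 - \<epsilon>) / (1 + \<epsilon>))\<^sup>2"
    and \<epsilon>: "0 < \<epsilon>" "\<epsilon> < 1" by auto
  obtain s0 where s0: "0 < s0" "\<And>s. 0 \<le> s \<Longrightarrow> s \<le> s0 \<Longrightarrow> N s \<le> s - (1 - \<epsilon>) * \<theta> * s\<^sup>2"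
    using N[OF \<epsilon>(1)] by blast
  have c0: "0 < min s0 1 * lmin / ((1 + \<epsilon>) / (1 - \<epsilon>))" using s0 \<open>0 < lmin\<close> \<epsilon> by simp
  from eventually_conj[OF profile_step_eventually[OF \<open>0 < \<beta>\<close> \<epsilon> \<open>0 < lmin\<close>, of \<kappa>] eventually_newton_less[OF c0, of \<kappa>]]
  show ?thesis
  proof (rule eventually_mono, intro allI impI, elim conjE)
    fix x \<alpha>
    \<comment> \<open>\<open>W x = w / L\<close>, and both \<open>W (x + z)\<close> and \<open>P W x\<close> are close to it\<close>
    define w where "w = newton \<kappa> x"
    define L where "L = \<alpha> + \<beta> * ln (Q x + \<kappa>)"
    define W where "W = profile \<alpha> \<beta> \<kappa>"
    define m where "m = min s0 1"
    assume L: "lmin \<le> \<alpha> + \<beta> * ln (Q x + \<kappa>)"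
      and small: "newton \<kappa> x < min s0 1 * lmin / ((1 + \<epsilon>) / (1 - \<epsilon>))"
      and pos: "0 < Q x + \<kappa>"
      and all: "\<forall>\<alpha> L. L = \<alpha> + \<beta> * ln (Q x + \<kappa>) \<longrightarrow> lmin \<le> L \<longrightarrow>
      (\<forall>z\<in>steps. (1 - \<epsilon>) / (1 + \<epsilon>) * (newton \<kappa> x / L) \<le> profile \<alpha> \<beta> \<kappa> (x + z) \<and>
         profile \<alpha> \<beta> \<kappa> (x + z) \<le> (1 + \<epsilon>) / (1 - \<epsilon>) * (newton \<kappa> x / L)) \<and>
      P (profile \<alpha> \<beta> \<kappa>) x \<le> profile \<alpha> \<beta> \<kappa> x + (1 / L + \<beta> / L\<^sup>2) * (P (newton \<kappa>) x - newton \<kappa> x)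
        + (newton \<kappa> x / L)\<^sup>2 * (2 * \<beta> * (1 + \<epsilon>)\<^sup>2 + 4 * \<beta>\<^sup>2 * (1 + \<epsilon>)\<^sup>2 / ((1 - \<epsilon>) * lmin)) \<and>
      profile \<alpha> \<beta> \<kappa> x + (1 / L + \<beta> / L\<^sup>2) * (P (newton \<kappa>) x - newton \<kappa> x)
        + (newton \<kappa> x / L)\<^sup>2 * (2 * \<beta> * (1 - \<epsilon>)\<^sup>2) \<le> P (profile \<alpha> \<beta> \<kappa>) x"
    have lmL: "lmin \<le> L" using L by (simp add: L_def)
    have Lpos: "0 < L" using lmL \<open>0 < lmin\<close> by linarith
    have wpos: "0 < w" using pos by (simp add: w_def newton_def)
    have facts: "\<And>z. z \<in> steps \<Longrightarrow> (1 - \<epsilon>) / (1 + \<epsilon>) * (w / L) \<le> W (x + z)"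
       "\<And>z. z \<in> steps \<Longrightarrow> W (x + z) \<le> (1 + \<epsilon>) / (1 - \<epsilon>) * (w / L)"
       "P W x \<le> W x + (1 / L + \<beta> / L\<^sup>2) * (P (newton \<kappa>) x - w)
        + (w / L)\<^sup>2 * (2 * \<beta> * (1 + \<epsilon>)\<^sup>2 + 4 * \<beta>\<^sup>2 * (1 + \<epsilon>)\<^sup>2 / ((1 - \<epsilon>) * lmin))"
      using all[rule_format, OF L_def lmL] unfolding w_def W_def by auto
    have "(1 + \<epsilon>) / (1 - \<epsilon>) * (w / L) \<le> (1 + \<epsilon>) / (1 - \<epsilon>) * (w / lmin)"
      using wpos lmL \<open>0 < lmin\<close> \<epsilon> by (intro mult_left_mono frac_le) auto
    also have "\<dots> \<le> min s0 1" using small \<epsilon> \<open>0 < lmin\<close> unfolding w_def[symmetric] m_def[symmetric]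
      by (simp add: field_simps)
    finally have ub: "(1 + \<epsilon>) / (1 - \<epsilon>) * (w / L) \<le> min s0 1" .
    have lb: "0 \<le> (1 - \<epsilon>) / (1 + \<epsilon>) * (w / L)" using \<epsilon> wpos Lpos by simp
    have bnd: "0 \<le> W (x + z) \<and> W (x + z) \<le> 1" if "z \<in> steps" for z
      using facts(1,2)[OF that] ub lb by linarith
    have Pl: "(1 - \<epsilon>) / (1 + \<epsilon>) * (w / L) \<le> P W x" by (intro walk_avg_ge facts)
    have Pu: "P W x \<le> s0" using ub by (intro walk_avg_le order_trans[OF facts(2)]) auto
    have "N (P W x) \<le> P W x - (1 - \<epsilon>) * \<theta> * (P W x)\<^sup>2" using Pl Pu lb by (intro s0) auto
    also have "\<dots> \<le> W x + 0 + (w / L)\<^sup>2 * ((1 - \<epsilon>) * \<theta> * ((1 - \<epsilon>) / (1 + \<epsilon>))\<^sup>2) - (1 - \<epsilon>) * \<theta> * ((1 - \<epsilon>) / (1 + \<epsilon>) * (w / L))\<^sup>2"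
    proof (intro diff_mono order_trans[OF facts(3)] add_mono order_refl mult_left_mono power_mono Pl lb)
      have "P (newton \<kappa>) x - w \<le> 0"
        using newton_superharmonic[OF \<kappa>, of x] pos unfolding w_def
        by (smt (verit) divide_nonneg_nonneg zero_le_power)
      then show "(1 / L + \<beta> / L\<^sup>2) * (P (newton \<kappa>) x - w) \<le> 0"
        using Lpos \<open>0 < \<beta>\<close> by (intro mult_nonneg_nonpos) auto
    qed (use h \<epsilon> \<open>0 < \<theta>\<close> in auto)
    also have "\<dots> = W x" by (simp add: power_mult_distrib power_divide)
    finally show "(\<forall>z\<in>steps. 0 \<le> profile \<alpha> \<beta> \<kappa> (x + z) \<and> profile \<alpha> \<beta> \<kappa> (x + z) \<le> 1) \<and>
      N (P (profile \<alpha> \<beta> \<kappa>) x) \<le> profile \<alpha> \<beta> \<kappa> x" using bnd by (simp add: W_def)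
  qed
qed

text \<open>
  The mirror image of \<open>profile_supersolution\<close>.  The remainder of order \<open>\<beta> / L\<close> is nonnegative, so the
  condition on \<open>\<beta>\<close> does not involve \<open>lmin\<close>.
\<close>

lemma profile_subsolution:
  assumes N: "\<And>s. 0 \<le> s \<Longrightarrow> s \<le> 1 \<Longrightarrow> s - \<theta> * s\<^sup>2 \<le> N s"
    and "0 < \<theta>" "0 < lmin" and \<beta>: "\<theta> < 2 * \<beta>" and \<kappa>: "\<kappa> \<le> - \<kappa>0"
  shows "\<forall>\<^sub>F x in far. \<forall>\<alpha>. lmin \<le> \<alpha> + \<beta> * ln (Q x + \<kappa>) \<longrightarrow>
    (\<forall>z\<in>steps. 0 \<le> profile \<alpha> \<beta> \<kappa> (x + z) \<and> profile \<alpha> \<beta> \<kappa> (x + z) \<le> 1) \<and>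
    profile \<alpha> \<beta> \<kappa> x \<le> N (P (profile \<alpha> \<beta> \<kappa>) x)"
proof -
  have "0 < \<beta>" using \<open>0 < \<theta>\<close> \<beta> by linarith
  have "((\<lambda>\<epsilon>. 2 * \<beta> * (1 - \<epsilon>)\<^sup>2 - \<theta> * ((1 + \<epsilon>) / (1 - \<epsilon>))\<^sup>2) \<longlongrightarrow> 2 * \<beta> - \<theta>) (at_right 0)"
    by (auto intro!: tendsto_eq_intros)
  moreover have "0 < 2 * \<beta> - \<theta>" using \<beta> by simp
  ultimately have "\<forall>\<^sub>F \<epsilon> in at_right 0. 0 < 2 * \<beta> * (1 - \<epsilon>)\<^sup>2 - \<theta> * ((1 + \<epsilon>) / (1 - \<epsilon>))\<^sup>2" by (rule order_tendstoD)
  moreover have "\<forall>\<^sub>F \<epsilon> in at_right (0::real). 0 < \<epsilon> \<and> \<epsilon> < 1"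
    using eventually_at_right_real[of 0 1] by (simp add: eventually_mono)
  ultimately have "\<forall>\<^sub>F \<epsilon> in at_right 0. 0 < 2 * \<beta> * (1 - \<epsilon>)\<^sup>2 - \<theta> * ((1 + \<epsilon>) / (1 - \<epsilon>))\<^sup>2 \<and> 0 < \<epsilon> \<and> \<epsilon> < 1"
    by (rule eventually_conj)
  from eventually_happens[OF this] obtain \<epsilon> where
    h: "\<theta> * ((1 + \<epsilon>) / (1 - \<epsilon>))\<^sup>2 < 2 * \<beta> * (1 - \<epsilon>)\<^sup>2" and \<epsilon>: "0 < \<epsilon>" "\<epsilon> < 1" by auto
  have c0: "0 < lmin / ((1 + \<epsilon>) / (1 - \<epsilon>))" using \<open>0 < lmin\<close> \<epsilon> by simp
  from eventually_conj[OF eventually_conj[OF profile_step_eventually[OF \<open>0 < \<beta>\<close> \<epsilon> \<open>0 < lmin\<close>, of \<kappa>]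
        newton_subharmonic[OF \<kappa>]] eventually_newton_less[OF c0, of \<kappa>]]
  show ?thesis
  proof (rule eventually_mono, intro allI impI, elim conjE)
    fix x \<alpha>
    define w where "w = newton \<kappa> x"
    define L where "L = \<alpha> + \<beta> * ln (Q x + \<kappa>)"
    define W where "W = profile \<alpha> \<beta> \<kappa>"
    assume L: "lmin \<le> \<alpha> + \<beta> * ln (Q x + \<kappa>)"
      and small: "newton \<kappa> x < lmin / ((1 + \<epsilon>) / (1 - \<epsilon>))"
      and pos: "0 < Q x + \<kappa>" and sub: "newton \<kappa> x \<le> P (newton \<kappa>) x"
      and all: "\<forall>\<alpha> L. L = \<alpha> + \<beta> * ln (Q x + \<kappa>) \<longrightarrow> lmin \<le> L \<longrightarrow>
      (\<forall>z\<in>steps. (1 - \<epsilon>) / (1 + \<epsilon>) * (newton \<kappa> x / L) \<le> profile \<alpha> \<beta> \<kappa> (x + z) \<and>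
         profile \<alpha> \<beta> \<kappa> (x + z) \<le> (1 + \<epsilon>) / (1 - \<epsilon>) * (newton \<kappa> x / L)) \<and>
      P (profile \<alpha> \<beta> \<kappa>) x \<le> profile \<alpha> \<beta> \<kappa> x + (1 / L + \<beta> / L\<^sup>2) * (P (newton \<kappa>) x - newton \<kappa> x)
        + (newton \<kappa> x / L)\<^sup>2 * (2 * \<beta> * (1 + \<epsilon>)\<^sup>2 + 4 * \<beta>\<^sup>2 * (1 + \<epsilon>)\<^sup>2 / ((1 - \<epsilon>) * lmin)) \<and>
      profile \<alpha> \<beta> \<kappa> x + (1 / L + \<beta> / L\<^sup>2) * (P (newton \<kappa>) x - newton \<kappa> x)
        + (newton \<kappa> x / L)\<^sup>2 * (2 * \<beta> * (1 - \<epsilon>)\<^sup>2) \<le> P (profile \<alpha> \<beta> \<kappa>) x"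
    have lmL: "lmin \<le> L" using L by (simp add: L_def)
    have Lpos: "0 < L" using lmL \<open>0 < lmin\<close> by linarith
    have wpos: "0 < w" using pos by (simp add: w_def newton_def)
    have facts: "\<And>z. z \<in> steps \<Longrightarrow> (1 - \<epsilon>) / (1 + \<epsilon>) * (w / L) \<le> W (x + z)"
       "\<And>z. z \<in> steps \<Longrightarrow> W (x + z) \<le> (1 + \<epsilon>) / (1 - \<epsilon>) * (w / L)"
       "W x + (1 / L + \<beta> / L\<^sup>2) * (P (newton \<kappa>) x - w) + (w / L)\<^sup>2 * (2 * \<beta> * (1 - \<epsilon>)\<^sup>2) \<le> P W x"
      using all[rule_format, OF L_def lmL] unfolding w_def W_def by auto
    have "(1 + \<epsilon>) / (1 - \<epsilon>) * (w / L) \<le> (1 + \<epsilon>) / (1 - \<epsilon>) * (w / lmin)"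
      using wpos lmL \<open>0 < lmin\<close> \<epsilon> by (intro mult_left_mono frac_le) auto
    also have "\<dots> \<le> 1" using small \<epsilon> \<open>0 < lmin\<close> unfolding w_def[symmetric] by (simp add: field_simps)
    finally have ub: "(1 + \<epsilon>) / (1 - \<epsilon>) * (w / L) \<le> 1" .
    have lb: "0 \<le> (1 - \<epsilon>) / (1 + \<epsilon>) * (w / L)" using \<epsilon> wpos Lpos by simp
    have bnd: "0 \<le> W (x + z) \<and> W (x + z) \<le> 1" if "z \<in> steps" for z
      using facts(1,2)[OF that] ub lb by linarith
    have Pl: "0 \<le> P W x" using bnd by (intro walk_avg_ge) auto
    have Pu: "P W x \<le> (1 + \<epsilon>) / (1 - \<epsilon>) * (w / L)" by (intro walk_avg_le facts)
    have "W x = W x + 0 + (w / L)\<^sup>2 * (\<theta> * ((1 + \<epsilon>) / (1 - \<epsilon>))\<^sup>2) - \<theta> * ((1 + \<epsilon>) / (1 - \<epsilon>) * (w / L))\<^sup>2"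
      by (simp add: power_mult_distrib power_divide)
    also have "\<dots> \<le> P W x - \<theta> * (P W x)\<^sup>2"
    proof (rule diff_mono[OF order_trans[OF _ facts(3)]], intro add_mono order_refl mult_left_mono)
      show "\<theta> * (P W x)\<^sup>2 \<le> \<theta> * ((1 + \<epsilon>) / (1 - \<epsilon>) * (w / L))\<^sup>2"
        using \<open>0 < \<theta>\<close> Pu Pl by (intro mult_left_mono power_mono) auto
      show "0 \<le> (1 / L + \<beta> / L\<^sup>2) * (P (newton \<kappa>) x - w)"
        using Lpos \<open>0 < \<beta>\<close> sub by (intro mult_nonneg_nonneg) (auto simp: w_def)
    qed (use h \<open>0 < \<theta>\<close> in auto)
    also have "\<dots> \<le> N (P W x)" using Pl Pu ub by (intro N) auto
    finally show "(\<forall>z\<in>steps. 0 \<le> profile \<alpha> \<beta> \<kappa> (x + z) \<and> profile \<alpha> \<beta> \<kappa> (x + z) \<le> 1) \<and>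
      profile \<alpha> \<beta> \<kappa> x \<le> N (P (profile \<alpha> \<beta> \<kappa>) x)" using bnd by (simp add: W_def)
  qed
qed

end

section \<open>The Green function as a potential of the Newtonian kernel\<close>

text \<open>
  If an average tends to an asymptotic upper bound of its terms, then so does every term.
\<close>

lemma tendsto_of_average:
  fixes B :: "nat \<Rightarrow> 'z \<Rightarrow> real"
  assumes fin: "finite S" and z: "z \<in> S" and pos: "\<And>z. z \<in> S \<Longrightarrow> 0 < m z" and sum1: "sum m S = 1"
    and avg: "(\<lambda>n. \<Sum>z\<in>S. m z * B n z) \<longlonglongrightarrow> a"
    and le: "\<And>z \<epsilon>. z \<in> S \<Longrightarrow> 0 < \<epsilon> \<Longrightarrow> \<forall>\<^sub>F n in sequentially. B n z \<le> a + \<epsilon>"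
  shows "(\<lambda>n. B n z) \<longlonglongrightarrow> a"
proof (rule order_tendstoI)
  fix c assume c: "c < a"
  \<comment> \<open>a term below \<open>c\<close> would pull the average below \<open>a - \<epsilon>\<close>, even if all others exceeded \<open>a\<close> by \<open>\<epsilon>\<close>\<close>
  define \<epsilon> where "\<epsilon> = m z * (a - c) / 3"
  have \<epsilon>: "0 < \<epsilon>" using c pos[OF z] by (simp add: \<epsilon>_def)
  have "\<forall>\<^sub>F n in sequentially. \<forall>z'\<in>S. B n z' \<le> a + \<epsilon>"
    using le \<epsilon> fin by (simp add: eventually_ball_finite_distrib)
  moreover have "\<forall>\<^sub>F n in sequentially. a - \<epsilon> < (\<Sum>z\<in>S. m z * B n z)"
    using avg \<epsilon> by (intro order_tendstoD) auto
  ultimately show "\<forall>\<^sub>F n in sequentially. c < B n z"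
  proof eventually_elim
    case (elim n)
    have m1: "sum m (S - {z}) = 1 - m z" using sum1 fin z by (simp add: sum_diff1)
    then have m01: "0 \<le> 1 - m z" using pos by (metis DiffD1 less_imp_le sum_nonneg)
    have "(\<Sum>z'\<in>S. m z' * B n z') = m z * B n z + (\<Sum>z'\<in>S - {z}. m z' * B n z')"
      using fin z by (simp add: sum.remove)
    also have "(\<Sum>z'\<in>S - {z}. m z' * B n z') \<le> (\<Sum>z'\<in>S - {z}. m z' * (a + \<epsilon>))"
      using elim pos by (intro sum_mono mult_left_mono) (auto simp: less_imp_le)
    also have "\<dots> = (1 - m z) * (a + \<epsilon>)" by (simp add: m1 flip: sum_distrib_right)
    finally have "a - \<epsilon> < m z * B n z + (1 - m z) * (a + \<epsilon>)" using elim by simp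
    also have "\<dots> \<le> m z * B n z + (a - m z * a) + \<epsilon>"
      using \<epsilon> pos[OF z] by (simp add: algebra_simps)
    finally have "m z * a - 2 * \<epsilon> < m z * B n z" by simp
    moreover have "m z * c < m z * a - 2 * \<epsilon>"
    proof -
      have "m z * a - m z * c = 3 * \<epsilon>" by (simp add: \<epsilon>_def algebra_simps)
      then show ?thesis using \<epsilon> by linarith
    qed
    ultimately have "m z * c < m z * B n z" by linarith
    then show ?case using pos[OF z] by simp
  qed
next
  fix c assume "a < c"
  then have "\<forall>\<^sub>F n in sequentially. B n z \<le> a + (c - a) / 2" using le[OF z, of "(c - a) / 2"] by simp
  then show "\<forall>\<^sub>F n in sequentially. B n z < c"
  proof eventually_elim
    case (elim n)
    then have "2 * B n z \<le> a + c" by (simp add: field_simps)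
    then show ?case using \<open>a < c\<close> by linarith
  qed
qed

context isotropic_walk
begin

lemma Q_add_ge: "(sqrt (Q x) - sqrt (Q y))\<^sup>2 \<le> Q (x + y)"
proof -
  have "\<bar>norm (e x) - norm (- e y)\<bar> \<le> norm (e x - - e y)" by (rule norm_triangle_ineq3)
  then have "\<bar>norm (e x) - norm (e y)\<bar>\<^sup>2 \<le> (norm (e x + e y))\<^sup>2" by (intro power_mono) auto
  then show ?thesis by (simp add: Q_def e_add)
qed

lemma Q_add_le: "Q (x + y) \<le> (sqrt (Q x) + sqrt (Q y))\<^sup>2"
  using norm_triangle_ineq[of "e x" "e y"] by (simp add: Q_def e_add power_mono)

lemma Q_shift_ratio: "((\<lambda>x. Q x / Q (x + y)) \<longlongrightarrow> 1) far"
proof (rule real_tendsto_sandwich)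
  define b where "b = sqrt (Q y)"
  have b: "0 \<le> b" by (simp add: b_def)
  have "((\<lambda>q. q / (sqrt q + b)\<^sup>2) \<longlongrightarrow> 1) at_top" by real_asymp
  from filterlim_compose[OF this Q_at_top] show "((\<lambda>x. Q x / (sqrt (Q x) + b)\<^sup>2) \<longlongrightarrow> 1) far" .
  have "((\<lambda>q. q / (sqrt q - b)\<^sup>2) \<longlongrightarrow> 1) at_top" by real_asymp
  from filterlim_compose[OF this Q_at_top] show "((\<lambda>x. Q x / (sqrt (Q x) - b)\<^sup>2) \<longlongrightarrow> 1) far" .
  have "\<forall>\<^sub>F q in at_top. b < sqrt q" by real_asymp
  from eventually_compose_filterlim[OF this Q_at_top]
  have pos: "\<forall>\<^sub>F x in far. 0 < Q (x + y) \<and> b < sqrt (Q x)"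
  proof eventually_elim
    case (elim x)
    then have "0 < (sqrt (Q x) - b)\<^sup>2" by simp
    also have "\<dots> \<le> Q (x + y)" using Q_add_ge[of x y] by (simp add: b_def)
    finally show ?case using elim by simp
  qed
  show "\<forall>\<^sub>F x in far. Q x / (sqrt (Q x) + b)\<^sup>2 \<le> Q x / Q (x + y)"
    using pos
  proof eventually_elim
    case (elim x)
    then have "0 < sqrt (Q x) + b" using b by linarith
    with elim show ?case using Q_add_le[of x y] by (auto simp: b_def intro!: divide_left_mono)
  qed
  show "\<forall>\<^sub>F x in far. Q x / Q (x + y) \<le> Q x / (sqrt (Q x) - b)\<^sup>2"
    using pos
  proof eventually_elim
    case (elim x)
    then show ?case using Q_add_ge[of x y] by (auto simp: b_def intro!: divide_left_mono)
  qed
qed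

lemma far_shift: "filterlim (\<lambda>x. x + y) far far"
proof -
  have "filterlim (\<lambda>x. Q (x + y)) at_top far"
  proof (rule filterlim_at_top_mono)
    have "filterlim (\<lambda>q. (sqrt q - c)\<^sup>2) at_top at_top" for c by real_asymp
    from filterlim_compose[OF this Q_at_top] show "filterlim (\<lambda>x. (sqrt (Q x) - sqrt (Q y))\<^sup>2) at_top far" .
  qed (use Q_add_ge in auto)
  then show ?thesis unfolding far_def by (simp add: filterlim_filtercomap_iff o_def)
qed

text \<open>
  The strong maximum principle at infinity: along a sequence realising the upper limit \<open>a\<close> of \<open>Q * h\<close>, the
  translates of \<open>Q * h\<close> converge to \<open>a\<close> too.  The shifts \<open>z\<close> for which this holds contain \<open>0\<close> and are closed
  under steps, since the harmonic average at \<open>X n + y\<close> has limit \<open>a\<close> and none of its terms exceeds \<open>a\<close>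
  asymptotically.
\<close>

lemma extremal_propagation:
  assumes X: "filterlim X far sequentially"
    and harm: "\<forall>\<^sub>F x in far. P h x = h x"
    and le: "\<And>\<epsilon>. 0 < \<epsilon> \<Longrightarrow> \<forall>\<^sub>F x in far. Q x * h x \<le> a + \<epsilon>"
    and lim: "(\<lambda>n. Q (X n) * h (X n)) \<longlonglongrightarrow> a"
  shows "(\<lambda>n. Q (X n) * h (X n + z)) \<longlonglongrightarrow> a"
proof -
  define H where "H = {z. (\<lambda>n. Q (X n) * h (X n + z)) \<longlonglongrightarrow> a}"
  have "H = UNIV"
  proof (rule irreducible)
    show "0 \<in> H" using lim by (simp add: H_def)
    fix y z assume y: "y \<in> H" and z: "z \<in> steps"
    have far_y: "filterlim (\<lambda>n. X n + u) far sequentially" for u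
      using filterlim_compose[OF far_shift X] .
    have "(\<lambda>n. Q (X n) * h (X n + y + z)) \<longlonglongrightarrow> a"
    proof (rule tendsto_of_average[where B = "\<lambda>n z. Q (X n) * h (X n + y + z)" and m = "pmf \<mu>", OF finite_steps z _ sum_steps])
      have "\<forall>\<^sub>F n in sequentially. P h (X n + y) = h (X n + y)"
        using eventually_compose_filterlim[OF harm far_y] .
      then have "\<forall>\<^sub>F n in sequentially. Q (X n) * h (X n + y) = (\<Sum>z\<in>steps. pmf \<mu> z * (Q (X n) * h (X n + y + z)))"
      proof eventually_elim
        case (elim n)
        then have "Q (X n) * h (X n + y) = Q (X n) * P h (X n + y)" by simp
        then show ?case by (simp add: walk_avg_def sum_distrib_left mult.left_commute)
      qed
      then show "(\<lambda>n. \<Sum>z\<in>steps. pmf \<mu> z * (Q (X n) * h (X n + y + z))) \<longlonglongrightarrow> a"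
        using y by (auto simp: H_def intro: Lim_transform_eventually)
    next
      fix z \<epsilon> assume "0 < (\<epsilon>::real)"
      define r where "r n = Q (X n) / Q (X n + (y + z))" for n
      have r: "r \<longlonglongrightarrow> 1" unfolding r_def using filterlim_compose[OF Q_shift_ratio X] .
      have "(\<lambda>n. r n * (a + \<epsilon> / 2)) \<longlonglongrightarrow> 1 * (a + \<epsilon> / 2)" by (intro tendsto_intros r)
      then have 1: "\<forall>\<^sub>F n in sequentially. r n * (a + \<epsilon> / 2) < a + \<epsilon>" using \<open>0 < \<epsilon>\<close> by (intro order_tendstoD) auto
      have 2: "\<forall>\<^sub>F n in sequentially. 0 < r n" using r by (intro order_tendstoD) auto
      have 3: "\<forall>\<^sub>F n in sequentially. Q (X n + (y + z)) * h (X n + (y + z)) \<le> a + \<epsilon> / 2"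
        using eventually_compose_filterlim[OF le far_y] \<open>0 < \<epsilon>\<close> by simp
      from 1 2 3 show "\<forall>\<^sub>F n in sequentially. Q (X n) * h (X n + y + z) \<le> a + \<epsilon>"
      proof eventually_elim
        case (elim n)
        have "Q (X n + (y + z)) \<noteq> 0" using elim(2) by (auto simp: r_def)
        then have "Q (X n) * h (X n + y + z) = r n * (Q (X n + (y + z)) * h (X n + (y + z)))"
          by (simp add: r_def add.assoc)
        also have "\<dots> \<le> r n * (a + \<epsilon> / 2)" using elim by (intro mult_left_mono) auto
        finally show ?case using elim by simp
      qed
    qed (auto simp: pmf_positive)
    then show "y + z \<in> H" by (simp add: H_def add.assoc)
  qed
  then show ?thesis by (auto simp: H_def)
qed

lemma limsup_sequence:
  fixes h :: "'a \<Rightarrow> real"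
  assumes bdd: "\<forall>\<^sub>F x in far. \<bar>h x\<bar> \<le> C" and nontriv: "far \<noteq> bot"
  obtains a X where "filterlim X far sequentially" "(\<lambda>n. h (X n)) \<longlonglongrightarrow> a"
    "\<And>\<epsilon>. 0 < \<epsilon> \<Longrightarrow> \<forall>\<^sub>F x in far. h x \<le> a + \<epsilon>"
proof -
  define U where "U = {c. \<forall>\<^sub>F x in far. h x \<le> c}"
  define a where "a = Inf U"
  have "C \<in> U" unfolding U_def using bdd by (auto elim: eventually_mono)
  have lowb: "- C \<le> c" if "c \<in> U" for c
  proof (rule ccontr)
    assume "\<not> - C \<le> c"
    have "\<forall>\<^sub>F x in far. h x \<le> c" using that by (simp add: U_def)
    then have "\<forall>\<^sub>F x in far. False" using bdd
      by eventually_elim (use \<open>\<not> - C \<le> c\<close> in linarith)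
    then show False using nontriv by (simp add: trivial_limit_def)
  qed
  have bb: "bdd_below U" using lowb by (auto simp: bdd_below_def)
  have up: "\<forall>\<^sub>F x in far. h x \<le> a + \<epsilon>" if \<epsilon>: "0 < \<epsilon>" for \<epsilon>
  proof -
    obtain c where "c \<in> U" "c < a + \<epsilon>"
    proof -
      have ne: "U \<noteq> {}" using \<open>C \<in> U\<close> by blast
      have lt: "Inf U < a + \<epsilon>" using \<epsilon> by (simp add: a_def)
      obtain c where "c \<in> U" "c < a + \<epsilon>" using cInf_lessD[OF ne lt] by blast
      then show thesis by (rule that)
    qed
    then show ?thesis unfolding U_def by (auto elim: eventually_mono)
  qed
  have "\<exists>x. real n \<le> Q x \<and> a - 1 / Suc n < h x \<and> h x \<le> a + 1 / Suc n" for n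
  proof (rule ccontr)
    assume no: "\<not> ?thesis"
    have "\<forall>\<^sub>F x in far. real n \<le> Q x" by (auto simp: eventually_far)
    moreover have "\<forall>\<^sub>F x in far. h x \<le> a + 1 / Suc n" by (intro up) simp
    ultimately have "\<forall>\<^sub>F x in far. h x \<le> a - 1 / Suc n"
      by eventually_elim (use no in force)
    then have "a \<le> a - 1 / Suc n" unfolding a_def by (intro cInf_lower bb) (simp add: U_def)
    then show False by simp
  qed
  then obtain X where X: "\<And>n. real n \<le> Q (X n)" "\<And>n. a - 1 / Suc n < h (X n)" "\<And>n. h (X n) \<le> a + 1 / Suc n"
    by metis
  show thesis
  proof (rule that[OF _ _ up])
    have "filterlim (\<lambda>n. Q (X n)) at_top sequentially"
      by (rule filterlim_at_top_mono[OF filterlim_real_sequentially]) (simp add: X(1))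
    then show "filterlim X far sequentially" unfolding far_def by (simp add: filterlim_filtercomap_iff o_def)
    have "(\<lambda>n. a - 1 / Suc n) \<longlonglongrightarrow> a - 0" "(\<lambda>n. a + 1 / Suc n) \<longlonglongrightarrow> a + 0"
      by (intro tendsto_intros LIMSEQ_Suc[OF lim_1_over_n])+
    then have "(\<lambda>n. a - 1 / Suc n) \<longlonglongrightarrow> a" "(\<lambda>n. a + 1 / Suc n) \<longlonglongrightarrow> a" by simp_all
    then show "(\<lambda>n. h (X n)) \<longlonglongrightarrow> a"
      by (rule real_tendsto_sandwich[OF always_eventually always_eventually, rotated 2]) (use X(2,3) in \<open>simp_all only: less_imp_le simp_thms\<close>)
  qed
qed

text \<open>
  The probability of being at \<open>0\<close> after \<open>k\<close> steps from \<open>x\<close>.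
\<close>

definition walk_prob :: "nat \<Rightarrow> 'a \<Rightarrow> real" where
  "walk_prob k = (P ^^ k) (indicator {0})"

definition green :: "'a \<Rightarrow> real" where "green x = (\<Sum>k. walk_prob k x)"

lemma iter_nonneg: "(\<And>x. 0 \<le> f x) \<Longrightarrow> 0 \<le> (P ^^ k) f x"
  by (induction k arbitrary: x) (auto intro: walk_avg_ge)

lemma iter_mono: "(\<And>x. f x \<le> h x) \<Longrightarrow> (P ^^ k) f x \<le> (P ^^ k) h x"
  by (induction k arbitrary: x) (auto intro: walk_avg_mono)

lemma iter_cmult: "(P ^^ k) (\<lambda>x. c * f x) x = c * (P ^^ k) f x"
proof (induction k arbitrary: x)
  case (Suc k)
  then have "(P ^^ k) (\<lambda>x. c * f x) = (\<lambda>x. c * (P ^^ k) f x)" by blast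
  then show ?case by (simp add: walk_avg_cmult)
qed simp

lemma iter_diff: "(P ^^ k) (\<lambda>x. f x - P f x) x = (P ^^ k) f x - (P ^^ Suc k) f x"
proof (induction k arbitrary: x)
  case (Suc k)
  then have "(P ^^ k) (\<lambda>x. f x - P f x) = (\<lambda>x. (P ^^ k) f x - (P ^^ Suc k) f x)" by blast
  then show ?case by (simp add: walk_avg_diff)
qed simp

lemma walk_prob_nonneg: "0 \<le> walk_prob k x"
  unfolding walk_prob_def by (rule iter_nonneg) simp

lemma iter_kernel:
  assumes f: "\<And>x. 0 \<le> f x"
  shows "ennreal ((P ^^ k) f x) = (\<integral>\<^sup>+z. ennreal (walk_prob k (x - z)) * ennreal (f z) \<partial>count_space UNIV)"
proof (induction k arbitrary: x)
  case 0
  have "(\<integral>\<^sup>+z. ennreal (walk_prob 0 (x - z)) * ennreal (f z) \<partial>count_space UNIV)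
      = (\<integral>\<^sup>+z. ennreal (f x) * indicator {x} z \<partial>count_space UNIV)"
    by (intro nn_integral_cong) (auto simp: walk_prob_def indicator_def)
  then show ?case by (simp add: nn_integral_cmult_indicator)
next
  case (Suc k)
  have "ennreal ((P ^^ Suc k) f x) = (\<Sum>\<zeta>\<in>steps. ennreal (pmf \<mu> \<zeta>) * ennreal ((P ^^ k) f (x + \<zeta>)))"
    by (simp add: walk_avg_def ennreal_mult[symmetric] iter_nonneg f sum_ennreal)
  also have "\<dots> = (\<integral>\<^sup>+z. (\<Sum>\<zeta>\<in>steps. ennreal (pmf \<mu> \<zeta>) * (ennreal (walk_prob k (x + \<zeta> - z)) * ennreal (f z))) \<partial>count_space UNIV)"
    unfolding Suc by (subst nn_integral_sum) (auto simp: nn_integral_cmult)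
  also have "\<dots> = (\<integral>\<^sup>+z. ennreal (walk_prob (Suc k) (x - z)) * ennreal (f z) \<partial>count_space UNIV)"
  proof (intro nn_integral_cong)
    fix z
    have "walk_prob (Suc k) (x - z) = (\<Sum>\<zeta>\<in>steps. pmf \<mu> \<zeta> * walk_prob k (x + \<zeta> - z))"
      by (simp add: walk_prob_def walk_avg_def algebra_simps)
    then have "ennreal (walk_prob (Suc k) (x - z)) = (\<Sum>\<zeta>\<in>steps. ennreal (pmf \<mu> \<zeta>) * ennreal (walk_prob k (x + \<zeta> - z)))"
      by (simp add: ennreal_mult[symmetric] walk_prob_nonneg sum_ennreal)
    then show "(\<Sum>\<zeta>\<in>steps. ennreal (pmf \<mu> \<zeta>) * (ennreal (walk_prob k (x + \<zeta> - z)) * ennreal (f z)))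
      = ennreal (walk_prob (Suc k) (x - z)) * ennreal (f z)"
      by (simp add: sum_distrib_right mult.assoc)
  qed
  finally show ?case .
qed

text \<open>
  The charge whose potential is \<open>newton \<kappa>\<close>; see \<open>newton_eq_green_charge\<close>.
\<close>

definition charge :: "real \<Rightarrow> 'a \<Rightarrow> real" where
  "charge \<kappa> x = newton \<kappa> x - P (newton \<kappa>) x"

lemma sum_iter_charge: "(\<Sum>k<n. (P ^^ k) (charge \<kappa>) x) = newton \<kappa> x - (P ^^ n) (newton \<kappa>) x"
  unfolding charge_def iter_diff by (subst sum_lessThan_telescope') simp

lemma newton_bounds: "\<kappa>0 \<le> \<kappa> \<Longrightarrow> 0 < newton \<kappa> x" "\<kappa>0 \<le> \<kappa> \<Longrightarrow> newton \<kappa> x \<le> 1"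
proof -
  assume "\<kappa>0 \<le> \<kappa>"
  then have "1 \<le> Q x + \<kappa>" using \<kappa>0_bounds(2) Q_nonneg[of x] by linarith
  then show "0 < newton \<kappa> x" "newton \<kappa> x \<le> 1" by (simp_all add: newton_def)
qed

lemma charge_pos: "\<kappa>0 \<le> \<kappa> \<Longrightarrow> 0 < charge \<kappa> x"
proof -
  assume k: "\<kappa>0 \<le> \<kappa>"
  then have "0 < Q x + \<kappa>" using \<kappa>0_bounds(2) Q_nonneg[of x] by linarith
  then have "0 < 4 / (Q x + \<kappa>) ^ 3" by simp
  then show ?thesis using newton_superharmonic[OF k, of x] unfolding charge_def by linarith
qed

text \<open>
  Transience.  The charge is positive at the origin, so a multiple of the point charge there is dominated
  by \<open>charge \<kappa>\<close>, and the partial sums of its potential are at most \<open>newton \<kappa>\<close>.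
\<close>

lemma summable_walk_prob: "summable (\<lambda>k. walk_prob k x)"
  and green_le_newton: "\<kappa>0 \<le> \<kappa> \<Longrightarrow> green x \<le> newton \<kappa> x / charge \<kappa> 0"
proof -
  have bound: "(\<Sum>k<n. walk_prob k x) \<le> newton \<kappa> x / charge \<kappa> 0" if k: "\<kappa>0 \<le> \<kappa>" for n \<kappa>
  proof -
    have "charge \<kappa> 0 * (\<Sum>k<n. walk_prob k x) = (\<Sum>k<n. (P ^^ k) (\<lambda>x. charge \<kappa> 0 * indicator {0} x) x)"
      by (simp add: iter_cmult walk_prob_def sum_distrib_left)
    also have "\<dots> \<le> (\<Sum>k<n. (P ^^ k) (charge \<kappa>) x)"
      using charge_pos[OF k] by (intro sum_mono iter_mono) (auto simp: indicator_def less_imp_le)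
    also have "\<dots> \<le> newton \<kappa> x"
      unfolding sum_iter_charge using iter_nonneg[of "newton \<kappa>"] newton_bounds(1)[OF k] by (simp add: less_imp_le)
    finally show ?thesis using charge_pos[OF k, of 0] by (simp add: field_simps)
  qed
  show s: "summable (\<lambda>k. walk_prob k x)"
    by (rule summableI_nonneg_bounded[OF walk_prob_nonneg bound[OF order_refl]])
  show "green x \<le> newton \<kappa> x / charge \<kappa> 0" if "\<kappa>0 \<le> \<kappa>"
    unfolding green_def by (rule suminf_le_const[OF s bound[OF that]])
qed

lemma green_nonneg: "0 \<le> green x"
  unfolding green_def by (intro suminf_nonneg summable_walk_prob walk_prob_nonneg)

lemma green_harmonic: "P green x = green x - indicator {0} x"
proof -
  have "(\<lambda>k. P (walk_prob k) x) sums P green x"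
    unfolding walk_avg_def green_def by (intro sums_sum sums_mult summable_sums summable_walk_prob)
  moreover have "P (walk_prob k) x = walk_prob (Suc k) x" for k by (simp add: walk_prob_def)
  ultimately have "(\<lambda>k. walk_prob (Suc k) x) sums P green x" by simp
  moreover have "(\<lambda>k. walk_prob (Suc k) x) sums (green x - walk_prob 0 x)"
    unfolding green_def by (subst sums_Suc_iff) (simp add: summable_sums summable_walk_prob)
  ultimately show ?thesis using sums_unique2 by (fastforce simp: walk_prob_def)
qed

text \<open>
  The limit is harmonic and vanishes at infinity, hence is zero by comparison with zero (for \<open>N\<close> the
  identity).
\<close>

lemma iter_newton_tendsto_0:
  assumes \<kappa>: "\<kappa>0 \<le> \<kappa>"
  shows "(\<lambda>n. (P ^^ n) (newton \<kappa>) x) \<longlonglongrightarrow> 0"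
proof -
  define u where "u n x = (P ^^ n) (newton \<kappa>) x" for n x
  have nonneg: "0 \<le> u n x" for n x
    unfolding u_def by (rule iter_nonneg) (simp add: newton_bounds[OF \<kappa>] less_imp_le)
  have dec: "decseq (\<lambda>n. u n x)" for x
  proof (rule decseq_SucI)
    fix n
    have "0 \<le> (P ^^ n) (charge \<kappa>) x" by (rule iter_nonneg) (simp add: charge_pos[OF \<kappa>] less_imp_le)
    then show "u (Suc n) x \<le> u n x" unfolding u_def charge_def iter_diff by simp
  qed
  define v where "v x = lim (\<lambda>n. u n x)" for x
  have lim: "(\<lambda>n. u n x) \<longlonglongrightarrow> v x" for x
  proof -
    have "convergent (\<lambda>n. u n x)"
      by (rule Bseq_monoseq_convergent[OF decseq_bounded[OF dec, of 0]]) (use dec nonneg in \<open>auto simp: decseq_imp_monoseq\<close>)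
    then show ?thesis unfolding v_def by (rule convergent_LIMSEQ_iff[THEN iffD1])
  qed
  have v_le: "v x \<le> newton \<kappa> x" for x
    using decseq_ge[OF dec lim, of x 0] by (simp add: u_def)
  have v0: "0 \<le> v x" for x by (rule LIMSEQ_le_const[OF lim]) (use nonneg in auto)
  have "(\<lambda>n. P (u n) x) \<longlonglongrightarrow> P v x" for x by (intro walk_avg_tendsto lim)
  moreover have "P (u n) x = u (Suc n) x" for n x by (simp add: u_def[abs_def])
  ultimately have lim': "(\<lambda>n. u (Suc n) x) \<longlonglongrightarrow> P v x" for x by simp
  have Pv: "P v x = v x" for x by (rule LIMSEQ_unique[OF lim' LIMSEQ_Suc[OF lim]])
  have v01: "0 \<le> v y \<and> v y \<le> 1" for y
    using v0[of y] order_trans[OF v_le newton_bounds(2)[OF \<kappa>], of y] by blast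
  have v_inf: "\<forall>\<^sub>F y in far. v y \<le> 0 + \<epsilon>" if "0 < \<epsilon>" for \<epsilon>
    using eventually_newton_less[OF that, of \<kappa>]
  proof eventually_elim
    case (elim y)
    show ?case using elim v_le[of y] by linarith
  qed
  have "v x \<le> (\<lambda>_. 0) x"
    by (rule comparison[where N = "\<lambda>s. s" and \<Omega> = UNIV and a = v and b = "\<lambda>_. 0" and x = x, OF _ _ v01 _ _ _ _ v_inf])
       (simp_all add: Pv)
  then show ?thesis using lim[of x] v0[of x] by (simp add: u_def)
qed

lemma newton_eq_green_charge:
  assumes \<kappa>: "\<kappa>0 \<le> \<kappa>"
  shows "ennreal (newton \<kappa> x) = (\<integral>\<^sup>+z. ennreal (green (x - z)) * ennreal (charge \<kappa> z) \<partial>count_space UNIV)"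
proof -
  have c0: "0 \<le> charge \<kappa> z" for z using charge_pos[OF \<kappa>, of z] by simp
  have "(\<lambda>k. (P ^^ k) (charge \<kappa>) x) sums newton \<kappa> x"
    unfolding sums_def sum_iter_charge using tendsto_diff[OF tendsto_const iter_newton_tendsto_0[OF \<kappa>], of "newton \<kappa> x"] by simp
  then have "(\<lambda>k. ennreal ((P ^^ k) (charge \<kappa>) x)) sums ennreal (newton \<kappa> x)"
    using iter_nonneg[of "charge \<kappa>"] c0 newton_bounds(1)[OF \<kappa>] by (subst sums_ennreal) (auto simp: less_imp_le)
  then have "ennreal (newton \<kappa> x) = (\<Sum>k. ennreal ((P ^^ k) (charge \<kappa>) x))" by (simp add: sums_iff)
  also have "\<dots> = (\<Sum>k. \<integral>\<^sup>+z. ennreal (walk_prob k (x - z)) * ennreal (charge \<kappa> z) \<partial>count_space UNIV)"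
    by (simp add: iter_kernel c0)
  also have "\<dots> = (\<integral>\<^sup>+z. (\<Sum>k. ennreal (walk_prob k (x - z)) * ennreal (charge \<kappa> z)) \<partial>count_space UNIV)"
    by (rule nn_integral_suminf[symmetric]) simp
  also have "\<dots> = (\<integral>\<^sup>+z. ennreal (green (x - z)) * ennreal (charge \<kappa> z) \<partial>count_space UNIV)"
    unfolding green_def
    by (intro nn_integral_cong) (simp add: suminf_ennreal2 walk_prob_nonneg summable_walk_prob)
  finally show ?thesis .
qed

end

section \<open>Asymptotics of the Green function\<close>

text \<open>
  A weighted Young inequality.  In \<open>green_limit_value\<close> it is applied with \<open>x\<close> the kernel at \<open>X n - z\<close> and
  \<open>y\<close> that at \<open>z\<close>: summed over \<open>z\<close>, the cubes of \<open>x\<close> give a constant, which a small \<open>t\<close> makes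
  negligible, and those of \<open>y\<close> the tail of a convergent sum.
\<close>

lemma product_square_le:
  fixes x y t :: real
  assumes "0 \<le> x" "0 \<le> y" "0 < t"
  shows "x * y\<^sup>2 \<le> t ^ 6 * x ^ 3 + y ^ 3 / t ^ 3"
proof (cases "y \<le> t ^ 3 * x")
  case True
  then have "x * y\<^sup>2 \<le> x * (t ^ 3 * x)\<^sup>2" using assms by (intro mult_left_mono power_mono) auto
  also have "(t ^ 3 * x)\<^sup>2 = t ^ 6 * x\<^sup>2" by (simp add: power_mult_distrib flip: power_mult)
  also have "x * (t ^ 6 * x\<^sup>2) = t ^ 6 * x ^ 3" by (simp add: power2_eq_square power3_eq_cube)
  also have "\<dots> \<le> t ^ 6 * x ^ 3 + y ^ 3 / t ^ 3" using assms by simp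
  finally show ?thesis .
next
  case False
  then have "x \<le> y / t ^ 3" using assms by (simp add: field_simps)
  then have "x * y\<^sup>2 \<le> (y / t ^ 3) * y\<^sup>2" by (intro mult_right_mono) auto
  also have "\<dots> = y ^ 3 / t ^ 3" by (simp add: power2_eq_square power3_eq_cube)
  also have "\<dots> \<le> t ^ 6 * x ^ 3 + y ^ 3 / t ^ 3" using assms by simp
  finally show ?thesis .
qed

text \<open>
  The coordinates enter the asymptotics of the Green function only through the limit of this lattice sum,
  which \<open>lattice_newton_sum\<close> evaluates.
\<close>

locale lattice_walk = isotropic_walk +
  fixes mass :: real
  assumes mass_pos: "0 < mass"
    and lattice_sum: "((\<lambda>\<kappa>. \<integral>\<^sup>+z. ennreal (4 * \<kappa> / (Q z + \<kappa>) ^ 3) \<partial>count_space UNIV) \<longlongrightarrow> ennreal mass) at_top"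
begin

abbreviation cube :: "real \<Rightarrow> 'a \<Rightarrow> real" where "cube \<kappa> z \<equiv> 1 / (Q z + \<kappa>) ^ 3"

lemma Q_plus_pos: "\<kappa>0 \<le> \<kappa> \<Longrightarrow> 0 < Q x + \<kappa>"
  using \<kappa>0_bounds(2) Q_nonneg[of x] by linarith

lemma integrable_cube: "\<kappa>0 \<le> \<kappa> \<Longrightarrow> integrable (count_space UNIV) (cube \<kappa>)"
proof -
  assume \<kappa>: "\<kappa>0 \<le> \<kappa>"
  have kpos: "0 < \<kappa>" using \<kappa> \<kappa>0_bounds by linarith
  have "\<forall>\<^sub>F \<kappa>' in at_top. (\<integral>\<^sup>+z. ennreal (4 * \<kappa>' / (Q z + \<kappa>') ^ 3) \<partial>count_space UNIV) < \<infinity> \<and> \<kappa> \<le> \<kappa>'"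
    using lattice_sum by (intro eventually_conj order_tendstoD eventually_ge_at_top) auto
  then obtain \<kappa>' where fin: "(\<integral>\<^sup>+z. ennreal (4 * \<kappa>' / (Q z + \<kappa>') ^ 3) \<partial>count_space UNIV) < \<infinity>" and kk: "\<kappa> \<le> \<kappa>'"
    using eventually_happens[of _ "at_top :: real filter"] by (metis (no_types, lifting) trivial_limit_at_top_linorder)
  have "integrable (count_space UNIV) (\<lambda>z. 4 * \<kappa>' / (Q z + \<kappa>') ^ 3)"
    using fin kpos kk by (intro integrableI_nonneg) (auto simp: add_nonneg_nonneg)
  then have "integrable (count_space UNIV) (\<lambda>z. ((\<kappa>' / \<kappa>) ^ 3 / (4 * \<kappa>')) * (4 * \<kappa>' / (Q z + \<kappa>') ^ 3))"
    by (rule integrable_mult_right)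
  then show ?thesis
  proof (rule Bochner_Integration.integrable_bound)
    show "AE z in count_space UNIV. norm (cube \<kappa> z) \<le> norm (((\<kappa>' / \<kappa>) ^ 3 / (4 * \<kappa>')) * (4 * \<kappa>' / (Q z + \<kappa>') ^ 3))"
    proof (intro AE_I2)
      fix z
      have p: "0 < Q z + \<kappa>" "0 < Q z + \<kappa>'" using Q_plus_pos[OF \<kappa>] kk \<kappa> Q_plus_pos by (auto intro: order_trans)
      have "Q z * \<kappa> \<le> Q z * \<kappa>'" using kk by (intro mult_left_mono) auto
      then have "Q z + \<kappa>' \<le> \<kappa>' / \<kappa> * (Q z + \<kappa>)" using kpos by (simp add: field_simps)
      then have "(Q z + \<kappa>') ^ 3 \<le> (\<kappa>' / \<kappa> * (Q z + \<kappa>)) ^ 3" using p by (intro power_mono) auto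
      then have "(Q z + \<kappa>') ^ 3 \<le> (\<kappa>' / \<kappa>) ^ 3 * (Q z + \<kappa>) ^ 3" by (simp only: power_mult_distrib)
      moreover have "1 / a \<le> r / b" if "b \<le> r * a" "0 < a" "0 < b" for a b r :: real
        using that by (simp add: field_simps)
      ultimately have "1 / (Q z + \<kappa>) ^ 3 \<le> (\<kappa>' / \<kappa>) ^ 3 / (Q z + \<kappa>') ^ 3" using p by simp
      moreover have "((\<kappa>' / \<kappa>) ^ 3 / (4 * \<kappa>')) * (4 * \<kappa>' / (Q z + \<kappa>') ^ 3) = (\<kappa>' / \<kappa>) ^ 3 / (Q z + \<kappa>') ^ 3"
        using kpos kk by simp
      ultimately show "norm (cube \<kappa> z) \<le> norm (((\<kappa>' / \<kappa>) ^ 3 / (4 * \<kappa>')) * (4 * \<kappa>' / (Q z + \<kappa>') ^ 3))"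
        using p kpos kk by (simp del: times_divide_eq_right times_divide_eq_left)
    qed
  qed simp
qed

lemma cube_sum_tendsto: "((\<lambda>\<kappa>. 4 * \<kappa> * (\<integral>z. cube \<kappa> z \<partial>count_space UNIV)) \<longlongrightarrow> mass) at_top"
proof -
  have "((\<lambda>\<kappa>. enn2real (\<integral>\<^sup>+z. ennreal (4 * \<kappa> / (Q z + \<kappa>) ^ 3) \<partial>count_space UNIV)) \<longlongrightarrow> mass) at_top"
    using tendsto_enn2real[OF lattice_sum] mass_pos by simp
  moreover have "\<forall>\<^sub>F \<kappa> in at_top. enn2real (\<integral>\<^sup>+z. ennreal (4 * \<kappa> / (Q z + \<kappa>) ^ 3) \<partial>count_space UNIV)
      = 4 * \<kappa> * (\<integral>z. cube \<kappa> z \<partial>count_space UNIV)"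
    using eventually_ge_at_top[of \<kappa>0]
  proof eventually_elim
    case (elim \<kappa>)
    have "enn2real (\<integral>\<^sup>+z. ennreal (4 * \<kappa> / (Q z + \<kappa>) ^ 3) \<partial>count_space UNIV) = (\<integral>z. 4 * \<kappa> / (Q z + \<kappa>) ^ 3 \<partial>count_space UNIV)"
      using elim \<kappa>0_bounds(2) by (intro integral_eq_nn_integral[symmetric]) (auto simp: add_nonneg_nonneg)
    also have "\<dots> = (\<integral>z. 4 * \<kappa> * cube \<kappa> z \<partial>count_space UNIV)" by simp
    also have "\<dots> = 4 * \<kappa> * (\<integral>z. cube \<kappa> z \<partial>count_space UNIV)" by (rule integral_mult_right_zero)
    finally show ?case .
  qed
  ultimately show ?thesis by (rule Lim_transform_eventually)
qed

lemma charge_cube: "\<kappa>0 \<le> \<kappa> \<Longrightarrow> \<bar>charge \<kappa> z - 4 * \<kappa> * cube \<kappa> z\<bar> \<le> C1 * cube \<kappa> z"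
  using newton_laplacian[of \<kappa> z] by (simp add: charge_def)

lemma charge_le_cube: "\<kappa>0 \<le> \<kappa> \<Longrightarrow> charge \<kappa> z \<le> (4 * \<kappa> + C1) * cube \<kappa> z"
  using charge_cube[of \<kappa> z] by (simp add: distrib_right abs_le_iff add_divide_distrib)

lemma integrable_charge: "\<kappa>0 \<le> \<kappa> \<Longrightarrow> integrable (count_space UNIV) (charge \<kappa>)"
proof -
  assume \<kappa>: "\<kappa>0 \<le> \<kappa>"
  have "integrable (count_space UNIV) (\<lambda>z. (4 * \<kappa> + C1) * cube \<kappa> z)"
    by (intro integrable_mult_right integrable_cube[OF \<kappa>])
  then show ?thesis
  proof (rule Bochner_Integration.integrable_bound)
    show "AE z in count_space UNIV. norm (charge \<kappa> z) \<le> norm ((4 * \<kappa> + C1) * cube \<kappa> z)"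
    proof (intro AE_I2)
      fix z
      have "norm (charge \<kappa> z) = charge \<kappa> z" using charge_pos[OF \<kappa>, of z] by simp
      also have "\<dots> \<le> (4 * \<kappa> + C1) * cube \<kappa> z" by (rule charge_le_cube[OF \<kappa>])
      finally show "norm (charge \<kappa> z) \<le> norm ((4 * \<kappa> + C1) * cube \<kappa> z)" by (simp only: real_norm_def)
    qed
  qed simp
qed

definition total_charge :: "real \<Rightarrow> real" where
  "total_charge \<kappa> = (\<integral>z. charge \<kappa> z \<partial>count_space UNIV)"

lemma total_charge_tendsto: "(total_charge \<longlongrightarrow> mass) at_top"
proof -
  define I where "I \<kappa> = (\<integral>z. cube \<kappa> z \<partial>count_space UNIV)" for \<kappa>
  have lim: "((\<lambda>\<kappa>. 4 * \<kappa> * I \<kappa>) \<longlongrightarrow> mass) at_top" using cube_sum_tendsto by (simp add: I_def)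
  have lim0: "((\<lambda>\<kappa>. (C / \<kappa>)) \<longlongrightarrow> 0) at_top" for C :: real by real_asymp
  have "((\<lambda>\<kappa>. (C1 / 4 / \<kappa>) * (4 * \<kappa> * I \<kappa>)) \<longlongrightarrow> 0) at_top"
    using tendsto_mult[OF lim0[of "C1 / 4"] lim] by (simp only: mult_zero_left)
  moreover have "\<forall>\<^sub>F \<kappa> in at_top. norm (total_charge \<kappa> - 4 * \<kappa> * I \<kappa>) \<le> (C1 / 4 / \<kappa>) * (4 * \<kappa> * I \<kappa>)"
    using eventually_ge_at_top[of \<kappa>0]
  proof eventually_elim
    case (elim \<kappa>)
    have "\<bar>total_charge \<kappa> - 4 * \<kappa> * I \<kappa>\<bar> = \<bar>\<integral>z. charge \<kappa> z - 4 * \<kappa> * cube \<kappa> z \<partial>count_space UNIV\<bar>"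
      unfolding total_charge_def I_def integral_mult_right_zero[symmetric]
      by (subst Bochner_Integration.integral_diff[OF integrable_charge[OF elim]])
         (auto intro: integrable_mult_right integrable_cube[OF elim] simp del: times_divide_eq_right)
    also have "\<dots> \<le> (\<integral>z. C1 * cube \<kappa> z \<partial>count_space UNIV)"
      using charge_cube[OF elim]
      by (intro integral_abs_bound[THEN order_trans] integral_mono Bochner_Integration.integrable_diff
          integrable_abs integrable_mult_right integrable_cube integrable_charge elim)
    also have "\<dots> = C1 * I \<kappa>" unfolding I_def by (rule integral_mult_right_zero)
    finally show ?case using elim \<kappa>0_bounds(2) by simp
  qed
  ultimately have "((\<lambda>\<kappa>. total_charge \<kappa> - 4 * \<kappa> * I \<kappa>) \<longlongrightarrow> 0) at_top"
    by (rule Lim_null_comparison[rotated])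
  from tendsto_add[OF this lim] show ?thesis by simp
qed

lemma integral_green_charge:
  assumes "\<kappa>0 \<le> \<kappa>"
  shows "integrable (count_space UNIV) (\<lambda>z. green (x - z) * charge \<kappa> z)"
    and "(\<integral>z. green (x - z) * charge \<kappa> z \<partial>count_space UNIV) = newton \<kappa> x"
proof -
  have nn: "0 \<le> green (x - z) * charge \<kappa> z" for z
    using green_nonneg charge_pos[OF assms, of z] by simp
  have eq: "(\<integral>\<^sup>+z. ennreal (green (x - z) * charge \<kappa> z) \<partial>count_space UNIV) = ennreal (newton \<kappa> x)"
    unfolding newton_eq_green_charge[OF assms] using green_nonneg charge_pos[OF assms]
    by (intro nn_integral_cong) (simp add: ennreal_mult less_imp_le)
  show "integrable (count_space UNIV) (\<lambda>z. green (x - z) * charge \<kappa> z)"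
    by (rule integrableI_nonneg) (use eq nn in auto)
  show "(\<integral>z. green (x - z) * charge \<kappa> z \<partial>count_space UNIV) = newton \<kappa> x"
    using nn eq newton_bounds(1)[OF assms, of x] by (subst integral_eq_nn_integral) auto
qed

lemma integral_shift:
  "integrable (count_space UNIV) f \<Longrightarrow> integrable (count_space UNIV) (\<lambda>z. f (x - z) :: real)"
  "(\<integral>z. f (x - z) \<partial>count_space UNIV) = (\<integral>z. f z \<partial>count_space (UNIV :: 'a set))"
proof -
  have b: "bij_betw (\<lambda>z. x - z) UNIV (UNIV :: 'a set)"
    by (rule bij_betw_byWitness[of _ "\<lambda>z. x - z"]) auto
  show "integrable (count_space UNIV) f \<Longrightarrow> integrable (count_space UNIV) (\<lambda>z. f (x - z) :: real)"
    using integrable_bij_count_space[OF b, of f] by simp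
  show "(\<integral>z. f (x - z) \<partial>count_space UNIV) = (\<integral>z. f z \<partial>count_space (UNIV :: 'a set))"
    using integral_bij_count_space[OF b, of f] by simp
qed

text \<open>
  In \<open>newton \<kappa> (X n) = (\<Sum>z. green (X n - z) * charge \<kappa> z)\<close>, multiplied by \<open>Q (X n)\<close>, the left side tends
  to one.  On the right, sites with \<open>4 * Q z \<le> Q (X n)\<close> are handled by dominated convergence and yield
  \<open>a\<close> times the total charge; the other sites contribute nothing in the limit, since there the charge is
  small and the Green function is bounded by \<open>newton \<kappa>\<close>.
\<close>

lemma green_limit_value:
  assumes \<kappa>: "\<kappa>0 \<le> \<kappa>" and X: "filterlim X far sequentially"
    and lim: "\<And>z. (\<lambda>n. Q (X n) * green (X n + z)) \<longlonglongrightarrow> a"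
  shows "a * total_charge \<kappa> = 1"
proof -
  define M where "M = count_space (UNIV :: 'a set)"
  define C where "C = 1 / charge \<kappa> 0"
  have C: "0 < C" using charge_pos[OF \<kappa>] by (simp add: C_def)
  have gC: "green y \<le> C / (Q y + \<kappa>)" for y
    using green_le_newton[OF \<kappa>, of y] by (simp add: C_def newton_def mult.commute)
  have kpos: "0 < \<kappa>" using \<kappa> \<kappa>0_bounds by linarith
  have c0: "0 \<le> charge \<kappa> z" for z using charge_pos[OF \<kappa>, of z] by simp
  have QX: "filterlim (\<lambda>n. Q (X n)) at_top sequentially" using filterlim_compose[OF Q_at_top X] .
  define f where "f n z = Q (X n) * (green (X n - z) * charge \<kappa> z)" for n z
  define A where "A n = {z. 4 * Q z \<le> Q (X n)}" for n
  have f0: "0 \<le> f n z" for n z unfolding f_def using green_nonneg c0 by simp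
  have fint: "integrable M (f n)" for n
    unfolding f_def M_def by (intro integrable_mult_right integral_green_charge \<kappa>)
  have find: "integrable M (\<lambda>z. f n z * indicator B z)" for n B
    by (rule integrable_real_mult_indicator[OF _ fint]) (simp add: M_def)
  have total: "(\<lambda>n. \<integral>z. f n z \<partial>M) \<longlonglongrightarrow> 1"
  proof -
    have "(\<integral>z. f n z \<partial>M) = Q (X n) / (Q (X n) + \<kappa>)" for n
      unfolding f_def M_def using integral_green_charge(2)[OF \<kappa>, of "X n"]
      by (subst integral_mult_right_zero) (simp add: newton_def)
    moreover have "((\<lambda>q. q / (q + \<kappa>)) \<longlongrightarrow> 1) at_top" by real_asymp
    ultimately show ?thesis using filterlim_compose[OF _ QX] by simp
  qed
  \<comment> \<open>here \<open>X n - z\<close> is at least half as far out as \<open>X n\<close>, so the charge itself is the dominating function\<close>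
  have near: "(\<lambda>n. \<integral>z. f n z * indicator (A n) z \<partial>M) \<longlonglongrightarrow> (\<integral>z. a * charge \<kappa> z \<partial>M)"
  proof (rule integral_dominated_convergence)
    show "integrable M (\<lambda>z. 4 * C * charge \<kappa> z)"
      unfolding M_def by (intro integrable_mult_right integrable_charge \<kappa>)
    show "AE z in M. (\<lambda>n. f n z * indicator (A n) z) \<longlonglongrightarrow> a * charge \<kappa> z"
    proof (intro AE_I2)
      fix z
      have "(\<lambda>n. Q (X n) * green (X n + (- z)) * charge \<kappa> z) \<longlonglongrightarrow> a * charge \<kappa> z"
        by (intro tendsto_intros lim)
      moreover have "\<forall>\<^sub>F n in sequentially. 4 * Q z \<le> Q (X n)"
        using QX by (simp add: filterlim_at_top)
      then have "\<forall>\<^sub>F n in sequentially. Q (X n) * green (X n + (- z)) * charge \<kappa> z = f n z * indicator (A n) z"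
        by eventually_elim (simp add: f_def A_def)
      ultimately show "(\<lambda>n. f n z * indicator (A n) z) \<longlonglongrightarrow> a * charge \<kappa> z"
        by (rule Lim_transform_eventually)
    qed
    fix n
    show "AE z in M. norm (f n z * indicator (A n) z) \<le> 4 * C * charge \<kappa> z"
    proof (intro AE_I2)
      fix z
      show "norm (f n z * indicator (A n) z) \<le> 4 * C * charge \<kappa> z"
      proof (cases "z \<in> A n")
        case True
        define q where "q = Q (X n)"
        have "sqrt (4 * Q z) \<le> sqrt q" using True by (intro real_sqrt_le_mono) (simp add: A_def q_def)
        then have "sqrt q / 2 \<le> sqrt q - sqrt (Q z)" by (simp add: real_sqrt_mult)
        then have "(sqrt q / 2)\<^sup>2 \<le> (sqrt q - sqrt (Q z))\<^sup>2" by (intro power_mono) (auto simp: q_def)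
        also have "\<dots> \<le> Q (X n - z)" using Q_add_ge[of "X n" "- z"] by (simp add: q_def)
        finally have "q / 4 \<le> Q (X n - z)" by (simp add: power_divide q_def)
        then have "green (X n - z) \<le> C / (q / 4 + \<kappa>)"
          using C kpos by (intro order_trans[OF gC] frac_le) (auto simp: q_def add_nonneg_pos)
        then have "q * green (X n - z) \<le> q * (C / (q / 4 + \<kappa>))" by (intro mult_left_mono) (auto simp: q_def)
        also have "\<dots> \<le> 4 * C" using C kpos by (simp add: q_def field_simps add_nonneg_pos)
        finally have "q * green (X n - z) * charge \<kappa> z \<le> 4 * C * charge \<kappa> z" using c0 by (intro mult_right_mono)
        then show ?thesis using True f0[of n z] by (simp add: f_def q_def mult.assoc)
      qed (use C c0 in simp)
    qed
  qed (auto simp: M_def)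
  \<comment> \<open>outside \<open>A n\<close> there is no fixed dominating function, because \<open>X n - z\<close> may be close to the origin\<close>
  define D where "D = 4 * (C * (4 * \<kappa> + C1))"
  have D: "0 < D" using C kpos C1_nonneg by (simp add: D_def add_pos_nonneg)
  define S where "S = (\<integral>z. cube \<kappa> z \<partial>M)"
  have S0: "0 \<le> S" unfolding S_def by (intro Bochner_Integration.integral_nonneg) (simp add: add_nonneg_nonneg kpos less_imp_le)
  define tail where "tail n = (\<integral>z. cube \<kappa> z * indicator (- A n) z \<partial>M)" for n
  have cint: "integrable M (cube \<kappa>)" unfolding M_def by (rule integrable_cube[OF \<kappa>])
  have cind: "integrable M (\<lambda>z. cube \<kappa> z * indicator B z)" for B
    by (rule integrable_real_mult_indicator[OF _ cint]) (simp add: M_def)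
  have tail: "tail \<longlonglongrightarrow> 0"
  proof -
    have "(\<lambda>n. \<integral>z. cube \<kappa> z * indicator (- A n) z \<partial>M) \<longlonglongrightarrow> (\<integral>z. 0 \<partial>M)"
    proof (rule integral_dominated_convergence[where w = "cube \<kappa>", OF _ _ cint])
      show "AE z in M. (\<lambda>n. cube \<kappa> z * indicator (- A n) z) \<longlonglongrightarrow> 0"
      proof (intro AE_I2)
        fix z
        have "\<forall>\<^sub>F n in sequentially. 4 * Q z \<le> Q (X n)" using QX by (simp add: filterlim_at_top)
        then have "\<forall>\<^sub>F n in sequentially. cube \<kappa> z * indicator (- A n) z = 0"
          by eventually_elim (simp add: A_def)
        then show "(\<lambda>n. cube \<kappa> z * indicator (- A n) z) \<longlonglongrightarrow> 0" by (rule tendsto_eventually)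
      qed
    qed (use kpos in \<open>auto simp: M_def indicator_def add_nonneg_nonneg\<close>)
    then show ?thesis by (simp add: tail_def[abs_def])
  qed
  have far_le: "(\<integral>z. f n z * indicator (- A n) z \<partial>M) \<le> D * (t ^ 6 * S + tail n / t ^ 3)" if t: "0 < t" for n t
  proof -
    have csh: "integrable M (\<lambda>z. cube \<kappa> (X n - z))" and Ssh: "(\<integral>z. cube \<kappa> (X n - z) \<partial>M) = S"
      using integral_shift[of "cube \<kappa>" "X n"] integrable_cube[OF \<kappa>] by (auto simp: M_def S_def)
    have lin: "(\<integral>z. D * (b * F z + G z / c) \<partial>M) = D * (b * (\<integral>z. F z \<partial>M) + (\<integral>z. G z \<partial>M) / c)"
      if "integrable M F" "integrable M G" for F G :: "'a \<Rightarrow> real" and b c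
      using that by simp
    have "(\<integral>z. f n z * indicator (- A n) z \<partial>M)
      \<le> (\<integral>z. D * (t ^ 6 * cube \<kappa> (X n - z) + (cube \<kappa> z * indicator (- A n) z) / t ^ 3) \<partial>M)"
    proof (intro integral_mono find integrable_mult_right Bochner_Integration.integrable_add csh integrable_divide cind)
      fix z
      show "f n z * indicator (- A n) z \<le> D * (t ^ 6 * cube \<kappa> (X n - z) + (cube \<kappa> z * indicator (- A n) z) / t ^ 3)"
      proof (cases "z \<in> A n")
        case False
        define x y where "x = 1 / (Q (X n - z) + \<kappa>)" and "y = 1 / (Q z + \<kappa>)"
        have xy: "0 < x" "0 < y" using Q_plus_pos[OF \<kappa>] by (auto simp: x_def y_def)
        have qy: "Q (X n) * y \<le> 4" using False Q_plus_pos[OF \<kappa>, of z] kpos by (simp add: y_def A_def field_simps)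
        have "f n z \<le> Q (X n) * ((C * x) * ((4 * \<kappa> + C1) * y ^ 3))"
          unfolding f_def using gC[of "X n - z"] charge_le_cube[OF \<kappa>, of z] green_nonneg c0 C xy
          by (intro mult_left_mono mult_mono) (auto simp: x_def y_def power_divide)
        also have "\<dots> = (Q (X n) * y) * (C * (4 * \<kappa> + C1) * (x * y\<^sup>2))"
          by (simp add: power2_eq_square power3_eq_cube)
        also have "\<dots> \<le> 4 * (C * (4 * \<kappa> + C1) * (x * y\<^sup>2))"
          using qy C kpos C1_nonneg xy by (intro mult_right_mono) auto
        also have "\<dots> = D * (x * y\<^sup>2)" by (simp add: D_def)
        also have "\<dots> \<le> D * (t ^ 6 * x ^ 3 + y ^ 3 / t ^ 3)"
          using D xy t by (intro mult_left_mono product_square_le) auto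
        finally show ?thesis using False by (simp add: x_def y_def power_divide)
      next
        case True
        then show ?thesis using D t Q_plus_pos[OF \<kappa>, of "X n - z"] by simp
      qed
    qed
    also have "\<dots> = D * (t ^ 6 * S + tail n / t ^ 3)"
      using lin[OF csh cind[of "- A n"], of "t ^ 6" "t ^ 3"] Ssh by (simp only: tail_def)
    finally show ?thesis .
  qed
  have far_0: "(\<lambda>n. \<integral>z. f n z * indicator (- A n) z \<partial>M) \<longlonglongrightarrow> 0"
  proof (rule tendstoI)
    fix \<epsilon> :: real assume \<epsilon>: "0 < \<epsilon>"
    define t where "t = min 1 (\<epsilon> / (2 * D * (S + 1)))"
    have t: "0 < t" "t \<le> 1" using \<epsilon> D S0 by (auto simp: t_def)
    have "t ^ 6 * S \<le> t * S" using t S0 power_decreasing[of 1 6 t] by (intro mult_right_mono) auto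
    also have "\<dots> \<le> t * (S + 1)" using t by simp
    also have "\<dots> \<le> (\<epsilon> / (2 * D * (S + 1))) * (S + 1)" using S0 by (intro mult_right_mono) (auto simp: t_def)
    also have "\<dots> = \<epsilon> / (2 * D)" using S0 D by simp
    finally have "D * (t ^ 6 * S + 0 / t ^ 3) < \<epsilon>" using D \<epsilon> by (simp add: field_simps)
    moreover have "(\<lambda>n. D * (t ^ 6 * S + tail n / t ^ 3)) \<longlonglongrightarrow> D * (t ^ 6 * S + 0 / t ^ 3)"
      using t by (intro tendsto_intros tail) auto
    ultimately have "\<forall>\<^sub>F n in sequentially. D * (t ^ 6 * S + tail n / t ^ 3) < \<epsilon>" by (intro order_tendstoD)
    then show "\<forall>\<^sub>F n in sequentially. dist (\<integral>z. f n z * indicator (- A n) z \<partial>M) 0 < \<epsilon>"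
    proof eventually_elim
      case (elim n)
      have "0 \<le> (\<integral>z. f n z * indicator (- A n) z \<partial>M)" using f0 by (intro Bochner_Integration.integral_nonneg) auto
      then show ?case using far_le[OF t(1), of n] elim by (simp add: dist_real_def)
    qed
  qed
  have "(\<integral>z. f n z \<partial>M) = (\<integral>z. f n z * indicator (A n) z \<partial>M) + (\<integral>z. f n z * indicator (- A n) z \<partial>M)" for n
    by (subst Bochner_Integration.integral_add[symmetric, OF find find])
       (auto intro!: Bochner_Integration.integral_cong simp: indicator_def)
  then have "(\<lambda>n. \<integral>z. f n z \<partial>M) \<longlonglongrightarrow> (\<integral>z. a * charge \<kappa> z \<partial>M) + 0"
    using tendsto_add[OF near far_0] by simp
  from LIMSEQ_unique[OF this total] show ?thesis
    by (simp add: total_charge_def M_def)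
qed

text \<open>
  The upper and the lower limit of \<open>Q * green\<close> are both equal to \<open>1 / mass\<close>: apply
  \<open>extremal_propagation\<close> to \<open>green\<close> and to \<open>- green\<close>, use \<open>green_limit_value\<close>, and let \<open>\<kappa>\<close> grow.
\<close>

lemma green_asymptotics: "((\<lambda>x. Q x * green x) \<longlongrightarrow> 1 / mass) far"
proof (cases "far = bot")
  case False
  have limit_eq: "a = 1 / mass" if X: "filterlim X far sequentially"
    and lim: "\<And>z. (\<lambda>n. Q (X n) * green (X n + z)) \<longlonglongrightarrow> a" for X a
  proof -
    have "\<forall>\<^sub>F \<kappa> in at_top. a * total_charge \<kappa> = 1"
      using eventually_ge_at_top[of \<kappa>0] by eventually_elim (rule green_limit_value[OF _ X lim])
    then have "((\<lambda>\<kappa>. a * total_charge \<kappa>) \<longlongrightarrow> 1) at_top" by (rule tendsto_eventually)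
    moreover have "((\<lambda>\<kappa>. a * total_charge \<kappa>) \<longlongrightarrow> a * mass) at_top" by (intro tendsto_intros total_charge_tendsto)
    ultimately have "a * mass = 1" by (intro tendsto_unique[of at_top]) auto
    then show ?thesis using mass_pos by (simp add: field_simps)
  qed
  define C where "C = 1 / charge \<kappa>0 0"
  have C: "0 < C" using charge_pos[OF order_refl] by (simp add: C_def)
  have bound: "\<bar>Q x * green x\<bar> \<le> C" for x
  proof -
    have "Q x * green x \<le> Q x * (C / (Q x + \<kappa>0))"
      using green_le_newton[OF order_refl, of x] by (intro mult_left_mono) (auto simp: C_def newton_def mult.commute)
    also have "\<dots> \<le> C" using C Q_plus_pos[OF order_refl, of x] \<kappa>0_bounds(2) by (simp add: field_simps)
    finally show ?thesis using green_nonneg[of x] by simp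
  qed
  have harm: "\<forall>\<^sub>F x in far. P green x = green x"
    by (rule eventually_far_finite, rule finite_subset[of _ "{0}"]) (auto simp: green_harmonic indicator_def)
  then have harm': "\<forall>\<^sub>F x in far. P (\<lambda>x. - green x) x = - green x"
    using walk_avg_cmult[of "-1" green] by simp
  obtain a X where X: "filterlim X far sequentially" "(\<lambda>n. Q (X n) * green (X n)) \<longlonglongrightarrow> a"
    and up: "\<And>\<epsilon>. 0 < \<epsilon> \<Longrightarrow> \<forall>\<^sub>F x in far. Q x * green x \<le> a + \<epsilon>"
    by (rule limsup_sequence[of "\<lambda>x. Q x * green x" C, OF _ False]) (use bound in auto)
  have a: "a = 1 / mass"
    using limit_eq[OF X(1)] extremal_propagation[OF X(1) harm up X(2)] by blast
  obtain b Y where Y: "filterlim Y far sequentially" "(\<lambda>n. Q (Y n) * (- green (Y n))) \<longlonglongrightarrow> b"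
    and low: "\<And>\<epsilon>. 0 < \<epsilon> \<Longrightarrow> \<forall>\<^sub>F x in far. Q x * (- green x) \<le> b + \<epsilon>"
    by (rule limsup_sequence[of "\<lambda>x. Q x * (- green x)" C, OF _ False]) (use bound in auto)
  have "(\<lambda>n. Q (Y n) * (- green (Y n + z))) \<longlonglongrightarrow> b" for z
    using extremal_propagation[OF Y(1) harm' low Y(2)] .
  then have "(\<lambda>n. Q (Y n) * green (Y n + z)) \<longlonglongrightarrow> - b" for z
    using tendsto_minus by fastforce
  then have b: "- b = 1 / mass" using limit_eq[OF Y(1)] by blast
  show ?thesis
  proof (rule tendstoI)
    fix \<epsilon> :: real assume "0 < \<epsilon>"
    then have "\<forall>\<^sub>F x in far. Q x * green x \<le> a + \<epsilon> / 2" "\<forall>\<^sub>F x in far. Q x * (- green x) \<le> b + \<epsilon> / 2"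
      using up low by simp_all
    then show "\<forall>\<^sub>F x in far. dist (Q x * green x) (1 / mass) < \<epsilon>"
      by eventually_elim (use \<open>0 < \<epsilon>\<close> a b in \<open>simp add: dist_real_def abs_less_iff\<close>)
  qed
qed simp

end

section \<open>Solutions of the branching recursion\<close>

text \<open>
  The expected product of \<open>\<Theta>\<close> over the positions in generations up to \<open>n\<close>, given here by its recursion at
  the root; the interpretation is \<open>expectation_tree_prod\<close>.
\<close>

primrec tree_avg :: "nat pmf \<Rightarrow> 'a::ab_group_add pmf \<Rightarrow> ('a \<Rightarrow> real) \<Rightarrow> nat \<Rightarrow> 'a \<Rightarrow> real" where
  "tree_avg p \<mu> \<Theta> 0 = \<Theta>"
| "tree_avg p \<mu> \<Theta> (Suc n) = (\<lambda>x. \<Theta> x * gen_fun p (walk_avg \<mu> (tree_avg p \<mu> \<Theta> n) x))"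

lemma tree_avg_bounds:
  assumes fin: "finite (set_pmf \<mu>)" and w: "\<And>x. 0 \<le> \<Theta> x \<and> \<Theta> x \<le> 1"
  shows "0 \<le> tree_avg p \<mu> \<Theta> n x \<and> tree_avg p \<mu> \<Theta> n x \<le> 1"
proof (induction n arbitrary: x)
  case (Suc n)
  define t where "t = walk_avg \<mu> (tree_avg p \<mu> \<Theta> n) x"
  have "t \<le> (\<Sum>z\<in>set_pmf \<mu>. pmf \<mu> z * 1)"
    unfolding t_def walk_avg_def using Suc by (intro sum_mono mult_left_mono) auto
  then have t: "0 \<le> t" "t \<le> 1"
    using Suc fin by (auto simp: t_def walk_avg_def sum_pmf_eq_1 intro!: sum_nonneg)
  have "0 \<le> gen_fun p t" by (rule sums_le[OF _ sums_zero gen_fun_sums[OF t]]) (use t in simp)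
  moreover have "gen_fun p t \<le> 1"
    by (rule sums_le[OF _ gen_fun_sums[OF t] pmf_nat_sums[of p]]) (use t in \<open>simp add: mult_left_le power_le_one\<close>)
  ultimately show ?case using w by (auto simp: t_def intro: mult_le_one)
qed (use w in simp)

text \<open>
  One minus the expected product of \<open>\<Theta>\<close> over the whole tree: the probability that some individual is
  marked, when each individual at \<open>y\<close> is marked independently with probability \<open>1 - \<Theta> y\<close>.
\<close>

definition hit_prob :: "nat pmf \<Rightarrow> 'a::ab_group_add pmf \<Rightarrow> ('a \<Rightarrow> real) \<Rightarrow> 'a \<Rightarrow> real" where
  "hit_prob p \<mu> \<Theta> x = 1 - lim (\<lambda>n. tree_avg p \<mu> \<Theta> n x)"

definition laplace_weight :: "'a set \<Rightarrow> ('a \<Rightarrow> real) \<Rightarrow> real \<Rightarrow> 'a \<Rightarrow> real" where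
  "laplace_weight K l T y = (if y \<in> K then exp (- (l y / T)) else 1)"

text \<open>
  The weight for which \<open>hit_prob\<close> is the probability of visiting \<open>K\<close>.
\<close>

definition kill :: "'a set \<Rightarrow> 'a \<Rightarrow> real" where "kill K y = (if y \<in> K then 0 else 1)"

locale critical_walk = critical_offspring p \<sigma> + lattice_walk \<mu> e mass
  for p :: "nat pmf" and \<sigma> :: real and \<mu> :: "'a::ab_group_add pmf" and e :: "'a \<Rightarrow> real ^ 4" and mass :: real
begin

abbreviation N :: "real \<Rightarrow> real" where "N \<equiv> survive p"

definition \<theta> :: real where "\<theta> = \<sigma>\<^sup>2 / 2"

lemma \<theta>_pos: "0 < \<theta>" using variance_pos by (simp add: \<theta>_def)

lemma N_upper: "0 < \<epsilon> \<Longrightarrow> \<exists>s0>0. \<forall>s. 0 \<le> s \<longrightarrow> s \<le> s0 \<longrightarrow> N s \<le> s - (1 - \<epsilon>) * \<theta> * s\<^sup>2"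
  unfolding \<theta>_def by (rule survive_le_quadratic) blast+

lemma N_lower: "0 \<le> s \<Longrightarrow> s \<le> 1 \<Longrightarrow> s - \<theta> * s\<^sup>2 \<le> N s"
  unfolding \<theta>_def by (rule survive_ge)

lemma N_pos: "0 < s \<Longrightarrow> s \<le> 1 \<Longrightarrow> 0 < N s"
proof -
  assume s: "0 < s" "s \<le> 1"
  define t where "t = min s (1 / (2 * \<theta>))"
  have t: "0 < t" "t \<le> s" "t \<le> 1 / (2 * \<theta>)" using s \<theta>_pos by (auto simp: t_def)
  have "t * \<theta> \<le> 1 / 2" using t(3) \<theta>_pos by (simp add: field_simps)
  then have "\<theta> * t\<^sup>2 \<le> t * (1 / 2)"
    using mult_left_mono[of "t * \<theta>" "1 / 2" t] t(1) by (simp add: power2_eq_square algebra_simps)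
  then have "0 < t - \<theta> * t\<^sup>2" using t(1) by linarith
  also have "\<dots> \<le> N t" using t s by (intro N_lower) auto
  also have "\<dots> \<le> N s" using t s by (intro survive_mono) auto
  finally show ?thesis .
qed

text \<open>
  \<open>profile_supersolution\<close> and \<open>comparison\<close> in the form in which they are used.  The function \<open>u\<close> need only
  be below the barrier on the layer \<open>r \<le> Q x < 2 * r + 4 * reach\<^sup>2\<close>: by \<open>Q_step_ge\<close> a step from outside the
  layer cannot jump over it.  The radius \<open>R\<close> is chosen before \<open>u\<close> and \<open>\<alpha>\<close>.
\<close>

lemma upper_barrier:
  assumes \<beta>: "0 < \<beta>" "0 < lmin" "2 * \<beta> * (1 + 2 * \<beta> / lmin) < \<theta>"
  obtains R where "\<And>r u \<alpha> x. R \<le> r \<Longrightarrow> (\<And>x. 0 \<le> u x \<and> u x \<le> 1) \<Longrightarrow>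
      (\<And>\<epsilon>. 0 < \<epsilon> \<Longrightarrow> \<forall>\<^sub>F x in far. u x \<le> \<epsilon>) \<Longrightarrow>
      (\<And>x. 2 * r + 4 * reach\<^sup>2 \<le> Q x \<Longrightarrow> u x = N (P u x)) \<Longrightarrow>
      (\<And>x. r \<le> Q x \<Longrightarrow> lmin \<le> \<alpha> + \<beta> * ln (Q x + \<kappa>0)) \<Longrightarrow>
      (\<And>x. r \<le> Q x \<Longrightarrow> Q x < 2 * r + 4 * reach\<^sup>2 \<Longrightarrow> u x \<le> profile \<alpha> \<beta> \<kappa>0 x) \<Longrightarrow>
      r \<le> Q x \<Longrightarrow> u x \<le> profile \<alpha> \<beta> \<kappa>0 x"
proof -
  have ev: "\<forall>\<^sub>F x in far. (\<forall>\<alpha>. lmin \<le> \<alpha> + \<beta> * ln (Q x + \<kappa>0) \<longrightarrow>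
    (\<forall>z\<in>steps. 0 \<le> profile \<alpha> \<beta> \<kappa>0 (x + z) \<and> profile \<alpha> \<beta> \<kappa>0 (x + z) \<le> 1) \<and>
    N (P (profile \<alpha> \<beta> \<kappa>0) x) \<le> profile \<alpha> \<beta> \<kappa>0 x) \<and> newton \<kappa>0 x < lmin"
    by (intro eventually_conj profile_supersolution[OF N_upper \<theta>_pos \<beta>(1,2,3) order_refl] eventually_newton_less \<beta>(2))
  then obtain R where R: "\<And>x. R \<le> Q x \<Longrightarrow> (\<forall>\<alpha>. lmin \<le> \<alpha> + \<beta> * ln (Q x + \<kappa>0) \<longrightarrow>
    (\<forall>z\<in>steps. 0 \<le> profile \<alpha> \<beta> \<kappa>0 (x + z) \<and> profile \<alpha> \<beta> \<kappa>0 (x + z) \<le> 1) \<and>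
    N (P (profile \<alpha> \<beta> \<kappa>0) x) \<le> profile \<alpha> \<beta> \<kappa>0 x) \<and> newton \<kappa>0 x < lmin"
    unfolding eventually_far by blast
  show thesis
  proof (rule that[of "max R 0"])
    fix r u \<alpha> x
    assume r: "max R 0 \<le> r" and u01: "\<And>x. 0 \<le> u x \<and> u x \<le> 1"
      and u_inf: "\<And>\<epsilon>. 0 < \<epsilon> \<Longrightarrow> \<forall>\<^sub>F x in far. u x \<le> \<epsilon>"
      and u_eq: "\<And>x. 2 * r + 4 * reach\<^sup>2 \<le> Q x \<Longrightarrow> u x = N (P u x)"
      and L: "\<And>x. r \<le> Q x \<Longrightarrow> lmin \<le> \<alpha> + \<beta> * ln (Q x + \<kappa>0)"
      and layer: "\<And>x. r \<le> Q x \<Longrightarrow> Q x < 2 * r + 4 * reach\<^sup>2 \<Longrightarrow> u x \<le> profile \<alpha> \<beta> \<kappa>0 x"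
      and x: "r \<le> Q x"
    \<comment> \<open>the value \<open>1\<close> inside makes \<open>W\<close> a trivial upper bound there\<close>
    define W where "W y = (if r \<le> Q y then profile \<alpha> \<beta> \<kappa>0 y else 1)" for y
    define \<Omega> where "\<Omega> = {y. 2 * r + 4 * reach\<^sup>2 \<le> Q y}"
    have \<Omega>r: "r \<le> Q y" if "y \<in> \<Omega>" for y
      using that r unfolding \<Omega>_def mem_Collect_eq using zero_le_power2[of reach] by linarith
    have nbr: "W (y + z) = profile \<alpha> \<beta> \<kappa>0 (y + z)" if "y \<in> \<Omega>" "z \<in> steps" for y z
      using Q_step_ge[OF that(2), of y] that(1) by (simp add: W_def \<Omega>_def)
    have prof: "0 \<le> profile \<alpha> \<beta> \<kappa>0 y \<and> profile \<alpha> \<beta> \<kappa>0 y \<le> 1" if "r \<le> Q y" for y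
    proof -
      have "newton \<kappa>0 y < lmin" using R[of y] that r by simp
      then show ?thesis using L[OF that] \<beta>(2) newton_bounds(1)[OF order_refl, of y]
        by (simp add: profile_def divide_le_eq)
    qed
    have "u x \<le> W x"
    proof (rule comparison[of N u W \<Omega> x])
      show "N t - N s \<le> t - s" if "0 \<le> s" "s \<le> t" "t \<le> 1" for s t by (rule survive_diff(2)[OF that])
      show "N s \<le> N t" if "0 \<le> s" "s \<le> t" "t \<le> 1" for s t by (rule survive_mono[OF that])
      show "0 \<le> u y \<and> u y \<le> 1" for y by (rule u01)
      show "0 \<le> W y \<and> W y \<le> 1" for y using prof by (simp add: W_def)
      show "u y \<le> N (P u y)" if "y \<in> \<Omega>" for y using u_eq[of y] that by (simp add: \<Omega>_def)
      show "N (P W y) \<le> W y" if y: "y \<in> \<Omega>" for y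
      proof -
        have "P W y = P (profile \<alpha> \<beta> \<kappa>0) y" using nbr[OF y] by (rule walk_avg_cong)
        then show ?thesis using R[of y] L[OF \<Omega>r[OF y]] \<Omega>r[OF y] r by (simp add: W_def)
      qed
      show "u y \<le> W y" if "y \<notin> \<Omega>" for y using that layer[of y] u01[of y] by (auto simp: W_def \<Omega>_def not_le)
      show "\<forall>\<^sub>F y in far. u y \<le> W y + \<epsilon>" if \<epsilon>: "0 < \<epsilon>" for \<epsilon>
        using u_inf[OF \<epsilon>]
      proof eventually_elim
        case (elim y)
        have "0 \<le> W y" using prof[of y] by (simp add: W_def)
        then show ?case using elim by linarith
      qed
    qed
    then show "u x \<le> profile \<alpha> \<beta> \<kappa>0 x" using x by (simp add: W_def)
  qed
qed

text \<open>
  The counterpart of \<open>upper_barrier\<close>; at infinity it is the barrier that vanishes.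
\<close>

lemma lower_barrier:
  assumes \<beta>: "\<theta> < 2 * \<beta>" "0 < lmin"
  obtains R where "\<kappa>0 + 1 \<le> R" "\<And>r u \<alpha> x. R \<le> r \<Longrightarrow> (\<And>x. 0 \<le> u x \<and> u x \<le> 1) \<Longrightarrow>
      (\<And>x. 2 * r + 4 * reach\<^sup>2 \<le> Q x \<Longrightarrow> u x = N (P u x)) \<Longrightarrow>
      (\<And>x. r \<le> Q x \<Longrightarrow> lmin \<le> \<alpha> + \<beta> * ln (Q x + - \<kappa>0)) \<Longrightarrow>
      (\<And>x. r \<le> Q x \<Longrightarrow> Q x < 2 * r + 4 * reach\<^sup>2 \<Longrightarrow> profile \<alpha> \<beta> (- \<kappa>0) x \<le> u x) \<Longrightarrow>
      r \<le> Q x \<Longrightarrow> profile \<alpha> \<beta> (- \<kappa>0) x \<le> u x"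
proof -
  have ev: "\<forall>\<^sub>F x in far. (\<forall>\<alpha>. lmin \<le> \<alpha> + \<beta> * ln (Q x + - \<kappa>0) \<longrightarrow>
    (\<forall>z\<in>steps. 0 \<le> profile \<alpha> \<beta> (- \<kappa>0) (x + z) \<and> profile \<alpha> \<beta> (- \<kappa>0) (x + z) \<le> 1) \<and>
    profile \<alpha> \<beta> (- \<kappa>0) x \<le> N (P (profile \<alpha> \<beta> (- \<kappa>0)) x)) \<and> newton (- \<kappa>0) x < lmin"
    by (intro eventually_conj profile_subsolution[OF N_lower \<theta>_pos \<beta>(2,1) order_refl] eventually_newton_less \<beta>(2))
  then obtain R where R: "\<And>x. R \<le> Q x \<Longrightarrow> (\<forall>\<alpha>. lmin \<le> \<alpha> + \<beta> * ln (Q x + - \<kappa>0) \<longrightarrow>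
    (\<forall>z\<in>steps. 0 \<le> profile \<alpha> \<beta> (- \<kappa>0) (x + z) \<and> profile \<alpha> \<beta> (- \<kappa>0) (x + z) \<le> 1) \<and>
    profile \<alpha> \<beta> (- \<kappa>0) x \<le> N (P (profile \<alpha> \<beta> (- \<kappa>0)) x)) \<and> newton (- \<kappa>0) x < lmin"
    unfolding eventually_far by blast
  show thesis
  proof (rule that[of "max R (\<kappa>0 + 1)"])
    fix r u \<alpha> x
    assume r: "max R (\<kappa>0 + 1) \<le> r" and u01: "\<And>x. 0 \<le> u x \<and> u x \<le> 1"
      and u_eq: "\<And>x. 2 * r + 4 * reach\<^sup>2 \<le> Q x \<Longrightarrow> u x = N (P u x)"
      and L: "\<And>x. r \<le> Q x \<Longrightarrow> lmin \<le> \<alpha> + \<beta> * ln (Q x + - \<kappa>0)"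
      and layer: "\<And>x. r \<le> Q x \<Longrightarrow> Q x < 2 * r + 4 * reach\<^sup>2 \<Longrightarrow> profile \<alpha> \<beta> (- \<kappa>0) x \<le> u x"
      and x: "r \<le> Q x"
    define W where "W y = (if r \<le> Q y then profile \<alpha> \<beta> (- \<kappa>0) y else 0)" for y
    define \<Omega> where "\<Omega> = {y. 2 * r + 4 * reach\<^sup>2 \<le> Q y}"
    have \<Omega>r: "r \<le> Q y" if "y \<in> \<Omega>" for y
      using that r \<kappa>0_bounds(2) unfolding \<Omega>_def mem_Collect_eq using zero_le_power2[of reach] by linarith
    have nbr: "W (y + z) = profile \<alpha> \<beta> (- \<kappa>0) (y + z)" if "y \<in> \<Omega>" "z \<in> steps" for y z
      using Q_step_ge[OF that(2), of y] that(1) by (simp add: W_def \<Omega>_def)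
    have newt: "0 < newton (- \<kappa>0) y \<and> newton (- \<kappa>0) y < lmin" if "r \<le> Q y" for y
      using R[of y] that r by (simp add: newton_def)
    have prof: "0 \<le> profile \<alpha> \<beta> (- \<kappa>0) y \<and> profile \<alpha> \<beta> (- \<kappa>0) y \<le> 1" if "r \<le> Q y" for y
      using newt[OF that] L[OF that] \<beta>(2) by (simp add: profile_def divide_le_eq)
    have "W x \<le> u x"
    proof (rule comparison[of N W u \<Omega> x])
      show "N t - N s \<le> t - s" if "0 \<le> s" "s \<le> t" "t \<le> 1" for s t by (rule survive_diff(2)[OF that])
      show "N s \<le> N t" if "0 \<le> s" "s \<le> t" "t \<le> 1" for s t by (rule survive_mono[OF that])
      show "0 \<le> u y \<and> u y \<le> 1" for y by (rule u01)
      show "0 \<le> W y \<and> W y \<le> 1" for y using prof by (simp add: W_def)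
      show "N (P u y) \<le> u y" if "y \<in> \<Omega>" for y using u_eq[of y] that by (simp add: \<Omega>_def)
      show "W y \<le> N (P W y)" if y: "y \<in> \<Omega>" for y
      proof -
        have "P W y = P (profile \<alpha> \<beta> (- \<kappa>0)) y" using nbr[OF y] by (rule walk_avg_cong)
        then show ?thesis using R[of y] L[OF \<Omega>r[OF y]] \<Omega>r[OF y] r by (simp add: W_def)
      qed
      show "W y \<le> u y" if "y \<notin> \<Omega>" for y using that layer[of y] u01[of y] by (auto simp: W_def \<Omega>_def not_le)
      show "\<forall>\<^sub>F y in far. W y \<le> u y + \<epsilon>" if \<epsilon>: "0 < \<epsilon>" for \<epsilon>
      proof -
        have "0 < \<epsilon> * lmin" using \<epsilon> \<beta> by simp
        from eventually_newton_less[OF this, of "- \<kappa>0"] show ?thesis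
        proof eventually_elim
          case (elim y)
          show ?case
          proof (cases "r \<le> Q y")
            case True
            have "newton (- \<kappa>0) y \<le> \<epsilon> * (\<alpha> + \<beta> * ln (Q y + - \<kappa>0))"
              using elim mult_left_mono[OF L[OF True], of \<epsilon>] \<epsilon> by linarith
            then have "profile \<alpha> \<beta> (- \<kappa>0) y \<le> \<epsilon>"
              using L[OF True] \<beta>(2) by (simp add: profile_def divide_le_eq)
            then show ?thesis using u01[of y] True by (simp add: W_def)
          qed (use u01[of y] \<epsilon> in \<open>simp add: W_def\<close>)
        qed
      qed
    qed
    then show "profile \<alpha> \<beta> (- \<kappa>0) x \<le> u x" using x by (simp add: W_def)
  qed simp
qed

end

context critical_walk
begin

lemma gen_fun_01: "0 \<le> t \<Longrightarrow> t \<le> 1 \<Longrightarrow> 0 \<le> gen_fun p t \<and> gen_fun p t \<le> 1"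
  using survive_nonneg[of "1 - t"] survive_le[of "1 - t"] by (simp add: survive_def)

lemma gen_fun_mono: "0 \<le> t \<Longrightarrow> t \<le> t' \<Longrightarrow> t' \<le> 1 \<Longrightarrow> gen_fun p t \<le> gen_fun p t'"
  using survive_mono[of "1 - t'" "1 - t"] by (simp add: survive_def)

abbreviation weight :: "('a \<Rightarrow> real) \<Rightarrow> bool" where "weight \<Theta> \<equiv> (\<forall>x. 0 \<le> \<Theta> x \<and> \<Theta> x \<le> 1)"

lemma tree_avg_01: "weight \<Theta> \<Longrightarrow> 0 \<le> tree_avg p \<mu> \<Theta> n x \<and> tree_avg p \<mu> \<Theta> n x \<le> 1"
  by (rule tree_avg_bounds[OF finite_steps]) blast

lemma tree_avg_dec: "weight \<Theta> \<Longrightarrow> tree_avg p \<mu> \<Theta> (Suc n) x \<le> tree_avg p \<mu> \<Theta> n x"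
proof (induction n arbitrary: x)
  case 0
  have "0 \<le> P \<Theta> x" "P \<Theta> x \<le> 1" using 0 by (auto intro: walk_avg_ge walk_avg_le)
  then have "gen_fun p (P \<Theta> x) \<le> 1" using gen_fun_01 by blast
  then show ?case using 0 by (auto intro: mult_left_le)
next
  case (Suc n)
  have "P (tree_avg p \<mu> \<Theta> (Suc n)) x \<le> P (tree_avg p \<mu> \<Theta> n) x"
    using Suc by (intro walk_avg_mono) blast
  moreover have "0 \<le> P (tree_avg p \<mu> \<Theta> (Suc n)) x" "P (tree_avg p \<mu> \<Theta> n) x \<le> 1"
    using tree_avg_01[OF Suc.prems] by (blast intro: walk_avg_ge walk_avg_le)+
  ultimately have "gen_fun p (P (tree_avg p \<mu> \<Theta> (Suc n)) x) \<le> gen_fun p (P (tree_avg p \<mu> \<Theta> n) x)"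
    by (intro gen_fun_mono)
  then have "\<Theta> x * gen_fun p (P (tree_avg p \<mu> \<Theta> (Suc n)) x) \<le> \<Theta> x * gen_fun p (P (tree_avg p \<mu> \<Theta> n) x)"
    using Suc.prems by (intro mult_left_mono) auto
  then show ?case by (simp only: tree_avg.simps(2))
qed

abbreviation hit :: "('a \<Rightarrow> real) \<Rightarrow> 'a \<Rightarrow> real" where "hit \<equiv> hit_prob p \<mu>"

lemma tree_avg_tendsto: "weight \<Theta> \<Longrightarrow> (\<lambda>n. tree_avg p \<mu> \<Theta> n x) \<longlonglongrightarrow> 1 - hit \<Theta> x"
proof -
  assume w: "weight \<Theta>"
  have dec: "decseq (\<lambda>n. tree_avg p \<mu> \<Theta> n x)" by (rule decseq_SucI) (rule tree_avg_dec[OF w])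
  have "Bseq (\<lambda>n. tree_avg p \<mu> \<Theta> n x)" by (rule decseq_bounded[OF dec, of 0]) (use tree_avg_01[OF w] in blast)
  then have "convergent (\<lambda>n. tree_avg p \<mu> \<Theta> n x)"
    using dec by (intro Bseq_monoseq_convergent) (auto simp: decseq_imp_monoseq)
  then show ?thesis by (simp add: hit_prob_def convergent_LIMSEQ_iff)
qed

lemma hit_ge_horizon: "weight \<Theta> \<Longrightarrow> 1 - tree_avg p \<mu> \<Theta> n x \<le> hit \<Theta> x"
proof -
  assume w: "weight \<Theta>"
  have dec: "decseq (\<lambda>n. tree_avg p \<mu> \<Theta> n x)" by (rule decseq_SucI) (rule tree_avg_dec[OF w])
  from decseq_ge[OF dec tree_avg_tendsto[OF w], of n] show ?thesis by simp
qed

lemma hit_01: "weight \<Theta> \<Longrightarrow> 0 \<le> hit \<Theta> x \<and> hit \<Theta> x \<le> 1"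
proof -
  assume w: "weight \<Theta>"
  have "0 \<le> 1 - hit \<Theta> x" by (rule LIMSEQ_le_const[OF tree_avg_tendsto[OF w]]) (use tree_avg_01[OF w] in blast)
  moreover have "0 \<le> hit \<Theta> x" using hit_ge_horizon[OF w, of 0 x] w by (auto intro: order_trans[rotated])
  ultimately show ?thesis by simp
qed

lemma tree_avg_Suc: "1 - tree_avg p \<mu> \<Theta> (Suc n) x = 1 - \<Theta> x * (1 - N (P (\<lambda>y. 1 - tree_avg p \<mu> \<Theta> n y) x))"
  by (simp add: survive_def walk_avg_diff)

text \<open>
  The limit of \<open>tree_avg_Suc\<close>; \<open>N\<close> is continuous because it is non-expanding.
\<close>

lemma hit_recursion:
  assumes w: "weight \<Theta>"
  shows "hit \<Theta> x = 1 - \<Theta> x * (1 - N (P (hit \<Theta>) x))"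
proof -
  define u where "u n y = 1 - tree_avg p \<mu> \<Theta> n y" for n y
  have u: "(\<lambda>n. u n y) \<longlonglongrightarrow> hit \<Theta> y" for y
    using tendsto_diff[OF tendsto_const tree_avg_tendsto[OF w], of 1 y] by (simp add: u_def)
  have Pu: "(\<lambda>n. P (u n) x) \<longlonglongrightarrow> P (hit \<Theta>) x" by (intro walk_avg_tendsto u)
  have u_le: "u n y \<le> hit \<Theta> y" for n y unfolding u_def by (rule hit_ge_horizon[OF w])
  have u0: "0 \<le> u n y" for n y using tree_avg_01[OF w] by (simp add: u_def)
  have PH: "P (hit \<Theta>) x \<le> 1" using hit_01[OF w] by (blast intro: walk_avg_le)
  have bnd: "\<bar>N (P (u n) x) - N (P (hit \<Theta>) x)\<bar> \<le> P (hit \<Theta>) x - P (u n) x" for n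
  proof -
    have a: "0 \<le> P (u n) x" "P (u n) x \<le> P (hit \<Theta>) x" using u0 u_le by (auto intro: walk_avg_ge walk_avg_mono)
    then show ?thesis using survive_diff[OF a PH] by simp
  qed
  have "(\<lambda>n. N (P (u n) x) - N (P (hit \<Theta>) x)) \<longlonglongrightarrow> 0"
  proof (rule Lim_null_comparison)
    show "(\<lambda>n. P (hit \<Theta>) x - P (u n) x) \<longlonglongrightarrow> 0" using tendsto_diff[OF tendsto_const Pu, of "P (hit \<Theta>) x"] by simp
  qed (use bnd in simp)
  then have "(\<lambda>n. N (P (u n) x)) \<longlonglongrightarrow> N (P (hit \<Theta>) x)" using LIM_zero_iff by blast
  then have "(\<lambda>n. 1 - \<Theta> x * (1 - N (P (u n) x))) \<longlonglongrightarrow> 1 - \<Theta> x * (1 - N (P (hit \<Theta>) x))"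
    by (intro tendsto_intros)
  moreover have "1 - \<Theta> x * (1 - N (P (u n) x)) = u (Suc n) x" for n
    unfolding u_def tree_avg_Suc ..
  ultimately have "(\<lambda>n. u (Suc n) x) \<longlonglongrightarrow> 1 - \<Theta> x * (1 - N (P (hit \<Theta>) x))" by simp
  then show ?thesis using LIMSEQ_unique LIMSEQ_Suc[OF u] by blast
qed

lemma hit_recursion_off: "weight \<Theta> \<Longrightarrow> \<Theta> x = 1 \<Longrightarrow> hit \<Theta> x = N (P (hit \<Theta>) x)"
  using hit_recursion[of \<Theta> x] by simp

definition potential :: "'a set \<Rightarrow> ('a \<Rightarrow> real) \<Rightarrow> 'a \<Rightarrow> real" where
  "potential K c x = (\<Sum>y\<in>K. c y * green (x - y))"

lemma walk_avg_green_shift: "P (\<lambda>x. green (x - y)) x = green (x - y) - indicator {y} x"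
proof -
  have "P (\<lambda>x. green (x - y)) x = P green (x - y)" by (simp add: walk_avg_def algebra_simps)
  then show ?thesis by (simp add: green_harmonic indicator_def)
qed

lemma walk_avg_sum: "P (\<lambda>x. \<Sum>y\<in>K. f y x) x = (\<Sum>y\<in>K. P (f y) x)"
  unfolding walk_avg_def sum_distrib_left by (rule sum.swap)

lemma potential_poisson: "finite K \<Longrightarrow> P (potential K c) x = potential K c x - (if x \<in> K then c x else 0)"
proof -
  assume fin: "finite K"
  have "P (potential K c) x = (\<Sum>y\<in>K. c y * P (\<lambda>x. green (x - y)) x)"
    by (simp add: potential_def[abs_def] walk_avg_sum walk_avg_cmult)
  also have "\<dots> = potential K c x - (\<Sum>y\<in>K. c y * indicator {y} x)"
    by (simp add: walk_avg_green_shift potential_def right_diff_distrib sum_subtractf)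
  also have "(\<Sum>y\<in>K. c y * indicator {y} x) = (if x \<in> K then c x else 0)"
    using fin by (simp add: indicator_def if_distrib cong: if_cong)
  finally show ?thesis .
qed

lemma potential_nonneg: "(\<And>y. y \<in> K \<Longrightarrow> 0 \<le> c y) \<Longrightarrow> 0 \<le> potential K c x"
  unfolding potential_def by (intro sum_nonneg mult_nonneg_nonneg green_nonneg)

text \<open>
  The first moment bound: dropping the nonlinearity turns the recursion into that of a Green potential.
\<close>

lemma hit_le_potential:
  assumes w: "weight \<Theta>" and fin: "finite K" and off: "\<And>x. x \<notin> K \<Longrightarrow> \<Theta> x = 1"
    and c: "\<And>y. y \<in> K \<Longrightarrow> 1 - \<Theta> y \<le> c y"
  shows "hit \<Theta> x \<le> potential K c x"
proof -
  have c0: "y \<in> K \<Longrightarrow> 0 \<le> c y" for y using c[of y] w by (smt (verit))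
  have src: "1 - \<Theta> x \<le> (if x \<in> K then c x else 0)" for x using c off by auto
  have "1 - tree_avg p \<mu> \<Theta> n x \<le> potential K c x" for n
  proof (induction n arbitrary: x)
    case 0
    have "0 \<le> P (potential K c) x" by (intro walk_avg_ge potential_nonneg c0)
    then show ?case using potential_poisson[OF fin, of c x] src[of x] by simp
  next
    case (Suc n)
    define t where "t = P (\<lambda>y. 1 - tree_avg p \<mu> \<Theta> n y) x"
    have t: "0 \<le> t" "t \<le> 1" unfolding t_def using tree_avg_01[OF w] by (auto intro!: walk_avg_ge walk_avg_le)
    have "1 - tree_avg p \<mu> \<Theta> (Suc n) x = (1 - \<Theta> x) + \<Theta> x * N t"
      unfolding tree_avg_Suc t_def by (simp add: algebra_simps)
    also have "\<Theta> x * N t \<le> 1 * t" using w t survive_le[of t] survive_nonneg[of t] by (intro mult_mono) auto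
    also have "1 * t \<le> P (potential K c) x" unfolding t_def using Suc by (auto intro: walk_avg_mono)
    finally show ?case using potential_poisson[OF fin, of c x] src[of x] by simp
  qed
  moreover have "(\<lambda>n. 1 - tree_avg p \<mu> \<Theta> n x) \<longlonglongrightarrow> hit \<Theta> x"
    using tendsto_diff[OF tendsto_const tree_avg_tendsto[OF w], of 1 x] by simp
  ultimately show ?thesis by (intro LIMSEQ_le_const2) auto
qed

text \<open>
  From far away a finite set of charges acts like a single point charge.
\<close>

lemma potential_asymptotics: "((\<lambda>x. Q x * potential K c x) \<longlongrightarrow> sum c K / mass) far"
proof -
  have "((\<lambda>x. Q x * green (x - y)) \<longlongrightarrow> 1 / mass) far" for y
  proof -
    have "((\<lambda>x. Q (x + - y) * green (x + - y)) \<longlongrightarrow> 1 / mass) far"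
      by (rule filterlim_compose[OF green_asymptotics far_shift])
    from tendsto_mult[OF Q_shift_ratio[of "- y"] this]
    have "((\<lambda>x. (Q x / Q (x + - y)) * (Q (x + - y) * green (x + - y))) \<longlongrightarrow> 1 / mass) far" by simp
    moreover have "\<forall>\<^sub>F x in far. 0 < Q (x + - y)"
      using filterlim_compose[OF Q_at_top far_shift, of "- y"] by (simp add: filterlim_at_top_dense)
    then have "\<forall>\<^sub>F x in far. (Q x / Q (x + - y)) * (Q (x + - y) * green (x + - y)) = Q x * green (x - y)"
      by eventually_elim simp
    ultimately show ?thesis by (rule Lim_transform_eventually)
  qed
  then have "((\<lambda>x. \<Sum>y\<in>K. c y * (Q x * green (x - y))) \<longlongrightarrow> (\<Sum>y\<in>K. c y * (1 / mass))) far"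
    by (intro tendsto_intros)
  then show ?thesis
    by (simp add: potential_def sum_distrib_left sum_divide_distrib mult.left_commute)
qed

lemma potential_vanishes:
  assumes "\<And>y. y \<in> K \<Longrightarrow> 0 \<le> c y"
  shows "(potential K c \<longlongrightarrow> 0) far"
proof -
  have "((\<lambda>q. 1 / q) \<longlongrightarrow> (0::real)) at_top" by real_asymp
  from tendsto_mult[OF potential_asymptotics filterlim_compose[OF this Q_at_top]]
  have "((\<lambda>x. Q x * potential K c x * (1 / Q x)) \<longlongrightarrow> 0) far" by simp
  moreover have "\<forall>\<^sub>F x in far. 0 < Q x" using Q_at_top by (simp add: filterlim_at_top_dense)
  then have "\<forall>\<^sub>F x in far. Q x * potential K c x * (1 / Q x) = potential K c x" by eventually_elim simp
  ultimately show ?thesis by (rule Lim_transform_eventually)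
qed

lemma potential_newton:
  assumes "0 < a" "a < sum c K / mass" "sum c K / mass < b"
  shows "\<forall>\<^sub>F x in far. a * newton \<kappa> x < potential K c x \<and> potential K c x < b * newton \<kappa> x"
proof -
  have "((\<lambda>q. (q + \<kappa>) / q) \<longlongrightarrow> 1) at_top" by real_asymp
  from tendsto_mult[OF filterlim_compose[OF this Q_at_top] potential_asymptotics]
  have "((\<lambda>x. ((Q x + \<kappa>) / Q x) * (Q x * potential K c x)) \<longlongrightarrow> sum c K / mass) far" by simp
  then have "\<forall>\<^sub>F x in far. a < ((Q x + \<kappa>) / Q x) * (Q x * potential K c x) \<and> ((Q x + \<kappa>) / Q x) * (Q x * potential K c x) < b"
    using assms by (intro eventually_conj order_tendstoD) auto
  moreover have "\<forall>\<^sub>F x in far. max 0 (- \<kappa>) < Q x" using Q_at_top unfolding filterlim_at_top_dense by blast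
  ultimately show ?thesis
  proof eventually_elim
    case (elim x)
    define v where "v = potential K c x"
    have q: "0 < Q x" "0 < Q x + \<kappa>" using elim by auto
    have "((Q x + \<kappa>) / Q x) * (Q x * v) = (Q x + \<kappa>) * v" using q by simp
    then have "a < (Q x + \<kappa>) * v" "(Q x + \<kappa>) * v < b" using elim by (simp_all add: v_def)
    then show ?case using q unfolding v_def[symmetric] newton_def
      by (simp add: pos_divide_less_eq pos_less_divide_eq mult.commute)
  qed
qed

lemma laplace_weight: "(\<And>y. y \<in> K \<Longrightarrow> 0 \<le> l y) \<Longrightarrow> 0 < T \<Longrightarrow> weight (laplace_weight K l T)"
  by (auto simp: laplace_weight_def)

text \<open>
  For large \<open>T\<close> the marks are sparse, so on a bounded region the first moment bound is asymptotically sharp.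
  Only finitely many generations are linearised: for each of them the nonlinearity disappears as \<open>T\<close>
  grows, and the truncated potentials increase to the full one.
\<close>

lemma hit_laplace_liminf:
  assumes fin: "finite K" and l: "\<And>y. y \<in> K \<Longrightarrow> 0 \<le> l y" and a: "a < potential K l x"
  shows "\<forall>\<^sub>F T in at_top. a < T * hit (laplace_weight K l T) x"
proof -
  define \<Theta> where "\<Theta> = laplace_weight K l"
  \<comment> \<open>\<open>e' n\<close> is the expected total weight seen in generations up to \<open>n\<close>\<close>
  define e' where "e' n x = (\<Sum>y\<in>K. l y * (\<Sum>k<Suc n. walk_prob k (x - y)))" for n x
  define src where "src x = (if x \<in> K then l x else 0)" for x
  have src_sum: "(\<Sum>y\<in>K. l y * walk_prob 0 (x - y)) = src x" for x
  proof -
    have "(\<Sum>y\<in>K. l y * walk_prob 0 (x - y)) = (\<Sum>y\<in>K. if x = y then l y else 0)"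
      by (intro sum.cong) (auto simp: walk_prob_def)
    then show ?thesis using fin by (simp add: src_def)
  qed
  have e'_Suc: "e' (Suc n) x = src x + P (e' n) x" for n x
  proof -
    have "P (\<lambda>x. walk_prob k (x - y)) x = walk_prob (Suc k) (x - y)" for k y
      by (simp add: walk_prob_def walk_avg_def algebra_simps)
    then have "P (e' n) x = (\<Sum>y\<in>K. l y * (\<Sum>k<Suc n. walk_prob (Suc k) (x - y)))"
      unfolding e'_def by (simp add: walk_avg_sum walk_avg_cmult del: sum.lessThan_Suc)
    then show ?thesis unfolding e'_def src_sum[symmetric]
      by (subst sum.lessThan_Suc_shift) (simp add: distrib_left sum.distrib del: sum.lessThan_Suc)
  qed
  have src_lim: "((\<lambda>T. T * (1 - \<Theta> T x)) \<longlongrightarrow> src x) at_top" for x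
  proof (cases "x \<in> K")
    case True
    have "((\<lambda>T. T * (1 - exp (- (b / T)))) \<longlongrightarrow> b) at_top" for b :: real by real_asymp
    then show ?thesis using True by (simp add: \<Theta>_def laplace_weight_def src_def)
  qed (simp add: \<Theta>_def laplace_weight_def src_def)
  have \<Theta>_lim: "((\<lambda>T. \<Theta> T x) \<longlongrightarrow> 1) at_top" for x
  proof (cases "x \<in> K")
    case True
    have "((\<lambda>T. exp (- (b / T))) \<longlongrightarrow> 1) at_top" for b :: real by real_asymp
    then show ?thesis using True by (simp add: \<Theta>_def laplace_weight_def)
  qed (simp add: \<Theta>_def laplace_weight_def)
  have lim: "((\<lambda>T. T * (1 - tree_avg p \<mu> (\<Theta> T) n x)) \<longlongrightarrow> e' n x) at_top" for n x
  proof (induction n arbitrary: x)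
    case 0
    then show ?case using src_lim[of x] src_sum[of x] by (simp add: e'_def)
  next
    case (Suc n)
    define t where "t T = P (\<lambda>y. 1 - tree_avg p \<mu> (\<Theta> T) n y) x" for T
    have Tt: "((\<lambda>T. T * t T) \<longlongrightarrow> P (e' n) x) at_top"
      unfolding t_def walk_avg_cmult[symmetric] by (intro walk_avg_tendsto Suc)
    have "((\<lambda>T. 1 / T) \<longlongrightarrow> (0::real)) at_top" by real_asymp
    from tendsto_mult[OF this Tt] have "((\<lambda>T. 1 / T * (T * t T)) \<longlongrightarrow> 0) at_top" by simp
    moreover have "\<forall>\<^sub>F T in at_top. 1 / T * (T * t T) = t T"
      using eventually_gt_at_top[of 0] by eventually_elim simp
    ultimately have t0: "(t \<longlongrightarrow> 0) at_top" by (rule Lim_transform_eventually)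
    have "((\<lambda>T. T * N (t T)) \<longlongrightarrow> P (e' n) x) at_top"
    proof (rule real_tendsto_sandwich[OF _ _ _ Tt])
      show "((\<lambda>T. T * t T - \<theta> * t T * (T * t T)) \<longlongrightarrow> P (e' n) x) at_top"
        by (rule tendsto_eq_rhs[OF tendsto_diff[OF Tt tendsto_mult[OF tendsto_mult[OF tendsto_const t0] Tt]]]) simp
      have t01: "0 \<le> t T \<and> t T \<le> 1" if "0 < T" for T
        unfolding t_def using tree_avg_01[OF laplace_weight[OF l that]]
        by (auto simp: \<Theta>_def intro!: walk_avg_ge walk_avg_le)
      show "\<forall>\<^sub>F T in at_top. T * N (t T) \<le> T * t T"
        using eventually_gt_at_top[of 0] by eventually_elim (use t01 survive_le in \<open>auto intro: mult_left_mono\<close>)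
      show "\<forall>\<^sub>F T in at_top. T * t T - \<theta> * t T * (T * t T) \<le> T * N (t T)"
        using eventually_gt_at_top[of 0]
      proof eventually_elim
        case (elim T)
        have "T * (t T - \<theta> * (t T)\<^sup>2) \<le> T * N (t T)" using t01[OF elim] elim N_lower by (intro mult_left_mono) auto
        then show ?case by (simp add: algebra_simps power2_eq_square)
      qed
    qed
    from tendsto_add[OF src_lim[of x] tendsto_mult[OF \<Theta>_lim[of x] this]]
    have "((\<lambda>T. T * (1 - \<Theta> T x) + \<Theta> T x * (T * N (t T))) \<longlongrightarrow> e' (Suc n) x) at_top" by (simp add: e'_Suc)
    moreover have "T * (1 - \<Theta> T x) + \<Theta> T x * (T * N (t T)) = T * (1 - tree_avg p \<mu> (\<Theta> T) (Suc n) x)" for T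
      unfolding tree_avg_Suc t_def by (simp add: algebra_simps)
    ultimately show ?case by simp
  qed
  have "(\<lambda>n. \<Sum>k<Suc n. walk_prob k (x - y)) \<longlonglongrightarrow> green (x - y)" for y
    unfolding green_def using LIMSEQ_Suc[OF summable_LIMSEQ[OF summable_walk_prob]] .
  then have "(\<lambda>n. e' n x) \<longlonglongrightarrow> potential K l x"
    unfolding e'_def potential_def by (intro tendsto_intros)
  then have "\<forall>\<^sub>F n in sequentially. a < e' n x" using a by (intro order_tendstoD)
  then obtain n where "a < e' n x" by (auto simp: eventually_sequentially)
  then have "\<forall>\<^sub>F T in at_top. a < T * (1 - tree_avg p \<mu> (\<Theta> T) n x)" using lim by (intro order_tendstoD)
  with eventually_gt_at_top[of 0] show ?thesis
  proof eventually_elim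
    case (elim T)
    have "T * (1 - tree_avg p \<mu> (\<Theta> T) n x) \<le> T * hit (\<Theta> T) x"
      unfolding \<Theta>_def using elim(1) by (intro mult_left_mono hit_ge_horizon laplace_weight l) auto
    then show ?case using elim(2) by (simp add: \<Theta>_def)
  qed
qed

text \<open>
  On a fixed layer the first moment bound is \<open>\<Lambda> / (mass * T)\<close> times the Newtonian kernel up to \<open>\<epsilon>\<close>, so the
  barrier with \<open>\<alpha>\<close> close to \<open>T * mass / \<Lambda>\<close> dominates there, and hence everywhere outside the layer.  The
  constants do not depend on \<open>T\<close>, which may therefore vary with \<open>x\<close>.
\<close>

lemma laplace_upper:
  assumes fin: "finite K" and l: "\<And>y. y \<in> K \<Longrightarrow> 0 \<le> l y" and \<Lambda>: "0 < sum l K" and \<epsilon>: "0 < \<epsilon>" "\<epsilon> < 1"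
  obtains C r T0 where "0 < T0" "\<And>T x. T0 \<le> T \<Longrightarrow> r \<le> Q x \<Longrightarrow>
     hit (laplace_weight K l T) x \<le> profile (T * (mass / ((1 + \<epsilon>) * sum l K)) - C) ((1 - \<epsilon>) * \<theta> / 2) \<kappa>0 x"
proof -
  define \<beta> where "\<beta> = (1 - \<epsilon>) * \<theta> / 2"
  define lmin where "lmin = 4 * \<beta> / \<epsilon>"
  have \<beta>: "0 < \<beta>" "0 < lmin" using \<epsilon> \<theta>_pos by (auto simp: \<beta>_def lmin_def)
  have "2 * \<beta> * (1 + 2 * \<beta> / lmin) = \<theta> * ((1 - \<epsilon>) * (1 + \<epsilon> / 2))"
    using \<epsilon> \<theta>_pos by (simp add: lmin_def \<beta>_def)
  also have "\<dots> < \<theta> * 1"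
    using \<epsilon> \<theta>_pos by (intro mult_strict_left_mono) (simp_all add: algebra_simps add_pos_pos)
  finally have \<beta>2: "2 * \<beta> * (1 + 2 * \<beta> / lmin) < \<theta>" by simp
  obtain R where R: "\<And>r u \<alpha> x. R \<le> r \<Longrightarrow> (\<And>x. 0 \<le> u x \<and> u x \<le> 1) \<Longrightarrow>
      (\<And>\<epsilon>. 0 < \<epsilon> \<Longrightarrow> \<forall>\<^sub>F x in far. u x \<le> \<epsilon>) \<Longrightarrow>
      (\<And>x. 2 * r + 4 * reach\<^sup>2 \<le> Q x \<Longrightarrow> u x = N (P u x)) \<Longrightarrow>
      (\<And>x. r \<le> Q x \<Longrightarrow> lmin \<le> \<alpha> + \<beta> * ln (Q x + \<kappa>0)) \<Longrightarrow>
      (\<And>x. r \<le> Q x \<Longrightarrow> Q x < 2 * r + 4 * reach\<^sup>2 \<Longrightarrow> u x \<le> profile \<alpha> \<beta> \<kappa>0 x) \<Longrightarrow>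
      r \<le> Q x \<Longrightarrow> u x \<le> profile \<alpha> \<beta> \<kappa>0 x"
  proof (rule upper_barrier[OF \<beta> \<beta>2], goal_cases)
    case (1 R)
    show thesis by (rule that) (fact 1)
  qed
  define b where "b = (1 + \<epsilon>) * sum l K / mass"
  have b: "0 < b" using \<epsilon> \<Lambda> mass_pos by (simp add: b_def)
  have half: "0 < sum l K / mass" "sum l K / mass / 2 < sum l K / mass" "0 < sum l K / mass / 2" "sum l K / mass < b"
    using \<epsilon> \<Lambda> mass_pos by (simp_all add: b_def divide_strict_right_mono) (simp_all add: divide_simps)
  have "\<forall>\<^sub>F x in far. (sum l K / mass / 2 * newton \<kappa>0 x < potential K l x \<and> potential K l x < b * newton \<kappa>0 x) \<and> x \<notin> K"
    using half fin by (intro eventually_conj[OF potential_newton eventually_far_finite]) simp_all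
  then obtain r2 where r2: "\<And>x. r2 \<le> Q x \<Longrightarrow> potential K l x < b * newton \<kappa>0 x \<and> x \<notin> K"
    unfolding eventually_far by blast
  define r where "r = max 0 (max R r2)"
  define C where "C = \<beta> * ln (2 * r + 4 * reach\<^sup>2 + \<kappa>0)"
  define T0 where "T0 = max 1 ((C + lmin) * b)"
  show thesis
  proof (rule that[of T0 r C])
    show "0 < T0" by (simp add: T0_def)
    fix T x assume T: "T0 \<le> T" and x: "r \<le> Q x"
    have T1: "0 < T" "(C + lmin) * b \<le> T" using T by (auto simp: T0_def)
    define \<alpha> where "\<alpha> = T / b - C"
    have Tb: "C + lmin \<le> T / b" using T1 b by (simp add: field_simps)
    have w: "weight (laplace_weight K l T)" by (rule laplace_weight[OF l T1(1)])
    have "hit (laplace_weight K l T) x \<le> profile \<alpha> \<beta> \<kappa>0 x"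
    proof (rule R[of r])
      show "R \<le> r" by (simp add: r_def)
      show "0 \<le> hit (laplace_weight K l T) x \<and> hit (laplace_weight K l T) x \<le> 1" for x by (rule hit_01[OF w])
      have le_pot: "hit (laplace_weight K l T) x \<le> potential K l x / T" for x
      proof -
        have "hit (laplace_weight K l T) x \<le> potential K (\<lambda>y. l y / T) x"
        proof (rule hit_le_potential[OF w fin])
          show "1 - laplace_weight K l T y \<le> l y / T" if "y \<in> K" for y
            using that exp_ge_add_one_self[of "- (l y / T)"] by (simp add: laplace_weight_def)
        qed (simp add: laplace_weight_def)
        then show ?thesis by (simp add: potential_def sum_divide_distrib)
      qed
      show "\<forall>\<^sub>F x in far. hit (laplace_weight K l T) x \<le> \<epsilon>'" if "0 < \<epsilon>'" for \<epsilon>'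
      proof -
        have "\<forall>\<^sub>F x in far. potential K l x < \<epsilon>' * T"
          using that T1 by (intro order_tendstoD(2)[OF potential_vanishes]) (auto intro: l)
        then show ?thesis
        proof eventually_elim
          case (elim x)
          then have "potential K l x / T \<le> \<epsilon>'" using T1 by (simp add: divide_le_eq)
          then show ?case using le_pot[of x] by linarith
        qed
      qed
      show "hit (laplace_weight K l T) x = N (P (hit (laplace_weight K l T)) x)" if "2 * r + 4 * reach\<^sup>2 \<le> Q x" for x
      proof (rule hit_recursion_off[OF w])
        have "0 \<le> r" "r2 \<le> r" by (auto simp: r_def)
        then have "r2 \<le> Q x" using that zero_le_power2[of reach] by linarith
        then show "laplace_weight K l T x = 1" using r2 by (simp add: laplace_weight_def)
      qed
      have ln0: "0 \<le> \<beta> * ln (Q x + \<kappa>0)" for x using \<beta> \<kappa>0_bounds(2) Q_nonneg[of x] by (intro mult_nonneg_nonneg ln_ge_zero) linarith+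
      show L: "lmin \<le> \<alpha> + \<beta> * ln (Q x + \<kappa>0)" if "r \<le> Q x" for x
        using Tb ln0[of x] by (simp add: \<alpha>_def)
      show "hit (laplace_weight K l T) x \<le> profile \<alpha> \<beta> \<kappa>0 x" if x: "r \<le> Q x" "Q x < 2 * r + 4 * reach\<^sup>2" for x
      proof -
        have "ln (Q x + \<kappa>0) \<le> ln (2 * r + 4 * reach\<^sup>2 + \<kappa>0)"
          using x(2) Q_plus_pos[OF order_refl, of x] by (subst ln_le_cancel_iff) auto
        then have "\<beta> * ln (Q x + \<kappa>0) \<le> C" unfolding C_def using \<beta> by (intro mult_left_mono) auto
        then have Lup: "\<alpha> + \<beta> * ln (Q x + \<kappa>0) \<le> T / b" by (simp add: \<alpha>_def)
        have "r2 \<le> Q x" using x(1) by (simp add: r_def)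
        then have "potential K l x / T \<le> b * newton \<kappa>0 x / T" using r2 T1 by (intro divide_right_mono) (auto simp: less_imp_le)
        also have "\<dots> = newton \<kappa>0 x / (T / b)" using T1 b by simp
        also have "\<dots> \<le> newton \<kappa>0 x / (\<alpha> + \<beta> * ln (Q x + \<kappa>0))"
          using Lup L[OF x(1)] \<beta>(2) newton_bounds(1)[OF order_refl, of x] T1 b by (intro divide_left_mono mult_pos_pos) auto
        finally show ?thesis using le_pot[of x] by (simp add: profile_def)
      qed
    qed (use x in auto)
    moreover have "\<alpha> = T * (mass / ((1 + \<epsilon>) * sum l K)) - C" by (simp add: \<alpha>_def b_def)
    ultimately show "hit (laplace_weight K l T) x \<le> profile (T * (mass / ((1 + \<epsilon>) * sum l K)) - C) ((1 - \<epsilon>) * \<theta> / 2) \<kappa>0 x"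
      by (simp add: \<beta>_def)
  qed
qed

text \<open>
  As \<open>laplace_upper\<close>, with the lower bound on the layer from \<open>hit_laplace_liminf\<close>.
\<close>

lemma laplace_lower:
  assumes fin: "finite K" and l: "\<And>y. y \<in> K \<Longrightarrow> 0 \<le> l y" and \<Lambda>: "0 < sum l K" and \<epsilon>: "0 < \<epsilon>" "\<epsilon> < 1"
  obtains C r T0 where "0 < T0" "\<And>T x. T0 \<le> T \<Longrightarrow> r \<le> Q x \<Longrightarrow>
     profile (T * (mass / ((1 - \<epsilon>) * sum l K)) - C) ((1 + \<epsilon>) * \<theta> / 2) (- \<kappa>0) x \<le> hit (laplace_weight K l T) x"
proof -
  define \<beta> where "\<beta> = (1 + \<epsilon>) * \<theta> / 2"
  have \<beta>: "\<theta> < 2 * \<beta>" "0 < \<beta>" using \<epsilon> \<theta>_pos by (auto simp: \<beta>_def algebra_simps add_pos_pos)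
  obtain R where R0: "\<kappa>0 + 1 \<le> R" and R: "\<And>r u \<alpha> x. R \<le> r \<Longrightarrow> (\<And>x. 0 \<le> u x \<and> u x \<le> 1) \<Longrightarrow>
      (\<And>x. 2 * r + 4 * reach\<^sup>2 \<le> Q x \<Longrightarrow> u x = N (P u x)) \<Longrightarrow>
      (\<And>x. r \<le> Q x \<Longrightarrow> 1 \<le> \<alpha> + \<beta> * ln (Q x + - \<kappa>0)) \<Longrightarrow>
      (\<And>x. r \<le> Q x \<Longrightarrow> Q x < 2 * r + 4 * reach\<^sup>2 \<Longrightarrow> profile \<alpha> \<beta> (- \<kappa>0) x \<le> u x) \<Longrightarrow>
      r \<le> Q x \<Longrightarrow> profile \<alpha> \<beta> (- \<kappa>0) x \<le> u x"
  proof (rule lower_barrier[OF \<beta>(1) zero_less_one], goal_cases)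
    case (1 R)
    show thesis by (rule that) (fact 1)+
  qed
  define b where "b = (1 - \<epsilon>) * sum l K / mass"
  have b: "0 < b" using \<epsilon> \<Lambda> mass_pos by (simp add: b_def)
  have "\<forall>\<^sub>F x in far. (b * newton (- \<kappa>0) x < potential K l x \<and> potential K l x < (sum l K / mass + 1) * newton (- \<kappa>0) x) \<and> x \<notin> K"
    using \<epsilon> \<Lambda> mass_pos fin b
    by (intro eventually_conj[OF potential_newton eventually_far_finite]) (auto simp: b_def divide_strict_right_mono)
  then obtain r2 where r2: "\<And>x. r2 \<le> Q x \<Longrightarrow> b * newton (- \<kappa>0) x < potential K l x \<and> x \<notin> K"
    unfolding eventually_far by blast
  define r where "r = max R r2"
  define F where "F = {x. r \<le> Q x \<and> Q x < 2 * r + 4 * reach\<^sup>2}"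
  have "finite F" unfolding F_def by (rule finite_subset[OF _ finite_Q_less]) auto
  moreover have "\<forall>\<^sub>F T in at_top. b * newton (- \<kappa>0) x < T * hit (laplace_weight K l T) x" if "x \<in> F" for x
    using that r2[of x] by (intro hit_laplace_liminf fin l) (auto simp: F_def r_def)
  ultimately have "\<forall>\<^sub>F T in at_top. \<forall>x\<in>F. b * newton (- \<kappa>0) x < T * hit (laplace_weight K l T) x"
    by (simp add: eventually_ball_finite_distrib)
  then obtain T1 where T1: "\<And>T x. T1 \<le> T \<Longrightarrow> x \<in> F \<Longrightarrow> b * newton (- \<kappa>0) x < T * hit (laplace_weight K l T) x"
    unfolding eventually_at_top_linorder by blast
  define C where "C = \<beta> * ln (r - \<kappa>0)"
  have rk: "1 \<le> r - \<kappa>0" using R0 by (simp add: r_def)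
  define T0 where "T0 = max (max 1 b) T1"
  show thesis
  proof (rule that[of T0 r C])
    show "0 < T0" by (simp add: T0_def)
    fix T x assume T: "T0 \<le> T" and x: "r \<le> Q x"
    have T2: "0 < T" "b \<le> T" "T1 \<le> T" using T by (auto simp: T0_def)
    define \<alpha> where "\<alpha> = T / b - C"
    have w: "weight (laplace_weight K l T)" by (rule laplace_weight[OF l T2(1)])
    have Lge: "T / b \<le> \<alpha> + \<beta> * ln (Q x + - \<kappa>0)" if "r \<le> Q x" for x
    proof -
      have "ln (r - \<kappa>0) \<le> ln (Q x - \<kappa>0)" using that rk by (subst ln_le_cancel_iff) auto
      then have "C \<le> \<beta> * ln (Q x - \<kappa>0)" unfolding C_def using \<beta> by (intro mult_left_mono) auto
      then show ?thesis by (simp add: \<alpha>_def)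
    qed
    have Tb: "1 \<le> T / b" using T2 b by simp
    have "profile \<alpha> \<beta> (- \<kappa>0) x \<le> hit (laplace_weight K l T) x"
    proof (rule R[of r])
      show "R \<le> r" by (simp add: r_def)
      show "0 \<le> hit (laplace_weight K l T) x \<and> hit (laplace_weight K l T) x \<le> 1" for x by (rule hit_01[OF w])
      show "hit (laplace_weight K l T) x = N (P (hit (laplace_weight K l T)) x)" if "2 * r + 4 * reach\<^sup>2 \<le> Q x" for x
      proof (rule hit_recursion_off[OF w])
        have "0 \<le> r" "r2 \<le> r" using rk \<kappa>0_bounds(2) by (auto simp: r_def)
        then have "r2 \<le> Q x" using that zero_le_power2[of reach] by linarith
        then show "laplace_weight K l T x = 1" using r2 by (simp add: laplace_weight_def)
      qed
      show "1 \<le> \<alpha> + \<beta> * ln (Q x + - \<kappa>0)" if "r \<le> Q x" for x using Lge[OF that] Tb by linarith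
      show "profile \<alpha> \<beta> (- \<kappa>0) x \<le> hit (laplace_weight K l T) x" if x: "r \<le> Q x" "Q x < 2 * r + 4 * reach\<^sup>2" for x
      proof -
        have "0 < newton (- \<kappa>0) x" using x(1) rk by (simp add: newton_def)
        then have "profile \<alpha> \<beta> (- \<kappa>0) x \<le> newton (- \<kappa>0) x / (T / b)"
          unfolding profile_def using Lge[OF x(1)] Tb by (intro divide_left_mono mult_pos_pos) auto
        also have "\<dots> = b * newton (- \<kappa>0) x / T" by simp
        also have "\<dots> \<le> hit (laplace_weight K l T) x"
          using T1[OF T2(3), of x] x T2(1) by (simp add: F_def divide_le_eq mult.commute less_imp_le)
        finally show ?thesis .
      qed
    qed (use x in auto)
    moreover have "\<alpha> = T * (mass / ((1 - \<epsilon>) * sum l K)) - C" by (simp add: \<alpha>_def b_def)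
    ultimately show "profile (T * (mass / ((1 - \<epsilon>) * sum l K)) - C) ((1 + \<epsilon>) * \<theta> / 2) (- \<kappa>0) x \<le> hit (laplace_weight K l T) x"
      by (simp add: \<beta>_def)
  qed
qed

lemma weight_kill: "weight (kill K)" by (simp add: kill_def)

text \<open>
  Positivity spreads from \<open>K\<close> along steps.
\<close>

lemma hit_kill_pos:
  assumes K: "K \<noteq> {}"
  shows "0 < hit (kill K) x"
proof -
  obtain y where y: "y \<in> K" using K by blast
  define H where "H = {z. 0 < hit (kill K) (y + z)}"
  have "H = UNIV"
  proof (rule irreducible)
    show "0 \<in> H"
    proof -
      have "kill K y = 0" using y by (simp add: kill_def)
      then show ?thesis using hit_recursion[OF weight_kill, of K y] by (simp add: H_def)
    qed
    fix v z assume v: "v \<in> H" and z: "z \<in> steps"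
    define u where "u = hit (kill K)"
    define x where "x = y + (v + z)"
    have z': "- z \<in> steps" using uminus_steps[OF z] .
    have u01: "0 \<le> u x \<and> u x \<le> 1" for x unfolding u_def by (rule hit_01[OF weight_kill])
    have "0 < pmf \<mu> (- z) * u (x + - z)"
      using v pmf_positive[OF z'] by (simp add: H_def u_def x_def)
    also have "\<dots> \<le> P u x" unfolding walk_avg_def
      using z' u01 finite_steps by (intro member_le_sum[of "- z" steps "\<lambda>z. pmf \<mu> z * u (x + z)"]) auto
    finally have "0 < P u x" .
    moreover have "P u x \<le> 1" using u01 by (intro walk_avg_le) auto
    ultimately have "0 < N (P u x)" by (rule N_pos)
    moreover have "kill K x = 0 \<or> kill K x = 1" by (simp add: kill_def)
    ultimately have "0 < u x" using hit_recursion[OF weight_kill, of K x] by (auto simp: u_def)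
    then show "v + z \<in> H" by (simp add: H_def u_def x_def)
  qed
  then have "x - y \<in> H" by simp
  then show ?thesis by (simp add: H_def)
qed

lemma hit_kill_vanishes:
  assumes "finite K" "0 < \<epsilon>"
  shows "\<forall>\<^sub>F x in far. hit (kill K) x \<le> \<epsilon>"
proof -
  have "\<forall>\<^sub>F x in far. potential K (\<lambda>_. 1) x < \<epsilon>"
    using potential_vanishes[of K "\<lambda>_. 1"] assms by (intro order_tendstoD) auto
  then show ?thesis
  proof eventually_elim
    case (elim x)
    have "hit (kill K) x \<le> potential K (\<lambda>_. 1) x"
      by (rule hit_le_potential[OF weight_kill assms(1)]) (auto simp: kill_def)
    then show ?case using elim by linarith
  qed
qed

lemma ln_layer_le:
  assumes "0 \<le> r" "Q x < 2 * r + 4 * reach\<^sup>2"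
  shows "ln (Q x + \<kappa>0) \<le> ln (r + \<kappa>0) + 1"
proof -
  have "Q x + \<kappa>0 \<le> 2 * (r + \<kappa>0)" using assms \<kappa>0_bounds unfolding distrib_left by linarith
  also have "\<dots> \<le> exp 1 * (r + \<kappa>0)"
    using assms \<kappa>0_bounds exp_ge_add_one_self[of "1::real"] by (intro mult_right_mono) auto
  finally have "ln (Q x + \<kappa>0) \<le> ln (exp 1 * (r + \<kappa>0))"
    using Q_plus_pos[OF order_refl, of x] by (subst ln_le_cancel_iff) auto
  then show ?thesis using assms \<kappa>0_bounds by (simp add: ln_mult)
qed

text \<open>
  A bound by a small multiple of the Newtonian kernel improves to a barrier with a logarithm; the smaller
  the multiple, the larger the admissible \<open>\<beta>\<close>.
\<close>

lemma kill_improve: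
  assumes fin: "finite K" and \<beta>: "0 < \<beta>" "0 < lmin" "2 * \<beta> * (1 + 2 * \<beta> / lmin) < \<theta>"
    and start: "\<forall>\<^sub>F x in far. hit (kill K) x * (lmin + \<beta>) \<le> newton \<kappa>0 x"
  shows "\<exists>\<alpha>. \<forall>\<^sub>F x in far. lmin \<le> \<alpha> + \<beta> * ln (Q x + \<kappa>0) \<and> hit (kill K) x \<le> profile \<alpha> \<beta> \<kappa>0 x"
proof -
  obtain R where R: "\<And>r u \<alpha> x. R \<le> r \<Longrightarrow> (\<And>x. 0 \<le> u x \<and> u x \<le> 1) \<Longrightarrow>
      (\<And>\<epsilon>. 0 < \<epsilon> \<Longrightarrow> \<forall>\<^sub>F x in far. u x \<le> \<epsilon>) \<Longrightarrow>
      (\<And>x. 2 * r + 4 * reach\<^sup>2 \<le> Q x \<Longrightarrow> u x = N (P u x)) \<Longrightarrow>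
      (\<And>x. r \<le> Q x \<Longrightarrow> lmin \<le> \<alpha> + \<beta> * ln (Q x + \<kappa>0)) \<Longrightarrow>
      (\<And>x. r \<le> Q x \<Longrightarrow> Q x < 2 * r + 4 * reach\<^sup>2 \<Longrightarrow> u x \<le> profile \<alpha> \<beta> \<kappa>0 x) \<Longrightarrow>
      r \<le> Q x \<Longrightarrow> u x \<le> profile \<alpha> \<beta> \<kappa>0 x"
  proof (rule upper_barrier[OF \<beta>], goal_cases)
    case (1 R)
    show thesis by (rule that) (fact 1)
  qed
  have "\<forall>\<^sub>F x in far. x \<notin> K" using fin by (intro eventually_far_finite) simp
  from eventually_conj[OF start this] obtain r2
    where r2: "\<And>x. r2 \<le> Q x \<Longrightarrow> hit (kill K) x * (lmin + \<beta>) \<le> newton \<kappa>0 x \<and> x \<notin> K"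
    unfolding eventually_far by blast
  define r where "r = max 0 (max R r2)"
  have r: "0 \<le> r" "R \<le> r" "r2 \<le> r" by (auto simp: r_def)
  define \<alpha> where "\<alpha> = lmin - \<beta> * ln (r + \<kappa>0)"
  have L: "lmin \<le> \<alpha> + \<beta> * ln (Q x + \<kappa>0)" if "r \<le> Q x" for x
  proof -
    have "ln (r + \<kappa>0) \<le> ln (Q x + \<kappa>0)" using that r \<kappa>0_bounds by (subst ln_le_cancel_iff) auto
    then have "\<beta> * ln (r + \<kappa>0) \<le> \<beta> * ln (Q x + \<kappa>0)" using \<beta> by (intro mult_left_mono) auto
    then show ?thesis by (simp add: \<alpha>_def)
  qed
  have "hit (kill K) x \<le> profile \<alpha> \<beta> \<kappa>0 x" if "r \<le> Q x" for x
  proof (rule R[OF r(2)])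
    show "0 \<le> hit (kill K) x \<and> hit (kill K) x \<le> 1" for x by (rule hit_01[OF weight_kill])
    show "\<forall>\<^sub>F x in far. hit (kill K) x \<le> \<epsilon>" if "0 < \<epsilon>" for \<epsilon> by (rule hit_kill_vanishes[OF fin that])
    show "hit (kill K) x = N (P (hit (kill K)) x)" if "2 * r + 4 * reach\<^sup>2 \<le> Q x" for x
    proof (rule hit_recursion_off[OF weight_kill])
      have "r2 \<le> Q x" using that r zero_le_power2[of reach] by linarith
      then show "kill K x = 1" using r2 by (simp add: kill_def)
    qed
    show "lmin \<le> \<alpha> + \<beta> * ln (Q x + \<kappa>0)" if "r \<le> Q x" for x by (rule L[OF that])
    show "hit (kill K) x \<le> profile \<alpha> \<beta> \<kappa>0 x" if x: "r \<le> Q x" "Q x < 2 * r + 4 * reach\<^sup>2" for x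
    proof -
      have "\<beta> * ln (Q x + \<kappa>0) \<le> \<beta> * (ln (r + \<kappa>0) + 1)" using ln_layer_le[OF r(1) x(2)] \<beta> by (intro mult_left_mono) auto
      then have "\<alpha> + \<beta> * ln (Q x + \<kappa>0) \<le> lmin + \<beta>" by (simp add: \<alpha>_def algebra_simps)
      then have "hit (kill K) x * (\<alpha> + \<beta> * ln (Q x + \<kappa>0)) \<le> hit (kill K) x * (lmin + \<beta>)"
        using hit_01[OF weight_kill] by (intro mult_left_mono) auto
      also have "\<dots> \<le> newton \<kappa>0 x" using r2[of x] x r by simp
      finally show ?thesis using L[OF x(1)] \<beta>(2) by (simp add: profile_def pos_le_divide_eq)
    qed
    show "r \<le> Q x" by (rule that)
  qed
  with L show ?thesis unfolding eventually_far by (intro exI[of _ \<alpha>] exI[of _ r]) blast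
qed

text \<open>
  Two rounds of \<open>kill_improve\<close>.  The first moment bound is only \<open>C\<close> times the Newtonian kernel and allows
  a small \<open>\<beta>\<close>.  The resulting barrier is \<open>o (newton \<kappa>0)\<close>, so in the second round \<open>lmin\<close> can be taken large
  and \<open>\<beta>\<close> sharp.
\<close>

lemma kill_upper:
  assumes fin: "finite K" "K \<noteq> {}" and \<epsilon>: "0 < \<epsilon>" "\<epsilon> < 1"
  shows "\<exists>\<alpha>. \<forall>\<^sub>F x in far. hit (kill K) x \<le> profile \<alpha> ((1 - \<epsilon>) * \<theta> / 2) \<kappa>0 x"
proof -
  define C where "C = real (card K) / mass + 1"
  have C: "0 < C" using mass_pos by (simp add: C_def add_nonneg_pos)
  define l1 where "l1 = 1 / (2 * C)"
  define \<beta>1 where "\<beta>1 = min (\<theta> / 8) (l1 / 2)"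
  have l1: "0 < l1" using C by (simp add: l1_def)
  have \<beta>1: "0 < \<beta>1" "\<beta>1 \<le> \<theta> / 8" "\<beta>1 \<le> l1 / 2" using \<theta>_pos l1 by (auto simp: \<beta>1_def)
  have "2 * \<beta>1 / l1 \<le> 1" using \<beta>1 l1 by (simp add: field_simps)
  then have "2 * \<beta>1 * (1 + 2 * \<beta>1 / l1) \<le> 2 * \<beta>1 * 2" using \<beta>1 by (intro mult_left_mono) auto
  also have "\<dots> < \<theta>" using \<beta>1 \<theta>_pos by linarith
  finally have cond1: "2 * \<beta>1 * (1 + 2 * \<beta>1 / l1) < \<theta>" .
  have "0 < real (card K)" using fin by (simp add: card_gt_0_iff)
  then have c: "0 < real (card K) / mass / 2" "real (card K) / mass / 2 < real (card K) / mass"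
    using mass_pos by (simp_all add: divide_simps)
  have "\<forall>\<^sub>F x in far. real (card K) / mass / 2 * newton \<kappa>0 x < potential K (\<lambda>_. 1) x \<and> potential K (\<lambda>_. 1) x < C * newton \<kappa>0 x"
    using potential_newton[of "real (card K) / mass / 2" "\<lambda>_. 1" K C \<kappa>0] c by (simp add: C_def)
  then have "\<forall>\<^sub>F x in far. hit (kill K) x * (l1 + \<beta>1) \<le> newton \<kappa>0 x"
  proof eventually_elim
    case (elim x)
    have "hit (kill K) x \<le> potential K (\<lambda>_. 1) x"
      by (rule hit_le_potential[OF weight_kill fin(1)]) (auto simp: kill_def)
    then have "hit (kill K) x \<le> C * newton \<kappa>0 x" using elim by linarith
    then have "hit (kill K) x * (l1 + \<beta>1) \<le> C * newton \<kappa>0 x * (1 / C)"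
      using C \<beta>1 l1 newton_bounds(1)[OF order_refl, of x]
      by (intro mult_mono) (auto simp: l1_def)
    then show ?case using C by simp
  qed
  from kill_improve[OF fin(1) \<beta>1(1) l1 cond1 this] obtain \<alpha>1 where
    rough: "\<forall>\<^sub>F x in far. l1 \<le> \<alpha>1 + \<beta>1 * ln (Q x + \<kappa>0) \<and> hit (kill K) x \<le> profile \<alpha>1 \<beta>1 \<kappa>0 x" by blast
  \<comment> \<open>the choice of \<open>lmin\<close> makes the correction factor \<open>1 + \<epsilon> / 2\<close>, and \<open>(1 - \<epsilon>) * (1 + \<epsilon> / 2) < 1\<close>\<close>
  define \<beta> where "\<beta> = (1 - \<epsilon>) * \<theta> / 2"
  define lmin where "lmin = 4 * \<beta> / \<epsilon>"
  have \<beta>: "0 < \<beta>" "0 < lmin" using \<epsilon> \<theta>_pos by (auto simp: \<beta>_def lmin_def)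
  have "2 * \<beta> * (1 + 2 * \<beta> / lmin) = \<theta> * ((1 - \<epsilon>) * (1 + \<epsilon> / 2))"
    using \<epsilon> \<theta>_pos by (simp add: lmin_def \<beta>_def)
  also have "\<dots> < \<theta> * 1"
    using \<epsilon> \<theta>_pos by (intro mult_strict_left_mono) (simp_all add: algebra_simps add_pos_pos)
  finally have \<beta>2: "2 * \<beta> * (1 + 2 * \<beta> / lmin) < \<theta>" by simp
  have "filterlim (\<lambda>q. c1 + \<beta>1 * ln (q + c2)) at_top at_top" for c1 c2 using \<beta>1(1) by real_asymp
  from filterlim_compose[OF this Q_at_top] have "\<forall>\<^sub>F x in far. lmin + \<beta> \<le> \<alpha>1 + \<beta>1 * ln (Q x + \<kappa>0)"
    by (simp add: filterlim_at_top)
  with rough have "\<forall>\<^sub>F x in far. hit (kill K) x * (lmin + \<beta>) \<le> newton \<kappa>0 x"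
  proof eventually_elim
    case (elim x)
    have L: "0 < \<alpha>1 + \<beta>1 * ln (Q x + \<kappa>0)" using elim l1 by linarith
    have "hit (kill K) x * (lmin + \<beta>) \<le> hit (kill K) x * (\<alpha>1 + \<beta>1 * ln (Q x + \<kappa>0))"
      using elim hit_01[OF weight_kill] by (intro mult_left_mono) auto
    also have "\<dots> \<le> newton \<kappa>0 x" using elim L by (simp add: profile_def pos_le_divide_eq)
    finally show ?case .
  qed
  from kill_improve[OF fin(1) \<beta> \<beta>2 this] show ?thesis
    unfolding \<beta>_def by (auto elim!: eventually_mono)
qed

text \<open>
  On a bounded layer the probability is bounded below by a positive constant, so a large \<open>\<alpha>\<close> puts the
  barrier below it.
\<close>

lemma kill_lower:
  assumes fin: "finite K" "K \<noteq> {}" and \<epsilon>: "0 < \<epsilon>"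
  shows "\<exists>\<alpha>. \<forall>\<^sub>F x in far. profile \<alpha> ((1 + \<epsilon>) * \<theta> / 2) (- \<kappa>0) x \<le> hit (kill K) x"
proof -
  define \<beta> where "\<beta> = (1 + \<epsilon>) * \<theta> / 2"
  have \<beta>: "\<theta> < 2 * \<beta>" "0 < \<beta>" using \<epsilon> \<theta>_pos by (auto simp: \<beta>_def algebra_simps add_pos_pos)
  obtain R where R0: "\<kappa>0 + 1 \<le> R" and R: "\<And>r u \<alpha> x. R \<le> r \<Longrightarrow> (\<And>x. 0 \<le> u x \<and> u x \<le> 1) \<Longrightarrow>
      (\<And>x. 2 * r + 4 * reach\<^sup>2 \<le> Q x \<Longrightarrow> u x = N (P u x)) \<Longrightarrow>
      (\<And>x. r \<le> Q x \<Longrightarrow> 1 \<le> \<alpha> + \<beta> * ln (Q x + - \<kappa>0)) \<Longrightarrow>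
      (\<And>x. r \<le> Q x \<Longrightarrow> Q x < 2 * r + 4 * reach\<^sup>2 \<Longrightarrow> profile \<alpha> \<beta> (- \<kappa>0) x \<le> u x) \<Longrightarrow>
      r \<le> Q x \<Longrightarrow> profile \<alpha> \<beta> (- \<kappa>0) x \<le> u x"
  proof (rule lower_barrier[OF \<beta>(1) zero_less_one], goal_cases)
    case (1 R)
    show thesis by (rule that) (fact 1)+
  qed
  have "\<forall>\<^sub>F x in far. x \<notin> K" using fin by (intro eventually_far_finite) simp
  then obtain r2 where r2: "\<And>x. r2 \<le> Q x \<Longrightarrow> x \<notin> K" unfolding eventually_far by blast
  define r where "r = max R r2"
  have r: "R \<le> r" "r2 \<le> r" "1 \<le> r - \<kappa>0" "0 \<le> r" using R0 \<kappa>0_bounds by (auto simp: r_def)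
  define F where "F = {x. r \<le> Q x \<and> Q x < 2 * r + 4 * reach\<^sup>2}"
  have finF: "finite F" unfolding F_def by (rule finite_subset[OF _ finite_Q_less]) auto
  define c where "c = Min (insert 1 (hit (kill K) ` F))"
  have c: "0 < c" "c \<le> 1" unfolding c_def using finF hit_kill_pos[OF fin(2)] by auto
  have cF: "c \<le> hit (kill K) x" if "x \<in> F" for x unfolding c_def using finF that by (intro Min_le) auto
  define \<alpha> where "\<alpha> = 1 / c"
  have ln0: "0 \<le> \<beta> * ln (Q x + - \<kappa>0)" if "r \<le> Q x" for x
    using that r \<beta> by (intro mult_nonneg_nonneg ln_ge_zero) auto
  have \<alpha>: "1 \<le> \<alpha>" using c by (simp add: \<alpha>_def)
  have "profile \<alpha> \<beta> (- \<kappa>0) x \<le> hit (kill K) x" if "r \<le> Q x" for x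
  proof (rule R[OF r(1)])
    show "0 \<le> hit (kill K) x \<and> hit (kill K) x \<le> 1" for x by (rule hit_01[OF weight_kill])
    show "hit (kill K) x = N (P (hit (kill K)) x)" if "2 * r + 4 * reach\<^sup>2 \<le> Q x" for x
    proof (rule hit_recursion_off[OF weight_kill])
      have "r2 \<le> Q x" using that r zero_le_power2[of reach] by linarith
      then show "kill K x = 1" using r2 by (simp add: kill_def)
    qed
    show "1 \<le> \<alpha> + \<beta> * ln (Q x + - \<kappa>0)" if "r \<le> Q x" for x using ln0[OF that] \<alpha> by linarith
    show "profile \<alpha> \<beta> (- \<kappa>0) x \<le> hit (kill K) x" if x: "r \<le> Q x" "Q x < 2 * r + 4 * reach\<^sup>2" for x
    proof -
      have "0 < newton (- \<kappa>0) x" "newton (- \<kappa>0) x \<le> 1" using x r by (auto simp: newton_def)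
      then have "profile \<alpha> \<beta> (- \<kappa>0) x \<le> 1 / \<alpha>"
        unfolding profile_def using ln0[OF x(1)] \<alpha> by (intro frac_le) auto
      also have "\<dots> = c" by (simp add: \<alpha>_def)
      also have "\<dots> \<le> hit (kill K) x" using x by (intro cF) (simp add: F_def)
      finally show ?thesis .
    qed
    show "r \<le> Q x" by (rule that)
  qed
  then show ?thesis unfolding \<beta>_def eventually_far by blast
qed

text \<open>
  Allows \<open>\<alpha>\<close> to depend on \<open>x\<close>, as it does in \<open>laplace_asymptotics\<close>, where it is proportional to \<open>T x\<close>.
\<close>

lemma profile_asymptotics:
  assumes a: "((\<lambda>x. a x / ln (Q x)) \<longlongrightarrow> b) far" and pos: "0 < b + \<beta>"
  shows "((\<lambda>x. Q x * ln (Q x) * profile (a x) \<beta> \<kappa> x) \<longlongrightarrow> 1 / (b + \<beta>)) far"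
proof -
  have "((\<lambda>q. q / (q + \<kappa>)) \<longlongrightarrow> 1) at_top" "((\<lambda>q. ln (q + \<kappa>) / ln q) \<longlongrightarrow> 1) at_top" by real_asymp+
  then have "((\<lambda>x. Q x / (Q x + \<kappa>)) \<longlongrightarrow> 1) far" "((\<lambda>x. ln (Q x + \<kappa>) / ln (Q x)) \<longlongrightarrow> 1) far"
    using filterlim_compose[OF _ Q_at_top] by blast+
  then have "((\<lambda>x. Q x / (Q x + \<kappa>) * (1 / (a x / ln (Q x) + \<beta> * (ln (Q x + \<kappa>) / ln (Q x))))) \<longlongrightarrow> 1 * (1 / (b + \<beta> * 1))) far"
    using a pos by (intro tendsto_intros) auto
  moreover have "\<forall>\<^sub>F q in at_top. 0 < ln (q::real)" by real_asymp
  from eventually_compose_filterlim[OF this Q_at_top]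
  have "\<forall>\<^sub>F x in far. Q x / (Q x + \<kappa>) * (1 / (a x / ln (Q x) + \<beta> * (ln (Q x + \<kappa>) / ln (Q x)))) = Q x * ln (Q x) * profile (a x) \<beta> \<kappa> x"
  proof eventually_elim
    case (elim x)
    define lg where "lg = ln (Q x)"
    have "a x / lg + \<beta> * (ln (Q x + \<kappa>) / lg) = (a x + \<beta> * ln (Q x + \<kappa>)) / lg"
      by (simp add: add_divide_distrib)
    then show ?case by (simp add: profile_def newton_def lg_def[symmetric])
  qed
  ultimately show ?thesis by (auto intro: Lim_transform_eventually)
qed

lemma tendsto_by_bounds:
  fixes f :: "'b \<Rightarrow> real"
  assumes up: "\<And>\<epsilon>::real. 0 < \<epsilon> \<Longrightarrow> \<epsilon> < 1 \<Longrightarrow> \<exists>h. (h \<longlongrightarrow> U \<epsilon>) F \<and> (\<forall>\<^sub>F x in F. f x \<le> h x)"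
    and low: "\<And>\<epsilon>::real. 0 < \<epsilon> \<Longrightarrow> \<epsilon> < 1 \<Longrightarrow> \<exists>h. (h \<longlongrightarrow> V \<epsilon>) F \<and> (\<forall>\<^sub>F x in F. h x \<le> f x)"
    and U: "(U \<longlongrightarrow> l) (at_right (0::real))" and V: "(V \<longlongrightarrow> l) (at_right 0)"
  shows "(f \<longlongrightarrow> l) F"
proof (rule order_tendstoI)
  have 01: "\<forall>\<^sub>F \<epsilon> in at_right (0::real). 0 < \<epsilon> \<and> \<epsilon> < 1"
    using eventually_at_right_real[of 0 1] by (simp add: eventually_mono)
  fix c assume "c < l"
  then have "\<forall>\<^sub>F \<epsilon> in at_right 0. c < V \<epsilon>" using V by (intro order_tendstoD)
  from eventually_happens[OF eventually_conj[OF this 01]] obtain \<epsilon> where \<epsilon>: "c < V \<epsilon>" "0 < \<epsilon>" "\<epsilon> < 1" by auto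
  then obtain h where h: "(h \<longlongrightarrow> V \<epsilon>) F" "\<forall>\<^sub>F x in F. h x \<le> f x" using low by blast
  have "\<forall>\<^sub>F x in F. c < h x" using h(1) \<epsilon>(1) by (rule order_tendstoD)
  with h(2) show "\<forall>\<^sub>F x in F. c < f x" by eventually_elim linarith
next
  have 01: "\<forall>\<^sub>F \<epsilon> in at_right (0::real). 0 < \<epsilon> \<and> \<epsilon> < 1"
    using eventually_at_right_real[of 0 1] by (simp add: eventually_mono)
  fix c assume "l < c"
  then have "\<forall>\<^sub>F \<epsilon> in at_right 0. U \<epsilon> < c" using U by (intro order_tendstoD)
  from eventually_happens[OF eventually_conj[OF this 01]] obtain \<epsilon> where \<epsilon>: "U \<epsilon> < c" "0 < \<epsilon>" "\<epsilon> < 1" by auto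
  then obtain h where h: "(h \<longlongrightarrow> U \<epsilon>) F" "\<forall>\<^sub>F x in F. f x \<le> h x" using up by blast
  have "\<forall>\<^sub>F x in F. h x < c" using h(1) \<epsilon>(1) by (rule order_tendstoD)
  with h(2) show "\<forall>\<^sub>F x in F. f x < c" by eventually_elim linarith
qed

lemma ln_Q_at_top: "filterlim (\<lambda>x. ln (Q x)) at_top far"
  by (rule filterlim_compose[OF ln_at_top Q_at_top])

lemma const_over_ln: "((\<lambda>x. c / ln (Q x)) \<longlongrightarrow> 0) far"
  using tendsto_mult[OF tendsto_const[of c] tendsto_inverse_0_at_top[OF ln_Q_at_top]] by (simp add: divide_inverse)

lemma QlnQ_nonneg: "\<forall>\<^sub>F x in far. 0 \<le> Q x * ln (Q x)"
proof -
  have "\<forall>\<^sub>F q in at_top. 0 < ln (q::real)" by real_asymp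
  from eventually_compose_filterlim[OF this Q_at_top] show ?thesis by eventually_elim simp
qed

theorem kill_asymptotics:
  assumes fin: "finite K" "K \<noteq> {}"
  shows "((\<lambda>x. Q x * ln (Q x) * hit (kill K) x) \<longlongrightarrow> 2 / \<theta>) far"
proof (rule tendsto_by_bounds)
  fix \<epsilon> :: real assume \<epsilon>: "0 < \<epsilon>" "\<epsilon> < 1"
  obtain \<alpha> where \<alpha>: "\<forall>\<^sub>F x in far. hit (kill K) x \<le> profile \<alpha> ((1 - \<epsilon>) * \<theta> / 2) \<kappa>0 x"
    using kill_upper[OF fin \<epsilon>] by blast
  have "((\<lambda>x. Q x * ln (Q x) * profile \<alpha> ((1 - \<epsilon>) * \<theta> / 2) \<kappa>0 x) \<longlongrightarrow> 1 / (0 + (1 - \<epsilon>) * \<theta> / 2)) far"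
    using \<epsilon> \<theta>_pos by (intro profile_asymptotics const_over_ln) simp
  moreover have "\<forall>\<^sub>F x in far. Q x * ln (Q x) * hit (kill K) x \<le> Q x * ln (Q x) * profile \<alpha> ((1 - \<epsilon>) * \<theta> / 2) \<kappa>0 x"
    using \<alpha> QlnQ_nonneg by eventually_elim (rule mult_left_mono)
  ultimately show "\<exists>h. (h \<longlongrightarrow> 1 / (0 + (1 - \<epsilon>) * \<theta> / 2)) far \<and> (\<forall>\<^sub>F x in far. Q x * ln (Q x) * hit (kill K) x \<le> h x)"
    by blast
  obtain \<alpha> where \<alpha>: "\<forall>\<^sub>F x in far. profile \<alpha> ((1 + \<epsilon>) * \<theta> / 2) (- \<kappa>0) x \<le> hit (kill K) x"
    using kill_lower[OF fin \<epsilon>(1)] by blast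
  have "((\<lambda>x. Q x * ln (Q x) * profile \<alpha> ((1 + \<epsilon>) * \<theta> / 2) (- \<kappa>0) x) \<longlongrightarrow> 1 / (0 + (1 + \<epsilon>) * \<theta> / 2)) far"
    using \<epsilon> \<theta>_pos by (intro profile_asymptotics const_over_ln) simp
  moreover have "\<forall>\<^sub>F x in far. Q x * ln (Q x) * profile \<alpha> ((1 + \<epsilon>) * \<theta> / 2) (- \<kappa>0) x \<le> Q x * ln (Q x) * hit (kill K) x"
    using \<alpha> QlnQ_nonneg by eventually_elim (rule mult_left_mono)
  ultimately show "\<exists>h. (h \<longlongrightarrow> 1 / (0 + (1 + \<epsilon>) * \<theta> / 2)) far \<and> (\<forall>\<^sub>F x in far. h x \<le> Q x * ln (Q x) * hit (kill K) x)"
    by blast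
next
  show "((\<lambda>\<epsilon>. 1 / (0 + (1 - \<epsilon>) * \<theta> / 2)) \<longlongrightarrow> 2 / \<theta>) (at_right 0)"
    using \<theta>_pos by (auto intro!: tendsto_eq_intros)
  show "((\<lambda>\<epsilon>. 1 / (0 + (1 + \<epsilon>) * \<theta> / 2)) \<longlongrightarrow> 2 / \<theta>) (at_right 0)"
    using \<theta>_pos by (auto intro!: tendsto_eq_intros)
qed

theorem laplace_asymptotics:
  assumes fin: "finite K" and l: "\<And>y. y \<in> K \<Longrightarrow> 0 \<le> l y" and \<Lambda>: "0 < sum l K"
    and T: "((\<lambda>x. T x / ln (Q x)) \<longlongrightarrow> \<tau>) far" and \<tau>: "0 < \<tau>"
  shows "((\<lambda>x. Q x * ln (Q x) * hit (laplace_weight K l (T x)) x) \<longlongrightarrow> 1 / (\<tau> * (mass / sum l K) + \<theta> / 2)) far"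
proof (rule tendsto_by_bounds)
  have Ttop: "filterlim T at_top far"
  proof -
    have "filterlim (\<lambda>x. T x / ln (Q x) * ln (Q x)) at_top far"
      by (rule filterlim_tendsto_pos_mult_at_top[OF T \<tau> ln_Q_at_top])
    moreover have "\<forall>\<^sub>F x in far. T x / ln (Q x) * ln (Q x) = T x"
      using ln_Q_at_top[unfolded filterlim_at_top_dense, rule_format, of 0] by eventually_elim simp
    ultimately show ?thesis by (rule filterlim_mono_eventually[OF _ order_refl order_refl])
  qed
  fix \<epsilon> :: real assume \<epsilon>: "0 < \<epsilon>" "\<epsilon> < 1"
  have arg: "((\<lambda>x. (T x * A - C) / ln (Q x)) \<longlongrightarrow> \<tau> * A) far" for A C
    using tendsto_diff[OF tendsto_mult[OF T tendsto_const[of A]] const_over_ln[of C]]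
    by (simp add: diff_divide_distrib)
  obtain C r T0 where b: "\<And>T x. T0 \<le> T \<Longrightarrow> r \<le> Q x \<Longrightarrow>
     hit (laplace_weight K l T) x \<le> profile (T * (mass / ((1 + \<epsilon>) * sum l K)) - C) ((1 - \<epsilon>) * \<theta> / 2) \<kappa>0 x"
    by (rule laplace_upper[OF fin l \<Lambda> \<epsilon>]) blast+
  have "((\<lambda>x. Q x * ln (Q x) * profile (T x * (mass / ((1 + \<epsilon>) * sum l K)) - C) ((1 - \<epsilon>) * \<theta> / 2) \<kappa>0 x)
      \<longlongrightarrow> 1 / (\<tau> * (mass / ((1 + \<epsilon>) * sum l K)) + (1 - \<epsilon>) * \<theta> / 2)) far"
    using \<epsilon> \<theta>_pos \<tau> mass_pos \<Lambda> by (intro profile_asymptotics arg add_pos_pos) simp_all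
  moreover have "\<forall>\<^sub>F x in far. r \<le> Q x" by (auto simp: eventually_far)
  then have "\<forall>\<^sub>F x in far. Q x * ln (Q x) * hit (laplace_weight K l (T x)) x
      \<le> Q x * ln (Q x) * profile (T x * (mass / ((1 + \<epsilon>) * sum l K)) - C) ((1 - \<epsilon>) * \<theta> / 2) \<kappa>0 x"
    using QlnQ_nonneg Ttop[unfolded filterlim_at_top, rule_format, of T0]
    by eventually_elim (intro mult_left_mono b)
  ultimately show "\<exists>h. (h \<longlongrightarrow> 1 / (\<tau> * (mass / ((1 + \<epsilon>) * sum l K)) + (1 - \<epsilon>) * \<theta> / 2)) far \<and>
      (\<forall>\<^sub>F x in far. Q x * ln (Q x) * hit (laplace_weight K l (T x)) x \<le> h x)" by blast
  obtain C r T0 where b: "\<And>T x. T0 \<le> T \<Longrightarrow> r \<le> Q x \<Longrightarrow>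
     profile (T * (mass / ((1 - \<epsilon>) * sum l K)) - C) ((1 + \<epsilon>) * \<theta> / 2) (- \<kappa>0) x \<le> hit (laplace_weight K l T) x"
    by (rule laplace_lower[OF fin l \<Lambda> \<epsilon>]) blast+
  have "((\<lambda>x. Q x * ln (Q x) * profile (T x * (mass / ((1 - \<epsilon>) * sum l K)) - C) ((1 + \<epsilon>) * \<theta> / 2) (- \<kappa>0) x)
      \<longlongrightarrow> 1 / (\<tau> * (mass / ((1 - \<epsilon>) * sum l K)) + (1 + \<epsilon>) * \<theta> / 2)) far"
    using \<epsilon> \<theta>_pos \<tau> mass_pos \<Lambda> by (intro profile_asymptotics arg add_pos_pos) simp_all
  moreover have "\<forall>\<^sub>F x in far. r \<le> Q x" by (auto simp: eventually_far)
  then have "\<forall>\<^sub>F x in far. Q x * ln (Q x) * profile (T x * (mass / ((1 - \<epsilon>) * sum l K)) - C) ((1 + \<epsilon>) * \<theta> / 2) (- \<kappa>0) x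
      \<le> Q x * ln (Q x) * hit (laplace_weight K l (T x)) x"
    using QlnQ_nonneg Ttop[unfolded filterlim_at_top, rule_format, of T0]
    by eventually_elim (intro mult_left_mono b)
  ultimately show "\<exists>h. (h \<longlongrightarrow> 1 / (\<tau> * (mass / ((1 - \<epsilon>) * sum l K)) + (1 + \<epsilon>) * \<theta> / 2)) far \<and>
      (\<forall>\<^sub>F x in far. h x \<le> Q x * ln (Q x) * hit (laplace_weight K l (T x)) x)" by blast
next
  have ne: "\<tau> * mass / sum l K + \<theta> / 2 \<noteq> 0"
    using \<tau> mass_pos \<Lambda> \<theta>_pos by (intro less_imp_neq[symmetric] add_pos_pos) auto
  show "((\<lambda>\<epsilon>. 1 / (\<tau> * (mass / ((1 + \<epsilon>) * sum l K)) + (1 - \<epsilon>) * \<theta> / 2)) \<longlongrightarrow> 1 / (\<tau> * (mass / sum l K) + \<theta> / 2)) (at_right 0)"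
    using ne \<Lambda> by (auto intro!: tendsto_eq_intros)
  show "((\<lambda>\<epsilon>. 1 / (\<tau> * (mass / ((1 - \<epsilon>) * sum l K)) + (1 + \<epsilon>) * \<theta> / 2)) \<longlongrightarrow> 1 / (\<tau> * (mass / sum l K) + \<theta> / 2)) (at_right 0)"
    using ne \<Lambda> by (auto intro!: tendsto_eq_intros)
qed

end

section \<open>Lattice sums and the determinant\<close>

text \<open>
  The columns of \<open>B\<close> are an orthonormal basis for the inner product given by \<open>A\<close>, built one vector at a
  time.
\<close>

lemma matrix_congruent_identity:
  fixes A :: "real ^ 'n ^ 'n"
  assumes "positive_definite A"
  obtains B :: "real ^ 'n ^ 'n" where "transpose B ** A ** B = mat 1"
proof -
  have sym: "transpose A = A" and pd: "\<And>v. v \<noteq> 0 \<Longrightarrow> 0 < v \<bullet> (A *v v)"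
    using assms by (auto simp: positive_definite_def)
  have swap: "u \<bullet> (A *v v) = v \<bullet> (A *v u)" for u v
    by (metis sym dot_lmul_matrix inner_commute transpose_matrix_vector)
  have "\<exists>f :: nat \<Rightarrow> real ^ 'n. \<forall>i<k. \<forall>j<k. f i \<bullet> (A *v f j) = (if i = j then 1 else 0)" if "k \<le> CARD('n)" for k
    using that
  proof (induction k)
    case (Suc k)
    then obtain f :: "nat \<Rightarrow> real ^ 'n" where f: "\<And>i j. i < k \<Longrightarrow> j < k \<Longrightarrow> f i \<bullet> (A *v f j) = (if i = j then 1 else 0)"
      by (metis Suc_leD)
    define S where "S = (\<lambda>i. A *v f i) ` {..<k}"
    have "dim S \<le> card S" unfolding S_def by (intro dim_le_card') auto
    also have "\<dots> \<le> k" unfolding S_def using card_image_le[of "{..<k}"] by (metis card_lessThan finite_lessThan)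
    also have "k < DIM(real ^ 'n)" using Suc.prems by simp
    finally obtain w where w: "w \<noteq> 0" "\<And>y. y \<in> span S \<Longrightarrow> orthogonal w y"
      using orthogonal_to_subspace_exists by blast
    have wf: "w \<bullet> (A *v f i) = 0" if "i < k" for i
      using w(2)[of "A *v f i"] that by (auto simp: S_def orthogonal_def intro: span_base)
    define c where "c = sqrt (w \<bullet> (A *v w))"
    have c: "0 < c" "c * c = w \<bullet> (A *v w)" using pd[OF w(1)] by (auto simp: c_def)
    define g where "g i = (if i = k then (1 / c) *\<^sub>R w else f i)" for i
    have "g i \<bullet> (A *v g j) = (if i = j then 1 else 0)" if "i < Suc k" "j < Suc k" for i j
    proof -
      have "(1 / c) *\<^sub>R w \<bullet> (A *v ((1 / c) *\<^sub>R w)) = 1"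
        using c by (simp add: matrix_vector_mult_scaleR) (simp flip: c(2))
      then show ?thesis using that f[of i j] wf[of i] wf[of j] swap[of "f i" w]
        by (auto simp: g_def matrix_vector_mult_scaleR less_Suc_eq)
    qed
    then show ?case by blast
  qed simp
  from this[OF order_refl] obtain f :: "nat \<Rightarrow> real ^ 'n"
    where f: "\<And>i j. i < CARD('n) \<Longrightarrow> j < CARD('n) \<Longrightarrow> f i \<bullet> (A *v f j) = (if i = j then 1 else 0)" by blast
  obtain h :: "'n \<Rightarrow> nat" where h: "bij_betw h UNIV {..<CARD('n)}"
    using ex_bij_betw_finite_nat[of "UNIV :: 'n set"] by (auto simp: atLeast0LessThan)
  define B :: "real ^ 'n ^ 'n" where "B = (\<chi> i j. f (h j) $ i)"
  have col: "column j B = f (h j)" for j by (simp add: column_def B_def vec_eq_iff)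
  have "(transpose B ** A ** B) $ i $ j = mat 1 $ i $ j" for i j
  proof -
    have "(transpose B ** A ** B) $ i $ j = (\<Sum>l\<in>UNIV. (\<Sum>k\<in>UNIV. B $ k $ i * A $ k $ l) * B $ l $ j)"
      by (simp add: matrix_matrix_mult_def transpose_def)
    also have "\<dots> = (\<Sum>k\<in>UNIV. \<Sum>l\<in>UNIV. B $ k $ i * (A $ k $ l * B $ l $ j))"
      by (simp add: sum_distrib_right mult.assoc) (rule sum.swap)
    also have "\<dots> = f (h i) \<bullet> (A *v f (h j))"
      by (simp add: B_def inner_vec_def matrix_vector_mult_def sum_distrib_left)
    also have "\<dots> = (if i = j then 1 else 0)"
    proof -
      have "h i < CARD('n)" "h j < CARD('n)" using bij_betwE[OF h] by auto
      moreover have "h i = h j \<longleftrightarrow> i = j" using h by (auto simp: bij_betw_def inj_on_def)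
      ultimately show ?thesis using f by simp
    qed
    finally show ?thesis by (simp add: mat_def)
  qed
  then have "transpose B ** A ** B = mat 1" by (simp add: vec_eq_iff)
  then show thesis by (rule that)
qed

text \<open>
  Sends a point to the corner of its unit cell; cells have volume one, so it maps Lebesgue measure to
  counting measure.
\<close>

definition lattice_floor :: "real ^ 'd \<Rightarrow> int ^ 'd" where
  "lattice_floor y = (\<chi> i. \<lfloor>y $ i\<rfloor>)"

lemma lattice_floor_near: "norm (y - real_vec (lattice_floor y)) \<le> real CARD('d)"
  for y :: "real ^ 'd"
proof -
  have "norm (y - real_vec (lattice_floor y)) \<le> (\<Sum>i\<in>UNIV. \<bar>(y - real_vec (lattice_floor y)) $ i\<bar>)"
    by (rule norm_le_l1_cart)
  also have "\<dots> \<le> (\<Sum>i\<in>(UNIV::'d set). 1)"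
    by (intro sum_mono) (simp add: real_vec_def lattice_floor_def, linarith)
  finally show ?thesis by simp
qed

lemma lattice_cell:
  "{y. lattice_floor y = z} = {y. \<forall>i. real_of_int (z $ i) \<le> y $ i \<and> y $ i < real_of_int (z $ i) + 1}"
  by (auto simp: lattice_floor_def vec_eq_iff floor_eq_iff)

lemma lattice_cell_sets [measurable]: "{y. lattice_floor y = z} \<in> sets borel"
  for z :: "int ^ 'd"
proof -
  have "{y. lattice_floor y = z} = (\<Inter>i. {y. real_of_int (z $ i) \<le> y $ i} \<inter> {y. y $ i < real_of_int (z $ i) + 1})"
    unfolding lattice_cell by auto
  also have "\<dots> \<in> sets borel"
    by (intro sets.countable_INT'' sets.Int borel_closed borel_open closed_Collect_le open_Collect_less continuous_intros) auto
  finally show ?thesis .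
qed

lemma emeasure_lattice_cell: "emeasure lborel {y. lattice_floor y = z} = 1" for z :: "int ^ 'd"
proof -
  define o1 :: "real ^ 'd" where "o1 = (\<chi> i. 1)"
  have one: "(\<Prod>b\<in>Basis. (real_vec z + o1 - real_vec z) \<bullet> b) = 1"
    by (intro prod.neutral) (auto simp: Basis_vec_def inner_axis o1_def)
  have le: "real_vec z \<bullet> b \<le> (real_vec z + o1) \<bullet> b" if "b \<in> Basis" for b
    using that by (auto simp: Basis_vec_def inner_axis o1_def inner_add_left)
  have "emeasure lborel (box (real_vec z) (real_vec z + o1)) \<le> emeasure lborel {y. lattice_floor y = z}"
    unfolding lattice_cell using lattice_cell_sets[of z, unfolded lattice_cell]
    by (intro emeasure_mono) (auto simp: mem_box_cart real_vec_def o1_def less_imp_le)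
  moreover have "emeasure lborel {y. lattice_floor y = z} \<le> emeasure lborel (cbox (real_vec z) (real_vec z + o1))"
    unfolding lattice_cell by (intro emeasure_mono) (auto simp: mem_box_cart real_vec_def o1_def less_imp_le)
  ultimately show ?thesis
    using emeasure_lborel_box[OF le] emeasure_lborel_cbox[OF le] one by simp
qed

lemma lattice_floor_measurable [measurable]: "lattice_floor \<in> measurable borel (count_space UNIV)"
  for dummy :: "'d::finite"
  unfolding measurable_count_space_eq2_countable
  using lattice_cell_sets by (auto simp: vimage_def)

lemma nn_integral_lattice_floor:
  fixes h :: "int ^ 'd \<Rightarrow> ennreal"
  shows "(\<integral>\<^sup>+z. h z \<partial>count_space UNIV) = (\<integral>\<^sup>+y. h (lattice_floor y) \<partial>lborel)"
proof -
  have "distr lborel (count_space UNIV) lattice_floor = count_space (UNIV :: (int ^ 'd) set)"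
  proof (rule measure_eqI_countable[of _ UNIV])
    fix z :: "int ^ 'd"
    show "emeasure (distr lborel (count_space UNIV) lattice_floor) {z} = emeasure (count_space UNIV) {z}"
      using emeasure_lattice_cell[of z] by (subst emeasure_distr) (auto simp: vimage_def)
  qed auto
  moreover have "(\<integral>\<^sup>+z. h z \<partial>distr lborel (count_space UNIV) lattice_floor) = (\<integral>\<^sup>+y. h (lattice_floor y) \<partial>lborel)"
    by (rule nn_integral_distr) auto
  ultimately show ?thesis by simp
qed

lemma emeasure_ellipsoid:
  fixes B :: "real ^ 4 ^ 4"
  assumes det: "det B \<noteq> 0" and t: "0 \<le> t"
  shows "emeasure lborel {y. (norm (transpose B *v y))\<^sup>2 \<le> t} = ennreal (pi\<^sup>2 / 2 / \<bar>det B\<bar> * t\<^sup>2)"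
proof -
  define M where "M = transpose B"
  have dM: "det M \<noteq> 0" using det by (simp add: M_def det_transpose)
  then have inv: "invertible M" by (simp add: invertible_det_nz)
  obtain C where CM: "C ** M = mat 1" "M ** C = mat 1" using inv by (auto simp: invertible_def)
  then have detC: "det C * det M = 1" by (metis det_I det_mul)
  have lin: "linear ((*v) C)" by (rule matrix_vector_mul_linear)
  have set: "{y. (norm (M *v y))\<^sup>2 \<le> t} = (*v) C ` cball 0 (sqrt t)"
  proof (intro equalityI subsetI)
    fix y assume "y \<in> {y. (norm (M *v y))\<^sup>2 \<le> t}"
    then have "norm (M *v y) \<le> sqrt t" by (simp add: real_le_rsqrt)
    moreover have "y = C *v (M *v y)" using CM by (simp add: matrix_vector_mul_assoc)
    ultimately show "y \<in> (*v) C ` cball 0 (sqrt t)" by force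
  next
    fix y assume "y \<in> (*v) C ` cball 0 (sqrt t)"
    then obtain x where x: "y = C *v x" "norm x \<le> sqrt t" by auto
    have "M *v y = x" using CM x by (simp add: matrix_vector_mul_assoc)
    then show "y \<in> {y. (norm (M *v y))\<^sup>2 \<le> t}" using x t power_mono[OF x(2), of 2] by simp
  qed
  have comp: "compact ((*v) C ` cball 0 (sqrt t))"
    by (intro compact_continuous_image linear_continuous_on linear_linear[THEN iffD2] lin compact_cball)
  have "measure lborel ((*v) C ` cball 0 (sqrt t)) = measure lebesgue ((*v) C ` cball 0 (sqrt t))"
    using compact_imp_closed[OF comp] by (simp add: measure_completion)
  also have "\<dots> = \<bar>det (matrix ((*v) C))\<bar> * measure lebesgue (cball (0 :: real ^ 4) (sqrt t))"
    by (rule measure_linear_image[OF lin]) simp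
  also have "\<dots> = \<bar>det C\<bar> * (pi\<^sup>2 / 2 * t\<^sup>2)"
    using t content_cball[of "sqrt t" "0 :: real ^ 4"]
    by (simp add: unit_ball_vol_4 measure_completion power4_eq_xxxx power2_eq_square)
  also have "\<bar>det C\<bar> = 1 / \<bar>det B\<bar>"
    using detC dM by (simp add: M_def det_transpose field_simps flip: abs_mult)
  finally have "measure lborel ((*v) C ` cball 0 (sqrt t)) = pi\<^sup>2 / 2 / \<bar>det B\<bar> * t\<^sup>2" by simp
  then show ?thesis
    using emeasure_compact_finite[OF comp] unfolding M_def[symmetric] set
    by (subst emeasure_eq_ennreal_measure) (auto simp: top_unique less_top)
qed

text \<open>
  Integration by layers: write the integrand as an integral over its superlevel sets and use that their
  volumes are \<open>V * t\<^sup>2\<close>.  The result does not depend on \<open>\<kappa>\<close>, by scaling in dimension four.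
\<close>

lemma newton_cube_integral:
  fixes q :: "real ^ 4 \<Rightarrow> real"
  assumes [measurable]: "q \<in> borel_measurable borel" and q0: "\<And>y. 0 \<le> q y" and V0: "0 \<le> V"
    and V: "\<And>t. 0 \<le> t \<Longrightarrow> emeasure lborel {y. q y \<le> t} = ennreal (V * t\<^sup>2)" and \<kappa>: "0 < \<kappa>"
  shows "(\<integral>\<^sup>+y. ennreal (4 * \<kappa> / (q y + \<kappa>) ^ 3) \<partial>lborel) = ennreal (4 * V)"
proof -
  define f where "f t = 12 * \<kappa> / (t + \<kappa>) ^ 4" for t :: real
  have [measurable]: "f \<in> borel_measurable borel" unfolding f_def by measurable
  have layer: "ennreal (4 * \<kappa> / (a + \<kappa>) ^ 3) = (\<integral>\<^sup>+t. ennreal (f t) * indicator {a..} t \<partial>lborel)" if a: "0 \<le> a" for a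
  proof -
    have "(\<integral>\<^sup>+t. ennreal (f t) * indicator {a..} t \<partial>lborel) = ennreal (0 - (- 4 * \<kappa> / (a + \<kappa>) ^ 3))"
    proof (rule nn_integral_FTC_atLeast[where F = "\<lambda>t. - 4 * \<kappa> / (t + \<kappa>) ^ 3" and f = f])
      fix x assume x: "a \<le> x"
      show "((\<lambda>t. - 4 * \<kappa> / (t + \<kappa>) ^ 3) has_real_derivative f x) (at x)"
      proof -
        define u where "u = x + \<kappa>"
        have "u \<noteq> 0" using x a \<kappa> by (simp add: u_def)
        then show ?thesis unfolding f_def
          by (auto intro!: derivative_eq_intros simp: u_def[symmetric] eval_nat_numeral)
      qed
      show "0 \<le> f x" using x a \<kappa> by (simp add: f_def)
    next
      show "((\<lambda>t. - 4 * \<kappa> / (t + \<kappa>) ^ 3) \<longlongrightarrow> 0) at_top" using \<kappa> by real_asymp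
    qed measurable
    then show ?thesis by simp
  qed
  have "(\<integral>\<^sup>+y. ennreal (4 * \<kappa> / (q y + \<kappa>) ^ 3) \<partial>lborel)
      = (\<integral>\<^sup>+y. \<integral>\<^sup>+t. ennreal (f t) * indicator {q y..} t \<partial>lborel \<partial>lborel)"
    by (simp add: layer q0)
  also have "\<dots> = (\<integral>\<^sup>+y. \<integral>\<^sup>+t. ennreal (f t) * indicator {p. q (fst p) \<le> snd p} (y, t) \<partial>lborel \<partial>lborel)"
    by (intro nn_integral_cong) (simp add: indicator_def)
  also have "\<dots> = (\<integral>\<^sup>+t. \<integral>\<^sup>+y. ennreal (f t) * indicator {p. q (fst p) \<le> snd p} (y, t) \<partial>lborel \<partial>lborel)"
    by (rule lborel_pair.Fubini'[symmetric]) measurable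
  also have "\<dots> = (\<integral>\<^sup>+t. ennreal (f t * (V * t\<^sup>2)) * indicator {0..} t \<partial>lborel)"
  proof (intro nn_integral_cong)
    fix t :: real
    have "(\<integral>\<^sup>+y. ennreal (f t) * indicator {p. q (fst p) \<le> snd p} (y, t) \<partial>lborel)
        = (\<integral>\<^sup>+y. ennreal (f t) * indicator {y. q y \<le> t} y \<partial>lborel)"
      by (intro nn_integral_cong) (simp add: indicator_def)
    also have "\<dots> = ennreal (f t) * emeasure lborel {y. q y \<le> t}"
      by (rule nn_integral_cmult_indicator) measurable
    also have "\<dots> = ennreal (f t * (V * t\<^sup>2)) * indicator {0..} t"
    proof (cases "0 \<le> t")
      case True
      have "0 \<le> f t" using True \<kappa> by (simp add: f_def)
      then have "ennreal (f t) * ennreal (V * t\<^sup>2) = ennreal (f t * (V * t\<^sup>2))"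
        using V0 by (intro ennreal_mult[symmetric]) auto
      then show ?thesis unfolding V[OF True] using True by (simp only: indicator_simps(1) atLeast_iff mult_1_right)
    next
      case False
      then have "\<not> q y \<le> t" for y using q0[of y] by linarith
      then show ?thesis using False by simp
    qed
    finally show "(\<integral>\<^sup>+y. ennreal (f t) * indicator {p. q (fst p) \<le> snd p} (y, t) \<partial>lborel)
      = ennreal (f t * (V * t\<^sup>2)) * indicator {0..} t" .
  qed
  also have "\<dots> = ennreal (4 * V - 4 * V * (0 / (0 + \<kappa>)) ^ 3)"
  proof (rule nn_integral_FTC_atLeast[where F = "\<lambda>t. 4 * V * (t / (t + \<kappa>)) ^ 3" and f = "\<lambda>t. f t * (V * t\<^sup>2)"])
    fix x :: real assume x: "0 \<le> x"
    show "((\<lambda>t. 4 * V * (t / (t + \<kappa>)) ^ 3) has_real_derivative f x * (V * x\<^sup>2)) (at x)"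
    proof -
      have u: "x + \<kappa> \<noteq> 0" using x \<kappa> by simp
      have "((\<lambda>t. t / (t + \<kappa>)) has_real_derivative \<kappa> / ((x + \<kappa>) * (x + \<kappa>))) (at x)"
        using u by (auto intro!: derivative_eq_intros)
      from DERIV_cmult[OF DERIV_power[OF this, of 3], of "4 * V"] show ?thesis
        by (rule DERIV_cong) (simp add: f_def power2_eq_square power4_eq_xxxx mult_ac)
    qed
    show "0 \<le> f x * (V * x\<^sup>2)" using x \<kappa> V0 by (simp add: f_def)
  next
    show "((\<lambda>t. 4 * V * (t / (t + \<kappa>)) ^ 3) \<longlongrightarrow> 4 * V) at_top" using \<kappa> by real_asymp
  qed measurable
  finally show ?thesis by simp
qed

text \<open>
  Rounding a point moves \<open>sqrt (Q + \<kappa>)\<close> by a bounded amount, whereas \<open>sqrt (Q + \<kappa>) \<ge> sqrt \<kappa>\<close>; so the sum and the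
  integral agree up to a factor that tends to one.
\<close>

lemma lattice_newton_sum:
  fixes B :: "real ^ 4 ^ 4"
  assumes det: "det B \<noteq> 0"
  shows "((\<lambda>\<kappa>. \<integral>\<^sup>+z. ennreal (4 * \<kappa> / ((norm (transpose B *v real_vec z))\<^sup>2 + \<kappa>) ^ 3) \<partial>count_space UNIV)
           \<longlongrightarrow> ennreal (2 * pi\<^sup>2 / \<bar>det B\<bar>)) at_top"
proof -
  define q where "q y = (norm (transpose B *v y))\<^sup>2" for y
  define I where "I = 2 * pi\<^sup>2 / \<bar>det B\<bar>"
  have I0: "0 \<le> I" by (simp add: I_def)
  have qm [measurable]: "q \<in> borel_measurable borel"
    unfolding q_def by (intro borel_measurable_continuous_onI continuous_intros linear_continuous_on matrix_vector_mul_bounded_linear)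
  obtain K where K: "0 < K" "\<And>y. norm (transpose B *v y) \<le> norm y * K"
    using bounded_linear.pos_bounded[OF matrix_vector_mul_bounded_linear[of "transpose B"]] by blast
  define M where "M = 4 * K"
  have M: "0 < M" using K by (simp add: M_def)
  define h where "h \<kappa> y = 4 * \<kappa> / (q y + \<kappa>) ^ 3" for \<kappa> y
  have near: "\<bar>sqrt (q y + \<kappa>) - sqrt (q (real_vec (lattice_floor y)) + \<kappa>)\<bar> \<le> M" if "0 < \<kappa>" for \<kappa> y
  proof -
    define u v where "u = transpose B *v y" and "v = transpose B *v real_vec (lattice_floor y)"
    have "norm (u - v) = norm (transpose B *v (y - real_vec (lattice_floor y)))"
      by (simp add: u_def v_def matrix_vector_mult_diff_distrib)
    also have "\<dots> \<le> norm (y - real_vec (lattice_floor y)) * K" by (rule K)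
    also have "\<dots> \<le> 4 * K" using lattice_floor_near[of y] K by (intro mult_right_mono) auto
    finally have uv: "norm (u - v) \<le> M" by (simp add: M_def)
    have nrm: "sqrt ((norm u)\<^sup>2 + \<kappa>) = norm (u, sqrt \<kappa>)" for u :: "real ^ 4"
      using that by (simp add: norm_Pair)
    have "\<bar>norm (u, sqrt \<kappa>) - norm (v, sqrt \<kappa>)\<bar> \<le> norm ((u, sqrt \<kappa>) - (v, sqrt \<kappa>))"
      by (rule norm_triangle_ineq3)
    also have "\<dots> = norm (u - v)" by (simp add: norm_Pair)
    finally show ?thesis using uv nrm by (simp add: q_def u_def v_def)
  qed
  have hs: "h \<kappa> y = 4 * \<kappa> / sqrt (q y + \<kappa>) ^ 6" if "0 < \<kappa>" for \<kappa> y
  proof -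
    have "sqrt (q y + \<kappa>) ^ 6 = (sqrt (q y + \<kappa>) ^ 2) ^ 3" by (simp flip: power_mult)
    also have "\<dots> = (q y + \<kappa>) ^ 3" using that by (simp add: q_def)
    finally show ?thesis by (simp add: h_def)
  qed
  have cmp: "h \<kappa> y / (1 + M / sqrt \<kappa>) ^ 6 \<le> h \<kappa> (real_vec (lattice_floor y)) \<and>
      h \<kappa> (real_vec (lattice_floor y)) \<le> h \<kappa> y / (1 - M / sqrt \<kappa>) ^ 6" if \<kappa>: "M\<^sup>2 < \<kappa>" for \<kappa> y
  proof -
    have k0: "0 < \<kappa>" using \<kappa> zero_le_power2[of M] by linarith
    have Ms: "M < sqrt \<kappa>" using \<kappa> M by (simp add: real_less_rsqrt)
    \<comment> \<open>the integrand is a function of \<open>sqrt (Q + \<kappa>)\<close> alone, whose values before and after rounding are compared\<close>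
    define a b where "a = sqrt (q y + \<kappa>)" and "b = sqrt (q (real_vec (lattice_floor y)) + \<kappa>)"
    have ab: "\<bar>a - b\<bar> \<le> M" using near[OF k0] by (simp add: a_def b_def)
    have as: "sqrt \<kappa> \<le> a" by (simp add: a_def q_def)
    have s0: "0 < sqrt \<kappa>" using k0 by simp
    have "M \<le> a * (M / sqrt \<kappa>)" using as s0 M by (simp add: field_simps)
    then have up: "b \<le> a * (1 + M / sqrt \<kappa>)" and lo: "a * (1 - M / sqrt \<kappa>) \<le> b"
      using ab by (auto simp: distrib_left right_diff_distrib abs_le_iff)
    have m1: "0 < 1 - M / sqrt \<kappa>" using Ms s0 by simp
    have a0: "0 < a" using as s0 by linarith
    have b0: "0 < b" using lo m1 a0 mult_pos_pos[OF a0 m1] by linarith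
    have "h \<kappa> y / (1 + M / sqrt \<kappa>) ^ 6 = 4 * \<kappa> / (a * (1 + M / sqrt \<kappa>)) ^ 6"
      by (simp add: hs[OF k0] a_def power_mult_distrib)
    also have "\<dots> \<le> 4 * \<kappa> / b ^ 6" using up b0 k0 by (intro divide_left_mono power_mono mult_pos_pos) auto
    also have "\<dots> = h \<kappa> (real_vec (lattice_floor y))" by (simp add: hs[OF k0] b_def)
    finally have 1: "h \<kappa> y / (1 + M / sqrt \<kappa>) ^ 6 \<le> h \<kappa> (real_vec (lattice_floor y))" .
    have "h \<kappa> (real_vec (lattice_floor y)) = 4 * \<kappa> / b ^ 6" by (simp add: hs[OF k0] b_def)
    also have "\<dots> \<le> 4 * \<kappa> / (a * (1 - M / sqrt \<kappa>)) ^ 6"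
      using lo b0 k0 a0 m1 by (intro divide_left_mono power_mono mult_pos_pos zero_less_power) auto
    also have "\<dots> = h \<kappa> y / (1 - M / sqrt \<kappa>) ^ 6" by (simp add: hs[OF k0] a_def power_mult_distrib)
    finally show ?thesis using 1 by blast
  qed
  have int: "(\<integral>\<^sup>+y. ennreal (h \<kappa> y / c) \<partial>lborel) = ennreal (I / c)" if "0 < \<kappa>" "0 < c" for \<kappa> c
  proof -
    have "(\<integral>\<^sup>+y. ennreal (h \<kappa> y) \<partial>lborel) = ennreal (4 * (pi\<^sup>2 / 2 / \<bar>det B\<bar>))"
      unfolding h_def
    proof (rule newton_cube_integral[OF qm])
      show "emeasure lborel {y. q y \<le> t} = ennreal (pi\<^sup>2 / 2 / \<bar>det B\<bar> * t\<^sup>2)" if "0 \<le> t" for t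
        unfolding q_def by (rule emeasure_ellipsoid[OF det that])
    qed (use that in \<open>auto simp: q_def\<close>)
    also have "4 * (pi\<^sup>2 / 2 / \<bar>det B\<bar>) = I" by (simp add: I_def)
    finally have base: "(\<integral>\<^sup>+y. ennreal (h \<kappa> y) \<partial>lborel) = ennreal I" .
    have [measurable]: "h \<kappa> \<in> borel_measurable borel" unfolding h_def by measurable
    have "(\<integral>\<^sup>+y. ennreal (h \<kappa> y / c) \<partial>lborel) = (\<integral>\<^sup>+y. ennreal (1 / c) * ennreal (h \<kappa> y) \<partial>lborel)"
      using that by (intro nn_integral_cong) (simp add: h_def q_def flip: ennreal_mult)
    also have "\<dots> = ennreal (1 / c) * ennreal I" by (subst nn_integral_cmult) (auto simp: base)
    finally show ?thesis using that I0 by (simp flip: ennreal_mult)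
  qed
  define S where "S \<kappa> = (\<integral>\<^sup>+z. ennreal (h \<kappa> (real_vec z)) \<partial>count_space UNIV)" for \<kappa>
  have S: "S \<kappa> = (\<integral>\<^sup>+y. ennreal (h \<kappa> (real_vec (lattice_floor y))) \<partial>lborel)" for \<kappa>
    unfolding S_def by (rule nn_integral_lattice_floor)
  have "(S \<longlongrightarrow> ennreal I) at_top"
  proof (rule tendsto_sandwich)
    have l1: "((\<lambda>\<kappa>. I / (1 + M / sqrt \<kappa>) ^ 6) \<longlongrightarrow> I) at_top" by real_asymp
    have l2: "((\<lambda>\<kappa>. I / (1 - M / sqrt \<kappa>) ^ 6) \<longlongrightarrow> I) at_top" by real_asymp
    show "((\<lambda>\<kappa>. ennreal (I / (1 + M / sqrt \<kappa>) ^ 6)) \<longlongrightarrow> ennreal I) at_top"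
      "((\<lambda>\<kappa>. ennreal (I / (1 - M / sqrt \<kappa>) ^ 6)) \<longlongrightarrow> ennreal I) at_top"
      by (intro tendsto_ennrealI l1 l2)+
    have pos: "0 < \<kappa> \<and> 0 < (1 + M / sqrt \<kappa>) ^ 6 \<and> 0 < (1 - M / sqrt \<kappa>) ^ 6" if "M\<^sup>2 < \<kappa>" for \<kappa>
    proof -
      have k0: "0 < \<kappa>" using that zero_le_power2[of M] by linarith
      have "M < sqrt \<kappa>" using that M by (simp add: real_less_rsqrt)
      then have "0 < 1 + M / sqrt \<kappa>" "0 < 1 - M / sqrt \<kappa>" using k0 M by (auto intro: add_pos_pos)
      then show ?thesis using k0 by (intro conjI zero_less_power)
    qed
    show "\<forall>\<^sub>F \<kappa> in at_top. ennreal (I / (1 + M / sqrt \<kappa>) ^ 6) \<le> S \<kappa>"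
      using eventually_gt_at_top[of "M\<^sup>2"]
    proof eventually_elim
      case (elim \<kappa>)
      have "ennreal (I / (1 + M / sqrt \<kappa>) ^ 6) = (\<integral>\<^sup>+y. ennreal (h \<kappa> y / (1 + M / sqrt \<kappa>) ^ 6) \<partial>lborel)"
        using int[of \<kappa> "(1 + M / sqrt \<kappa>) ^ 6"] pos[OF elim] by simp
      also have "\<dots> \<le> S \<kappa>" unfolding S using cmp[OF elim] by (intro nn_integral_mono ennreal_leI) auto
      finally show ?case .
    qed
    show "\<forall>\<^sub>F \<kappa> in at_top. S \<kappa> \<le> ennreal (I / (1 - M / sqrt \<kappa>) ^ 6)"
      using eventually_gt_at_top[of "M\<^sup>2"]
    proof eventually_elim
      case (elim \<kappa>)
      have "S \<kappa> \<le> (\<integral>\<^sup>+y. ennreal (h \<kappa> y / (1 - M / sqrt \<kappa>) ^ 6) \<partial>lborel)"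
        unfolding S using cmp[OF elim] by (intro nn_integral_mono ennreal_leI) auto
      also have "\<dots> = ennreal (I / (1 - M / sqrt \<kappa>) ^ 6)"
        using int[of \<kappa> "(1 - M / sqrt \<kappa>) ^ 6"] pos[OF elim] by blast
      finally show ?case .
    qed
  qed
  then show ?thesis by (simp add: S_def[abs_def] h_def q_def I_def)
qed

section \<open>Products along the genealogical tree\<close>

text \<open>
  The sample seen from child \<open>i\<close> of the root, relabelled so that the child becomes the root: labels list
  the most recent generation first, so the ancestor \<open>i\<close> is appended at the end.
\<close>

definition subtree :: "nat \<Rightarrow> 'd::finite brw_sample \<Rightarrow> 'd brw_sample" where
  "subtree i \<omega> = (\<lambda>v. \<omega> (v @ [i]))"

text \<open>
  The product of \<open>\<Theta>\<close> over the positions in generations up to \<open>n\<close>, as a recursion at the root; the closed form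
  is \<open>tree_prod_eq\<close>.  The child's own jump is the label of the root of its subtree.
\<close>

primrec tree_prod :: "(int ^ 'd::finite \<Rightarrow> real) \<Rightarrow> nat \<Rightarrow> int ^ 'd \<Rightarrow> 'd brw_sample \<Rightarrow> real" where
  "tree_prod \<Theta> 0 x \<omega> = \<Theta> x"
| "tree_prod \<Theta> (Suc n) x \<omega> =
    \<Theta> x * (\<Prod>i<fst (\<omega> []). tree_prod \<Theta> n (x + snd (subtree i \<omega> [])) (subtree i \<omega>))"

lemma space_brw [simp]: "space (brw_space p \<mu>) = UNIV"
  by (simp add: brw_space_def space_PiM PiE_UNIV_domain)

lemma prob_space_brw: "prob_space (brw_space p \<mu>)"
  unfolding brw_space_def by (intro prob_space_PiM measure_pmf.prob_space_axioms)

lemma label_measurable [measurable]: "(\<lambda>\<omega>. \<omega> v) \<in> measurable (brw_space p \<mu>) (count_space UNIV)"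
proof -
  have "(\<lambda>\<omega>. \<omega> v) \<in> measurable (brw_space p \<mu>) (measure_pmf (pair_pmf p \<mu>))"
    unfolding brw_space_def by (rule measurable_component_singleton) simp
  then show ?thesis by (simp cong: measurable_cong_sets)
qed

lemma label_fst_measurable: "(\<lambda>\<omega>. fst (\<omega> v)) \<in> measurable (brw_space p \<mu>) (count_space UNIV)"
  and label_snd_measurable: "(\<lambda>\<omega>. snd (\<omega> v)) \<in> measurable (brw_space p \<mu>) (count_space UNIV)"
  by (rule measurable_compose[OF label_measurable], simp)+

lemma subtree_measurable [measurable]: "subtree i \<in> measurable (brw_space p \<mu>) (brw_space p \<mu>)"
  unfolding subtree_def brw_space_def
  by (rule measurable_PiM_single', rule measurable_component_singleton) (simp_all add: space_PiM PiE_UNIV_domain)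

lemma distr_subtree: "distr (brw_space p \<mu>) (brw_space p \<mu>) (subtree i) = brw_space p \<mu>"
  using distr_PiM_reindex[of UNIV "\<lambda>_. measure_pmf (pair_pmf p \<mu>)" "\<lambda>v. v @ [i]" UNIV]
  by (simp add: brw_space_def subtree_def[abs_def] measure_pmf.prob_space_axioms inj_on_def restrict_def)

lemma prob_label: "measure (brw_space p \<mu>) {\<omega>. \<omega> v = (k, z)} = pmf p k * pmf \<mu> z"
proof -
  have d: "distr (brw_space p \<mu>) (measure_pmf (pair_pmf p \<mu>)) (\<lambda>\<omega>. \<omega> v) = measure_pmf (pair_pmf p \<mu>)"
    unfolding brw_space_def by (rule distr_PiM_component) (auto simp: measure_pmf.prob_space_axioms)
  have m: "(\<lambda>\<omega>. \<omega> v) \<in> measurable (brw_space p \<mu>) (measure_pmf (pair_pmf p \<mu>))"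
    unfolding brw_space_def by (rule measurable_component_singleton) simp
  have "pmf (pair_pmf p \<mu>) (k, z) = measure (distr (brw_space p \<mu>) (measure_pmf (pair_pmf p \<mu>)) (\<lambda>\<omega>. \<omega> v)) {(k, z)}"
    unfolding d by (simp add: pmf.rep_eq)
  also have "\<dots> = measure (brw_space p \<mu>) {\<omega>. \<omega> v = (k, z)}"
    by (subst measure_distr[OF m]) (auto simp: vimage_def)
  finally show ?thesis by (simp add: pmf_pair)
qed

lemma tree_prod_measurable [measurable]: "tree_prod \<Theta> n x \<in> borel_measurable (brw_space p \<mu>)"
proof (induction n arbitrary: x)
  case (Suc n)
  have step: "(\<lambda>\<omega>. tree_prod \<Theta> n (x + snd (subtree i \<omega> [])) (subtree i \<omega>)) \<in> borel_measurable (brw_space p \<mu>)" for i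
  proof -
    have "(\<lambda>\<omega>. tree_prod \<Theta> n (x + snd (\<omega> [])) \<omega>) \<in> borel_measurable (brw_space p \<mu>)"
      by (rule measurable_compose_countable[where f = "\<lambda>z \<omega>. tree_prod \<Theta> n (x + z) \<omega>", OF Suc label_snd_measurable])
    from measurable_compose[OF subtree_measurable this] show ?thesis .
  qed
  have "(\<lambda>\<omega>. \<Prod>i<fst (\<omega> []). tree_prod \<Theta> n (x + snd (subtree i \<omega> [])) (subtree i \<omega>)) \<in> borel_measurable (brw_space p \<mu>)"
    by (rule measurable_compose_countable[where f = "\<lambda>k \<omega>. \<Prod>i<k. tree_prod \<Theta> n (x + snd (subtree i \<omega> [])) (subtree i \<omega>)" , OF _ label_fst_measurable])
       (use step in measurable)
  moreover have "tree_prod \<Theta> (Suc n) x = (\<lambda>\<omega>. \<Theta> x * (\<Prod>i<fst (\<omega> []). tree_prod \<Theta> n (x + snd (subtree i \<omega> [])) (subtree i \<omega>)))"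
    by (rule ext) simp
  ultimately show ?case by simp
next
  case 0
  have "tree_prod \<Theta> 0 x = (\<lambda>\<omega>. \<Theta> x)" by (rule ext) simp
  then show ?case by simp
qed

lemma tree_prod_01: "(\<And>x. 0 \<le> \<Theta> x \<and> \<Theta> x \<le> 1) \<Longrightarrow> 0 \<le> tree_prod \<Theta> n x \<omega> \<and> tree_prod \<Theta> n x \<omega> \<le> 1"
proof (induction n arbitrary: x \<omega>)
  case (Suc n)
  have "0 \<le> (\<Prod>i<fst (\<omega> []). tree_prod \<Theta> n (x + snd (subtree i \<omega> [])) (subtree i \<omega>))"
    using Suc by (intro prod_nonneg) blast
  moreover have "(\<Prod>i<fst (\<omega> []). tree_prod \<Theta> n (x + snd (subtree i \<omega> [])) (subtree i \<omega>)) \<le> 1"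
    using Suc by (intro prod_le_1) blast
  ultimately show ?case using Suc.prems by (simp add: mult_le_one)
qed simp

text \<open>
  The label of the root and the subtrees of its children depend on disjoint sets of labels, hence are
  independent.
\<close>

lemma expectation_root_subtrees:
  fixes G :: "'d::finite brw_sample \<Rightarrow> real"
  assumes Gm [measurable]: "G \<in> borel_measurable (brw_space p \<mu>)" and G01: "\<And>\<omega>. 0 \<le> G \<omega> \<and> G \<omega> \<le> 1"
  shows "(\<integral>\<omega>. indicator {\<omega>. \<omega> [] = (k, z)} \<omega> * (\<Prod>i<m. G (subtree i \<omega>)) \<partial>brw_space p \<mu>)
    = pmf p k * pmf \<mu> z * (\<integral>\<omega>. G \<omega> \<partial>brw_space p \<mu>) ^ m"
proof -
  define S where "S = measure_pmf (pair_pmf p \<mu>)"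
  define M where "M = brw_space p \<mu>"
  have M: "M = (\<Pi>\<^sub>M v\<in>UNIV. S)" by (simp add: M_def brw_space_def S_def)
  interpret prob_space M unfolding M_def by (rule prob_space_brw)
  have coord: "indep_vars (\<lambda>_. S) (\<lambda>v \<omega>. \<omega> v) UNIV"
  proof (subst indep_vars_iff_distr_eq_PiM)
    show "(\<lambda>\<omega>. \<omega> v) \<in> measurable M S" for v unfolding M by simp
    have "distr M S (\<lambda>\<omega>. \<omega> v) = S" for v
      unfolding M by (rule distr_PiM_component) (auto simp: S_def measure_pmf.prob_space_axioms)
    moreover have "distr M M (\<lambda>x. x) = M" by (rule distr_id)
    ultimately show "distr M (Pi\<^sub>M UNIV (\<lambda>i. S)) (\<lambda>x. \<lambda>i\<in>UNIV. x i) = Pi\<^sub>M UNIV (\<lambda>i. distr M S (\<lambda>x. x i))"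
      by (simp add: M[symmetric] restrict_def)
  qed simp
  \<comment> \<open>the label of the root, followed by the labels in the subtree of each child\<close>
  define blk where "blk j = (case j of 0 \<Rightarrow> {[]} | Suc i \<Rightarrow> (\<lambda>v. v @ [i]) ` (UNIV :: nat list set))" for j
  have disj: "disjoint_family_on blk {..m}"
    by (auto simp: disjoint_family_on_def blk_def split: nat.splits)
  have ind: "indep_vars (\<lambda>j. PiM (blk j) (\<lambda>_. S)) (\<lambda>j \<omega>. restrict (\<lambda>v. \<omega> v) (blk j)) {..m}"
    by (rule indep_vars_restrict[OF coord _ disj]) simp
  define Y where "Y j w = (case j of 0 \<Rightarrow> indicator {(k, z)} (w []) | Suc i \<Rightarrow> G (\<lambda>v. w (v @ [i])))" for j and w :: "'d brw_sample"
  have Ym: "Y j \<in> borel_measurable (PiM (blk j) (\<lambda>_. S))" for j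
  proof (cases j)
    case 0
    have "(\<lambda>w. w []) \<in> measurable (PiM {[]} (\<lambda>_. S)) S"
      by (rule measurable_component_singleton) simp
    then have "(\<lambda>w. indicator {(k, z)} (w []) :: real) \<in> borel_measurable (PiM {[]} (\<lambda>_. S))"
      by (rule measurable_compose) (simp add: S_def)
    then show ?thesis by (simp add: 0 Y_def[abs_def] blk_def)
  next
    case (Suc i)
    have "(\<lambda>w. \<lambda>v. w (v @ [i])) \<in> measurable (PiM (blk j) (\<lambda>_. S)) M"
      unfolding M by (rule measurable_PiM_single', rule measurable_component_singleton) (auto simp: Suc blk_def S_def space_PiM)
    from measurable_compose[OF this Gm[folded M_def]] show ?thesis by (simp add: Suc Y_def[abs_def])
  qed
  have ind2: "indep_vars (\<lambda>_. borel) (\<lambda>j \<omega>. Y j (restrict \<omega> (blk j))) {..m}"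
    using indep_vars_compose2[OF ind Ym] by simp
  have Y0: "Y 0 (restrict \<omega> (blk 0)) = indicator {\<omega>. \<omega> [] = (k, z)} \<omega>" for \<omega>
    by (simp add: Y_def blk_def indicator_def)
  have YS: "Y (Suc i) (restrict \<omega> (blk (Suc i))) = G (subtree i \<omega>)" for i \<omega>
    by (simp add: Y_def blk_def subtree_def)
  have Yint: "integrable M (\<lambda>\<omega>. Y j (restrict \<omega> (blk j)))" for j
  proof (rule integrable_const_bound[of _ 1])
    show "(\<lambda>\<omega>. Y j (restrict \<omega> (blk j))) \<in> borel_measurable M"
      unfolding M by (rule measurable_compose[OF measurable_restrict_subset Ym]) simp
    show "AE \<omega> in M. norm (Y j (restrict \<omega> (blk j))) \<le> 1"
      using G01 by (intro AE_I2) (auto simp: Y_def indicator_def split: nat.splits)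
  qed
  have EG: "(\<integral>\<omega>. G (subtree i \<omega>) \<partial>M) = (\<integral>\<omega>. G \<omega> \<partial>M)" for i
    using integral_distr[OF subtree_measurable Gm, of i] by (simp add: distr_subtree M_def)
  have E0: "(\<integral>\<omega>. indicator {\<omega>. \<omega> [] = (k, z)} \<omega> \<partial>M) = pmf p k * pmf \<mu> z"
    using prob_label[of p \<mu> "[]" k z] by (simp add: M_def)
  have "(\<integral>\<omega>. indicator {\<omega>. \<omega> [] = (k, z)} \<omega> * (\<Prod>i<m. G (subtree i \<omega>)) \<partial>M)
      = (\<integral>\<omega>. (\<Prod>j\<le>m. Y j (restrict \<omega> (blk j))) \<partial>M)"
    by (simp add: prod.atMost_shift Y0 YS)
  also have "\<dots> = (\<Prod>j\<le>m. \<integral>\<omega>. Y j (restrict \<omega> (blk j)) \<partial>M)"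
    by (rule indep_vars_lebesgue_integral[OF _ ind2 Yint]) simp
  also have "\<dots> = pmf p k * pmf \<mu> z * (\<integral>\<omega>. G \<omega> \<partial>M) ^ m"
    unfolding prod.atMost_shift Y0 YS E0 EG by simp
  finally show ?thesis by (simp add: M_def)
qed

lemma AE_root_step: "AE \<omega> in brw_space p \<mu>. snd (\<omega> []) \<in> set_pmf \<mu>"
proof -
  have d: "distr (brw_space p \<mu>) (measure_pmf (pair_pmf p \<mu>)) (\<lambda>\<omega>. \<omega> []) = measure_pmf (pair_pmf p \<mu>)"
    unfolding brw_space_def by (rule distr_PiM_component) (auto simp: measure_pmf.prob_space_axioms)
  have m: "(\<lambda>\<omega>. \<omega> []) \<in> measurable (brw_space p \<mu>) (measure_pmf (pair_pmf p \<mu>))"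
    unfolding brw_space_def by (rule measurable_component_singleton) simp
  have "AE x in measure_pmf (pair_pmf p \<mu>). snd x \<in> set_pmf \<mu>"
    by (auto simp: AE_measure_pmf_iff)
  then have "AE x in distr (brw_space p \<mu>) (measure_pmf (pair_pmf p \<mu>)) (\<lambda>\<omega>. \<omega> []). snd x \<in> set_pmf \<mu>"
    by (simp only: d)
  from AE_distrD[OF m this] show ?thesis .
qed

lemma nn_integral_by_root_step:
  fixes H :: "int ^ 'd::finite \<Rightarrow> 'd brw_sample \<Rightarrow> ennreal"
  assumes fin: "finite (set_pmf \<mu>)" and [measurable]: "\<And>z. H z \<in> borel_measurable (brw_space p \<mu>)"
  shows "(\<integral>\<^sup>+\<omega>. H (snd (\<omega> [])) \<omega> \<partial>brw_space p \<mu>)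
    = (\<Sum>z\<in>set_pmf \<mu>. \<integral>\<^sup>+\<omega>. indicator {\<omega>. snd (\<omega> []) = z} \<omega> * H z \<omega> \<partial>brw_space p \<mu>)"
proof -
  have [measurable]: "(\<lambda>\<omega>. indicator {\<omega>. snd (\<omega> []) = z} \<omega> :: ennreal) \<in> borel_measurable (brw_space p \<mu>)" for z
  proof -
    have "(\<lambda>\<omega>. indicator {z} (snd (\<omega> [])) :: ennreal) \<in> borel_measurable (brw_space p \<mu>)"
      by (rule measurable_compose[OF label_measurable[of "[]"]]) simp
    then show ?thesis by (simp add: indicator_def)
  qed
  have "(\<integral>\<^sup>+\<omega>. H (snd (\<omega> [])) \<omega> \<partial>brw_space p \<mu>)
     = (\<integral>\<^sup>+\<omega>. (\<Sum>z\<in>set_pmf \<mu>. indicator {\<omega>. snd (\<omega> []) = z} \<omega> * H z \<omega>) \<partial>brw_space p \<mu>)"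
    using AE_root_step[where p = p and \<mu> = \<mu>]
  proof (intro nn_integral_cong_AE, eventually_elim)
    case (elim \<omega>)
    have "(\<Sum>z\<in>set_pmf \<mu>. indicator {\<omega>. snd (\<omega> []) = z} \<omega> * H z \<omega>)
        = (\<Sum>z\<in>set_pmf \<mu>. if snd (\<omega> []) = z then H z \<omega> else 0)"
      by (intro sum.cong) (auto simp: indicator_def)
    then show ?case using fin elim by simp
  qed
  also have "\<dots> = (\<Sum>z\<in>set_pmf \<mu>. \<integral>\<^sup>+\<omega>. indicator {\<omega>. snd (\<omega> []) = z} \<omega> * H z \<omega> \<partial>brw_space p \<mu>)"
    by (rule nn_integral_sum) measurable
  finally show ?thesis .
qed

text \<open>
  The jump of the root is not used by \<open>tree_prod\<close>, so it is independent of it.  This has to be proved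
  along with the expectation itself, because in the next generation that jump becomes the displacement of
  the subtree.
\<close>

lemma expectation_tree_prod_step:
  fixes \<mu> :: "(int ^ 'd::finite) pmf"
  assumes fin: "finite (set_pmf \<mu>)" and w: "\<And>x. 0 \<le> \<Theta> x \<and> \<Theta> x \<le> 1"
  shows "(\<integral>\<^sup>+\<omega>. indicator {\<omega>. snd (\<omega> []) = z} \<omega> * ennreal (tree_prod \<Theta> n x \<omega>) \<partial>brw_space p \<mu>)
    = ennreal (pmf \<mu> z * tree_avg p \<mu> \<Theta> n x)"
proof (induction n arbitrary: x z)
  case 0
  have m: "{\<omega>. snd (\<omega> []) = z} \<in> sets (brw_space p \<mu>)" for z :: "int ^ 'd"
    using measurable_sets[OF measurable_compose[OF label_measurable[of "[]"], of snd "count_space UNIV"], of "{z}" p \<mu>]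
    by (simp add: vimage_def)
  have "(\<integral>\<^sup>+\<omega>. indicator {\<omega>. snd (\<omega> []) = z} \<omega> \<partial>brw_space p \<mu>) = ennreal (pmf \<mu> z)"
  proof -
    have d: "distr (brw_space p \<mu>) (measure_pmf (pair_pmf p \<mu>)) (\<lambda>\<omega>. \<omega> []) = measure_pmf (pair_pmf p \<mu>)"
      unfolding brw_space_def by (rule distr_PiM_component) (auto simp: measure_pmf.prob_space_axioms)
    have ml: "(\<lambda>\<omega>. \<omega> []) \<in> measurable (brw_space p \<mu>) (measure_pmf (pair_pmf p \<mu>))"
      unfolding brw_space_def by (rule measurable_component_singleton) simp
    have "emeasure (brw_space p \<mu>) {\<omega>. snd (\<omega> []) = z} = emeasure (distr (brw_space p \<mu>) (measure_pmf (pair_pmf p \<mu>)) (\<lambda>\<omega>. \<omega> [])) {y. snd y = z}"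
      by (subst emeasure_distr[OF ml]) (auto simp: vimage_def)
    also have "\<dots> = emeasure (measure_pmf (map_pmf snd (pair_pmf p \<mu>))) {z}"
      unfolding d by (simp add: vimage_def del: map_snd_pair_pmf)
    also have "\<dots> = ennreal (pmf \<mu> z)" by (simp add: map_snd_pair_pmf emeasure_pmf_single)
    finally show ?thesis using m by simp
  qed
  then show ?case using w m by (simp add: nn_integral_multc ennreal_mult)
next
  case (Suc n)
  define G where "G \<omega> = tree_prod \<Theta> n (x + snd (\<omega> [])) \<omega>" for \<omega> :: "'d brw_sample"
  define E where "E = walk_avg \<mu> (tree_avg p \<mu> \<Theta> n) x"
  have Gm [measurable]: "G \<in> borel_measurable (brw_space p \<mu>)"
    unfolding G_def
    by (rule measurable_compose_countable[where f = "\<lambda>z \<omega>. tree_prod \<Theta> n (x + z) \<omega>" , OF _ label_snd_measurable]) measurable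
  have G01: "0 \<le> G \<omega> \<and> G \<omega> \<le> 1" for \<omega> unfolding G_def by (rule tree_prod_01[OF w])
  have ta: "0 \<le> tree_avg p \<mu> \<Theta> n y \<and> tree_avg p \<mu> \<Theta> n y \<le> 1" for y by (rule tree_avg_bounds[OF fin w])
  have E0: "0 \<le> E" unfolding E_def walk_avg_def using ta by (intro sum_nonneg) auto
  have "E \<le> (\<Sum>z\<in>set_pmf \<mu>. pmf \<mu> z * 1)"
    unfolding E_def walk_avg_def using ta by (intro sum_mono mult_left_mono) auto
  then have E1: "E \<le> 1" using fin by (simp add: sum_pmf_eq_1)
  have "(\<integral>\<^sup>+\<omega>. ennreal (G \<omega>) \<partial>brw_space p \<mu>) = ennreal E"
  proof -
    have "(\<integral>\<^sup>+\<omega>. ennreal (G \<omega>) \<partial>brw_space p \<mu>) = (\<Sum>z\<in>set_pmf \<mu>. ennreal (pmf \<mu> z * tree_avg p \<mu> \<Theta> n (x + z)))"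
      unfolding G_def Suc.IH[symmetric]
      by (rule nn_integral_by_root_step[OF fin, where H = "\<lambda>z \<omega>. ennreal (tree_prod \<Theta> n (x + z) \<omega>)"]) measurable
    also have "\<dots> = ennreal E" unfolding E_def walk_avg_def using ta by (intro sum_ennreal) auto
    finally show ?thesis .
  qed
  then have EG: "(\<integral>\<omega>. G \<omega> \<partial>brw_space p \<mu>) = E"
    using G01 E0 by (subst integral_eq_nn_integral) auto
  have lab [measurable]: "(\<lambda>\<omega>. indicator {\<omega>. \<omega> [] = (k, z)} \<omega> :: real) \<in> borel_measurable (brw_space p \<mu>)" for k
  proof -
    have "(\<lambda>\<omega>. indicator {(k, z)} (\<omega> []) :: real) \<in> borel_measurable (brw_space p \<mu>)"
      by (rule measurable_compose[OF label_measurable[of "[]"]]) simp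
    then show ?thesis by (simp add: indicator_def)
  qed
  have subm [measurable]: "(\<lambda>\<omega>. G (subtree i \<omega>)) \<in> borel_measurable (brw_space p \<mu>)" for i
    by (rule measurable_compose[OF subtree_measurable Gm])
  \<comment> \<open>the contribution of \<open>k\<close> children to the product\<close>
  define R where "R k \<omega> = indicator {\<omega>. \<omega> [] = (k, z)} \<omega> * (\<Prod>i<k. G (subtree i \<omega>))" for k \<omega>
  have Rm [measurable]: "R k \<in> borel_measurable (brw_space p \<mu>)" for k unfolding R_def by measurable
  have R0: "0 \<le> R k \<omega>" for k \<omega> unfolding R_def using G01 by (intro mult_nonneg_nonneg prod_nonneg) auto
  have RI: "(\<integral>\<^sup>+\<omega>. ennreal (R k \<omega>) \<partial>brw_space p \<mu>) = ennreal (pmf p k * pmf \<mu> z * E ^ k)" for k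
  proof -
    interpret prob_space "brw_space p \<mu>" by (rule prob_space_brw)
    have "R k \<omega> \<le> 1" for \<omega>
      unfolding R_def using G01 by (intro mult_le_one prod_le_1 prod_nonneg) (auto simp: indicator_def)
    then have "integrable (brw_space p \<mu>) (R k)"
      using R0 by (intro integrable_const_bound[of _ 1]) auto
    then have "(\<integral>\<^sup>+\<omega>. ennreal (R k \<omega>) \<partial>brw_space p \<mu>) = ennreal (\<integral>\<omega>. R k \<omega> \<partial>brw_space p \<mu>)"
      using R0 by (intro nn_integral_eq_integral) auto
    also have "(\<integral>\<omega>. R k \<omega> \<partial>brw_space p \<mu>) = pmf p k * pmf \<mu> z * E ^ k"
      unfolding R_def expectation_root_subtrees[OF Gm G01] EG ..
    finally show ?thesis .
  qed
  have point: "indicator {\<omega>. snd (\<omega> []) = z} \<omega> * ennreal (tree_prod \<Theta> (Suc n) x \<omega>) = ennreal (\<Theta> x) * (\<Sum>k. ennreal (R k \<omega>))" for \<omega>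
  proof (cases "snd (\<omega> []) = z")
    case True
    define k where "k = fst (\<omega> [])"
    have lk: "\<omega> [] = (k', z) \<longleftrightarrow> k' = k" for k' using True by (auto simp: k_def prod_eq_iff)
    have "(\<Sum>j. ennreal (R j \<omega>)) = (\<Sum>j\<in>{k}. ennreal (R j \<omega>))"
      by (rule suminf_finite) (auto simp: R_def lk)
    also have "\<dots> = ennreal (\<Prod>i<k. G (subtree i \<omega>))" by (simp add: R_def lk)
    finally show ?thesis using True w G01 by (simp add: G_def k_def ennreal_mult' del: snd_conv)
  next
    case False
    then have "\<omega> [] \<noteq> (k, z)" for k by auto
    then have "R k \<omega> = 0" for k by (simp add: R_def)
    then show ?thesis using False by simp
  qed
  have "(\<integral>\<^sup>+\<omega>. indicator {\<omega>. snd (\<omega> []) = z} \<omega> * ennreal (tree_prod \<Theta> (Suc n) x \<omega>) \<partial>brw_space p \<mu>)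
      = ennreal (\<Theta> x) * (\<integral>\<^sup>+\<omega>. (\<Sum>k. ennreal (R k \<omega>)) \<partial>brw_space p \<mu>)"
    unfolding point by (rule nn_integral_cmult) measurable
  also have "(\<integral>\<^sup>+\<omega>. (\<Sum>k. ennreal (R k \<omega>)) \<partial>brw_space p \<mu>) = (\<Sum>k. ennreal (pmf p k * pmf \<mu> z * E ^ k))"
    by (subst nn_integral_suminf) (auto simp: RI)
  also have "\<dots> = ennreal (pmf \<mu> z * gen_fun p E)"
  proof -
    have "(\<lambda>k. pmf \<mu> z * (pmf p k * E ^ k)) sums (pmf \<mu> z * gen_fun p E)"
      by (intro sums_mult gen_fun_sums E0 E1)
    then have s: "(\<lambda>k. pmf p k * pmf \<mu> z * E ^ k) sums (pmf \<mu> z * gen_fun p E)" by (simp add: mult_ac)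
    then show ?thesis using E0 by (subst suminf_ennreal2) (auto simp: sums_iff)
  qed
  also have "ennreal (\<Theta> x) * ennreal (pmf \<mu> z * gen_fun p E) = ennreal (pmf \<mu> z * tree_avg p \<mu> \<Theta> (Suc n) x)"
    using w by (simp add: E_def mult_ac flip: ennreal_mult')
  finally show ?case .
qed

theorem expectation_tree_prod:
  fixes \<mu> :: "(int ^ 'd::finite) pmf"
  assumes fin: "finite (set_pmf \<mu>)" and w: "\<And>x. 0 \<le> \<Theta> x \<and> \<Theta> x \<le> 1"
  shows "(\<integral>\<omega>. tree_prod \<Theta> n x \<omega> \<partial>brw_space p \<mu>) = tree_avg p \<mu> \<Theta> n x"
proof -
  have ta: "0 \<le> tree_avg p \<mu> \<Theta> n x" by (rule conjunct1[OF tree_avg_bounds[OF fin]]) (rule w)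
  have "(\<integral>\<^sup>+\<omega>. ennreal (tree_prod \<Theta> n x \<omega>) \<partial>brw_space p \<mu>)
     = (\<Sum>z\<in>set_pmf \<mu>. ennreal (pmf \<mu> z * tree_avg p \<mu> \<Theta> n x))"
    unfolding expectation_tree_prod_step[OF fin w, symmetric]
    by (rule nn_integral_by_root_step[OF fin, where H = "\<lambda>z \<omega>. ennreal (tree_prod \<Theta> n x \<omega>)"]) measurable
  also have "\<dots> = ennreal (\<Sum>z\<in>set_pmf \<mu>. pmf \<mu> z * tree_avg p \<mu> \<Theta> n x)"
    using ta by (intro sum_ennreal) auto
  also have "(\<Sum>z\<in>set_pmf \<mu>. pmf \<mu> z * tree_avg p \<mu> \<Theta> n x) = tree_avg p \<mu> \<Theta> n x"
    using fin by (simp add: sum_pmf_eq_1 flip: sum_distrib_right)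
  moreover have "0 \<le> tree_prod \<Theta> n x \<omega>" for \<omega> by (rule conjunct1[OF tree_prod_01]) (rule w)
  ultimately show ?thesis using ta by (subst integral_eq_nn_integral) auto
qed

definition tree_upto :: "nat \<Rightarrow> 'd::finite brw_sample \<Rightarrow> nat list set" where
  "tree_upto n \<omega> = {u \<in> tree \<omega>. length u \<le> n}"

lemma tree_append_iff: "v @ [i] \<in> tree \<omega> \<longleftrightarrow> i < fst (\<omega> []) \<and> v \<in> tree (subtree i \<omega>)"
proof (induction v)
  case Nil
  show ?case by (auto intro: tree.intros elim: tree.cases)
next
  case (Cons j v)
  have "(j # v) @ [i] \<in> tree \<omega> \<longleftrightarrow> v @ [i] \<in> tree \<omega> \<and> j < fst (\<omega> (v @ [i]))"
    by (auto intro: tree.intros elim: tree.cases)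
  moreover have "j # v \<in> tree (subtree i \<omega>) \<longleftrightarrow> v \<in> tree (subtree i \<omega>) \<and> j < fst (subtree i \<omega> v)"
    by (auto intro: tree.intros elim: tree.cases)
  ultimately show ?case using Cons by (auto simp: subtree_def)
qed

lemma tree_upto_Suc:
  "tree_upto (Suc n) \<omega> = insert [] (\<Union>i<fst (\<omega> []). (\<lambda>v. v @ [i]) ` tree_upto n (subtree i \<omega>))"
proof (intro equalityI subsetI)
  fix u assume u: "u \<in> tree_upto (Suc n) \<omega>"
  show "u \<in> insert [] (\<Union>i<fst (\<omega> []). (\<lambda>v. v @ [i]) ` tree_upto n (subtree i \<omega>))"
    using u by (cases u rule: rev_cases) (auto simp: tree_upto_def tree_append_iff)
qed (auto simp: tree_upto_def tree_append_iff intro: tree.intros)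

lemma finite_tree_upto: "finite (tree_upto n \<omega>)"
proof (induction n arbitrary: \<omega>)
  case 0
  have "tree_upto 0 \<omega> \<subseteq> {[]}" by (auto simp: tree_upto_def)
  then show ?case by (rule finite_subset) simp
qed (simp add: tree_upto_Suc)

lemma position_append: "position x \<omega> (v @ [i]) = position (x + snd (subtree i \<omega> [])) (subtree i \<omega>) v"
  by (induction v) (simp_all add: subtree_def)

lemma tree_prod_eq: "tree_prod \<Theta> n x \<omega> = (\<Prod>u\<in>tree_upto n \<omega>. \<Theta> (position x \<omega> u))"
proof (induction n arbitrary: x \<omega>)
  case 0
  have "tree_upto 0 \<omega> = {[]}" by (auto simp: tree_upto_def intro: tree.intros)
  then show ?case by simp
next
  case (Suc n)
  have "(\<Prod>u\<in>tree_upto (Suc n) \<omega>. \<Theta> (position x \<omega> u))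
     = \<Theta> x * (\<Prod>u\<in>(\<Union>i<fst (\<omega> []). (\<lambda>v. v @ [i]) ` tree_upto n (subtree i \<omega>)). \<Theta> (position x \<omega> u))"
    unfolding tree_upto_Suc by (subst prod.insert) (auto simp: finite_tree_upto)
  also have "(\<Prod>u\<in>(\<Union>i<fst (\<omega> []). (\<lambda>v. v @ [i]) ` tree_upto n (subtree i \<omega>)). \<Theta> (position x \<omega> u))
     = (\<Prod>i<fst (\<omega> []). \<Prod>u\<in>(\<lambda>v. v @ [i]) ` tree_upto n (subtree i \<omega>). \<Theta> (position x \<omega> u))"
    by (rule prod.UNION_disjoint) (auto simp: finite_tree_upto)
  also have "\<dots> = (\<Prod>i<fst (\<omega> []). tree_prod \<Theta> n (x + snd (subtree i \<omega> [])) (subtree i \<omega>))"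
    by (intro prod.cong refl) (simp add: prod.reindex inj_on_def Suc position_append)
  finally show ?case by simp
qed

definition visits :: "int ^ 'd::finite \<Rightarrow> (int ^ 'd) set \<Rightarrow> 'd brw_sample \<Rightarrow> nat list set" where
  "visits x B \<omega> = {u \<in> tree \<omega>. position x \<omega> u \<in> B}"

lemma occupation_eq: "occupation x B \<omega> = (if finite (visits x B \<omega>) then ennreal (real (card (visits x B \<omega>))) else \<infinity>)"
proof -
  have "occupation x B \<omega> = (\<integral>\<^sup>+u. indicator (visits x B \<omega>) u \<partial>count_space (tree \<omega>))"
    unfolding occupation_def by (intro nn_integral_cong) (auto simp: visits_def indicator_def)
  also have "\<dots> = emeasure (count_space (tree \<omega>)) (visits x B \<omega>)"
    by (intro nn_integral_indicator) (auto simp: visits_def)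
  also have "\<dots> = (if finite (visits x B \<omega>) then ennreal (real (card (visits x B \<omega>))) else \<infinity>)"
    by (subst emeasure_count_space) (auto simp: visits_def ennreal_of_nat_eq_real_of_nat)
  finally show ?thesis .
qed

section \<open>Convergence in law from Laplace transforms\<close>

text \<open>
  The linear span of the monomials on \<open>K\<close>; composed with \<open>exp_coords\<close>, a monomial becomes the integrand of a
  Laplace transform at an integer point.
\<close>

inductive_set exp_poly :: "'i set \<Rightarrow> (('i \<Rightarrow> real) \<Rightarrow> real) set" for K where
  mono: "(\<lambda>w. \<Prod>y\<in>K. w y ^ (m y :: nat)) \<in> exp_poly K"
| add: "f \<in> exp_poly K \<Longrightarrow> g \<in> exp_poly K \<Longrightarrow> (\<lambda>w. f w + g w) \<in> exp_poly K"
| scale: "f \<in> exp_poly K \<Longrightarrow> (\<lambda>w. c * f w) \<in> exp_poly K"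

lemma exp_poly_mult_mono:
  assumes "f \<in> exp_poly K"
  shows "(\<lambda>w. (\<Prod>y\<in>K. w y ^ m y) * f w) \<in> exp_poly K"
  using assms
proof induction
  case (mono m')
  from exp_poly.mono[where K = K and m = "\<lambda>y. m y + m' y"] show ?case
    by (simp only: prod.distrib power_add)
next
  case (add f g)
  from exp_poly.add[OF add.IH] show ?case by (simp add: distrib_left)
next
  case (scale f c)
  from exp_poly.scale[OF scale.IH, of c] show ?case by (simp add: mult.left_commute)
qed

lemma exp_poly_mult:
  assumes "f \<in> exp_poly K" and g: "g \<in> exp_poly K"
  shows "(\<lambda>w. f w * g w) \<in> exp_poly K"
  using assms(1)
proof induction
  case (mono m)
  show ?case by (rule exp_poly_mult_mono[OF g])
next
  case (add f h)
  from exp_poly.add[OF add.IH] show ?case by (simp add: distrib_right)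
next
  case (scale f c)
  from exp_poly.scale[OF scale.IH, of c] show ?case by (simp add: mult.assoc)
qed

lemma continuous_exp_poly: "f \<in> exp_poly K \<Longrightarrow> continuous_on UNIV f"
proof (induction rule: exp_poly.induct)
  case (mono m)
  show ?case by (intro continuous_intros continuous_on_product_coordinates)
qed (auto intro: continuous_intros)

text \<open>
  The cube is embedded in the space of all functions, with value \<open>0\<close> outside \<open>K\<close>, so that it is a compact
  subset of a topological type and the Stone--Weierstrass theorem applies.
\<close>

definition unit_cube :: "'i set \<Rightarrow> ('i \<Rightarrow> real) set" where
  "unit_cube K = {w. \<forall>y. w y \<in> (if y \<in> K then {0..1} else {0})}"

lemma compact_unit_cube: "compact (unit_cube K)"
  for K :: "'i set"
proof -
  have "compactin (product_topology (\<lambda>_::'i. euclidean) UNIV) (\<Pi>\<^sub>E y\<in>UNIV. if y \<in> K then {0..1::real} else {0})"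
    by (subst compactin_PiE) auto
  moreover have "(\<Pi>\<^sub>E y\<in>UNIV. if y \<in> K then {0..1::real} else {0}) = unit_cube K"
    by (simp add: unit_cube_def PiE_UNIV_domain Pi_def)
  ultimately show ?thesis by (simp add: euclidean_product_topology)
qed

lemma exp_poly_dense:
  fixes h :: "('i::countable \<Rightarrow> real) \<Rightarrow> real"
  assumes fin: "finite K" and h: "continuous_on (unit_cube K) h" and \<epsilon>: "0 < \<epsilon>"
  shows "\<exists>g\<in>exp_poly K. \<forall>w\<in>unit_cube K. \<bar>h w - g w\<bar> < \<epsilon>"
proof -
  interpret function_ring_on "exp_poly K" "unit_cube K"
  proof
    show "compact (unit_cube K)" by (rule compact_unit_cube)
    show "continuous_on (unit_cube K) f" if "f \<in> exp_poly K" for f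
      by (rule continuous_on_subset[OF continuous_exp_poly[OF that]]) simp
    show "(\<lambda>w. f w + g w) \<in> exp_poly K" if "f \<in> exp_poly K" "g \<in> exp_poly K" for f g
      by (rule exp_poly.add[OF that])
    show "(\<lambda>w. f w * g w) \<in> exp_poly K" if "f \<in> exp_poly K" "g \<in> exp_poly K" for f g
      by (rule exp_poly_mult[OF that])
    show "(\<lambda>_. c) \<in> exp_poly K" for c
      using exp_poly.scale[OF exp_poly.mono[where K = K and m = "\<lambda>_. 0"], of c] by simp
    fix u v assume uv: "u \<in> unit_cube K" "v \<in> unit_cube K" "u \<noteq> v"
    then obtain y where y: "u y \<noteq> v y" by blast
    have "y \<in> K"
    proof (rule ccontr)
      assume "y \<notin> K"
      then have "u y = 0" "v y = 0" using uv(1,2)[unfolded unit_cube_def mem_Collect_eq, rule_format, of y] by simp_all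
      with y show False by simp
    qed
    have "(\<Prod>x\<in>K. w x ^ (if x = y then 1 else 0)) = w y" for w :: "'i \<Rightarrow> real"
    proof -
      have "(\<Prod>x\<in>K. w x ^ (if x = y then 1 else 0)) = (\<Prod>x\<in>K. if x = y then w y else 1)"
        by (intro prod.cong) auto
      then show ?thesis using fin \<open>y \<in> K\<close> by simp
    qed
    with exp_poly.mono[where K = K and m = "\<lambda>x. if x = y then 1 else 0"]
    have "(\<lambda>w. w y) \<in> exp_poly K" by (simp only:)
    then show "\<exists>f\<in>exp_poly K. f u \<noteq> f v" using y by (intro bexI[where x = "\<lambda>w. w y"])
  qed
  show ?thesis by (rule Stone_Weierstrass_basic[OF h \<epsilon>])
qed

definition exp_coords :: "'i set \<Rightarrow> ('i \<Rightarrow> real) \<Rightarrow> 'i \<Rightarrow> real" where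
  "exp_coords K z = (\<lambda>y. if y \<in> K then exp (- z y) else 0)"

lemma exp_coords_measurable [measurable]:
  "exp_coords K \<in> borel_measurable (\<Pi>\<^sub>M y\<in>K. borel)"
  for K :: "'i::countable set"
proof -
  have "exp_coords K \<in> measurable (\<Pi>\<^sub>M y\<in>K. borel) (\<Pi>\<^sub>M y\<in>UNIV. borel)"
  proof (rule measurable_PiM_single')
    show "(\<lambda>z. exp_coords K z y) \<in> borel_measurable (\<Pi>\<^sub>M y\<in>K. borel)" for y
      by (cases "y \<in> K") (simp_all add: exp_coords_def)
  qed (simp add: PiE_UNIV_domain)
  then show ?thesis by (simp add: sets_PiM_equal_borel cong: measurable_cong_sets)
qed

lemma exp_coords_in_cube: "(\<forall>y\<in>K. 0 \<le> z y) \<Longrightarrow> exp_coords K z \<in> unit_cube K"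
  by (auto simp: exp_coords_def unit_cube_def)

lemma continuous_map_on_all:
  fixes K :: "'i set"
  assumes "continuous_map (product_topology (\<lambda>_. euclideanreal) K) euclideanreal f"
  shows "continuous_on UNIV (\<lambda>w. f (restrict w K))"
proof -
  have "continuous_map euclidean (product_topology (\<lambda>_. euclideanreal) K) (\<lambda>w :: 'i \<Rightarrow> real. restrict w K)"
    unfolding continuous_map_componentwise
    by (auto simp: continuous_on_product_coordinates)
  from continuous_map_compose[OF this assms] show ?thesis by (simp add: o_def)
qed

text \<open>
  Laws of nonnegative vectors indexed by \<open>K\<close>.
\<close>

definition laplace_like :: "'i set \<Rightarrow> ('i \<Rightarrow> real) measure \<Rightarrow> bool" where
  "laplace_like K M \<longleftrightarrow> prob_space M \<and> sets M = sets (\<Pi>\<^sub>M y\<in>K. borel) \<and> (AE z in M. \<forall>y\<in>K. 0 \<le> z y)"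

lemma laplace_like_integrable:
  fixes h :: "('i::countable \<Rightarrow> real) \<Rightarrow> real"
  assumes M: "laplace_like K M" and h: "continuous_on UNIV h"
  shows "integrable M (\<lambda>z. h (exp_coords K z))"
proof -
  interpret prob_space M using M by (simp add: laplace_like_def)
  have sets: "sets M = sets (\<Pi>\<^sub>M y\<in>K. borel)" using M by (simp add: laplace_like_def)
  have "bounded (h ` unit_cube K)"
    by (intro compact_imp_bounded compact_continuous_image compact_unit_cube continuous_on_subset[OF h]) simp
  then obtain B where B: "\<And>w. w \<in> unit_cube K \<Longrightarrow> norm (h w) \<le> B" by (auto simp: bounded_iff)
  have hm: "h \<in> borel_measurable borel" by (rule borel_measurable_continuous_onI[OF h])
  have "exp_coords K \<in> measurable M borel" using exp_coords_measurable[of K] sets by (simp cong: measurable_cong_sets)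
  from measurable_compose[OF this hm] have "(\<lambda>z. h (exp_coords K z)) \<in> borel_measurable M" .
  moreover have "AE z in M. norm (h (exp_coords K z)) \<le> B"
  proof -
    have "AE z in M. \<forall>y\<in>K. 0 \<le> z y" using M by (simp add: laplace_like_def)
    then show ?thesis by eventually_elim (intro B exp_coords_in_cube)
  qed
  ultimately show ?thesis by (intro integrable_const_bound[of _ B]) auto
qed

text \<open>
  Laplace transforms at integer points determine the integrals of polynomials in \<open>exp (- z y)\<close>, which are
  uniformly dense among the continuous functions on the cube.
\<close>

lemma exp_coords_converges:
  fixes K :: "'i::countable set" and N :: "'a \<Rightarrow> ('i \<Rightarrow> real) measure"
  assumes fin: "finite K" and N: "\<forall>\<^sub>F x in F. laplace_like K (N x)" and L: "laplace_like K L"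
    and lap: "\<And>m :: 'i \<Rightarrow> nat. ((\<lambda>x. \<integral>z. exp (- (\<Sum>y\<in>K. real (m y) * z y)) \<partial>N x) \<longlongrightarrow> (\<integral>z. exp (- (\<Sum>y\<in>K. real (m y) * z y)) \<partial>L)) F"
    and h: "continuous_on UNIV (h :: ('i \<Rightarrow> real) \<Rightarrow> real)"
  shows "((\<lambda>x. \<integral>z. h (exp_coords K z) \<partial>N x) \<longlongrightarrow> (\<integral>z. h (exp_coords K z) \<partial>L)) F"
proof -
  have poly: "((\<lambda>x. \<integral>z. g (exp_coords K z) \<partial>N x) \<longlongrightarrow> (\<integral>z. g (exp_coords K z) \<partial>L)) F" if "g \<in> exp_poly K" for g
    using that
  proof induction
    case (mono m)
    have "(\<Prod>y\<in>K. exp_coords K z y ^ m y) = exp (- (\<Sum>y\<in>K. real (m y) * z y))" for z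
    proof -
      have "(\<Prod>y\<in>K. exp_coords K z y ^ m y) = (\<Prod>y\<in>K. exp (- (real (m y) * z y)))"
        by (intro prod.cong) (auto simp: exp_coords_def simp flip: exp_of_nat_mult)
      also have "\<dots> = exp (\<Sum>y\<in>K. - (real (m y) * z y))" using fin by (simp add: exp_sum)
      finally show ?thesis by (simp add: sum_negf)
    qed
    then show ?case using lap[of m] by simp
  next
    case (add f g)
    have "(\<integral>z. f (exp_coords K z) + g (exp_coords K z) \<partial>M) = (\<integral>z. f (exp_coords K z) \<partial>M) + (\<integral>z. g (exp_coords K z) \<partial>M)"
      if "laplace_like K M" for M
      by (intro Bochner_Integration.integral_add laplace_like_integrable[OF that] continuous_exp_poly[OF add.hyps(1)] continuous_exp_poly[OF add.hyps(2)])
    note sum = this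
    have "\<forall>\<^sub>F x in F. (\<integral>z. f (exp_coords K z) \<partial>N x) + (\<integral>z. g (exp_coords K z) \<partial>N x) = (\<integral>z. f (exp_coords K z) + g (exp_coords K z) \<partial>N x)"
      using N by (rule eventually_mono) (simp only: sum)
    then show ?case unfolding sum[OF L] by (rule Lim_transform_eventually[OF tendsto_add[OF add.IH]])
  next
    case (scale f c)
    then show ?case by (auto intro: tendsto_intros)
  qed
  have diff: "\<bar>(\<integral>z. h (exp_coords K z) \<partial>M) - (\<integral>z. g (exp_coords K z) \<partial>M)\<bar> \<le> \<epsilon>"
    if M: "laplace_like K M" and g: "g \<in> exp_poly K" "\<forall>w\<in>unit_cube K. \<bar>h w - g w\<bar> < \<epsilon>" for M g \<epsilon>
  proof -
    interpret prob_space M using M by (simp add: laplace_like_def)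
    have hi: "integrable M (\<lambda>z. h (exp_coords K z))" by (rule laplace_like_integrable[OF M h])
    have gi: "integrable M (\<lambda>z. g (exp_coords K z))" by (rule laplace_like_integrable[OF M continuous_exp_poly[OF g(1)]])
    have "(\<integral>z. h (exp_coords K z) \<partial>M) - (\<integral>z. g (exp_coords K z) \<partial>M) = (\<integral>z. h (exp_coords K z) - g (exp_coords K z) \<partial>M)"
      by (rule Bochner_Integration.integral_diff[OF hi gi, symmetric])
    also have "\<bar>\<dots>\<bar> \<le> (\<integral>z. \<bar>h (exp_coords K z) - g (exp_coords K z)\<bar> \<partial>M)"
      by (rule integral_abs_bound)
    also have "\<dots> \<le> (\<integral>z. \<epsilon> \<partial>M)"
    proof (rule integral_mono_AE)
      show "AE z in M. \<bar>h (exp_coords K z) - g (exp_coords K z)\<bar> \<le> \<epsilon>"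
      proof -
        have "AE z in M. \<forall>y\<in>K. 0 \<le> z y" using M by (simp add: laplace_like_def)
        then show ?thesis by eventually_elim (use g(2) exp_coords_in_cube in \<open>blast intro: less_imp_le\<close>)
      qed
    qed (use hi gi in auto)
    finally show ?thesis by (simp add: prob_space)
  qed
  show ?thesis
  proof (rule tendstoI)
    fix \<epsilon> :: real assume "0 < \<epsilon>"
    then obtain g where g: "g \<in> exp_poly K" "\<forall>w\<in>unit_cube K. \<bar>h w - g w\<bar> < \<epsilon> / 4"
      using exp_poly_dense[OF fin continuous_on_subset[OF h], of "\<epsilon> / 4"] by auto
    have "\<forall>\<^sub>F x in F. dist (\<integral>z. g (exp_coords K z) \<partial>N x) (\<integral>z. g (exp_coords K z) \<partial>L) < \<epsilon> / 4"
      using poly[OF g(1)] \<open>0 < \<epsilon>\<close> by (intro tendstoD) auto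
    with N show "\<forall>\<^sub>F x in F. dist (\<integral>z. h (exp_coords K z) \<partial>N x) (\<integral>z. h (exp_coords K z) \<partial>L) < \<epsilon>"
    proof eventually_elim
      case (elim x)
      then show ?case using diff[OF elim(1) g] diff[OF L g] \<open>0 < \<epsilon>\<close> unfolding dist_real_def by linarith
    qed
  qed
qed

text \<open>
  A bounded continuous function \<open>f\<close> of \<open>z\<close> is a continuous function of \<open>exp (- z)\<close> only away from the faces
  of the cube where a coordinate vanishes.  Multiplying \<open>f\<close> by a cutoff near these faces reduces to
  \<open>exp_coords_converges\<close>.  The error is controlled by the integral of one minus the cutoff, which is small
  for the limit law and, since the cutoff is itself a continuous function on the cube, also for the
  approximating laws: tightness comes for free.
\<close>

theorem law_from_laplace:
  fixes K :: "'i::countable set" and N :: "'a \<Rightarrow> ('i \<Rightarrow> real) measure"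
  assumes fin: "finite K" and N: "\<forall>\<^sub>F x in F. laplace_like K (N x)" and L: "laplace_like K L"
    and lap: "\<And>m :: 'i \<Rightarrow> nat. ((\<lambda>x. \<integral>z. exp (- (\<Sum>y\<in>K. real (m y) * z y)) \<partial>N x) \<longlongrightarrow> (\<integral>z. exp (- (\<Sum>y\<in>K. real (m y) * z y)) \<partial>L)) F"
  shows "converges_in_law (product_topology (\<lambda>_. euclideanreal) K) N L F"
  unfolding converges_in_law_def
proof (intro allI impI, elim conjE)
  fix f :: "('i \<Rightarrow> real) \<Rightarrow> real"
  assume f: "continuous_map (product_topology (\<lambda>_. euclideanreal) K) euclideanreal f"
    and bdd: "bounded (f ` topspace (product_topology (\<lambda>_. euclideanreal) K))"
  obtain B where "\<forall>v\<in>f ` topspace (product_topology (\<lambda>_. euclideanreal) K). norm v \<le> B"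
    using bdd unfolding bounded_iff by (elim exE)
  then have B0: "\<bar>f z\<bar> \<le> B" if "z \<in> (\<Pi>\<^sub>E y\<in>K. UNIV)" for z
    using that by (simp add: topspace_product_topology)
  define B' where "B' = max B 1"
  have B: "\<bar>f z\<bar> \<le> B'" if "z \<in> (\<Pi>\<^sub>E y\<in>K. UNIV)" for z using B0[OF that] by (simp add: B'_def)
  have B'0: "0 < B'" by (simp add: B'_def)
  have fc: "continuous_on UNIV (\<lambda>w. f (restrict w K))" by (rule continuous_map_on_all[OF f])
  \<comment> \<open>zero where a coordinate is below \<open>1 / n\<close>, and tending to one where all coordinates are positive\<close>
  define cut where "cut n w = (\<Prod>y\<in>K. max 0 (min 1 (real n * w y - 1)))" for n :: nat and w :: "'i \<Rightarrow> real"
  \<comment> \<open>recovers \<open>z\<close> from \<open>exp (- z)\<close> where the cutoff is nonzero; capped to be continuous on the whole space\<close>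
  define zz where "zz n w = (\<lambda>y. - ln (max (w y) (1 / real (Suc n))))" for n :: nat and w :: "'i \<Rightarrow> real"
  have coord: "continuous_on UNIV (\<lambda>w :: 'i \<Rightarrow> real. w y)" for y by (rule continuous_on_product_coordinates)
  have cut_c: "continuous_on UNIV (cut n)" for n
    unfolding cut_def by (intro continuous_intros coord)
  have cut01: "0 \<le> cut n w \<and> cut n w \<le> 1" for n w
    unfolding cut_def by (auto intro!: prod_nonneg prod_le_1)
  have zz_c: "continuous_on UNIV (zz n)" for n
    unfolding zz_def by (intro continuous_on_coordinatewise_then_product continuous_intros coord) (auto simp: max_def)
  define h where "h n w = f (restrict (zz n w) K) * cut n w" for n w
  have h_c: "continuous_on UNIV (h n)" for n
    unfolding h_def by (intro continuous_intros cut_c continuous_on_compose2[OF fc zz_c]) auto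
  have h_eq: "h n (exp_coords K z) = f z * cut n (exp_coords K z)" if z: "z \<in> (\<Pi>\<^sub>E y\<in>K. UNIV)" for n z
  proof (cases "\<forall>y\<in>K. 1 / real (Suc n) \<le> exp (- z y)")
    case True
    have "restrict (zz n (exp_coords K z)) K = z"
    proof (rule ext)
      fix y
      show "restrict (zz n (exp_coords K z)) K y = z y"
        using z True by (cases "y \<in> K") (auto simp: zz_def exp_coords_def PiE_def extensional_def max_absorb1)
    qed
    then show ?thesis by (simp add: h_def)
  next
    case False
    then obtain y where y: "y \<in> K" "exp (- z y) < 1 / real (Suc n)" by (auto simp: not_le)
    then have "real (Suc n) * exp (- z y) < 1" by (simp add: field_simps)
    then have "real n * exp (- z y) - 1 \<le> 0"
      by (simp add: distrib_right)
         (use exp_gt_zero[of "- z y"] in linarith)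
    then have "cut n (exp_coords K z) = 0"
      unfolding cut_def using fin y(1) by (auto simp: exp_coords_def intro!: bexI[of _ y])
    then show ?thesis by (simp add: h_def)
  qed
  have space: "space M = (\<Pi>\<^sub>E y\<in>K. UNIV)" if "laplace_like K M" for M
    using that sets_eq_imp_space_eq[of M] by (auto simp: laplace_like_def space_PiM)
  have fint: "integrable M f" if M: "laplace_like K M" for M
  proof -
    interpret prob_space M using M by (simp add: laplace_like_def)
    have sets: "sets M = sets (\<Pi>\<^sub>M y\<in>K. borel)" using M by (simp add: laplace_like_def)
    define ext where "ext z = (\<lambda>y. if y \<in> K then z y else 0)" for z :: "'i \<Rightarrow> real"
    have "ext \<in> measurable (\<Pi>\<^sub>M y\<in>K. borel) (\<Pi>\<^sub>M y\<in>UNIV. borel)"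
    proof (rule measurable_PiM_single')
      show "(\<lambda>z. ext z y) \<in> borel_measurable (\<Pi>\<^sub>M y\<in>K. borel)" for y
        by (cases "y \<in> K") (simp_all add: ext_def)
    qed (simp add: PiE_UNIV_domain)
    then have "ext \<in> measurable M borel" using sets by (simp add: sets_PiM_equal_borel cong: measurable_cong_sets)
    from measurable_compose[OF this borel_measurable_continuous_onI[OF fc]]
    have "(\<lambda>z. f (restrict (ext z) K)) \<in> borel_measurable M" .
    moreover have "f (restrict (ext z) K) = f z" if "z \<in> space M" for z
    proof -
      have "restrict (ext z) K = z" using that space[OF M] by (auto simp: fun_eq_iff ext_def PiE_def extensional_def)
      then show ?thesis by simp
    qed
    ultimately have "f \<in> borel_measurable M" by (simp cong: measurable_cong)
    then show ?thesis by (intro integrable_const_bound[of _ B']) (use B space[OF M] in auto)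
  qed
  have err: "\<bar>(\<integral>z. f z \<partial>M) - (\<integral>z. h n (exp_coords K z) \<partial>M)\<bar> \<le> B' * (1 - (\<integral>z. cut n (exp_coords K z) \<partial>M))"
    if M: "laplace_like K M" for M n
  proof -
    interpret prob_space M using M by (simp add: laplace_like_def)
    have hi: "integrable M (\<lambda>z. h n (exp_coords K z))" and ci: "integrable M (\<lambda>z. cut n (exp_coords K z))"
      by (rule laplace_like_integrable[OF M h_c], rule laplace_like_integrable[OF M cut_c])
    have "(\<integral>z. f z \<partial>M) - (\<integral>z. h n (exp_coords K z) \<partial>M) = (\<integral>z. f z - h n (exp_coords K z) \<partial>M)"
      by (rule Bochner_Integration.integral_diff[OF fint[OF M] hi, symmetric])
    also have "\<bar>\<dots>\<bar> \<le> (\<integral>z. \<bar>f z - h n (exp_coords K z)\<bar> \<partial>M)" by (rule integral_abs_bound)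
    also have "\<dots> \<le> (\<integral>z. B' * (1 - cut n (exp_coords K z)) \<partial>M)"
    proof (rule integral_mono)
      fix z assume "z \<in> space M"
      then have z: "z \<in> (\<Pi>\<^sub>E y\<in>K. UNIV)" using space[OF M] by simp
      have "f z - h n (exp_coords K z) = f z * (1 - cut n (exp_coords K z))"
        by (simp add: h_eq[OF z] algebra_simps)
      then show "\<bar>f z - h n (exp_coords K z)\<bar> \<le> B' * (1 - cut n (exp_coords K z))"
        using B[OF z] cut01[of n "exp_coords K z"] by (simp add: abs_mult mult_right_mono)
    qed (use fint[OF M] hi ci in auto)
    also have "\<dots> = B' * (1 - (\<integral>z. cut n (exp_coords K z) \<partial>M))" using ci by (simp add: prob_space)
    finally show ?thesis .
  qed
  have cut_lim: "(\<lambda>n. \<integral>z. cut n (exp_coords K z) \<partial>L) \<longlonglongrightarrow> 1"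
  proof -
    interpret prob_space L using L by (simp add: laplace_like_def)
    have "(\<lambda>n. \<integral>z. cut n (exp_coords K z) \<partial>L) \<longlonglongrightarrow> (\<integral>z. 1 \<partial>L)"
    proof (rule integral_dominated_convergence[where w = "\<lambda>_. 1"])
      show "(\<lambda>z. cut n (exp_coords K z)) \<in> borel_measurable L" for n
        using laplace_like_integrable[OF L cut_c] by auto
      show "AE z in L. (\<lambda>n. cut n (exp_coords K z)) \<longlonglongrightarrow> 1"
      proof (intro AE_I2)
        fix z :: "'i \<Rightarrow> real"
        have one: "(\<lambda>n. max 0 (min 1 (real n * exp (- z y) - 1))) \<longlonglongrightarrow> 1" for y
        proof (rule tendsto_eventually)
          have "filterlim (\<lambda>n. real n * exp (- z y)) at_top sequentially"
            by (rule filterlim_at_top_mult_tendsto_pos[OF tendsto_const _ filterlim_real_sequentially]) simp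
          then have "\<forall>\<^sub>F n in sequentially. 2 \<le> real n * exp (- z y)" by (simp add: filterlim_at_top)
          then show "\<forall>\<^sub>F n in sequentially. max 0 (min 1 (real n * exp (- z y) - 1)) = 1"
            by eventually_elim auto
        qed
        have "(\<lambda>n. \<Prod>y\<in>K. max 0 (min 1 (real n * exp (- z y) - 1))) \<longlonglongrightarrow> (\<Prod>y\<in>K. 1)"
          by (intro tendsto_prod one)
        moreover have "cut n (exp_coords K z) = (\<Prod>y\<in>K. max 0 (min 1 (real n * exp (- z y) - 1)))" for n
          unfolding cut_def by (intro prod.cong) (auto simp: exp_coords_def)
        ultimately show "(\<lambda>n. cut n (exp_coords K z)) \<longlonglongrightarrow> 1" by simp
      qed
    qed (use cut01 in auto)
    then show ?thesis by (simp add: prob_space)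
  qed
  show "((\<lambda>x. \<integral>z. f z \<partial>N x) \<longlongrightarrow> (\<integral>z. f z \<partial>L)) F"
  proof (rule tendstoI)
    fix \<epsilon> :: real assume \<epsilon>: "0 < \<epsilon>"
    define \<delta> where "\<delta> = \<epsilon> / (8 * B')"
    have \<delta>: "0 < \<delta>" "B' * \<delta> = \<epsilon> / 8" using \<epsilon> B'0 by (auto simp: \<delta>_def)
    have "\<forall>\<^sub>F n in sequentially. 1 - \<delta> < (\<integral>z. cut n (exp_coords K z) \<partial>L)"
      using cut_lim \<delta> by (intro order_tendstoD) auto
    then obtain n where n: "1 - \<delta> < (\<integral>z. cut n (exp_coords K z) \<partial>L)" by (auto simp: eventually_sequentially)
    note conv = exp_coords_converges[OF fin N L lap]
    have "\<forall>\<^sub>F x in F. 1 - \<delta> < (\<integral>z. cut n (exp_coords K z) \<partial>N x)"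
      using conv[OF cut_c] n by (rule order_tendstoD)
    moreover have "\<forall>\<^sub>F x in F. dist (\<integral>z. h n (exp_coords K z) \<partial>N x) (\<integral>z. h n (exp_coords K z) \<partial>L) < \<epsilon> / 8"
      using conv[OF h_c] \<epsilon> by (intro tendstoD) auto
    ultimately show "\<forall>\<^sub>F x in F. dist (\<integral>z. f z \<partial>N x) (\<integral>z. f z \<partial>L) < \<epsilon>"
      using N
    proof eventually_elim
      case (elim x)
      have "B' * (1 - (\<integral>z. cut n (exp_coords K z) \<partial>N x)) \<le> B' * \<delta>"
        using elim(1) B'0 by (intro mult_left_mono) auto
      moreover have "B' * (1 - (\<integral>z. cut n (exp_coords K z) \<partial>L)) \<le> B' * \<delta>"
        using n B'0 by (intro mult_left_mono) auto
      ultimately show ?case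
        using err[OF elim(3), of n] err[OF L, of n] elim(2) \<delta>(2) \<epsilon> unfolding dist_real_def by linarith
    qed
  qed
qed

section \<open>Occupation times conditioned on a visit\<close>

lemma tree_measurable: "{\<omega>. u \<in> tree \<omega>} \<in> sets (brw_space p \<mu>)"
proof (induction u)
  case Nil
  have "{\<omega> :: 'a brw_sample. [] \<in> tree \<omega>} = space (brw_space p \<mu>)" by (auto intro: tree.intros)
  then show ?case by (simp only: sets.top)
next
  case (Cons i v)
  have "{\<omega>. i < fst (\<omega> v)} \<in> sets (brw_space p \<mu>)"
    using measurable_sets[OF label_fst_measurable[of v], of "{i<..}" p \<mu>] by (simp add: vimage_def)
  moreover have "{\<omega> :: 'a brw_sample. i # v \<in> tree \<omega>} = {\<omega>. v \<in> tree \<omega>} \<inter> {\<omega>. i < fst (\<omega> v)}"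
    by (auto intro: tree.intros elim: tree.cases)
  ultimately show ?case using Cons by auto
qed

lemma position_measurable: "(\<lambda>\<omega>. position x \<omega> u) \<in> measurable (brw_space p \<mu>) (count_space UNIV)"
proof (induction u)
  case (Cons i v)
  have "(\<lambda>\<omega>. position x \<omega> v + z) \<in> measurable (brw_space p \<mu>) (count_space UNIV)" for z
    by (rule measurable_compose[OF Cons]) simp
  then have "(\<lambda>\<omega>. position x \<omega> v + snd (\<omega> (i # v))) \<in> measurable (brw_space p \<mu>) (count_space UNIV)"
    by (rule measurable_compose_countable[where f = "\<lambda>z \<omega>. position x \<omega> v + z"]) (rule label_snd_measurable)
  then show ?case by simp
qed simp

lemma occupation_measurable [measurable]: "occupation x B \<in> borel_measurable (brw_space p \<mu>)"
proof -
  interpret labels: sigma_finite_measure "count_space (UNIV :: nat list set)"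
    by (rule sigma_finite_measure_count_space)
  have visit: "{\<omega>. u \<in> visits x B \<omega>} \<in> sets (brw_space p \<mu>)" for u
  proof -
    have "{\<omega>. u \<in> visits x B \<omega>} = {\<omega>. u \<in> tree \<omega>} \<inter> {\<omega>. position x \<omega> u \<in> B}"
      by (auto simp: visits_def)
    moreover have "{\<omega>. position x \<omega> u \<in> B} \<in> sets (brw_space p \<mu>)"
      using measurable_sets[OF position_measurable[of x u], of B p \<mu>] by (simp add: vimage_def)
    ultimately show ?thesis using tree_measurable[of u] by auto
  qed
  have "(\<lambda>\<omega>. \<integral>\<^sup>+u. indicator (visits x B \<omega>) u \<partial>count_space UNIV) \<in> borel_measurable (brw_space p \<mu>)"
  proof (rule labels.borel_measurable_nn_integral)
    have "(\<lambda>\<omega>. indicator (visits x B \<omega>) u :: ennreal) \<in> borel_measurable (brw_space p \<mu>)" for u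
    proof -
      have "(\<lambda>\<omega>. indicator (visits x B \<omega>) u :: ennreal) = indicator {\<omega>. u \<in> visits x B \<omega>}"
        by (auto simp: indicator_def)
      then show ?thesis using visit[of u] by simp
    qed
    then have "(\<lambda>z. indicator (visits x B (snd z)) (fst z) :: ennreal) \<in> borel_measurable (count_space UNIV \<Otimes>\<^sub>M brw_space p \<mu>)"
      by (intro measurable_pair_measure_countable1) auto
    from measurable_compose[OF measurable_pair_swap' this]
    show "(\<lambda>(\<omega>, u). indicator (visits x B \<omega>) u :: ennreal) \<in> borel_measurable (brw_space p \<mu> \<Otimes>\<^sub>M count_space UNIV)"
      by (simp add: case_prod_beta)
  qed
  moreover have "(\<integral>\<^sup>+u. indicator (visits x B \<omega>) u \<partial>count_space UNIV) = occupation x B \<omega>" for \<omega>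
    by (simp add: occupation_eq emeasure_count_space ennreal_of_nat_eq_real_of_nat)
  ultimately show ?thesis by simp
qed

lemma visits_nonempty_iff: "1 \<le> occupation x B \<omega> \<longleftrightarrow> visits x B \<omega> \<noteq> {}"
proof (cases "finite (visits x B \<omega>)")
  case True
  then have "1 \<le> occupation x B \<omega> \<longleftrightarrow> 1 \<le> real (card (visits x B \<omega>))"
    by (simp add: occupation_eq flip: ennreal_1)
  also have "\<dots> \<longleftrightarrow> visits x B \<omega> \<noteq> {}" using True card_gt_0_iff[of "visits x B \<omega>"] by linarith
  finally show ?thesis .
qed (auto simp: occupation_eq)

lemma finite_subset_tree_upto:
  assumes "finite F" "F \<subseteq> tree \<omega>"
  shows "\<forall>\<^sub>F n in sequentially. F \<subseteq> tree_upto n \<omega>"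
proof -
  have "F \<subseteq> tree_upto n \<omega>" if "Max (insert 0 (length ` F)) \<le> n" for n
    using that assms by (auto simp: tree_upto_def)
  then show ?thesis by (rule eventually_sequentiallyI)
qed

lemma visits_upto_subset: "tree_upto n \<omega> \<inter> visits x B \<omega> = {u \<in> tree_upto n \<omega>. position x \<omega> u \<in> B}"
  by (auto simp: visits_def tree_upto_def)

lemma tree_prod_restrict:
  assumes "\<And>y. y \<notin> K \<Longrightarrow> \<Theta> y = 1"
  shows "tree_prod \<Theta> n x \<omega> = (\<Prod>u\<in>tree_upto n \<omega> \<inter> visits x K \<omega>. \<Theta> (position x \<omega> u))"
  unfolding tree_prod_eq visits_upto_subset
  using assms by (intro prod.mono_neutral_right) (auto simp: finite_tree_upto)

lemma tree_prod_stabilises: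
  assumes "\<And>y. y \<notin> K \<Longrightarrow> \<Theta> y = 1" and fin: "finite (visits x K \<omega>)"
  shows "(\<lambda>n. tree_prod \<Theta> n x \<omega>) \<longlonglongrightarrow> (\<Prod>u\<in>visits x K \<omega>. \<Theta> (position x \<omega> u))"
proof (rule tendsto_eventually)
  have "visits x K \<omega> \<subseteq> tree \<omega>" by (auto simp: visits_def)
  from finite_subset_tree_upto[OF fin this]
  show "\<forall>\<^sub>F n in sequentially. tree_prod \<Theta> n x \<omega> = (\<Prod>u\<in>visits x K \<omega>. \<Theta> (position x \<omega> u))"
    by eventually_elim (simp add: tree_prod_restrict[where K = K, OF assms(1)] Int_absorb1)
qed

lemma tree_prod_infinite_visits:
  assumes \<Theta>: "\<And>y. y \<in> K \<Longrightarrow> \<Theta> y = r" "\<And>y. y \<notin> K \<Longrightarrow> \<Theta> y = 1" and r: "0 \<le> r" "r < 1"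
    and inf: "infinite (visits x K \<omega>)"
  shows "(\<lambda>n. tree_prod \<Theta> n x \<omega>) \<longlonglongrightarrow> 0"
proof -
  have "filterlim (\<lambda>n. card (tree_upto n \<omega> \<inter> visits x K \<omega>)) at_top sequentially"
    unfolding filterlim_at_top
  proof
    fix m
    obtain F where F: "F \<subseteq> visits x K \<omega>" "finite F" "card F = m"
      using infinite_arbitrarily_large[OF inf, of m] by auto
    have "F \<subseteq> tree \<omega>" using F(1) by (auto simp: visits_def)
    from finite_subset_tree_upto[OF F(2) this]
    show "\<forall>\<^sub>F n in sequentially. m \<le> card (tree_upto n \<omega> \<inter> visits x K \<omega>)"
    proof eventually_elim
      case (elim n)
      then show ?case using F card_mono[of "tree_upto n \<omega> \<inter> visits x K \<omega>" F] by (simp add: finite_tree_upto)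
    qed
  qed
  from filterlim_compose[OF LIMSEQ_power_zero this, of r]
  have "(\<lambda>n. r ^ card (tree_upto n \<omega> \<inter> visits x K \<omega>)) \<longlonglongrightarrow> 0" using r by simp
  moreover have "tree_prod \<Theta> n x \<omega> = r ^ card (tree_upto n \<omega> \<inter> visits x K \<omega>)" for n
  proof -
    have "(\<Prod>u\<in>tree_upto n \<omega> \<inter> visits x K \<omega>. \<Theta> (position x \<omega> u)) = (\<Prod>u\<in>tree_upto n \<omega> \<inter> visits x K \<omega>. r)"
      by (intro prod.cong) (auto simp: visits_def \<Theta>)
    then show ?thesis by (simp add: tree_prod_restrict[where K = K, OF \<Theta>(2)])
  qed
  ultimately show ?thesis by simp
qed

lemma visits_Union: "visits x K \<omega> = (\<Union>y\<in>K. visits x {y} \<omega>)"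
  by (auto simp: visits_def)

lemma integral_uniform_measure:
  fixes f :: "'a \<Rightarrow> real"
  assumes "prob_space M" and A: "A \<in> sets M" "measure M A \<noteq> 0" and f: "f \<in> borel_measurable M"
  shows "(\<integral>x. f x \<partial>uniform_measure M A) = (\<integral>x. indicator A x * f x \<partial>M) / measure M A"
proof -
  interpret prob_space M by fact
  have "uniform_measure M A = density M (\<lambda>x. ennreal (indicator A x / measure M A))"
    unfolding uniform_measure_def emeasure_eq_measure using A
    by (intro arg_cong2[where f = density] ext refl)
       (auto simp: indicator_def divide_ennreal zero_less_measure_iff simp flip: ennreal_1)
  then have "(\<integral>x. f x \<partial>uniform_measure M A) = (\<integral>x. (indicator A x / measure M A) * f x \<partial>M)"
    using f A by (simp add: integral_density)
  then show ?thesis by simp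
qed

locale critical_brw = critical_walk p \<sigma> \<mu> e mass
  for p :: "nat pmf" and \<sigma> :: real and \<mu> :: "(int ^ 'd::finite) pmf" and e :: "int ^ 'd \<Rightarrow> real ^ 4" and mass :: real
begin

lemma tree_prod_kill_tendsto:
  "(\<lambda>n. tree_prod (kill K) n x \<omega>) \<longlonglongrightarrow> (if visits x K \<omega> = {} then 1 else 0)"
proof (cases "visits x K \<omega> = {}")
  case True
  then show ?thesis using tree_prod_stabilises[of K "kill K" x \<omega>] by (simp add: kill_def)
next
  case False
  then obtain u where u: "u \<in> tree \<omega>" "position x \<omega> u \<in> K" by (auto simp: visits_def)
  have "\<forall>\<^sub>F n in sequentially. {u} \<subseteq> tree_upto n \<omega>" by (rule finite_subset_tree_upto) (use u in auto)
  then have "\<forall>\<^sub>F n in sequentially. tree_prod (kill K) n x \<omega> = 0"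
    by eventually_elim (use u in \<open>auto simp: tree_prod_eq finite_tree_upto kill_def\<close>)
  then show ?thesis using False by (simp add: tendsto_eventually)
qed

text \<open>
  Grouping the visits by site turns the product over individuals into the exponential of the occupation
  times.
\<close>

lemma prod_visits_laplace_weight:
  assumes K: "finite K" and fin: "finite (visits x K \<omega>)"
  shows "(\<Prod>u\<in>visits x K \<omega>. laplace_weight K l T (position x \<omega> u))
    = exp (- (\<Sum>y\<in>K. l y * (enn2real (occupation x {y} \<omega>) / T)))"
proof -
  have fin': "finite (visits x {y} \<omega>)" if "y \<in> K" for y
    using fin that by (rule_tac finite_subset[of _ "visits x K \<omega>"]) (auto simp: visits_def)
  have "(\<Prod>u\<in>visits x K \<omega>. laplace_weight K l T (position x \<omega> u))
      = (\<Prod>y\<in>K. \<Prod>u\<in>visits x {y} \<omega>. laplace_weight K l T (position x \<omega> u))"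
    unfolding visits_Union[of x K \<omega>]
    by (rule prod.UNION_disjoint) (use K fin' in \<open>auto simp: visits_def\<close>)
  also have "\<dots> = (\<Prod>y\<in>K. exp (- (l y * (enn2real (occupation x {y} \<omega>) / T))))"
  proof (rule prod.cong)
    fix y assume y: "y \<in> K"
    have "(\<Prod>u\<in>visits x {y} \<omega>. laplace_weight K l T (position x \<omega> u)) = (\<Prod>u\<in>visits x {y} \<omega>. exp (- (l y / T)))"
      by (intro prod.cong) (use y in \<open>auto simp: visits_def laplace_weight_def\<close>)
    also have "\<dots> = exp (real (card (visits x {y} \<omega>)) * - (l y / T))" by (simp only: prod_constant exp_of_nat_mult)
    finally show "(\<Prod>u\<in>visits x {y} \<omega>. laplace_weight K l T (position x \<omega> u)) = exp (- (l y * (enn2real (occupation x {y} \<omega>) / T)))"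
      by (simp add: occupation_eq fin'[OF y] mult.commute)
  qed simp
  also have "\<dots> = exp (- (\<Sum>y\<in>K. l y * (enn2real (occupation x {y} \<omega>) / T)))"
    using K by (simp add: exp_sum flip: sum_negf)
  finally show ?thesis .
qed

sublocale brw: prob_space "brw_space p \<mu>" by (rule prob_space_brw)

text \<open>
  The passage to the whole tree, by dominated convergence.
\<close>

lemma expectation_tree_limit:
  assumes w: "weight \<Theta>" and L: "AE \<omega> in brw_space p \<mu>. (\<lambda>n. tree_prod \<Theta> n x \<omega>) \<longlonglongrightarrow> L \<omega>"
    and Lm: "L \<in> borel_measurable (brw_space p \<mu>)"
  shows "(\<integral>\<omega>. L \<omega> \<partial>brw_space p \<mu>) = 1 - hit \<Theta> x"
proof (rule LIMSEQ_unique)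
  show "(\<lambda>n. \<integral>\<omega>. tree_prod \<Theta> n x \<omega> \<partial>brw_space p \<mu>) \<longlonglongrightarrow> (\<integral>\<omega>. L \<omega> \<partial>brw_space p \<mu>)"
  proof (rule integral_dominated_convergence[where w = "\<lambda>_. 1"])
    show "AE \<omega> in brw_space p \<mu>. norm (tree_prod \<Theta> n x \<omega>) \<le> 1" for n
      using tree_prod_01[of \<Theta> n x] w by (intro AE_I2) simp
  qed (use L Lm in auto)
  show "(\<lambda>n. \<integral>\<omega>. tree_prod \<Theta> n x \<omega> \<partial>brw_space p \<mu>) \<longlonglongrightarrow> 1 - hit \<Theta> x"
    using tree_avg_tendsto[OF w, of x] w by (simp add: expectation_tree_prod[OF finite_steps])
qed

lemma brw_prob_UNIV: "brw.prob UNIV = 1"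
  using brw.prob_space by simp

lemma integrable_event: "A \<in> brw.events \<Longrightarrow> integrable (brw_space p \<mu>) (indicator A :: _ \<Rightarrow> real)"
  by (simp add: brw.emeasure_eq_measure)

lemma visit_event_measurable: "{\<omega>. 1 \<le> occupation x K \<omega>} \<in> brw.events"
proof -
  have "{\<omega> \<in> space (brw_space p \<mu>). 1 \<le> occupation x K \<omega>} \<in> brw.events" by measurable
  then show ?thesis by simp
qed

lemma prob_visit: "brw.prob {\<omega>. 1 \<le> occupation x K \<omega>} = hit (kill K) x"
proof -
  have m: "{\<omega>. 1 \<le> occupation x K \<omega>} \<in> brw.events" by (rule visit_event_measurable)
  have "(\<integral>\<omega>. 1 - indicator {\<omega>. 1 \<le> occupation x K \<omega>} \<omega> \<partial>brw_space p \<mu>) = 1 - hit (kill K) x"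
  proof (rule expectation_tree_limit[OF weight_kill])
    show "AE \<omega> in brw_space p \<mu>. (\<lambda>n. tree_prod (kill K) n x \<omega>) \<longlonglongrightarrow> 1 - indicator {\<omega>. 1 \<le> occupation x K \<omega>} \<omega>"
    proof (intro AE_I2)
      fix \<omega> show "(\<lambda>n. tree_prod (kill K) n x \<omega>) \<longlonglongrightarrow> 1 - indicator {\<omega>. 1 \<le> occupation x K \<omega>} \<omega>"
        using tree_prod_kill_tendsto[of K x \<omega>] by (cases "visits x K \<omega> = {}") (simp_all add: visits_nonempty_iff)
    qed
  qed (use m in simp)
  moreover have "(\<integral>\<omega>. (1::real) - indicator {\<omega>. 1 \<le> occupation x K \<omega>} \<omega> \<partial>brw_space p \<mu>)
     = (\<integral>\<omega>. 1 \<partial>brw_space p \<mu>) - (\<integral>\<omega>. indicator {\<omega>. 1 \<le> occupation x K \<omega>} \<omega> \<partial>brw_space p \<mu>)"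
    using integrable_event[OF m] by (intro Bochner_Integration.integral_diff) auto
  ultimately show ?thesis using m by (simp add: brw_prob_UNIV)
qed

text \<open>
  With infinitely many visits, the product of a constant \<open>exp (- 1 / T)\<close> over the visits vanishes; so the
  probability of finitely many visits is at least \<open>1 - hit\<close> for every \<open>T\<close>, and \<open>hit = O (1 / T)\<close> by the
  first moment bound.
\<close>

lemma AE_finite_visits:
  assumes K: "finite K"
  shows "AE \<omega> in brw_space p \<mu>. finite (visits x K \<omega>)"
proof -
  define A where "A = {\<omega>. occupation x K \<omega> \<noteq> \<infinity>}"
  have "{\<omega> \<in> space (brw_space p \<mu>). occupation x K \<omega> \<noteq> \<infinity>} \<in> brw.events" by measurable
  then have Am: "A \<in> brw.events" by (simp add: A_def)
  have A: "\<omega> \<in> A \<longleftrightarrow> finite (visits x K \<omega>)" for \<omega> by (simp add: A_def occupation_eq)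
  have lower: "1 - potential K (\<lambda>_. 1) x / T \<le> brw.prob A" if T: "0 < T" for T
  proof -
    define \<Theta> where "\<Theta> = laplace_weight K (\<lambda>_. 1) T"
    have w: "weight \<Theta>" unfolding \<Theta>_def using T by (intro laplace_weight) auto
    have on: "\<Theta> y = exp (- (1 / T))" if "y \<in> K" for y using that by (simp add: \<Theta>_def laplace_weight_def)
    have off: "\<Theta> y = 1" if "y \<notin> K" for y using that by (simp add: \<Theta>_def laplace_weight_def)
    have "1 - 1 / T \<le> exp (- (1 / T))" using exp_ge_add_one_self[of "- (1 / T)"] by simp
    then have "hit \<Theta> x \<le> potential K (\<lambda>_. 1 / T) x"
      by (intro hit_le_potential[OF w K off]) (simp_all add: on)
    also have "\<dots> = potential K (\<lambda>_. 1) x / T" by (simp add: potential_def sum_divide_distrib)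
    finally have le: "1 - potential K (\<lambda>_. 1) x / T \<le> 1 - hit \<Theta> x" by simp
    define L where "L \<omega> = indicator A \<omega> * exp (- (\<Sum>y\<in>K. 1 * (enn2real (occupation x {y} \<omega>) / T)))" for \<omega>
    have Lm: "L \<in> borel_measurable (brw_space p \<mu>)" unfolding L_def using Am by measurable
    have "(\<lambda>n. tree_prod \<Theta> n x \<omega>) \<longlonglongrightarrow> L \<omega>" for \<omega>
    proof (cases "\<omega> \<in> A")
      case True
      then have fin: "finite (visits x K \<omega>)" by (simp add: A)
      have "(\<lambda>n. tree_prod \<Theta> n x \<omega>) \<longlonglongrightarrow> (\<Prod>u\<in>visits x K \<omega>. \<Theta> (position x \<omega> u))"
        by (rule tree_prod_stabilises[OF off fin])
      then show ?thesis using True unfolding \<Theta>_def prod_visits_laplace_weight[OF K fin] by (simp add: L_def)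
    next
      case False
      then have "infinite (visits x K \<omega>)" by (simp add: A)
      then have "(\<lambda>n. tree_prod \<Theta> n x \<omega>) \<longlonglongrightarrow> 0"
        using T by (intro tree_prod_infinite_visits[OF on off]) auto
      then show ?thesis using False by (simp add: L_def)
    qed
    then have "(\<integral>\<omega>. L \<omega> \<partial>brw_space p \<mu>) = 1 - hit \<Theta> x"
      by (intro expectation_tree_limit[OF w _ Lm] AE_I2)
    moreover have "(\<integral>\<omega>. L \<omega> \<partial>brw_space p \<mu>) \<le> (\<integral>\<omega>. indicator A \<omega> \<partial>brw_space p \<mu>)"
    proof (rule integral_mono)
      have L01: "0 \<le> L \<omega> \<and> L \<omega> \<le> indicator A \<omega>" for \<omega>
        using T by (auto simp: L_def indicator_def intro!: sum_nonneg)
      then show "L \<omega> \<le> indicator A \<omega>" for \<omega> by simp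
      have "norm (L \<omega>) \<le> 1" for \<omega> using L01[of \<omega>] by (cases "\<omega> \<in> A") auto
      then show "integrable (brw_space p \<mu>) L"
        by (intro brw.integrable_const_bound[OF _ Lm, of 1] AE_I2)
    qed (rule integrable_event[OF Am])
    ultimately show ?thesis using le Am by simp
  qed
  have "((\<lambda>T. 1 - potential K (\<lambda>_. 1) x / T) \<longlongrightarrow> 1 - 0) at_top"
    by (intro tendsto_diff tendsto_const tendsto_divide_0[OF tendsto_const] filterlim_at_top_imp_at_infinity filterlim_ident)
  moreover have "\<forall>\<^sub>F T in at_top. 1 - potential K (\<lambda>_. 1) x / T \<le> brw.prob A"
    using eventually_gt_at_top[of 0] by eventually_elim (rule lower)
  ultimately have "1 - 0 \<le> brw.prob A" by (rule tendsto_upperbound) simp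
  then have "brw.prob A = 1" using brw.prob_le_1[of A] by simp
  then have "AE \<omega> in brw_space p \<mu>. \<omega> \<in> A" using Am by (simp add: brw.prob_eq_1)
  then show ?thesis by (simp add: A)
qed

lemma laplace_occupation:
  assumes K: "finite K" and l: "\<And>y. y \<in> K \<Longrightarrow> 0 \<le> l y" and T: "0 < T"
  shows "(\<integral>\<omega>. exp (- (\<Sum>y\<in>K. l y * (enn2real (occupation x {y} \<omega>) / T))) \<partial>brw_space p \<mu>)
    = 1 - hit (laplace_weight K l T) x"
proof (rule expectation_tree_limit)
  show "weight (laplace_weight K l T)" by (rule laplace_weight[OF l T])
  show "AE \<omega> in brw_space p \<mu>. (\<lambda>n. tree_prod (laplace_weight K l T) n x \<omega>) \<longlonglongrightarrow> exp (- (\<Sum>y\<in>K. l y * (enn2real (occupation x {y} \<omega>) / T)))"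
    using AE_finite_visits[OF K, of x]
  proof eventually_elim
    case (elim \<omega>)
    show ?case unfolding prod_visits_laplace_weight[OF K elim, symmetric]
      by (rule tree_prod_stabilises[OF _ elim]) (simp add: laplace_weight_def)
  qed
qed measurable

lemma visit_event: "{\<omega> \<in> space (brw_space p \<mu>). 1 \<le> occupation x K \<omega>} = {\<omega>. 1 \<le> occupation x K \<omega>}"
  by simp

text \<open>
  Off the event of a visit all occupation times vanish and the exponential is one.
\<close>

lemma conditional_laplace:
  assumes K: "finite K" "K \<noteq> {}" and l: "\<And>y. y \<in> K \<Longrightarrow> 0 \<le> l y" and T: "0 < T"
  shows "(\<integral>\<omega>. exp (- (\<Sum>y\<in>K. l y * (enn2real (occupation x {y} \<omega>) / T))) \<partial>brw_visiting p \<mu> x K)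
    = 1 - hit (laplace_weight K l T) x / hit (kill K) x"
proof -
  define H where "H = {\<omega>. 1 \<le> occupation x K \<omega>}"
  define f where "f \<omega> = exp (- (\<Sum>y\<in>K. l y * (enn2real (occupation x {y} \<omega>) / T)))" for \<omega>
  have Hm: "H \<in> brw.events" unfolding H_def by (rule visit_event_measurable)
  have fm: "f \<in> borel_measurable (brw_space p \<mu>)" unfolding f_def by measurable
  have H: "brw.prob H = hit (kill K) x" "hit (kill K) x \<noteq> 0"
    using prob_visit[of x K] hit_kill_pos[OF K(2), of x] by (simp_all add: H_def)
  have "indicator H \<omega> * f \<omega> = f \<omega> - (1 - indicator H \<omega>)" for \<omega>
  proof (cases "\<omega> \<in> H")
    case False
    then have "visits x K \<omega> = {}" unfolding H_def mem_Collect_eq visits_nonempty_iff by simp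
    then have "visits x {y} \<omega> = {}" if "y \<in> K" for y using that by (auto simp: visits_def)
    then have "f \<omega> = 1" by (simp add: f_def occupation_eq)
    with False show ?thesis by simp
  qed simp
  moreover have "integrable (brw_space p \<mu>) f"
  proof (rule brw.integrable_const_bound[OF _ fm, of 1])
    have "norm (f \<omega>) \<le> 1" for \<omega> using T l by (auto simp: f_def intro!: sum_nonneg)
    then show "AE \<omega> in brw_space p \<mu>. norm (f \<omega>) \<le> 1" by simp
  qed
  moreover note integrable_event[OF Hm]
  ultimately have "(\<integral>\<omega>. indicator H \<omega> * f \<omega> \<partial>brw_space p \<mu>) = (\<integral>\<omega>. f \<omega> \<partial>brw_space p \<mu>) - (1 - brw.prob H)"
    using Hm by (simp add: brw_prob_UNIV)
  also have "(\<integral>\<omega>. f \<omega> \<partial>brw_space p \<mu>) = 1 - hit (laplace_weight K l T) x"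
    unfolding f_def by (rule laplace_occupation[OF K(1) l T])
  finally have "(\<integral>\<omega>. indicator H \<omega> * f \<omega> \<partial>brw_space p \<mu>) = hit (kill K) x - hit (laplace_weight K l T) x"
    by (simp add: H(1))
  moreover have "(\<integral>\<omega>. f \<omega> \<partial>brw_visiting p \<mu> x K) = (\<integral>\<omega>. indicator H \<omega> * f \<omega> \<partial>brw_space p \<mu>) / brw.prob H"
    unfolding brw_visiting_def visit_event H_def[symmetric]
    by (rule integral_uniform_measure[OF prob_space_brw Hm _ fm]) (use H in simp)
  ultimately show ?thesis unfolding H(1) using H(2) by (simp add: f_def diff_divide_distrib)
qed

lemma laplace_exponential:
  assumes \<Lambda>: "0 \<le> \<Lambda>"
  shows "(\<integral>t. exp (- (\<Lambda> * t)) \<partial>density lborel (exponential_density 1)) = 1 / (1 + \<Lambda>)"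
proof -
  have "(\<integral>t. exp (- (\<Lambda> * t)) \<partial>density lborel (exponential_density 1)) = (\<integral>t. exponential_density 1 t * exp (- (\<Lambda> * t)) \<partial>lborel)"
    by (subst integral_density) (auto simp: exponential_density_nonneg)
  also have "\<dots> = (\<integral>t. exponential_density (1 + \<Lambda>) t / (1 + \<Lambda>) \<partial>lborel)"
  proof (intro Bochner_Integration.integral_cong refl)
    fix t :: real
    have "exp (- t) * exp (- (\<Lambda> * t)) = exp (- t * (1 + \<Lambda>))"
      by (simp add: algebra_simps flip: exp_add)
    then show "exponential_density 1 t * exp (- (\<Lambda> * t)) = exponential_density (1 + \<Lambda>) t / (1 + \<Lambda>)"
      using \<Lambda> by (simp add: exponential_density_def)
  qed
  also have "\<dots> = 1 / (1 + \<Lambda>)"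
  proof -
    interpret E: prob_space "density lborel (exponential_density (1 + \<Lambda>))"
      using \<Lambda> by (intro prob_space_exponential_density) simp
    have "(\<integral>t. 1 \<partial>density lborel (exponential_density (1 + \<Lambda>))) = (\<integral>t. exponential_density (1 + \<Lambda>) t * 1 \<partial>lborel)"
      using \<Lambda> by (subst integral_density) (auto simp: exponential_density_nonneg)
    then show ?thesis using E.prob_space by simp
  qed
  finally show ?thesis .
qed

text \<open>
  The normalisation is chosen so that the two terms of the denominator in \<open>laplace_asymptotics\<close> are in
  ratio \<open>1 : \<Lambda>\<close>, where \<open>\<Lambda>\<close> is the sum of the weights.
\<close>

theorem occupation_law:
  assumes K: "finite K" "K \<noteq> {}" and T: "((\<lambda>x. T x / ln (Q x)) \<longlongrightarrow> \<theta> / (2 * mass)) far"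
  shows "converges_in_law (product_topology (\<lambda>_. euclideanreal) K)
           (\<lambda>x. distr (brw_visiting p \<mu> x K) (\<Pi>\<^sub>M y\<in>K. borel) (\<lambda>\<omega>. \<lambda>y\<in>K. enn2real (occupation x {y} \<omega>) / T x))
           (distr (density lborel (exponential_density 1)) (\<Pi>\<^sub>M y\<in>K. borel) (\<lambda>t. \<lambda>y\<in>K. t)) far"
proof (rule law_from_laplace[OF K(1)])
  let ?E = "density lborel (exponential_density 1)"
  define X where "X x \<omega> = (\<lambda>y\<in>K. enn2real (occupation x {y} \<omega>) / T x)" for x \<omega>
  have Xm: "X x \<in> measurable (brw_visiting p \<mu> x K) (\<Pi>\<^sub>M y\<in>K. borel)" for x
  proof -
    have "X x \<in> measurable (brw_space p \<mu>) (\<Pi>\<^sub>M y\<in>K. borel)" unfolding X_def by measurable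
    then show ?thesis by (simp add: brw_visiting_def cong: measurable_cong_sets)
  qed
  have ps: "prob_space (brw_visiting p \<mu> x K)" for x
    unfolding brw_visiting_def visit_event
    by (intro prob_space_uniform_measure)
       (use prob_visit[of x K] hit_kill_pos[OF K(2), of x] in \<open>simp_all add: brw.emeasure_eq_measure\<close>)
  have Em: "(\<lambda>t. \<lambda>y\<in>K. t) \<in> measurable ?E (\<Pi>\<^sub>M y\<in>K. borel)" by measurable
  interpret E: prob_space ?E by (rule prob_space_exponential_density) simp
  have \<tau>: "0 < \<theta> / (2 * mass)" using \<theta>_pos mass_pos by simp
  have T0: "\<forall>\<^sub>F x in far. 0 < T x"
    using order_tendstoD(1)[OF T \<tau>] ln_Q_at_top[unfolded filterlim_at_top_dense, rule_format, of 0]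
    by eventually_elim (simp add: zero_less_divide_iff)
  show "\<forall>\<^sub>F x in far. laplace_like K (distr (brw_visiting p \<mu> x K) (\<Pi>\<^sub>M y\<in>K. borel) (\<lambda>\<omega>. \<lambda>y\<in>K. enn2real (occupation x {y} \<omega>) / T x))"
    using T0
  proof eventually_elim
    case (elim x)
    have "AE z in distr (brw_visiting p \<mu> x K) (\<Pi>\<^sub>M y\<in>K. borel) (X x). \<forall>y\<in>K. 0 \<le> z y"
      by (subst AE_distr_iff[OF Xm]) (use elim K(1) in \<open>auto simp: X_def\<close>)
    then show ?case unfolding X_def[symmetric] laplace_like_def
      using prob_space.prob_space_distr[OF ps Xm] by simp
  qed
  show "laplace_like K (distr ?E (\<Pi>\<^sub>M y\<in>K. borel) (\<lambda>t. \<lambda>y\<in>K. t))"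
    unfolding laplace_like_def
  proof (intro conjI)
    have "AE t in ?E. 0 \<le> t" by (subst AE_density) (auto simp: exponential_density_def)
    then have "AE t in ?E. \<forall>y\<in>K. 0 \<le> (\<lambda>y\<in>K. t) y" by eventually_elim simp
    then show "AE z in distr ?E (\<Pi>\<^sub>M y\<in>K. borel) (\<lambda>t. \<lambda>y\<in>K. t). \<forall>y\<in>K. 0 \<le> z y"
      by (subst AE_distr_iff[OF Em]) (use K(1) in auto)
  qed (use E.prob_space_distr[OF Em] in auto)
  fix m :: "int ^ 'd \<Rightarrow> nat"
  define l where "l y = real (m y)" for y
  define \<Lambda> where "\<Lambda> = sum l K"
  have l0: "0 \<le> l y" for y by (simp add: l_def)
  have \<Lambda>0: "0 \<le> \<Lambda>" unfolding \<Lambda>_def by (intro sum_nonneg l0)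
  have gm: "(\<lambda>z. exp (- (\<Sum>y\<in>K. real (m y) * z y))) \<in> borel_measurable (\<Pi>\<^sub>M y\<in>K. borel)"
    by measurable
  have "(\<integral>z. exp (- (\<Sum>y\<in>K. real (m y) * z y)) \<partial>distr ?E (\<Pi>\<^sub>M y\<in>K. borel) (\<lambda>t. \<lambda>y\<in>K. t))
      = (\<integral>t. exp (- (\<Sum>y\<in>K. real (m y) * (\<lambda>y\<in>K. t) y)) \<partial>?E)"
    by (rule integral_distr[OF Em gm])
  also have "\<dots> = (\<integral>t. exp (- (\<Lambda> * t)) \<partial>?E)" by (simp add: \<Lambda>_def l_def sum_distrib_right)
  finally have limit: "(\<integral>z. exp (- (\<Sum>y\<in>K. real (m y) * z y)) \<partial>distr ?E (\<Pi>\<^sub>M y\<in>K. borel) (\<lambda>t. \<lambda>y\<in>K. t)) = 1 / (1 + \<Lambda>)"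
    using laplace_exponential[OF \<Lambda>0] by simp
  have law: "\<forall>\<^sub>F x in far. 1 - hit (laplace_weight K l (T x)) x / hit (kill K) x
      = (\<integral>z. exp (- (\<Sum>y\<in>K. real (m y) * z y)) \<partial>distr (brw_visiting p \<mu> x K) (\<Pi>\<^sub>M y\<in>K. borel) (\<lambda>\<omega>. \<lambda>y\<in>K. enn2real (occupation x {y} \<omega>) / T x))"
    using T0
  proof eventually_elim
    case (elim x)
    have "(\<integral>z. exp (- (\<Sum>y\<in>K. real (m y) * z y)) \<partial>distr (brw_visiting p \<mu> x K) (\<Pi>\<^sub>M y\<in>K. borel) (X x))
       = (\<integral>\<omega>. exp (- (\<Sum>y\<in>K. real (m y) * X x \<omega> y)) \<partial>brw_visiting p \<mu> x K)"
      by (rule integral_distr[OF Xm gm])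
    also have "\<dots> = (\<integral>\<omega>. exp (- (\<Sum>y\<in>K. l y * (enn2real (occupation x {y} \<omega>) / T x))) \<partial>brw_visiting p \<mu> x K)"
      by (simp add: X_def l_def)
    also have "\<dots> = 1 - hit (laplace_weight K l (T x)) x / hit (kill K) x"
      by (rule conditional_laplace[OF K l0 elim])
    finally show ?case unfolding X_def by (rule sym)
  qed
  have "((\<lambda>x. 1 - hit (laplace_weight K l (T x)) x / hit (kill K) x) \<longlongrightarrow> 1 / (1 + \<Lambda>)) far"
  proof (cases "\<Lambda> = 0")
    case True
    then have "l y = 0" if "y \<in> K" for y using that K(1) l0 by (simp add: \<Lambda>_def sum_nonneg_eq_0_iff)
    then have "laplace_weight K l T = (\<lambda>_. 1)" for T by (auto simp: laplace_weight_def)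
    moreover have "hit (\<lambda>_. 1) x = 0" for x
      using hit_le_potential[of "\<lambda>_. 1" "{}" "\<lambda>_. 0" x] hit_01[of "\<lambda>_. 1" x] by (simp add: potential_def)
    ultimately show ?thesis using True by simp
  next
    case False
    then have \<Lambda>: "0 < sum l K" using \<Lambda>0 by (simp add: \<Lambda>_def)
    have pos: "0 < \<theta>" "0 < mass" by (rule \<theta>_pos, rule mass_pos)
    have "((\<lambda>x. 1 - Q x * ln (Q x) * hit (laplace_weight K l (T x)) x / (Q x * ln (Q x) * hit (kill K) x))
        \<longlongrightarrow> 1 - 1 / (\<theta> / (2 * mass) * (mass / sum l K) + \<theta> / 2) / (2 / \<theta>)) far"
      using pos by (intro tendsto_intros laplace_asymptotics[OF K(1) l0 \<Lambda> T \<tau>] kill_asymptotics[OF K]) simp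
    moreover have "1 - 1 / (\<theta> / (2 * mass) * (mass / sum l K) + \<theta> / 2) / (2 / \<theta>) = 1 / (1 + \<Lambda>)"
    proof -
      have "\<theta> / (2 * mass) * (mass / sum l K) + \<theta> / 2 = \<theta> * (1 + \<Lambda>) / (2 * \<Lambda>)"
        using pos \<Lambda> unfolding \<Lambda>_def by (simp add: field_simps)
      moreover have "1 - 1 / (t * (1 + s) / (2 * s)) / (2 / t) = 1 / (1 + s)" if "0 < s" "0 < t" for s t :: real
        using that by (simp add: divide_simps)
      ultimately show ?thesis using pos(1) \<Lambda> by (simp only: \<Lambda>_def)
    qed
    moreover have "\<forall>\<^sub>F q in at_top. 0 < q * ln (q::real)" by real_asymp
    from eventually_compose_filterlim[OF this Q_at_top]
    have "\<forall>\<^sub>F x in far. 1 - Q x * ln (Q x) * hit (laplace_weight K l (T x)) x / (Q x * ln (Q x) * hit (kill K) x)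
       = 1 - hit (laplace_weight K l (T x)) x / hit (kill K) x"
    proof eventually_elim
      case (elim x)
      then have "Q x * ln (Q x) \<noteq> 0" by (rule less_imp_neq[symmetric])
      then show ?case by (simp only: nonzero_mult_divide_mult_cancel_left simp_thms)
    qed
    ultimately show ?thesis by (auto intro: Lim_transform_eventually)
  qed
  with law show "((\<lambda>x. \<integral>z. exp (- (\<Sum>y\<in>K. real (m y) * z y)) \<partial>distr (brw_visiting p \<mu> x K) (\<Pi>\<^sub>M y\<in>K. borel) (\<lambda>\<omega>. \<lambda>y\<in>K. enn2real (occupation x {y} \<omega>) / T x))
      \<longlongrightarrow> (\<integral>z. exp (- (\<Sum>y\<in>K. real (m y) * z y)) \<partial>distr ?E (\<Pi>\<^sub>M y\<in>K. borel) (\<lambda>t. \<lambda>y\<in>K. t))) far"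
    unfolding limit by (rule Lim_transform_eventually[rotated])
qed

end

section \<open>Walks on the four-dimensional lattice\<close>

lemma covariance_quadratic_form:
  fixes \<mu> :: "(int ^ 'd::finite) pmf"
  assumes fin: "finite (set_pmf \<mu>)" and mean: "mean_vec \<mu> = 0"
  shows "(\<Sum>z\<in>set_pmf \<mu>. pmf \<mu> z * (u \<bullet> real_vec z)\<^sup>2) = u \<bullet> (covariance_matrix \<mu> *v u)"
proof -
  have entry: "covariance_matrix \<mu> $ i $ j = (\<Sum>z\<in>set_pmf \<mu>. pmf \<mu> z * (real_vec z $ i * real_vec z $ j))" for i j
    by (simp add: covariance_matrix_def mean integral_measure_pmf_real[OF fin] mult.commute)
  have "u \<bullet> (covariance_matrix \<mu> *v u)
      = (\<Sum>i\<in>UNIV. \<Sum>j\<in>UNIV. \<Sum>z\<in>set_pmf \<mu>. pmf \<mu> z * ((u $ i * real_vec z $ i) * (u $ j * real_vec z $ j)))"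
    by (simp add: inner_vec_def matrix_vector_mult_def entry sum_distrib_left sum_distrib_right mult_ac)
  also have "\<dots> = (\<Sum>z\<in>set_pmf \<mu>. \<Sum>i\<in>UNIV. \<Sum>j\<in>UNIV. pmf \<mu> z * ((u $ i * real_vec z $ i) * (u $ j * real_vec z $ j)))"
    by (simp add: sum.swap[of _ "set_pmf \<mu>"])
  also have "\<dots> = (\<Sum>z\<in>set_pmf \<mu>. pmf \<mu> z * (u \<bullet> real_vec z)\<^sup>2)"
    by (simp add: inner_vec_def power2_eq_square sum_product flip: sum_distrib_left)
  finally show ?thesis by simp
qed

lemma finite_lattice_ball: "finite {x :: int ^ 'd::finite. norm (real_vec x) \<le> r}"
proof -
  have "(($) ` {x :: int ^ 'd. norm (real_vec x) \<le> r}) \<subseteq> (\<Pi>\<^sub>E i\<in>UNIV. {- \<lceil>r\<rceil>..\<lceil>r\<rceil>})"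
  proof
    fix g assume "g \<in> ($) ` {x :: int ^ 'd. norm (real_vec x) \<le> r}"
    then obtain x :: "int ^ 'd" where g: "g = ($) x" and x: "norm (real_vec x) \<le> r" by auto
    have "x $ i \<in> {- \<lceil>r\<rceil>..\<lceil>r\<rceil>}" for i
    proof -
      have "\<bar>real_of_int (x $ i)\<bar> \<le> r"
        using component_le_norm_cart[of "real_vec x" i] x by (simp add: real_vec_def)
      then show ?thesis by (simp add: abs_le_iff) linarith
    qed
    then show "g \<in> (\<Pi>\<^sub>E i\<in>UNIV. {- \<lceil>r\<rceil>..\<lceil>r\<rceil>})" by (simp add: g PiE_UNIV_domain)
  qed
  then have "finite (($) ` {x :: int ^ 'd. norm (real_vec x) \<le> r})" by (rule finite_subset) (simp add: finite_PiE)
  then show ?thesis by (rule finite_imageD) (auto simp: inj_on_def vec_eq_iff fun_eq_iff)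
qed

text \<open>
  The translations that map \<open>H\<close> into itself together with their inverses form a subgroup, which contains
  the steps because these are symmetric.
\<close>

lemma symmetric_steps_irreducible:
  fixes \<mu> :: "(int ^ 'd::finite) pmf"
  assumes gen: "\<forall>H. lattice_subgroup H \<and> set_pmf \<mu> \<subseteq> H \<longrightarrow> H = UNIV"
    and sym: "\<forall>z. pmf \<mu> (- z) = pmf \<mu> z"
    and H0: "0 \<in> H" and step: "\<And>x z. x \<in> H \<Longrightarrow> z \<in> set_pmf \<mu> \<Longrightarrow> x + z \<in> H"
  shows "H = UNIV"
proof -
  \<comment> \<open>a subgroup even if \<open>H\<close> is not\<close>
  define G where "G = {g. \<forall>h\<in>H. h + g \<in> H \<and> h - g \<in> H}"
  have "lattice_subgroup G"
    unfolding lattice_subgroup_def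
  proof (intro conjI ballI)
    fix a b assume "a \<in> G" "b \<in> G"
    then have "h + a + b \<in> H \<and> h - a - b \<in> H" if "h \<in> H" for h using that by (simp add: G_def)
    then show "a + b \<in> G" by (simp add: G_def add.assoc diff_diff_eq)
  qed (simp_all add: G_def)
  moreover have "set_pmf \<mu> \<subseteq> G"
  proof
    fix z assume z: "z \<in> set_pmf \<mu>"
    then have "- z \<in> set_pmf \<mu>" using sym by (simp add: set_pmf_iff)
    then have "h + z \<in> H \<and> h + - z \<in> H" if "h \<in> H" for h using that z by (intro conjI step)
    then show "z \<in> G" by (simp add: G_def)
  qed
  ultimately have "G = UNIV" using gen by blast
  then have "0 + g \<in> H" for g using H0 unfolding G_def by blast
  then show ?thesis by auto
qed

text \<open>
  With these, the squared norm in the coordinates \<open>transpose B *v x\<close> is the quadratic form of the inverse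
  covariance matrix, and the Jacobian of the coordinates is expressed by its determinant.
\<close>

lemma congruent_identity_inverse:
  fixes A B :: "real ^ 'n ^ 'n"
  assumes B: "transpose B ** A ** B = mat 1"
  shows "matrix_inv A = B ** transpose B" and "(det B)\<^sup>2 * det A = 1"
proof -
  have "B ** (transpose B ** A) = mat 1" using B by (simp only: matrix_left_right_inverse)
  then have "(B ** transpose B) ** A = mat 1" by (simp add: matrix_mul_assoc)
  moreover from this have "A ** (B ** transpose B) = mat 1" by (simp only: matrix_left_right_inverse)
  ultimately have "invertible A" and C: "(B ** transpose B) ** A = mat 1" by (auto simp: invertible_def)
  from \<open>invertible A\<close> have "A ** matrix_inv A = mat 1" unfolding matrix_inv_def invertible_def by (rule someI2_ex) simp
  then have "(B ** transpose B) ** (A ** matrix_inv A) = B ** transpose B" by simp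
  then show "matrix_inv A = B ** transpose B" by (simp only: matrix_mul_assoc C matrix_mul_lid)
  have "det (transpose B ** A ** B) = 1" unfolding B by simp
  then show "(det B)\<^sup>2 * det A = 1" by (simp add: det_mul power2_eq_square mult_ac)
qed

lemma isotropic_coordinates:
  fixes \<mu> :: "(int ^ 4) pmf"
  assumes fin: "finite (set_pmf \<mu>)" and mean: "mean_vec \<mu> = 0"
    and gen: "\<forall>H. lattice_subgroup H \<and> set_pmf \<mu> \<subseteq> H \<longrightarrow> H = UNIV"
    and sym: "\<forall>z. pmf \<mu> (- z) = pmf \<mu> z"
    and B: "transpose B ** covariance_matrix \<mu> ** B = mat 1"
  shows "isotropic_walk \<mu> (\<lambda>x. transpose B *v real_vec x)"
proof
  have adj: "v \<bullet> (transpose B *v y) = (B *v v) \<bullet> y" for v y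
  proof -
    have "(y v* B) \<bullet> v = y \<bullet> (B *v v)" by (rule dot_lmul_matrix)
    then show ?thesis by (simp add: inner_commute)
  qed
  show "transpose B *v real_vec (x + y) = transpose B *v real_vec x + transpose B *v real_vec y" for x y
  proof -
    have "real_vec (x + y) = real_vec x + real_vec y" by (simp add: real_vec_def vec_eq_iff)
    then show ?thesis by (simp only: matrix_vector_right_distrib)
  qed
  show "(\<Sum>z\<in>set_pmf \<mu>. pmf \<mu> z * (v \<bullet> (transpose B *v real_vec z))\<^sup>2) = v \<bullet> v" for v
  proof -
    have "(\<Sum>z\<in>set_pmf \<mu>. pmf \<mu> z * (v \<bullet> (transpose B *v real_vec z))\<^sup>2) = (B *v v) \<bullet> (covariance_matrix \<mu> *v (B *v v))"
      unfolding adj by (rule covariance_quadratic_form[OF fin mean])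
    also have "\<dots> = v \<bullet> ((transpose B ** covariance_matrix \<mu> ** B) *v v)"
      unfolding adj[symmetric] by (simp add: matrix_vector_mul_assoc matrix_mul_assoc)
    finally show ?thesis by (simp add: B)
  qed
  show "finite {x. norm (transpose B *v real_vec x) \<le> r}" for r
  proof -
    define A where "A = covariance_matrix \<mu>"
    define C where "C = onorm ((*v) (A ** B))"
    have inv: "(A ** B) *v (transpose B *v y) = y" for y
    proof -
      have "transpose B ** (A ** B) = mat 1" using B by (simp add: A_def matrix_mul_assoc)
      then have "(A ** B) ** transpose B = mat 1" by (simp only: matrix_left_right_inverse)
      then show ?thesis by (simp only: matrix_vector_mul_assoc matrix_vector_mul_lid)
    qed
    have "norm (real_vec x) \<le> C * r" if "norm (transpose B *v real_vec x) \<le> r" for x :: "int ^ 4"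
    proof -
      have "norm (real_vec x) = norm ((A ** B) *v (transpose B *v real_vec x))" by (simp only: inv)
      also have "\<dots> \<le> C * norm (transpose B *v real_vec x)"
        unfolding C_def by (rule onorm) (rule matrix_vector_mul_bounded_linear)
      also have "\<dots> \<le> C * r"
        using that unfolding C_def by (intro mult_left_mono onorm_pos_le matrix_vector_mul_bounded_linear)
      finally show ?thesis .
    qed
    then have "{x. norm (transpose B *v real_vec x) \<le> r} \<subseteq> {x :: int ^ 4. norm (real_vec x) \<le> C * r}" by auto
    then show ?thesis by (rule finite_subset) (rule finite_lattice_ball)
  qed
  show "pmf \<mu> (- z) = pmf \<mu> z" for z using sym by simp
  show "H = UNIV" if "0 \<in> H" "\<And>x z. x \<in> H \<Longrightarrow> z \<in> set_pmf \<mu> \<Longrightarrow> x + z \<in> H" for H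
    by (rule symmetric_steps_irreducible[OF gen sym that])
qed (rule fin)

text \<open>
  Both filters are cofinite on the lattice; one inclusion suffices to transfer limits.
\<close>

lemma (in critical_brw) at_infinity_le_far: "filtercomap real_vec at_infinity \<le> far"
  unfolding le_filter_def
proof (intro allI impI)
  fix R :: "int ^ 'd \<Rightarrow> bool" assume "eventually R far"
  then have fin: "finite {x. \<not> R x}" by (simp add: eventually_far_iff_finite)
  define b where "b = Max (insert 0 ((\<lambda>x. norm (real_vec x)) ` {x. \<not> R x})) + 1"
  have "R x" if "b \<le> norm (real_vec x)" for x
  proof (rule ccontr)
    assume "\<not> R x"
    then have "norm (real_vec x) \<le> Max (insert 0 ((\<lambda>x. norm (real_vec x)) ` {x. \<not> R x}))"
      using fin by (intro Max_ge) auto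
    then show False using that by (simp add: b_def)
  qed
  then show "eventually R (filtercomap real_vec at_infinity)"
    unfolding eventually_filtercomap eventually_at_infinity by (intro exI[of _ "\<lambda>y. b \<le> norm y"]) auto
qed

theorem corollary1p2:
  fixes p :: "nat pmf"
    and \<mu> :: "(int ^ 4) pmf"
    and \<sigma> c4 :: real
    and K :: "(int ^ 4) set"
  assumes "pmf p 1 < 1"
    and "(\<lambda>k. real k * pmf p k) sums 1"
    and "(\<lambda>k. (real k - 1)\<^sup>2 * pmf p k) sums \<sigma>\<^sup>2"
    and "0 < \<sigma>\<^sup>2"
    and "mean_vec \<mu> = 0"
    and "positive_definite (covariance_matrix \<mu>)"
    and "\<forall>H. lattice_subgroup H \<and> set_pmf \<mu> \<subseteq> H \<longrightarrow> H = UNIV"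
    and "\<forall>z. pmf \<mu> (- z) = pmf \<mu> z"
    and "finite (set_pmf \<mu>)"
    and "finite K" and "K \<noteq> {}"
    and "c4 = 1 / (8 * pi\<^sup>2 * sqrt (det (covariance_matrix \<mu>)))"
  shows "converges_in_law (product_topology (\<lambda>_. euclideanreal) K)
           (\<lambda>x. distr (brw_visiting p \<mu> x K) (\<Pi>\<^sub>M y\<in>K. borel)
              (\<lambda>\<omega>. \<lambda>y\<in>K. enn2real (occupation x {y} \<omega>)
                            / (2 * \<sigma>\<^sup>2 * c4 * ln (jump_norm \<mu> x))))
           (distr (density lborel (exponential_density 1)) (\<Pi>\<^sub>M y\<in>K. borel)
              (\<lambda>t. \<lambda>y\<in>K. t))
           (filtercomap real_vec at_infinity)"
proof -
  obtain B :: "real ^ 4 ^ 4" where B: "transpose B ** covariance_matrix \<mu> ** B = mat 1"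
    by (rule matrix_congruent_identity[OF assms(6)]) (rule that)
  define D where "D = det (covariance_matrix \<mu>)"
  have D: "(det B)\<^sup>2 * D = 1" unfolding D_def by (rule congruent_identity_inverse(2)[OF B])
  then have dB: "det B \<noteq> 0" by auto
  have D0: "0 < D" by (rule zero_less_mult_pos[of "(det B)\<^sup>2"]) (use D dB in simp_all)
  have sqrtD: "1 / \<bar>det B\<bar> = sqrt D"
  proof -
    have "\<bar>det B\<bar> * sqrt D = 1" using arg_cong[OF D, of sqrt] by (simp add: real_sqrt_mult)
    then show ?thesis using dB by (simp add: field_simps)
  qed
  define e where "e x = transpose B *v real_vec x" for x :: "int ^ 4"
  define mass where "mass = 2 * pi\<^sup>2 * sqrt D"
  have iso: "isotropic_walk \<mu> e"
    unfolding e_def by (rule isotropic_coordinates[OF assms(9,5,7,8) B])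
  interpret critical_brw p \<sigma> \<mu> e mass
  proof (intro critical_brw.intro critical_walk.intro lattice_walk.intro critical_offspring.intro lattice_walk_axioms.intro iso)
    show "0 < mass" using D0 by (simp add: mass_def)
    have "2 * pi\<^sup>2 / \<bar>det B\<bar> = mass" using sqrtD by (simp add: mass_def divide_inverse)
    then show "((\<lambda>\<kappa>. \<integral>\<^sup>+z. ennreal (4 * \<kappa> / (isotropic_walk.Q e z + \<kappa>) ^ 3) \<partial>count_space UNIV) \<longlongrightarrow> ennreal mass) at_top"
      using lattice_newton_sum[OF dB] by (simp add: isotropic_walk.Q_def[OF iso] e_def)
  qed (rule assms)+
  have norm_eq: "jump_norm \<mu> x = sqrt (Q x / 4)" for x
  proof -
    have "real_vec x \<bullet> ((B ** transpose B) *v real_vec x) = (transpose B *v real_vec x) \<bullet> (transpose B *v real_vec x)"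
      using dot_lmul_matrix[of "real_vec x" B "transpose B *v real_vec x"]
      by (simp flip: matrix_vector_mul_assoc)
    then show ?thesis
      by (simp add: jump_norm_def congruent_identity_inverse(1)[OF B] Q_def e_def power2_norm_eq_inner)
  qed
  have "((\<lambda>q. 2 * \<sigma>\<^sup>2 * c4 * (ln (sqrt (q / 4)) / ln q)) \<longlongrightarrow> 2 * \<sigma>\<^sup>2 * c4 * (1 / 2)) at_top"
    by (intro tendsto_mult tendsto_const) real_asymp
  from filterlim_compose[OF this Q_at_top]
  have "((\<lambda>x. 2 * \<sigma>\<^sup>2 * c4 * ln (jump_norm \<mu> x) / ln (Q x)) \<longlongrightarrow> \<sigma>\<^sup>2 * c4) far"
    by (simp add: norm_eq)
  moreover have "\<sigma>\<^sup>2 * c4 = \<theta> / (2 * mass)"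
    by (simp add: assms(12) \<theta>_def mass_def D_def)
  ultimately have "((\<lambda>x. 2 * \<sigma>\<^sup>2 * c4 * ln (jump_norm \<mu> x) / ln (Q x)) \<longlongrightarrow> \<theta> / (2 * mass)) far" by simp
  note law = occupation_law[OF assms(10,11) this]
  show ?thesis
    unfolding converges_in_law_def
    by (intro allI impI tendsto_mono[OF at_infinity_le_far] law[unfolded converges_in_law_def, rule_format])
qed

end
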